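(* Let $F\colon Q^{\Delta}\to Q^{I_2(2n)}$ be a weighted folding (one of the five families $\Delta\in\{A_{2n-1},D_{n+1},E_6,E_7,E_8\}$ listed in the context) and let $\mathcal{A}$ be either $\operatorname{mod} KQ^{\Delta}$ or $\mathcal{D}^b(\operatorname{mod} KQ^{\Delta})$. For any $i\in Q_0^{\Delta}$ and any $m\in\mathbb{Z}$ (with $\tau^mP(i)\neq 0$ if $\mathcal{A}=\operatorname{mod}KQ^\Delta$), the length of the vector $\delta^{\mathcal{A}}_F(\tau^mP(i))$ with respect to the standard basis of $\mathbb{R}^2$ is $$\ell\left(\delta^{\mathcal{A}}_F(\tau^mP(i))\right)=\kappa(i).$$
   Context: Conventions. $K$ is an algebraically closed field; modules are finitely generated right modules and paths are read left to right. $P(i)$ is the indecomposable projective $KQ^{\Delta}$-module at $i$ (simple iff $i$ is a sink). $\tau$ is the Auslander--Reiten translate of $\mathcal{A}$, $\Sigma$ is the shift functor; a module is viewed in $\mathcal{D}^b$ as a complex in degree $0$. $U_i$ is the $i$-th Chebyshev polynomial of the second kind, $U_i(\cos\theta)\sin\theta=\sin((i+1)\theta)$. $R=\mathbb{Z}[2\cos\frac{\pi}{2n}]\subset\mathbb{R}$ with field of fractions $\operatorname{Frac}(R)$. Weighted foldings. $Q^{I_2(2n)}$ has two vertices and one arrow $[0]\to[1]$ (of weight $2\cos\frac{\pi}{2n}$). In every case below $F$ maps each source of $Q^\Delta$ to $[0]$ and each sink to $[1]$; $\kappa\colon Q^\Delta_0\to R_{>0}$ and $\varsigma\colon\{[0],[1]\}\to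 R_{>0}$ are the vertex weights. - $\Delta=A_{2n-1}$ ($n\ge 2$): vertices $0,1,\dots,2n-2$, one arrow between $i$ and $i+1$ for each $i$, directed from the even to the odd vertex; $\kappa(i)=U_i(\cos\frac{\pi}{2n})$; $\varsigma([0])=1$, $\varsigma([1])=2\cos\frac{\pi}{2n}$. - $\Delta=D_{n+1}$ ($n\geq 3$): vertices $0,1,\dots,n-2,(n-1)^+,(n-1)^-$; edges $i - (i+1)$ for $0\le i\le n-3$ and $(n-2) - (n-1)^{\pm}$, each directed from the even to the odd vertex ($(n-1)^\pm$ has the parity of $n-1$); $\kappa(i)=2U_i(\cos\frac{\pi}{2n})$ for $0\le i\le n-2$, $\kappa((n-1)^{\pm})=U_{n-1}(\cos\frac{\pi}{2n})$; $\varsigma([0])=2$, $\varsigma([1])=4\cos\frac{\pi}{2n}$. - $\Delta=E_6$ ($n=6$): arrows $0^+\to1^+$, $0^-\to 1^-$, $2\to1^+$, $2\to1^-$, $2\to v_6$; $\kappa(i^{\pm})=U_i(\cos\frac{\pi}{12})$, $\kappa(2)=U_2(\cos\frac{\pi}{12})$, $\kappa(v_6)=\sqrt2$. - $\Delta=E_7$ ($n=9$): arrows $0\to1$, $2\to1$, $2\to3$, $\widetilde1\to3$, $\widetilde2\to3$, $\widetilde2\to v_7$; $\kappa(i)=U_i(\cos\frac{\pi}{18})$, $\kappa(\widetilde i)=U_i(\cos\frac{\pi}{9})$, $\kappa(v_7)=2\cos\frac{5\pi}{18}$. - $\Delta=E_8$ ($n=15$): arrows $0\to1$, $2\to1$,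 $2\to3$, $4\to3$, $4\to v_8$, $4\to\phi_1$, $\phi_0\to\phi_1$; $\kappa(i)=U_i(\cos\frac{\pi}{30})$, $\kappa(\phi_i)=\varphi U_i(\cos\frac{\pi}{30})$, $\kappa(v_8)=\varphi^{-1}U_3(\cos\frac{\pi}{30})$, with $\varphi=2\cos\frac{\pi}{5}$. For $E_6,E_7,E_8$: $\varsigma([0])=1$, $\varsigma([1])=2\cos\frac{\pi}{2n}$. Lengths. Put $\lambda=\varsigma([0])$. A vector $(a,b)\in\operatorname{Frac}(R)^2$ is identified with the point $a\lambda+b\cdot2\lambda\cos(\frac{\pi}{2n})\exp(\frac{(2n-1)\pi \mathrm{i}}{2n})\in\mathbb{C}=\mathbb{R}^2$ (coordinates with respect to the simple roots of the standard root system of $I_2(2n)$), and $\ell(a,b)$ is the Euclidean length of that point. Projection. $d_F\colon\mathbb{Z}^{Q_0^\Delta}\to\operatorname{Frac}(R)^2$ is $d_F((u_i)_i)=\left(\sum_{F(i)=[0]}\frac{\kappa(i)}{\varsigma([0])}u_i,\ \sum_{F(i)=[1]}\frac{\kappa(i)}{\varsigma([1])}u_i\right)$. For a module $M$, $\delta_F^{\operatorname{mod}KQ^\Delta}(M)=d_F(\underline{\dim}M)$. For $X=\bigoplus_j\Sigma^jM_j\in\mathcal{D}^b(\operatorname{mod}KQ^\Delta)$ with $M_j$ modules, $\delta_F^{\mathcal{D}^b}(X)=\sum_{j\text{ even}}\delta_F^{\operatorname{mod}}(M_j)-\sum_{j\text{ odd}}\delta_F^{\operatorname{mod}}(M_j)$.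 *)

theory Defs
  imports
    Complex_Main
    "HOL-Library.Product_Plus"
    "HOL-Computational_Algebra.Polynomial"
    "Jordan_Normal_Form.VS_Connect"
    "Graph_Theory.Arc_Walk"
begin

hide_const (open) Modules.module_hom

section \<open>Right modules\<close>

text \<open>
  Right modules over a (non-commutative) ring are stored in the library record \<open>module\<close>,
  with \<open>a \<odot>\<^bsub>M\<^esub> x\<close> standing for \<open>x \<cdot> a\<close>; the fields \<open>mult\<close> and \<open>one\<close> of the record carry
  no meaning.  The library set \<open>module_hom A M N\<close> makes no use of commutativity and is the
  set of homomorphisms of right \<open>A\<close>-modules.

  The algebra \<open>A\<close> is itself a record \<open>module\<close>: a ring together with scalar multiplication
  by the field \<open>'k\<close>.
\<close>

locale right_module = A?: ring A + M?: abelian_group M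
  for A :: "('k::field, 'a) module" and M :: "('a, 'm) module" (structure) +
  assumes smult_closed: "a \<in> carrier A \<Longrightarrow> x \<in> carrier M \<Longrightarrow> a \<odot> x \<in> carrier M"
    and smult_add_scalar: "a \<in> carrier A \<Longrightarrow> b \<in> carrier A \<Longrightarrow> x \<in> carrier M \<Longrightarrow>
      (a \<oplus>\<^bsub>A\<^esub> b) \<odot> x = a \<odot> x \<oplus> b \<odot> x"
    and smult_add: "a \<in> carrier A \<Longrightarrow> x \<in> carrier M \<Longrightarrow> y \<in> carrier M \<Longrightarrow>
      a \<odot> (x \<oplus> y) = a \<odot> x \<oplus> a \<odot> y"
    and smult_mult: "a \<in> carrier A \<Longrightarrow> b \<in> carrier A \<Longrightarrow> x \<in> carrier M \<Longrightarrow>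
      (a \<otimes>\<^bsub>A\<^esub> b) \<odot> x = b \<odot> (a \<odot> x)"
    and smult_one: "x \<in> carrier M \<Longrightarrow> \<one>\<^bsub>A\<^esub> \<odot> x = x"

definition mod_kernel ::
    "('a, 'm) module \<Rightarrow> ('a, 'n) module \<Rightarrow> ('m \<Rightarrow> 'n) \<Rightarrow> 'm set" where
  "mod_kernel M N f = {x \<in> carrier M. f x = \<zero>\<^bsub>N\<^esub>}"

definition zero_mod :: "('a, 'm) module \<Rightarrow> bool" where
  "zero_mod M \<longleftrightarrow> carrier M = {\<zero>\<^bsub>M\<^esub>}"

definition mod_iso :: "('k::field, 'a) module \<Rightarrow> ('a, 'm) module \<Rightarrow> ('a, 'n) module \<Rightarrow> bool" where
  "mod_iso A M N \<longleftrightarrow> (\<exists>f \<in> module_hom A M N. bij_betw f (carrier M) (carrier N))"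

definition free_mod :: "('k::field, 'a) module \<Rightarrow> nat \<Rightarrow> ('a, nat \<Rightarrow> 'a) module" where
  "free_mod A n =
    \<lparr> carrier = {..<n} \<rightarrow>\<^sub>E carrier A, mult = undefined, one = undefined,
      zero = (\<lambda>i\<in>{..<n}. \<zero>\<^bsub>A\<^esub>),
      add = (\<lambda>f g. \<lambda>i\<in>{..<n}. f i \<oplus>\<^bsub>A\<^esub> g i),
      smult = (\<lambda>a f. \<lambda>i\<in>{..<n}. f i \<otimes>\<^bsub>A\<^esub> a) \<rparr>"

definition fg_mod :: "('k::field, 'a) module \<Rightarrow> ('a, 'm) module \<Rightarrow> bool" where
  "fg_mod A M \<longleftrightarrow> right_module A M \<and>
    (\<exists>n. \<exists>f \<in> module_hom A (free_mod A n) M. f ` carrier (free_mod A n) = carrier M)"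

text \<open>Finitely generated projective: a direct summand of some \<open>A\<^sup>n\<close>.\<close>

definition fg_projective :: "('k::field, 'a) module \<Rightarrow> ('a, 'm) module \<Rightarrow> bool" where
  "fg_projective A P \<longleftrightarrow> right_module A P \<and>
    (\<exists>n. \<exists>s \<in> module_hom A P (free_mod A n). \<exists>r \<in> module_hom A (free_mod A n) P.
      \<forall>x \<in> carrier P. r (s x) = x)"

definition right_submodule :: "('k::field, 'a) module \<Rightarrow> 'm set \<Rightarrow> ('a, 'm) module \<Rightarrow> bool" where
  "right_submodule A U M \<longleftrightarrow> U \<subseteq> carrier M \<and> \<zero>\<^bsub>M\<^esub> \<in> U \<and>
    (\<forall>x \<in> U. \<forall>y \<in> U. x \<oplus>\<^bsub>M\<^esub> y \<in> U) \<and> (\<forall>a \<in> carrier A. \<forall>x \<in> U. a \<odot>\<^bsub>M\<^esub> x \<in> U)"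

definition superfluous :: "('k::field, 'a) module \<Rightarrow> 'm set \<Rightarrow> ('a, 'm) module \<Rightarrow> bool" where
  "superfluous A L M \<longleftrightarrow>
    (\<forall>U. right_submodule A U M \<and> (\<forall>x \<in> carrier M. \<exists>u \<in> U. \<exists>l \<in> L. x = u \<oplus>\<^bsub>M\<^esub> l)
      \<longrightarrow> U = carrier M)"


section \<open>Duality and transpose\<close>

text \<open>Left \<open>A\<close>-modules are treated as right modules over the opposite algebra.\<close>

definition opp :: "('k, 'a) module \<Rightarrow> ('k, 'a) module" where
  "opp A = A\<lparr>mult := \<lambda>x y. y \<otimes>\<^bsub>A\<^esub> x\<rparr>"

text \<open>The underlying \<open>'k\<close>-vector space of a right \<open>A\<close>-module: a scalar \<open>c\<close> acts as \<open>c \<cdot> 1\<^sub>A\<close>.\<close>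

definition kspace :: "('k::field, 'a) module \<Rightarrow> ('a, 'm) module \<Rightarrow> ('k, 'm) module" where
  "kspace A M =
    \<lparr> carrier = carrier M, mult = undefined, one = undefined,
      zero = \<zero>\<^bsub>M\<^esub>, add = (\<oplus>\<^bsub>M\<^esub>), smult = (\<lambda>c x. (c \<odot>\<^bsub>A\<^esub> \<one>\<^bsub>A\<^esub>) \<odot>\<^bsub>M\<^esub> x) \<rparr>"

text \<open>\<open>D M = Hom\<^sub>K(M, K)\<close>, with \<open>(a\<phi>)(x) = \<phi>(xa)\<close>: a right module over \<open>opp A\<close>.\<close>

definition kdual :: "('k::field, 'a) module \<Rightarrow> ('a, 'm) module \<Rightarrow> ('a, 'm \<Rightarrow> 'k) module" where
  "kdual A M =
    \<lparr> carrier = {\<phi> \<in> extensional (carrier M).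
        (\<forall>x \<in> carrier M. \<forall>y \<in> carrier M. \<phi> (x \<oplus>\<^bsub>M\<^esub> y) = \<phi> x + \<phi> y) \<and>
        (\<forall>c. \<forall>x \<in> carrier M. \<phi> (c \<odot>\<^bsub>kspace A M\<^esub> x) = c * \<phi> x)},
      mult = undefined, one = undefined,
      zero = (\<lambda>x \<in> carrier M. 0),
      add = (\<lambda>\<phi> \<psi>. \<lambda>x \<in> carrier M. \<phi> x + \<psi> x),
      smult = (\<lambda>a \<phi>. \<lambda>x \<in> carrier M. \<phi> (a \<odot>\<^bsub>M\<^esub> x)) \<rparr>"

definition kdual_map :: "('a, 'm) module \<Rightarrow> ('a, 'n) module \<Rightarrow> ('m \<Rightarrow> 'n) \<Rightarrow>
    ('n \<Rightarrow> 'k) \<Rightarrow> ('m \<Rightarrow> 'k)" where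
  "kdual_map M N f = (\<lambda>\<phi>. \<lambda>x \<in> carrier M. \<phi> (f x))"

text \<open>\<open>Hom\<^sub>A(P, A)\<close>, with \<open>(af)(x) = a f(x)\<close>: a right module over \<open>opp A\<close>.\<close>

definition adual :: "('k::field, 'a) module \<Rightarrow> ('a, 'm) module \<Rightarrow> ('a, 'm \<Rightarrow> 'a) module" where
  "adual A P =
    \<lparr> carrier = {f \<in> extensional (carrier P).
        (\<forall>x \<in> carrier P. f x \<in> carrier A) \<and>
        (\<forall>x \<in> carrier P. \<forall>y \<in> carrier P. f (x \<oplus>\<^bsub>P\<^esub> y) = f x \<oplus>\<^bsub>A\<^esub> f y) \<and>
        (\<forall>a \<in> carrier A. \<forall>x \<in> carrier P. f (a \<odot>\<^bsub>P\<^esub> x) = f x \<otimes>\<^bsub>A\<^esub> a)},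
      mult = undefined, one = undefined,
      zero = (\<lambda>x \<in> carrier P. \<zero>\<^bsub>A\<^esub>),
      add = (\<lambda>f g. \<lambda>x \<in> carrier P. f x \<oplus>\<^bsub>A\<^esub> g x),
      smult = (\<lambda>a f. \<lambda>x \<in> carrier P. a \<otimes>\<^bsub>A\<^esub> f x) \<rparr>"

definition adual_map :: "('a, 'm) module \<Rightarrow> ('a, 'n) module \<Rightarrow> ('m \<Rightarrow> 'n) \<Rightarrow>
    ('n \<Rightarrow> 'a) \<Rightarrow> ('m \<Rightarrow> 'a)" where
  "adual_map P Q f = (\<lambda>g. \<lambda>x \<in> carrier P. g (f x))"

text \<open>\<open>f\<close> and \<open>p\<close> form a minimal projective presentation \<open>P1 \<rightarrow> P0 \<rightarrow> M \<rightarrow> 0\<close>: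
  both \<open>P0 \<rightarrow> M\<close> and \<open>P1 \<rightarrow> ker p\<close> are projective covers.\<close>

definition min_proj_pres :: "('k::field, 'a) module \<Rightarrow> ('a, 'p) module \<Rightarrow> ('p \<Rightarrow> 'q) \<Rightarrow>
    ('a, 'q) module \<Rightarrow> ('q \<Rightarrow> 'm) \<Rightarrow> ('a, 'm) module \<Rightarrow> bool" where
  "min_proj_pres A P1 f P0 p M \<longleftrightarrow>
    fg_projective A P1 \<and> fg_projective A P0 \<and> fg_mod A M \<and>
    f \<in> module_hom A P1 P0 \<and> p \<in> module_hom A P0 M \<and>
    p ` carrier P0 = carrier M \<and> f ` carrier P1 = mod_kernel P0 M p \<and>
    superfluous A (mod_kernel P0 M p) P0 \<and> superfluous A (mod_kernel P1 P0 f) P1"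

text \<open>
  Every finitely generated module over a finite-dimensional algebra has an isomorphic copy
  whose carrier consists of elements of \<open>nat \<Rightarrow> 'k\<close>.  This type serves as the universe in which
  objects that are determined only up to isomorphism are chosen.

  \<open>is_transpose A M T\<close>: the left module \<open>T\<close> is (isomorphic to) the transpose
  \<open>Tr M = coker (Hom\<^sub>A(P0, A) \<rightarrow> Hom\<^sub>A(P1, A))\<close>; the map \<open>q\<close> exhibits \<open>T\<close> as the cokernel.
\<close>

definition is_transpose :: "('k::field, 'a) module \<Rightarrow> ('a, 'm) module \<Rightarrow>
    ('a, nat \<Rightarrow> 'k) module \<Rightarrow> bool" where
  "is_transpose A M T \<longleftrightarrow> fg_mod (opp A) T \<and>
    (\<exists>(P1 :: ('a, nat \<Rightarrow> 'k) module) (P0 :: ('a, nat \<Rightarrow> 'k) module) f p q.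
      min_proj_pres A P1 f P0 p M \<and>
      q \<in> module_hom (opp A) (adual A P1) T \<and> q ` carrier (adual A P1) = carrier T \<and>
      mod_kernel (adual A P1) T q = adual_map P1 P0 f ` carrier (adual A P0))"

text \<open>The Auslander--Reiten translates \<open>\<tau> = D Tr\<close> and \<open>\<tau>\<^sup>-\<^sup>1 = Tr D\<close> on finitely generated
  modules, as relations up to isomorphism.\<close>

definition is_tau :: "('k::field, 'a) module \<Rightarrow> ('a, nat \<Rightarrow> 'k) module \<Rightarrow>
    ('a, nat \<Rightarrow> 'k) module \<Rightarrow> bool" where
  "is_tau A M N \<longleftrightarrow> fg_mod A N \<and> (\<exists>T. is_transpose A M T \<and> mod_iso A (kdual (opp A) T) N)"

definition is_tau_inv :: "('k::field, 'a) module \<Rightarrow> ('a, nat \<Rightarrow> 'k) module \<Rightarrow>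
    ('a, nat \<Rightarrow> 'k) module \<Rightarrow> bool" where
  "is_tau_inv A M N \<longleftrightarrow> is_transpose (opp A) (kdual A M) N"

text \<open>\<open>k\<close>-fold iteration of a relation \<open>T\<close>, starting with isomorphism \<open>E\<close>.\<close>

primrec iterate_rel :: "('x \<Rightarrow> 'y \<Rightarrow> bool) \<Rightarrow> ('y \<Rightarrow> 'y \<Rightarrow> bool) \<Rightarrow> nat \<Rightarrow> 'x \<Rightarrow> 'y \<Rightarrow> bool" where
  "iterate_rel E T 0 X Y \<longleftrightarrow> E X Y"
| "iterate_rel E T (Suc k) X Y \<longleftrightarrow> (\<exists>Z. iterate_rel E T k X Z \<and> T Z Y)"

text \<open>\<open>N \<cong> \<tau>\<^sup>m M\<close> in \<open>mod A\<close>.\<close>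

definition is_tau_power :: "('k::field, 'a) module \<Rightarrow> int \<Rightarrow> ('a, 'm) module \<Rightarrow>
    ('a, nat \<Rightarrow> 'k) module \<Rightarrow> bool" where
  "is_tau_power A m M N \<longleftrightarrow>
    iterate_rel (\<lambda>M N. fg_mod A M \<and> fg_mod A N \<and> mod_iso A M N)
      (if 0 \<le> m then is_tau A else is_tau_inv A) (nat \<bar>m\<bar>) M N"


section \<open>The bounded derived category\<close>

text \<open>Cochain complexes of right modules; \<open>diff X n\<close> maps degree \<open>n\<close> to degree \<open>n + 1\<close>.\<close>

record ('a, 'm) cochain_complex =
  obj :: "int \<Rightarrow> ('a, 'm) module"
  diff :: "int \<Rightarrow> 'm \<Rightarrow> 'm"

definition bounded_complex :: "('k::field, 'a) module \<Rightarrow> ('a, 'm) cochain_complex \<Rightarrow> bool" where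
  "bounded_complex A X \<longleftrightarrow>
    (\<forall>n. fg_mod A (obj X n)) \<and> (\<forall>n. diff X n \<in> module_hom A (obj X n) (obj X (n + 1))) \<and>
    (\<forall>n. \<forall>x \<in> carrier (obj X n). diff X (n + 1) (diff X n x) = \<zero>\<^bsub>obj X (n + 2)\<^esub>) \<and>
    finite {n. \<not> zero_mod (obj X n)}"

definition cocycles :: "('a, 'm) cochain_complex \<Rightarrow> int \<Rightarrow> 'm set" where
  "cocycles X n = mod_kernel (obj X n) (obj X (n + 1)) (diff X n)"

definition coboundaries :: "('a, 'm) cochain_complex \<Rightarrow> int \<Rightarrow> 'm set" where
  "coboundaries X n = diff X (n - 1) ` carrier (obj X (n - 1))"

definition chain_map :: "('k::field, 'a) module \<Rightarrow> ('a, 'm) cochain_complex \<Rightarrow>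
    ('a, 'n) cochain_complex \<Rightarrow> (int \<Rightarrow> 'm \<Rightarrow> 'n) \<Rightarrow> bool" where
  "chain_map A X Y f \<longleftrightarrow> (\<forall>n. f n \<in> module_hom A (obj X n) (obj Y n)) \<and>
    (\<forall>n. \<forall>x \<in> carrier (obj X n). f (n + 1) (diff X n x) = diff Y n (f n x))"

text \<open>The last two conjuncts say that \<open>f\<close> is injective and surjective on cohomology.\<close>

definition quasi_iso :: "('k::field, 'a) module \<Rightarrow> ('a, 'm) cochain_complex \<Rightarrow>
    ('a, 'n) cochain_complex \<Rightarrow> (int \<Rightarrow> 'm \<Rightarrow> 'n) \<Rightarrow> bool" where
  "quasi_iso A X Y f \<longleftrightarrow> chain_map A X Y f \<and>
    (\<forall>n. \<forall>x \<in> cocycles X n. f n x \<in> coboundaries Y n \<longrightarrow> x \<in> coboundaries X n) \<and>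
    (\<forall>n. \<forall>y \<in> cocycles Y n. \<exists>x \<in> cocycles X n. \<exists>b \<in> coboundaries Y n.
      y = f n x \<oplus>\<^bsub>obj Y n\<^esub> b)"

text \<open>Isomorphism in the derived category, the localisation at the quasi-isomorphisms: the
  isomorphisms \<open>X \<rightarrow> Y\<close> are the roofs \<open>X \<leftarrow> Z \<rightarrow> Y\<close> with two quasi-isomorphisms as legs.\<close>

definition derived_iso :: "('k::field, 'a) module \<Rightarrow> ('a, 'm) cochain_complex \<Rightarrow>
    ('a, 'n) cochain_complex \<Rightarrow> bool" where
  "derived_iso A X Y \<longleftrightarrow> bounded_complex A X \<and> bounded_complex A Y \<and>
    (\<exists>(Z :: ('a, nat \<Rightarrow> 'k) cochain_complex) f g.
      bounded_complex A Z \<and> quasi_iso A Z X f \<and> quasi_iso A Z Y g)"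

definition shift :: "int \<Rightarrow> ('a, 'm) cochain_complex \<Rightarrow> ('a, 'm) cochain_complex" where
  "shift k X = \<lparr> obj = (\<lambda>n. obj X (n + k)),
    diff = (\<lambda>n x. if even k then diff X (n + k) x
                  else \<ominus>\<^bsub>obj X (n + k + 1)\<^esub> diff X (n + k) x) \<rparr>"

text \<open>\<open>\<Oplus>\<^sub>j \<Sigma>\<^sup>j M\<^sub>j\<close>; the summand \<open>\<Sigma>\<^sup>j M\<^sub>j\<close> is concentrated in degree \<open>-j\<close>.\<close>

definition sum_of_shifts :: "(int \<Rightarrow> ('a, 'm) module) \<Rightarrow> ('a, 'm) cochain_complex" where
  "sum_of_shifts M = \<lparr> obj = (\<lambda>n. M (- n)), diff = (\<lambda>n x. \<zero>\<^bsub>M (- (n + 1))\<^esub>) \<rparr>"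

definition stalk :: "('a, 'm) module \<Rightarrow> ('a, 'm) cochain_complex" where
  "stalk M = sum_of_shifts (\<lambda>j. if j = 0 then M else M\<lparr>carrier := {\<zero>\<^bsub>M\<^esub>}\<rparr>)"

text \<open>The Nakayama functor \<open>\<nu> = D Hom\<^sub>A(-, A)\<close>, applied degreewise.\<close>

definition nakayama_complex :: "('k::field, 'a) module \<Rightarrow> ('a, 'm) cochain_complex \<Rightarrow>
    ('a, ('m \<Rightarrow> 'a) \<Rightarrow> 'k) cochain_complex" where
  "nakayama_complex A P =
    \<lparr> obj = (\<lambda>n. kdual (opp A) (adual A (obj P n))),
      diff = (\<lambda>n. kdual_map (adual A (obj P (n + 1))) (adual A (obj P n))
                    (adual_map (obj P n) (obj P (n + 1)) (diff P n))) \<rparr>"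

text \<open>The Auslander--Reiten translate \<open>\<tau> = \<Sigma>\<^sup>-\<^sup>1 \<circ> \<nu>\<close> of the bounded derived category of an algebra
  of finite global dimension, with \<open>\<nu>\<close> the derived Nakayama functor (the Serre functor),
  which is computed on a bounded complex \<open>P\<close> of finitely generated projectives isomorphic
  to \<open>X\<close>.\<close>

definition is_derived_tau :: "('k::field, 'a) module \<Rightarrow> ('a, nat \<Rightarrow> 'k) cochain_complex \<Rightarrow>
    ('a, nat \<Rightarrow> 'k) cochain_complex \<Rightarrow> bool" where
  "is_derived_tau A X Y \<longleftrightarrow> (\<exists>P :: ('a, nat \<Rightarrow> 'k) cochain_complex.
    (\<forall>n. fg_projective A (obj P n)) \<and> derived_iso A P X \<and>
    derived_iso A (shift (-1) (nakayama_complex A P)) Y)"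

text \<open>\<open>Y \<cong> \<tau>\<^sup>m X\<close> in the bounded derived category, where \<open>\<tau>\<close> is an autoequivalence, so that
  \<open>Y \<cong> \<tau>\<^sup>-\<^sup>1 X\<close> means \<open>X \<cong> \<tau> Y\<close>.\<close>

definition is_derived_tau_power :: "('k::field, 'a) module \<Rightarrow> int \<Rightarrow> ('a, 'm) cochain_complex \<Rightarrow>
    ('a, nat \<Rightarrow> 'k) cochain_complex \<Rightarrow> bool" where
  "is_derived_tau_power A m X Y \<longleftrightarrow>
    iterate_rel (derived_iso A)
      (if 0 \<le> m then is_derived_tau A else (\<lambda>Y Z. is_derived_tau A Z Y)) (nat \<bar>m\<bar>) X Y"


section \<open>Path algebras\<close>

text \<open>A path is a pair of its starting vertex and its list of arrows, read from left to right.\<close>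

definition quiver_paths :: "('v, 'e) pre_digraph \<Rightarrow> ('v \<times> 'e list) set" where
  "quiver_paths Q = {(u, p). \<exists>v. pre_digraph.awalk Q u p v}"

definition path_algebra ::
    "('v, 'e) pre_digraph \<Rightarrow> ('k::field, 'v \<times> 'e list \<Rightarrow> 'k) module" where
  "path_algebra Q =
    \<lparr> carrier = {f. finite {x. f x \<noteq> 0} \<and> {x. f x \<noteq> 0} \<subseteq> quiver_paths Q},
      mult = (\<lambda>f g. \<lambda>(u, p). \<Sum>n\<le>length p.
        f (u, take n p) * g (last (pre_digraph.awalk_verts Q u (take n p)), drop n p)),
      one = (\<lambda>(u, p). if u \<in> verts Q \<and> p = [] then 1 else 0),
      zero = (\<lambda>_. 0), add = (\<lambda>f g x. f x + g x), smult = (\<lambda>c f x. c * f x) \<rparr>"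

definition vertex_idem :: "'v \<Rightarrow> 'v \<times> 'e list \<Rightarrow> 'k::field" where
  "vertex_idem v = (\<lambda>x. if x = (v, []) then 1 else 0)"

definition proj_at :: "('v, 'e) pre_digraph \<Rightarrow> 'v \<Rightarrow>
    ('v \<times> 'e list \<Rightarrow> 'k::field, 'v \<times> 'e list \<Rightarrow> 'k) module" where
  "proj_at Q v = (let A = path_algebra Q in
    \<lparr> carrier = (\<lambda>a. vertex_idem v \<otimes>\<^bsub>A\<^esub> a) ` carrier A, mult = undefined, one = undefined,
      zero = \<zero>\<^bsub>A\<^esub>, add = (\<oplus>\<^bsub>A\<^esub>), smult = (\<lambda>a x. x \<otimes>\<^bsub>A\<^esub> a) \<rparr>)"

definition dim_vector :: "('v, 'e) pre_digraph \<Rightarrow>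
    ('v \<times> 'e list \<Rightarrow> 'k::field, 'm) module \<Rightarrow> 'v \<Rightarrow> int" where
  "dim_vector Q M v = int (vectorspace.dim (class_ring :: 'k ring)
    ((kspace (path_algebra Q) M)\<lparr>carrier := (\<lambda>x. vertex_idem v \<odot>\<^bsub>M\<^esub> x) ` carrier M\<rparr>))"


section \<open>Weighted foldings\<close>

text \<open>Chebyshev polynomials of the second kind.\<close>

fun cheb_U :: "nat \<Rightarrow> real poly" where
  "cheb_U 0 = 1"
| "cheb_U (Suc 0) = [:0, 2:]"
| "cheb_U (Suc (Suc i)) = [:0, 2:] * cheb_U (Suc i) - cheb_U i"

lemma cheb_U_cos: "poly (cheb_U i) (cos \<theta>) * sin \<theta> = sin (real (i + 1) * \<theta>)"
proof (induction i rule: cheb_U.induct)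
  case 2
  show ?case by (simp add: sin_double)
next
  case (3 i)
  define a where "a = (real i + 2) * \<theta>"
  have e: "real (Suc (Suc i) + 1) * \<theta> = a + \<theta>" "real (i + 1) * \<theta> = a - \<theta>"
    "real (Suc i + 1) * \<theta> = a"
    by (simp_all add: a_def algebra_simps)
  show ?case
    using 3 unfolding e by (simp add: sin_add sin_diff algebra_simps)
qed simp

text \<open>\<open>Fold_A n\<close> is \<open>\<Delta> = A\<^sub>2\<^sub>n\<^sub>-\<^sub>1\<close> and \<open>Fold_D n\<close> is \<open>\<Delta> = D\<^sub>n\<^sub>+\<^sub>1\<close>.\<close>

datatype folding = Fold_A nat | Fold_D nat | Fold_E6 | Fold_E7 | Fold_E8

text \<open>\<open>Vtx i\<close>, \<open>Plus i\<close>, \<open>Minus i\<close>, \<open>Tilde i\<close>, \<open>Phi i\<close> are the vertices written \<open>i\<close>, \<open>i\<^sup>+\<close>, \<open>i\<^sup>-\<close>,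
  \<open>i\<close> with a tilde, and \<open>\<phi>\<^sub>i\<close>; \<open>Extra\<close> is \<open>v\<^sub>6\<close>, \<open>v\<^sub>7\<close> or \<open>v\<^sub>8\<close>.\<close>

datatype vertex = Vtx nat | Plus nat | Minus nat | Tilde nat | Phi nat | Extra

fun valid_folding :: "folding \<Rightarrow> bool" where
  "valid_folding (Fold_A n) \<longleftrightarrow> n \<ge> 2"
| "valid_folding (Fold_D n) \<longleftrightarrow> n \<ge> 3"
| "valid_folding _ \<longleftrightarrow> True"

text \<open>The number \<open>n\<close> for which the folding has target \<open>I\<^sub>2(2n)\<close>.\<close>

fun fold_n :: "folding \<Rightarrow> nat" where
  "fold_n (Fold_A n) = n"
| "fold_n (Fold_D n) = n"
| "fold_n Fold_E6 = 6"
| "fold_n Fold_E7 = 9"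
| "fold_n Fold_E8 = 15"

fun fold_verts :: "folding \<Rightarrow> vertex set" where
  "fold_verts (Fold_A n) = Vtx ` {0..2 * n - 2}"
| "fold_verts (Fold_D n) = Vtx ` {0..n - 2} \<union> {Plus (n - 1), Minus (n - 1)}"
| "fold_verts Fold_E6 = {Plus 0, Minus 0, Plus 1, Minus 1, Vtx 2, Extra}"
| "fold_verts Fold_E7 = {Vtx 0, Vtx 1, Vtx 2, Vtx 3, Tilde 1, Tilde 2, Extra}"
| "fold_verts Fold_E8 = {Vtx 0, Vtx 1, Vtx 2, Vtx 3, Vtx 4, Extra, Phi 0, Phi 1}"

fun vertex_index :: "vertex \<Rightarrow> nat" where
  "vertex_index (Vtx i) = i"
| "vertex_index (Plus i) = i"
| "vertex_index (Minus i) = i"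
| "vertex_index (Tilde i) = i"
| "vertex_index (Phi i) = i"
| "vertex_index Extra = 0"

definition even_to_odd :: "(vertex \<times> vertex) set \<Rightarrow> (vertex \<times> vertex) set" where
  "even_to_odd E = {(u, v) \<in> E \<union> E\<inverse>. even (vertex_index u) \<and> odd (vertex_index v)}"

fun fold_arrows :: "folding \<Rightarrow> (vertex \<times> vertex) set" where
  "fold_arrows (Fold_A n) = even_to_odd {(Vtx i, Vtx (i + 1)) |i. i + 1 \<le> 2 * n - 2}"
| "fold_arrows (Fold_D n) = even_to_odd ({(Vtx i, Vtx (i + 1)) |i. i + 1 \<le> n - 2} \<union>
    {(Vtx (n - 2), Plus (n - 1)), (Vtx (n - 2), Minus (n - 1))})"
| "fold_arrows Fold_E6 = {(Plus 0, Plus 1), (Minus 0, Minus 1), (Vtx 2, Plus 1),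
    (Vtx 2, Minus 1), (Vtx 2, Extra)}"
| "fold_arrows Fold_E7 = {(Vtx 0, Vtx 1), (Vtx 2, Vtx 1), (Vtx 2, Vtx 3), (Tilde 1, Vtx 3),
    (Tilde 2, Vtx 3), (Tilde 2, Extra)}"
| "fold_arrows Fold_E8 = {(Vtx 0, Vtx 1), (Vtx 2, Vtx 1), (Vtx 2, Vtx 3), (Vtx 4, Vtx 3),
    (Vtx 4, Extra), (Vtx 4, Phi 1), (Phi 0, Phi 1)}"

definition fold_quiver :: "folding \<Rightarrow> (vertex, vertex \<times> vertex) pre_digraph" where
  "fold_quiver \<Delta> = \<lparr> verts = fold_verts \<Delta>, arcs = fold_arrows \<Delta>, tail = fst, head = snd \<rparr>"

datatype i2_vertex = I0 | I1

text \<open>Sources go to \<open>[0]\<close>; every other vertex of these quivers is a sink and goes to \<open>[1]\<close>.\<close>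

definition fold_map :: "folding \<Rightarrow> vertex \<Rightarrow> i2_vertex" where
  "fold_map \<Delta> v = (if in_arcs (fold_quiver \<Delta>) v = {} then I0 else I1)"

definition golden :: real where
  "golden = 2 * cos (pi / 5)"

fun kappa :: "folding \<Rightarrow> vertex \<Rightarrow> real" where
  "kappa (Fold_A n) (Vtx i) = poly (cheb_U i) (cos (pi / (2 * n)))"
| "kappa (Fold_D n) (Vtx i) = 2 * poly (cheb_U i) (cos (pi / (2 * n)))"
| "kappa (Fold_D n) (Plus i) = poly (cheb_U i) (cos (pi / (2 * n)))"
| "kappa (Fold_D n) (Minus i) = poly (cheb_U i) (cos (pi / (2 * n)))"
| "kappa Fold_E6 (Plus i) = poly (cheb_U i) (cos (pi / 12))"
| "kappa Fold_E6 (Minus i) = poly (cheb_U i) (cos (pi / 12))"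
| "kappa Fold_E6 (Vtx i) = poly (cheb_U i) (cos (pi / 12))"
| "kappa Fold_E6 Extra = sqrt 2"
| "kappa Fold_E7 (Vtx i) = poly (cheb_U i) (cos (pi / 18))"
| "kappa Fold_E7 (Tilde i) = poly (cheb_U i) (cos (pi / 9))"
| "kappa Fold_E7 Extra = 2 * cos (5 * pi / 18)"
| "kappa Fold_E8 (Vtx i) = poly (cheb_U i) (cos (pi / 30))"
| "kappa Fold_E8 (Phi i) = golden * poly (cheb_U i) (cos (pi / 30))"
| "kappa Fold_E8 Extra = inverse golden * poly (cheb_U 3) (cos (pi / 30))"
| "kappa _ _ = undefined"

fun varsigma :: "folding \<Rightarrow> i2_vertex \<Rightarrow> real" where
  "varsigma (Fold_D n) I0 = 2"
| "varsigma (Fold_D n) I1 = 4 * cos (pi / (2 * n))"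
| "varsigma \<Delta> I0 = 1"
| "varsigma \<Delta> I1 = 2 * cos (pi / (2 * fold_n \<Delta>))"

text \<open>Coordinate pairs over the subfield \<open>Frac(\<int>[2 cos(\<pi>/2n)])\<close> of the reals are represented
  as pairs of reals.\<close>

definition fold_proj :: "folding \<Rightarrow> (vertex \<Rightarrow> int) \<Rightarrow> real \<times> real" where
  "fold_proj \<Delta> u =
    (\<Sum>i | i \<in> verts (fold_quiver \<Delta>) \<and> fold_map \<Delta> i = I0. kappa \<Delta> i / varsigma \<Delta> I0 * u i,
     \<Sum>i | i \<in> verts (fold_quiver \<Delta>) \<and> fold_map \<Delta> i = I1. kappa \<Delta> i / varsigma \<Delta> I1 * u i)"

definition fold_length :: "folding \<Rightarrow> real \<times> real \<Rightarrow> real" where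
  "fold_length \<Delta> = (\<lambda>(a, b). let n = fold_n \<Delta>; l = varsigma \<Delta> I0 in
    cmod (of_real (a * l) +
      of_real (b * (2 * l * cos (pi / (2 * n)))) *
        exp (\<i> * of_real ((2 * real n - 1) * pi / (2 * n)))))"

type_synonym 'k kq = "vertex \<times> (vertex \<times> vertex) list \<Rightarrow> 'k"

definition delta_mod :: "folding \<Rightarrow> ('k::field kq, 'm) module \<Rightarrow> real \<times> real" where
  "delta_mod \<Delta> M = fold_proj \<Delta> (dim_vector (fold_quiver \<Delta>) M)"

text \<open>\<open>v\<close> is the value of \<open>\<delta>\<close> at \<open>X \<cong> \<Oplus>\<^sub>j \<Sigma>\<^sup>j M\<^sub>j\<close>.\<close>

definition is_delta_derived :: "folding \<Rightarrow> ('k::field kq, nat \<Rightarrow> 'k) cochain_complex \<Rightarrow>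
    real \<times> real \<Rightarrow> bool" where
  "is_delta_derived \<Delta> X v \<longleftrightarrow>
    (\<exists>M :: int \<Rightarrow> ('k kq, nat \<Rightarrow> 'k) module.
      derived_iso (path_algebra (fold_quiver \<Delta>)) X (sum_of_shifts M) \<and>
      v = (\<Sum>j | \<not> zero_mod (M j) \<and> even j. delta_mod \<Delta> (M j))
        - (\<Sum>j | \<not> zero_mod (M j) \<and> odd j. delta_mod \<Delta> (M j)))"

end

theory Submission
  imports Defs
begin

text \<open>
  Write \<open>A = KQ\<close>. For a bipartite quiver the length of \<open>d\<^sub>F(u)\<close> is the square root of
  \<open>q(a, b) = a\<^sup>2 + b\<^sup>2 - 2 a b cos(\<pi>/2n)\<close>, where \<open>a\<close> and \<open>b\<close> are the sums of \<open>u\<close> over the sources and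
  over the sinks, weighted by \<open>\<kappa>\<close>. Since \<open>\<kappa>\<close> is an eigenvector of the adjacency matrix for the
  eigenvalue \<open>2 cos(\<pi>/2n)\<close>, the Coxeter transformation acts on \<open>(a, b)\<close> as a product of two
  reflections that preserve \<open>q\<close>, and \<open>q\<close> takes the value \<open>\<kappa>(i)\<^sup>2\<close> on the dimension vector of \<open>P(i)\<close>.
  It remains to see that \<open>\<tau>\<close> acts by the Coxeter transformation. In the derived category this holds
  because Euler characteristics are invariant under quasi-isomorphisms. In the module category \<open>\<tau>\<close>
  kills projectives, which settles \<open>m > 0\<close>. For \<open>m < 0\<close> all modules that occur are bricks, meaning that
  their endomorphisms are scalars: if \<open>L\<close> is a brick with \<open>Hom\<^sub>A(L, A) \<noteq> 0\<close>, then \<open>L\<close> is projective and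
  \<open>Tr L = 0\<close>; otherwise \<open>0 \<rightarrow> Hom\<^sub>A(P0, A) \<rightarrow> Hom\<^sub>A(P1, A) \<rightarrow> Tr L \<rightarrow> 0\<close> is exact for a minimal
  presentation \<open>P1 \<rightarrow> P0\<close> of \<open>L\<close>, which gives the dimension vector of \<open>Tr L\<close>, and \<open>Tr L\<close> is a brick.
\<close>

section \<open>Finite-dimensional vector spaces\<close>

text \<open>Projectives enter only as direct summands of free modules and are never decomposed into
  the P(i). The dimension vector of Hom(P, A) and the injectivity of P1 -> P0, which is the
  hereditary property of A, both rest on one consequence of such a splitting: functionals on the
  component of P at a source extend to homomorphisms P -> A (\<open>projective_extend\<close>).

  The natural invariant under the inverse translate would be indecomposability, but carrying it
  through Tr calls for decompositions of presentations. Being a brick is a statement about maps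
  alone, and an endomorphism can be lifted along a presentation and along a double dual. For Tr D
  the brick to be tested is a module over the opposite algebra; hence the abstract bipartite
  setting, which is closed under reversing all arrows.

  In the derived category no such care is needed: invariance of the quadratic form is a symmetric
  statement, so one argument serves both directions.\<close>

abbreviation vspace :: "('k::field, 'v) module \<Rightarrow> bool" where
  "vspace V \<equiv> vectorspace class_ring V"

abbreviation kdim :: "('k::field, 'v) module \<Rightarrow> nat" where
  "kdim V \<equiv> vectorspace.dim class_ring V"

abbreviation subsp :: "'v set \<Rightarrow> ('k::field, 'v) module \<Rightarrow> bool" where
  "subsp S V \<equiv> submodule class_ring S V"

abbreviation fn_space :: "'i set \<Rightarrow> ('k::field, 'i \<Rightarrow> 'k) module" where
  "fn_space I \<equiv> ring.func_space class_ring I"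

definition fdim :: "('k::field, 'v) module \<Rightarrow> bool" where
  "fdim V \<longleftrightarrow> vspace V \<and> vectorspace.fin_dim class_ring V"

lemma fdim_vspace: "fdim V \<Longrightarrow> vspace V"
  by (simp add: fdim_def)

lemma vspaceI:
  fixes V :: "('k::field, 'v) module"
  assumes "abelian_group V"
    and "\<And>c x. x \<in> carrier V \<Longrightarrow> c \<odot>\<^bsub>V\<^esub> x \<in> carrier V"
    and "\<And>c d x. x \<in> carrier V \<Longrightarrow> (c + d) \<odot>\<^bsub>V\<^esub> x = c \<odot>\<^bsub>V\<^esub> x \<oplus>\<^bsub>V\<^esub> d \<odot>\<^bsub>V\<^esub> x"
    and "\<And>c x y. x \<in> carrier V \<Longrightarrow> y \<in> carrier V \<Longrightarrow>
      c \<odot>\<^bsub>V\<^esub> (x \<oplus>\<^bsub>V\<^esub> y) = c \<odot>\<^bsub>V\<^esub> x \<oplus>\<^bsub>V\<^esub> c \<odot>\<^bsub>V\<^esub> y"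
    and "\<And>c d x. x \<in> carrier V \<Longrightarrow> (c * d) \<odot>\<^bsub>V\<^esub> x = c \<odot>\<^bsub>V\<^esub> (d \<odot>\<^bsub>V\<^esub> x)"
    and "\<And>x. x \<in> carrier V \<Longrightarrow> 1 \<odot>\<^bsub>V\<^esub> x = x"
  shows "vspace V"
proof -
  have "Module.module class_ring V"
    unfolding Module.module_def module_axioms_def
    using assms class_cring.is_cring by auto
  then show ?thesis unfolding vectorspace_def using class_field by auto
qed

lemma subsp_iff:
  assumes "vspace V"
  shows "subsp S V \<longleftrightarrow> S \<subseteq> carrier V \<and> \<zero>\<^bsub>V\<^esub> \<in> S \<and> (\<forall>x\<in>S. \<forall>y\<in>S. x \<oplus>\<^bsub>V\<^esub> y \<in> S) \<and>
    (\<forall>c. \<forall>x\<in>S. c \<odot>\<^bsub>V\<^esub> x \<in> S)"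
  using assms unfolding submodule_def vectorspace_def by auto

lemma subsp_vspace:
  assumes "vspace V" "subsp S V"
  shows "vspace (V\<lparr>carrier := S\<rparr>)"
proof -
  interpret V: vectorspace class_ring V by fact
  show ?thesis
    by (rule V.subspace_is_vs, rule VectorSpace.subspace.intro) (use assms in auto)
qed

lemma khom_iff:
  "T \<in> module_hom class_ring V W \<longleftrightarrow> (\<forall>x\<in>carrier V. T x \<in> carrier W) \<and>
    (\<forall>x\<in>carrier V. \<forall>y\<in>carrier V. T (x \<oplus>\<^bsub>V\<^esub> y) = T x \<oplus>\<^bsub>W\<^esub> T y) \<and>
    (\<forall>c. \<forall>x\<in>carrier V. T (c \<odot>\<^bsub>V\<^esub> x) = c \<odot>\<^bsub>W\<^esub> T x)"
  unfolding LinearCombinations.module_hom_def by auto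

lemma linear_mapI:
  assumes "vspace V" "vspace W" "T \<in> module_hom class_ring V W"
  shows "linear_map class_ring V W T"
  using assms unfolding linear_map_def mod_hom_def vectorspace_def mod_hom_axioms_def by auto

lemma kernel_subsp:
  assumes "vspace V" "vspace W" "T \<in> module_hom class_ring V W"
  shows "subsp (mod_kernel V W T) V"
proof -
  interpret linear_map class_ring V W T by (rule linear_mapI[OF assms])
  show ?thesis using ker_is_submodule unfolding ker_def mod_kernel_def .
qed

lemma image_subsp:
  assumes "vspace V" "vspace W" "T \<in> module_hom class_ring V W"
  shows "subsp (T ` carrier V) W"
proof -
  interpret linear_map class_ring V W T by (rule linear_mapI[OF assms])
  show ?thesis using im_is_submodule unfolding im_def .
qed

text \<open>Independent subsets of \<open>S\<close> stay independent in \<open>V\<close>, so their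
  size is bounded by the dimension of \<open>V\<close>; a maximal one exists and generates
  \<open>S\<close>.\<close>

lemma fdim_subsp:
  assumes "fdim V" "subsp S V"
  shows "fdim (V\<lparr>carrier := S\<rparr>)"
proof -
  interpret V: vectorspace class_ring V using assms(1) by (rule fdim_vspace)
  interpret S: vectorspace class_ring "V\<lparr>carrier := S\<rparr>"
    using subsp_vspace[OF fdim_vspace] assms by blast
  have sub: "S \<subseteq> carrier V" using assms(2) unfolding submodule_def by auto
  have small: "finite A \<and> card A \<le> V.dim" if "A \<subseteq> S \<and> S.lin_indpt A" for A
  proof -
    have "V.lin_indpt A" using V.span_li_not_depend(2)[of A S] that assms(2) by simp
    moreover have "A \<subseteq> carrier V" using that sub by (meson subset_trans)
    ultimately show ?thesis using V.li_le_dim[of A] assms(1) unfolding fdim_def by simp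
  qed
  have "\<exists>A. finite A \<and> maximal A (\<lambda>B. B \<subseteq> carrier (V\<lparr>carrier := S\<rparr>) \<and> S.lin_indpt B)"
  proof (rule maximal_exists[where N = "V.dim" and B = "{}"])
    show "finite A \<and> card A \<le> V.dim" if "A \<subseteq> carrier (V\<lparr>carrier := S\<rparr>) \<and> S.lin_indpt A" for A
      by (rule small) (use that in simp)
    show "{} \<subseteq> carrier (V\<lparr>carrier := S\<rparr>) \<and> S.lin_indpt {}"
      by (simp add: S.lin_dep_def)
  qed
  then obtain A where A: "finite A" "maximal A (\<lambda>B. B \<subseteq> carrier (V\<lparr>carrier := S\<rparr>) \<and> S.lin_indpt B)"
    by blast
  have "S.gen_set A" by (rule S.max_li_is_gen[OF A(2)])
  moreover have "A \<subseteq> carrier (V\<lparr>carrier := S\<rparr>)" using A(2) unfolding maximal_def by blast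
  ultimately show ?thesis
    unfolding fdim_def S.fin_dim_def using A(1) S.vectorspace_axioms by metis
qed

text \<open>Rank-nullity in the shape that the later dimension counts use: the image is replaced by
  a surjectivity hypothesis, and the kernel is the \<open>mod_kernel\<close> of modules.\<close>

lemma rank_nullity_onto:
  assumes V: "fdim V" and W: "vspace W" and T: "T \<in> module_hom class_ring V W"
    and onto: "T ` carrier V = carrier W"
  shows "fdim W" "kdim V = kdim W + kdim (V\<lparr>carrier := mod_kernel V W T\<rparr>)"
proof -
  interpret linear_map class_ring V W T by (rule linear_mapI[OF fdim_vspace[OF V] W T])
  have fd: "V.fin_dim" using V unfolding fdim_def by simp
  show "fdim W" unfolding fdim_def using rank_nullity_main(2)[OF fd onto] W by auto
  have "W.vs (T ` carrier V) = W" using onto by simp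
  then show "kdim V = kdim W + kdim (V\<lparr>carrier := mod_kernel V W T\<rparr>)"
    using rank_nullity[OF fd] unfolding im_def ker_def mod_kernel_def by simp
qed

lemma kdim_bij:
  assumes V: "fdim V" and W: "vspace W" and T: "T \<in> module_hom class_ring V W"
    and bij: "bij_betw T (carrier V) (carrier W)"
  shows "fdim W" "kdim V = kdim W"
proof -
  interpret linear_map class_ring V W T by (rule linear_mapI[OF fdim_vspace[OF V] W T])
  have b: "inj_on T (carrier V)" "T ` carrier V = carrier W" using bij by (auto simp: bij_betw_def)
  show "fdim W" by (rule rank_nullity_onto[OF V W T b(2)])
  show "kdim V = kdim W" using dim_eq b V unfolding fdim_def by blast
qed

lemma kdim_zero:
  assumes "vspace V" "carrier V = {\<zero>\<^bsub>V\<^esub>}"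
  shows "fdim V" "kdim V = 0"
proof -
  interpret V: vectorspace class_ring V by fact
  have g: "V.gen_set {}" using assms(2) V.span_empty by simp
  show "fdim V" unfolding fdim_def V.fin_dim_def using g V.vectorspace_axioms by (auto intro!: exI[of _ "{}"])
  show "kdim V = 0" using V.gen_ge_dim[of "{}"] g by simp
qed

section \<open>Function spaces, coordinates and duals\<close>

lemma fn_space_simps:
  fixes I :: "'i set"
  shows "carrier (fn_space I :: ('k::field, 'i \<Rightarrow> 'k) module) = I \<rightarrow>\<^sub>E UNIV"
    "\<zero>\<^bsub>(fn_space I :: ('k, 'i \<Rightarrow> 'k) module)\<^esub> = (\<lambda>i\<in>I. 0)"
    "f \<oplus>\<^bsub>(fn_space I :: ('k, 'i \<Rightarrow> 'k) module)\<^esub> g = (\<lambda>i\<in>I. f i + g i)"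
    "c \<odot>\<^bsub>(fn_space I :: ('k, 'i \<Rightarrow> 'k) module)\<^esub> f = (\<lambda>i\<in>I. c * f i)"
  by (simp_all add: class_ring.func_space_def)

lemma fn_space_vspace: "vspace (fn_space I :: ('k::field, 'i \<Rightarrow> 'k) module)"
proof -
  have "Module.module class_ring (fn_space I :: ('k, 'i \<Rightarrow> 'k) module)"
    by (rule cring.func_space_is_module) (rule class_cring.is_cring)
  then show ?thesis unfolding vectorspace_def using class_field by blast
qed

lemma basis_coords:
  fixes V :: "('k::field, 'v) module"
  assumes "vspace V" "finite B" "vectorspace.basis class_ring V B"
  shows "(\<lambda>a. module.lincomb V a B) \<in> module_hom class_ring (fn_space B) V"
    "bij_betw (\<lambda>a. module.lincomb V a B) (B \<rightarrow>\<^sub>E UNIV) (carrier V)"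
proof -
  interpret V: vectorspace class_ring V by fact
  have sub: "B \<subseteq> carrier V" using assms unfolding V.basis_def by simp
  interpret L: linear_map class_ring "fn_space B" V "\<lambda>a. V.lincomb a B"
    using V.lincomb_is_linear[OF assms(2) sub] by simp
  show "(\<lambda>a. V.lincomb a B) \<in> module_hom class_ring (fn_space B) V" by (rule L.f_hom)
  have ex: "\<exists>!a. a \<in> B \<rightarrow>\<^sub>E UNIV \<and> V.lincomb a B = v" if "v \<in> carrier V" for v
    using V.basis_criterion[OF assms(2) sub] assms(3) that by auto
  show "bij_betw (\<lambda>a. V.lincomb a B) (B \<rightarrow>\<^sub>E UNIV) (carrier V)"
    unfolding bij_betw_def inj_on_def
  proof (intro conjI ballI impI)
    fix a b assume ab: "a \<in> B \<rightarrow>\<^sub>E UNIV" "b \<in> B \<rightarrow>\<^sub>E UNIV" "V.lincomb a B = V.lincomb b B"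
    have "V.lincomb a B \<in> carrier V" using L.f_im[of a] ab by (simp add: fn_space_simps)
    from ex[OF this] ab show "a = b" by metis
  next
    show "(\<lambda>a. V.lincomb a B) ` (B \<rightarrow>\<^sub>E UNIV) = carrier V"
    proof (intro equalityI subsetI)
      fix v assume "v \<in> (\<lambda>a. V.lincomb a B) ` (B \<rightarrow>\<^sub>E UNIV)"
      then obtain a where "a \<in> carrier (fn_space B :: ('k, 'v \<Rightarrow> 'k) module)" "v = V.lincomb a B"
        unfolding fn_space_simps by blast
      then show "v \<in> carrier V" using L.f_im[of a] by simp
    next
      fix v assume "v \<in> carrier V"
      from ex[OF this] show "v \<in> (\<lambda>a. V.lincomb a B) ` (B \<rightarrow>\<^sub>E UNIV)" by blast
    qed
  qed
qed

lemma inv_khom: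
  assumes V: "vspace V" and T: "T \<in> module_hom class_ring V W"
    and bij: "bij_betw T (carrier V) (carrier W)"
  shows "the_inv_into (carrier V) T \<in> module_hom class_ring W V"
proof -
  let ?S = "the_inv_into (carrier V) T"
  interpret V: vectorspace class_ring V by fact
  have inj: "inj_on T (carrier V)" and im: "T ` carrier V = carrier W"
    using bij by (auto simp: bij_betw_def)
  have TS: "T (?S w) = w" if "w \<in> carrier W" for w using f_the_inv_into_f[OF inj] that im by blast
  have S: "?S w \<in> carrier V" if "w \<in> carrier W" for w using the_inv_into_into[OF inj] that im by blast
  have ST: "?S (T v) = v" if "v \<in> carrier V" for v by (rule the_inv_into_f_f[OF inj that])
  have T': "T (x \<oplus>\<^bsub>V\<^esub> y) = T x \<oplus>\<^bsub>W\<^esub> T y" "T (c \<odot>\<^bsub>V\<^esub> x) = c \<odot>\<^bsub>W\<^esub> T x"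
    if "x \<in> carrier V" "y \<in> carrier V" for x y c using T that unfolding khom_iff by auto
  have cl: "x \<oplus>\<^bsub>V\<^esub> y \<in> carrier V" "c \<odot>\<^bsub>V\<^esub> x \<in> carrier V"
    if "x \<in> carrier V" "y \<in> carrier V" for x y c using that by auto
  show ?thesis
    unfolding khom_iff
  proof (intro conjI ballI allI)
    fix x y c assume x: "x \<in> carrier W"
    show "?S x \<in> carrier V" by (rule S[OF x])
    show "?S (c \<odot>\<^bsub>W\<^esub> x) = c \<odot>\<^bsub>V\<^esub> ?S x"
      using ST[OF cl(2)[OF S[OF x] S[OF x]]] T'(2)[OF S[OF x] S[OF x]] TS[OF x] by metis
    assume y: "y \<in> carrier W"
    show "?S (x \<oplus>\<^bsub>W\<^esub> y) = ?S x \<oplus>\<^bsub>V\<^esub> ?S y"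
      using ST[OF cl(1)[OF S[OF x] S[OF y]]] T'(1)[OF S[OF x] S[OF y]] TS[OF x] TS[OF y] by metis
  qed
qed

text \<open>Here finite dimension is known for the target, so \<open>kdim_bij\<close> is applied to
  the inverse map.\<close>

lemma kdim_bij':
  assumes V: "vspace V" and W: "fdim W" and T: "T \<in> module_hom class_ring V W"
    and bij: "bij_betw T (carrier V) (carrier W)"
  shows "fdim V" "kdim V = kdim W"
  using kdim_bij[OF W V inv_khom[OF V T bij] bij_betw_the_inv_into[OF bij]] by simp_all

text \<open>A quotient space \<open>V/S\<close>, realised by coordinates.\<close>

lemma quotient_map:
  fixes V :: "('k::field, 'v) module"
  assumes V: "fdim V" and S: "subsp S V"
  obtains I :: "'v set" and \<pi> where "finite I" "\<pi> \<in> module_hom class_ring V (fn_space I)"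
    "\<pi> ` carrier V = carrier (fn_space I :: ('k, 'v \<Rightarrow> 'k) module)"
    "mod_kernel V (fn_space I) \<pi> = S"
proof -
  interpret V: vectorspace class_ring V using V by (rule fdim_vspace)
  let ?S = "V\<lparr>carrier := S\<rparr>"
  have fS: "fdim ?S" by (rule fdim_subsp[OF V S])
  interpret S: vectorspace class_ring ?S using fS by (rule fdim_vspace)
  obtain C where C: "finite C" "S.basis C" using S.finite_basis_exists fS unfolding fdim_def by blast
  have CS: "C \<subseteq> S" using C(2) unfolding S.basis_def by simp
  have SV: "S \<subseteq> carrier V" using S unfolding submodule_def by auto
  have spC: "V.span C = S" and liC: "V.lin_indpt C"
    using V.span_li_not_depend[OF CS S] C(2) unfolding S.basis_def by auto
  have fd: "V.fin_dim" using V unfolding fdim_def by simp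
  \<comment> \<open>A basis \<open>C\<close> of \<open>S\<close> is extended to a basis
    \<open>B\<close> of \<open>V\<close>: maximality is taken only among the independent sets that
    contain \<open>C\<close>.\<close>
  have "\<exists>B. finite B \<and> maximal B (\<lambda>D. C \<subseteq> D \<and> D \<subseteq> carrier V \<and> V.lin_indpt D)"
  proof (rule maximal_exists[where N = "V.dim" and B = C])
    show "finite A \<and> card A \<le> V.dim" if "C \<subseteq> A \<and> A \<subseteq> carrier V \<and> V.lin_indpt A" for A
      using V.li_le_dim[OF fd] that by blast
    show "C \<subseteq> C \<and> C \<subseteq> carrier V \<and> V.lin_indpt C" using CS SV liC by blast
  qed
  then obtain B where B: "finite B" "maximal B (\<lambda>D. C \<subseteq> D \<and> D \<subseteq> carrier V \<and> V.lin_indpt D)"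
    by blast
  have CB: "C \<subseteq> B" and BV: "B \<subseteq> carrier V" using B(2) unfolding maximal_def by blast+
  have "maximal B (\<lambda>D. D \<subseteq> carrier V \<and> V.lin_indpt D)"
    using B(2) unfolding maximal_def by blast
  then have bB: "V.basis B" by (rule V.max_li_is_basis)
  let ?L = "\<lambda>a. V.lincomb a B"
  let ?F = "fn_space B :: ('k, 'v \<Rightarrow> 'k) module"
  let ?G = "fn_space (B - C) :: ('k, 'v \<Rightarrow> 'k) module"
  note L = basis_coords[OF V.vectorspace_axioms B(1) bB]
  have cF: "carrier ?F = B \<rightarrow>\<^sub>E UNIV" by (simp add: fn_space_simps)
  have bij: "bij_betw ?L (carrier ?F) (carrier V)" using L(2) unfolding cF .
  define M where "M = the_inv_into (carrier ?F) ?L"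
  have M: "M \<in> module_hom class_ring V ?F"
    unfolding M_def by (rule inv_khom[OF fn_space_vspace L(1) bij])
  have inv1: "M (?L a) = a" if "a \<in> B \<rightarrow>\<^sub>E UNIV" for a
    unfolding M_def using the_inv_into_f_f[of ?L "carrier ?F" a] bij that cF by (auto simp: bij_betw_def)
  have inv2: "?L (M v) = v" if "v \<in> carrier V" for v
    unfolding M_def using f_the_inv_into_f[of ?L "carrier ?F" v] bij that by (auto simp: bij_betw_def)
  \<comment> \<open>The quotient by the span of \<open>C\<close> is read off from the coordinates
    outside \<open>C\<close>.\<close>
  define \<pi> where "\<pi> = (\<lambda>v. restrict (M v) (B - C))"
  have hom: "\<pi> \<in> module_hom class_ring V ?G"
    using M unfolding khom_iff \<pi>_def by (auto simp: fn_space_simps restrict_def fun_eq_iff split: if_splits)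
  have onto: "\<pi> ` carrier V = carrier ?G"
  proof (intro equalityI subsetI)
    fix g assume "g \<in> \<pi> ` carrier V"
    then show "g \<in> carrier ?G" using hom unfolding khom_iff by auto
  next
    fix g assume g: "g \<in> carrier ?G"
    define a where "a = (\<lambda>b\<in>B. g b)"
    have a: "a \<in> B \<rightarrow>\<^sub>E UNIV" unfolding a_def by auto
    have "?L a \<in> carrier V" using bij a cF by (auto simp: bij_betw_def)
    moreover have "\<pi> (?L a) = g"
      using inv1[OF a] g unfolding \<pi>_def a_def by (auto simp: fn_space_simps PiE_def extensional_def fun_eq_iff)
    ultimately show "g \<in> \<pi> ` carrier V" by (metis imageI)
  qed
  have lc: "?L a = V.lincomb a C" if "\<And>b. b \<in> B - C \<Longrightarrow> a b = 0" for a :: "'v \<Rightarrow> 'k"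
  proof -
    have "V.lincomb a (C \<union> (B - C)) = V.lincomb a C \<oplus>\<^bsub>V\<^esub> V.lincomb a (B - C)"
      by (rule V.module.lincomb_union) (use C B CB BV in auto)
    moreover have "V.lincomb a (B - C) = \<zero>\<^bsub>V\<^esub>"
      by (rule V.lincomb_zero) (use that BV in auto)
    moreover have "C \<union> (B - C) = B" using CB by blast
    ultimately show ?thesis using CB BV by (simp add: V.lincomb_closed subset_trans)
  qed
  have ker: "mod_kernel V ?G \<pi> = S"
  proof (intro equalityI subsetI)
    fix v assume "v \<in> mod_kernel V ?G \<pi>"
    then have v: "v \<in> carrier V" and "restrict (M v) (B - C) = (\<lambda>i\<in>B - C. 0)"
      unfolding mod_kernel_def \<pi>_def by (auto simp: fn_space_simps)
    then have "M v b = 0" if "b \<in> B - C" for b using that by (metis restrict_apply')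
    then have "v = V.lincomb (M v) C" using lc[of "M v"] inv2[OF v] by simp
    also have "\<dots> \<in> V.span C" unfolding V.finite_span[OF C(1) subset_trans[OF CS SV]] by auto
    finally show "v \<in> S" using spC by simp
  next
    fix v assume v: "v \<in> S"
    then have "v \<in> V.span C" using spC by simp
    then obtain a where a: "v = V.lincomb a C" "a \<in> C \<rightarrow> UNIV"
      unfolding V.finite_span[OF C(1) subset_trans[OF CS SV]] by auto
    define a' where "a' = (\<lambda>b\<in>B. if b \<in> C then a b else 0)"
    have a': "a' \<in> B \<rightarrow>\<^sub>E UNIV" unfolding a'_def by auto
    have "?L a' = V.lincomb a' C" by (rule lc) (simp add: a'_def)
    also have "\<dots> = V.lincomb a C"
      by (rule V.lincomb_cong) (use CS SV CB in \<open>auto simp: a'_def\<close>)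
    finally have "M v = a'" using inv1[OF a'] a(1) by simp
    then have "\<pi> v = \<zero>\<^bsub>?G\<^esub>" unfolding \<pi>_def a'_def by (auto simp: fn_space_simps fun_eq_iff)
    then show "v \<in> mod_kernel V ?G \<pi>" using v SV unfolding mod_kernel_def by auto
  qed
  show ?thesis by (rule that[of "B - C" \<pi>]) (use B hom onto ker in auto)
qed

text \<open>Functionals are extensional on the carrier, so two of them are equal as functions once
  they agree there. The functionals are those of \<open>kdual\<close>, but only the field acts;
  linear algebra and module structure can thus share them.\<close>

definition vdual :: "('k::field, 'v) module \<Rightarrow> ('k, 'v \<Rightarrow> 'k) module" where
  "vdual V = \<lparr> carrier = {\<phi> \<in> extensional (carrier V).
        (\<forall>x \<in> carrier V. \<forall>y \<in> carrier V. \<phi> (x \<oplus>\<^bsub>V\<^esub> y) = \<phi> x + \<phi> y) \<and>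
        (\<forall>c. \<forall>x \<in> carrier V. \<phi> (c \<odot>\<^bsub>V\<^esub> x) = c * \<phi> x)},
      mult = undefined, one = undefined,
      zero = (\<lambda>x \<in> carrier V. 0),
      add = (\<lambda>\<phi> \<psi>. \<lambda>x \<in> carrier V. \<phi> x + \<psi> x),
      smult = (\<lambda>c \<phi>. \<lambda>x \<in> carrier V. c * \<phi> x) \<rparr>"

lemma vdual_simps:
  "\<phi> \<in> carrier (vdual V) \<longleftrightarrow> \<phi> \<in> extensional (carrier V) \<and>
        (\<forall>x \<in> carrier V. \<forall>y \<in> carrier V. \<phi> (x \<oplus>\<^bsub>V\<^esub> y) = \<phi> x + \<phi> y) \<and>
        (\<forall>c. \<forall>x \<in> carrier V. \<phi> (c \<odot>\<^bsub>V\<^esub> x) = c * \<phi> x)"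
  "\<zero>\<^bsub>vdual V\<^esub> = (\<lambda>x \<in> carrier V. 0)"
  "\<phi> \<oplus>\<^bsub>vdual V\<^esub> \<psi> = (\<lambda>x \<in> carrier V. \<phi> x + \<psi> x)"
  "c \<odot>\<^bsub>vdual V\<^esub> \<phi> = (\<lambda>x \<in> carrier V. c * \<phi> x)"
  by (simp_all add: vdual_def)

lemma vdual_vspace:
  assumes "vspace V"
  shows "vspace (vdual V)"
proof -
  interpret V: vectorspace class_ring V by fact
  have cl: "x \<oplus>\<^bsub>V\<^esub> y \<in> carrier V" "c \<odot>\<^bsub>V\<^esub> x \<in> carrier V"
    if "x \<in> carrier V" "y \<in> carrier V" for x y c using that by auto
  show ?thesis
  proof (rule vspaceI)
    show "abelian_group (vdual V)"
    proof (rule abelian_groupI)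
      fix \<phi> assume p: "\<phi> \<in> carrier (vdual V)"
      show "\<zero>\<^bsub>vdual V\<^esub> \<oplus>\<^bsub>vdual V\<^esub> \<phi> = \<phi>"
        using p by (auto simp: vdual_simps extensional_def fun_eq_iff)
      show "\<exists>\<psi>\<in>carrier (vdual V). \<psi> \<oplus>\<^bsub>vdual V\<^esub> \<phi> = \<zero>\<^bsub>vdual V\<^esub>"
        by (rule bexI[of _ "\<lambda>x \<in> carrier V. - \<phi> x"]) (use p cl in \<open>auto simp: vdual_simps\<close>)
    qed (auto simp: vdual_simps algebra_simps cl)
  next
    fix c d \<phi> assume "\<phi> \<in> carrier (vdual V)"
    then show "c \<odot>\<^bsub>vdual V\<^esub> \<phi> \<in> carrier (vdual V)"
      using cl by (auto simp: vdual_simps algebra_simps)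
  qed (auto simp: vdual_simps algebra_simps fun_eq_iff extensional_def)
qed

text \<open>Induction over the support of the argument, split into its one-point parts. Additivity
  and homogeneity are asked only on extensional functions, because these form the carrier of
  \<open>fn_space\<close>.\<close>

lemma functional_fn_space:
  fixes \<phi> :: "('i \<Rightarrow> 'k::field) \<Rightarrow> 'k"
  assumes I: "finite I" and a: "a \<in> I \<rightarrow>\<^sub>E UNIV"
    and add: "\<And>f g. f \<in> I \<rightarrow>\<^sub>E UNIV \<Longrightarrow> g \<in> I \<rightarrow>\<^sub>E UNIV \<Longrightarrow> \<phi> (\<lambda>i\<in>I. f i + g i) = \<phi> f + \<phi> g"
    and smult: "\<And>c f. f \<in> I \<rightarrow>\<^sub>E UNIV \<Longrightarrow> \<phi> (\<lambda>i\<in>I. c * f i) = c * \<phi> f"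
  shows "\<phi> a = (\<Sum>i\<in>I. a i * \<phi> (\<lambda>j\<in>I. if j = i then 1 else 0))"
proof -
  have "\<phi> (\<lambda>j\<in>I. if j \<in> F then a j else 0) = (\<Sum>i\<in>F. a i * \<phi> (\<lambda>j\<in>I. if j = i then 1 else 0))"
    if "F \<subseteq> I" for F
    using finite_subset[OF that I] that
  proof (induction F rule: finite_induct)
    case empty
    have "\<phi> (\<lambda>i\<in>I. 0 * a i) = 0" using smult[OF a, of 0] by simp
    then show ?case by (simp add: restrict_def)
  next
    case (insert x F)
    let ?d = "\<lambda>j\<in>I. if j = x then 1 else 0 :: 'k" and ?t = "\<lambda>j\<in>I. if j \<in> F then a j else 0"
    have "(\<lambda>j\<in>I. if j \<in> insert x F then a j else 0) = (\<lambda>i\<in>I. ?t i + (\<lambda>i\<in>I. a x * ?d i) i)"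
      using insert.hyps by (auto simp: fun_eq_iff)
    then have "\<phi> (\<lambda>j\<in>I. if j \<in> insert x F then a j else 0) = \<phi> (\<lambda>i\<in>I. ?t i + (\<lambda>i\<in>I. a x * ?d i) i)"
      by (rule arg_cong)
    also have "\<dots> = \<phi> ?t + \<phi> (\<lambda>i\<in>I. a x * ?d i)" by (rule add) auto
    also have "\<phi> (\<lambda>i\<in>I. a x * ?d i) = a x * \<phi> ?d" by (rule smult) auto
    finally have e: "\<phi> (\<lambda>j\<in>I. if j \<in> insert x F then a j else 0) = \<phi> ?t + a x * \<phi> ?d" .
    show ?case unfolding e using insert.IH insert.prems insert.hyps by (simp add: restrict_def)
  qed
  from this[OF subset_refl] have "\<phi> (\<lambda>j\<in>I. if j \<in> I then a j else 0) = (\<Sum>i\<in>I. a i * \<phi> (\<lambda>j\<in>I. if j = i then 1 else 0))" .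
  moreover have "(\<lambda>j\<in>I. if j \<in> I then a j else 0) = a" using a by (auto simp: fun_eq_iff PiE_def extensional_def)
  ultimately show ?thesis by simp
qed

text \<open>A basis together with its coordinate functionals, packed so that consequences can be
  drawn without a basis predicate. The last two clauses say that coordinates may be prescribed and
  that they determine the vector.\<close>

lemma dual_basis:
  fixes V :: "('k::field, 'v) module"
  assumes V: "fdim V"
  shows "\<exists>(I :: 'v set) b (\<beta> :: 'v \<Rightarrow> 'v \<Rightarrow> 'k).
    finite I \<and> b ` I \<subseteq> carrier V \<and> \<beta> ` I \<subseteq> carrier (vdual V) \<and>
    (\<forall>i\<in>I. \<forall>j\<in>I. \<beta> i (b j) = (if i = j then 1 else 0)) \<and>
    (\<forall>\<phi>\<in>carrier (vdual V). \<forall>v\<in>carrier V. \<phi> v = (\<Sum>i\<in>I. \<phi> (b i) * \<beta> i v)) \<and>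
    (\<forall>c. \<exists>v\<in>carrier V. \<forall>i\<in>I. \<beta> i v = c i) \<and>
    (\<forall>v\<in>carrier V. \<forall>w\<in>carrier V. (\<forall>i\<in>I. \<beta> i v = \<beta> i w) \<longrightarrow> v = w)"
proof -
  interpret V: vectorspace class_ring V using V by (rule fdim_vspace)
  obtain I where I: "finite I" "V.basis I" using V.finite_basis_exists V unfolding fdim_def by blast
  let ?L = "\<lambda>a. V.lincomb a I" and ?F = "fn_space I :: ('k, 'v \<Rightarrow> 'k) module"
  note L = basis_coords[OF V.vectorspace_axioms I]
  have cF: "carrier ?F = I \<rightarrow>\<^sub>E UNIV" by (simp add: fn_space_simps)
  have bij: "bij_betw ?L (carrier ?F) (carrier V)" using L(2) unfolding cF .
  define M where "M = the_inv_into (carrier ?F) ?L"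
  have M: "M \<in> module_hom class_ring V ?F"
    unfolding M_def by (rule inv_khom[OF fn_space_vspace L(1) bij])
  have inv1: "M (?L a) = a" if "a \<in> I \<rightarrow>\<^sub>E UNIV" for a
    unfolding M_def using the_inv_into_f_f[of ?L "carrier ?F" a] bij that cF by (auto simp: bij_betw_def)
  have inv2: "?L (M v) = v" if "v \<in> carrier V" for v
    unfolding M_def using f_the_inv_into_f[of ?L "carrier ?F" v] bij that by (auto simp: bij_betw_def)
  have Lc: "?L a \<in> carrier V" if "a \<in> I \<rightarrow>\<^sub>E UNIV" for a using bij that cF by (auto simp: bij_betw_def)
  have Mc: "M v \<in> I \<rightarrow>\<^sub>E UNIV" if "v \<in> carrier V" for v using M that cF unfolding khom_iff by auto
  define \<delta> where "\<delta> i = (\<lambda>j\<in>I. if j = i then 1 else 0 :: 'k)" for i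
  have \<delta>: "\<delta> i \<in> I \<rightarrow>\<^sub>E UNIV" for i unfolding \<delta>_def by auto
  define b where "b i = ?L (\<delta> i)" for i
  define \<beta> where "\<beta> i = (\<lambda>v\<in>carrier V. M v i)" for i
  have bc: "b i \<in> carrier V" for i unfolding b_def by (rule Lc[OF \<delta>])
  show ?thesis
  proof (intro exI[of _ I] exI[of _ b] exI[of _ \<beta>] conjI ballI allI impI)
    show "\<beta> ` I \<subseteq> carrier (vdual V)"
      using M unfolding khom_iff \<beta>_def by (auto simp: vdual_simps fn_space_simps)
    show "\<beta> i (b j) = (if i = j then 1 else 0)" if "i \<in> I" "j \<in> I" for i j
      using bc[of j] inv1[OF \<delta>, of j] that unfolding \<beta>_def b_def by (simp add: \<delta>_def)
    show "\<phi> v = (\<Sum>i\<in>I. \<phi> (b i) * \<beta> i v)" if \<phi>: "\<phi> \<in> carrier (vdual V)" and v: "v \<in> carrier V" for \<phi> v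
    proof -
      have "\<phi> (?L (M v)) = (\<Sum>i\<in>I. M v i * \<phi> (?L (\<lambda>j\<in>I. if j = i then 1 else 0)))"
      proof (rule functional_fn_space[of I "M v" "\<lambda>a. \<phi> (?L a)", OF I(1) Mc[OF v]])
        show "\<phi> (?L (\<lambda>i\<in>I. f i + g i)) = \<phi> (?L f) + \<phi> (?L g)"
          if fg: "f \<in> I \<rightarrow>\<^sub>E UNIV" "g \<in> I \<rightarrow>\<^sub>E UNIV" for f g
        proof -
          have "?L (\<lambda>i\<in>I. f i + g i) = ?L f \<oplus>\<^bsub>V\<^esub> ?L g"
            using L(1) fg unfolding khom_iff fn_space_simps by simp
          then show ?thesis using \<phi> Lc fg by (simp add: vdual_simps)
        qed
        show "\<phi> (?L (\<lambda>i\<in>I. c * f i)) = c * \<phi> (?L f)" if f: "f \<in> I \<rightarrow>\<^sub>E UNIV" for c f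
        proof -
          have "?L (\<lambda>i\<in>I. c * f i) = c \<odot>\<^bsub>V\<^esub> ?L f"
            using L(1) f unfolding khom_iff fn_space_simps by simp
          then show ?thesis using \<phi> Lc f by (simp add: vdual_simps)
        qed
      qed
      then show ?thesis unfolding inv2[OF v] b_def \<delta>_def \<beta>_def using v by (simp add: mult.commute)
    qed
    show "\<exists>v\<in>carrier V. \<forall>i\<in>I. \<beta> i v = c i" for c
    proof (rule bexI[of _ "?L (\<lambda>i\<in>I. c i)"])
      show "?L (\<lambda>i\<in>I. c i) \<in> carrier V" by (rule Lc) auto
      then show "\<forall>i\<in>I. \<beta> i (?L (\<lambda>i\<in>I. c i)) = c i"
        unfolding \<beta>_def by (simp add: inv1)
    qed
    show "v = w" if vw: "v \<in> carrier V" "w \<in> carrier V" and e: "\<forall>i\<in>I. \<beta> i v = \<beta> i w" for v w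
    proof -
      have "M v = M w" using Mc[OF vw(1)] Mc[OF vw(2)] e vw unfolding \<beta>_def
        by (auto simp: PiE_def extensional_def fun_eq_iff)
      then show ?thesis using inv2[OF vw(1)] inv2[OF vw(2)] by metis
    qed
  qed (use I bc in auto)
qed

text \<open>An enumeration \<open>h\<close> of \<open>I\<close> transports the known dimension of
  the space of vectors of length \<open>card I\<close>.\<close>

lemma fn_space_dim:
  assumes "finite I"
  shows "fdim (fn_space I :: ('k::field, 'i \<Rightarrow> 'k) module)"
    "kdim (fn_space I :: ('k, 'i \<Rightarrow> 'k) module) = card I"
proof -
  obtain h where h: "bij_betw h {..<card I} I"
    using bij_betw_from_nat_into_finite[OF assms] by blast
  let ?V = "module_vec TYPE('k) (card I)" and ?W = "fn_space I :: ('k, 'i \<Rightarrow> 'k) module"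
  let ?T = "\<lambda>v::'k vec. \<lambda>i\<in>I. v $ (the_inv_into {..<card I} h i)"
  have g: "the_inv_into {..<card I} h i < card I" if "i \<in> I" for i
    using the_inv_into_into[of h "{..<card I}" i "{..<card I}"] h that by (auto simp: bij_betw_def)
  have gh: "the_inv_into {..<card I} h (h k) = k" "h k \<in> I" if "k < card I" for k
    using the_inv_into_f_f[of h "{..<card I}" k] h that by (auto simp: bij_betw_def)
  have V: "fdim ?V \<and> kdim ?V = card I"
  proof -
    interpret vec_space "TYPE('k)" "card I" .
    show ?thesis unfolding fdim_def using fin_dim vectorspace_axioms dim_is_n by (simp add: class_ring_simps)
  qed
  have T: "?T \<in> module_hom class_ring ?V ?W"
    using g unfolding khom_iff by (auto simp: fn_space_simps module_vec_simps)
  have "bij_betw ?T (carrier ?V) (carrier ?W)"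
    unfolding bij_betw_def
  proof
    show "inj_on ?T (carrier ?V)"
    proof (rule inj_onI)
      fix v w :: "'k vec" assume v: "v \<in> carrier ?V" and w: "w \<in> carrier ?V" and eq: "?T v = ?T w"
      have "v $ k = w $ k" if "k < card I" for k
        using fun_cong[OF eq, of "h k"] gh[OF that] by simp
      then show "v = w" using v w by (auto simp: module_vec_simps)
    qed
    show "?T ` carrier ?V = carrier ?W"
    proof (intro equalityI subsetI)
      fix f assume f: "f \<in> carrier ?W"
      have "?T (vec (card I) (\<lambda>k. f (h k))) = f"
        using f g f_the_inv_into_f[of h "{..<card I}"] h
        by (auto simp: fn_space_simps fun_eq_iff PiE_def extensional_def bij_betw_def)
      moreover have "vec (card I) (\<lambda>k. f (h k)) \<in> carrier ?V" by (simp add: module_vec_simps)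
      ultimately show "f \<in> ?T ` carrier ?V" by (intro image_eqI[where x = "vec (card I) (\<lambda>k. f (h k))"]) simp_all
    qed (auto simp: fn_space_simps)
  qed
  from kdim_bij[OF V[THEN conjunct1] fn_space_vspace T this] V
  show "fdim ?W" "kdim ?W = card I" by simp_all
qed

lemma vdual_eqI:
  assumes "\<phi> \<in> carrier (vdual V)" "\<psi> \<in> carrier (vdual V)" "\<And>v. v \<in> carrier V \<Longrightarrow> \<phi> v = \<psi> v"
  shows "\<phi> = \<psi>"
  by (rule extensionalityI[of _ "carrier V"]) (use assms in \<open>auto simp: vdual_simps(1)\<close>)

text \<open>A dual basis indexed by \<open>I\<close> identifies both spaces with the functions on
  \<open>I\<close>: a vector goes to its coordinates, a functional to its values on the
  basis.\<close>

lemma kdim_vdual: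
  fixes V :: "('k::field, 'v) module"
  assumes V: "fdim V"
  shows "fdim (vdual V)" "kdim (vdual V) = kdim V"
proof -
  obtain I :: "'v set" and b and \<beta> :: "'v \<Rightarrow> 'v \<Rightarrow> 'k" where I0: "finite I" "b ` I \<subseteq> carrier V" "\<beta> ` I \<subseteq> carrier (vdual V)"
    "\<forall>i\<in>I. \<forall>j\<in>I. \<beta> i (b j) = (if i = j then 1 else 0)"
    "\<forall>\<phi>\<in>carrier (vdual V). \<forall>v\<in>carrier V. \<phi> v = (\<Sum>i\<in>I. \<phi> (b i) * \<beta> i v)"
    "\<forall>c. \<exists>v\<in>carrier V. \<forall>i\<in>I. \<beta> i v = c i"
    "\<forall>v\<in>carrier V. \<forall>w\<in>carrier V. (\<forall>i\<in>I. \<beta> i v = \<beta> i w) \<longrightarrow> v = w"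
    using dual_basis[OF V] by (elim exE conjE) (rule that; assumption)
  note I = I0(1-3) I0(4,5)[rule_format] I0(6)[THEN spec] I0(7)[rule_format]
  let ?F = "fn_space I :: ('k, 'v \<Rightarrow> 'k) module"
  interpret V: vectorspace class_ring V using V by (rule fdim_vspace)
  have cl: "x \<oplus>\<^bsub>V\<^esub> y \<in> carrier V" "c \<odot>\<^bsub>V\<^esub> x \<in> carrier V"
    if "x \<in> carrier V" "y \<in> carrier V" for x y c using that by auto
  have F: "fdim ?F" by (rule fn_space_dim(1)[OF I(1)])
  let ?T = "\<lambda>v. \<lambda>i\<in>I. \<beta> i v"
  have T: "?T \<in> module_hom class_ring V ?F"
    using I(3) unfolding khom_iff by (force simp: fn_space_simps vdual_simps)
  have bT: "bij_betw ?T (carrier V) (carrier ?F)"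
    unfolding bij_betw_def
  proof (intro conjI inj_onI equalityI subsetI)
    fix v w assume "v \<in> carrier V" "w \<in> carrier V" and e: "?T v = ?T w"
    moreover have "\<forall>i\<in>I. \<beta> i v = \<beta> i w" using e by (metis restrict_apply')
    ultimately show "v = w" using I(7) by blast
  next
    fix f assume f: "f \<in> carrier ?F"
    obtain v where "v \<in> carrier V" "\<forall>i\<in>I. \<beta> i v = f i" using I(6)[of f] by blast
    moreover from this f have "?T v = f" by (auto simp: fn_space_simps fun_eq_iff PiE_def extensional_def)
    ultimately show "f \<in> ?T ` carrier V" by (intro image_eqI[where x = v]) simp_all
  qed (auto simp: fn_space_simps)
  let ?E = "\<lambda>\<phi>. \<lambda>i\<in>I. \<phi> (b i)"
  have E: "?E \<in> module_hom class_ring (vdual V) ?F"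
    unfolding khom_iff
  proof (intro conjI ballI allI)
    fix \<phi> \<psi> c
    have bc: "b i \<in> carrier V" if "i \<in> I" for i using I(2) that by auto
    show "?E \<phi> \<in> carrier ?F" by (simp add: fn_space_simps)
    show "?E (\<phi> \<oplus>\<^bsub>vdual V\<^esub> \<psi>) = ?E \<phi> \<oplus>\<^bsub>?F\<^esub> ?E \<psi>"
      using bc by (simp add: fn_space_simps vdual_simps cong: restrict_cong)
    show "?E (c \<odot>\<^bsub>vdual V\<^esub> \<phi>) = c \<odot>\<^bsub>?F\<^esub> ?E \<phi>"
      using bc by (simp add: fn_space_simps vdual_simps cong: restrict_cong)
  qed
  have bE: "bij_betw ?E (carrier (vdual V)) (carrier ?F)"
    unfolding bij_betw_def
  proof (intro conjI inj_onI equalityI subsetI)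
    fix \<phi> \<psi> assume p: "\<phi> \<in> carrier (vdual V)" "\<psi> \<in> carrier (vdual V)" and e: "?E \<phi> = ?E \<psi>"
    have "\<phi> (b i) = \<psi> (b i)" if "i \<in> I" for i using e that by (metis restrict_apply')
    then have "\<phi> v = \<psi> v" if "v \<in> carrier V" for v
      unfolding I(5)[OF p(1) that] I(5)[OF p(2) that] by simp
    then show "\<phi> = \<psi>" by (rule vdual_eqI[OF p])
  next
    fix f assume f: "f \<in> carrier ?F"
    define \<phi> where "\<phi> = (\<lambda>v\<in>carrier V. \<Sum>i\<in>I. f i * \<beta> i v)"
    have "\<beta> i (x \<oplus>\<^bsub>V\<^esub> y) = \<beta> i x + \<beta> i y" "\<beta> i (c \<odot>\<^bsub>V\<^esub> x) = c * \<beta> i x"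
      if "i \<in> I" "x \<in> carrier V" "y \<in> carrier V" for i x y c
    proof -
      have "\<beta> i \<in> carrier (vdual V)" using I(3) that by auto
      then show "\<beta> i (x \<oplus>\<^bsub>V\<^esub> y) = \<beta> i x + \<beta> i y" "\<beta> i (c \<odot>\<^bsub>V\<^esub> x) = c * \<beta> i x"
        using that unfolding vdual_simps(1) by blast+
    qed
    then have "\<phi> \<in> carrier (vdual V)"
      unfolding \<phi>_def using cl
      by (auto simp: vdual_simps algebra_simps sum.distrib sum_distrib_left cong: sum.cong)
    moreover have "?E \<phi> = f"
    proof
      fix j show "?E \<phi> j = f j"
      proof (cases "j \<in> I")
        case True
        then have "b j \<in> carrier V" using I(2) by auto
        then have "\<phi> (b j) = (\<Sum>i\<in>I. f i * (if i = j then 1 else 0))"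
          unfolding \<phi>_def using True I(4) by (simp cong: sum.cong)
        then show ?thesis using True I(1) by (simp add: if_distrib cong: if_cong)
      next
        case False
        then show ?thesis using f by (auto simp: fn_space_simps PiE_def extensional_def)
      qed
    qed
    ultimately show "f \<in> ?E ` carrier (vdual V)" by (intro image_eqI[where x = \<phi>]) simp_all
  qed (auto simp: fn_space_simps)
  have dv: "vspace (vdual V)" by (rule vdual_vspace) (rule V.vectorspace_axioms)
  show "fdim (vdual V)" by (rule kdim_bij'(1)[OF dv F E bE])
  show "kdim (vdual V) = kdim V"
    using kdim_bij'(2)[OF dv F E bE] kdim_bij(2)[OF V fn_space_vspace T bT] by simp
qed

text \<open>The vector \<open>y\<close> is the one whose coordinates are the values of
  \<open>F\<close> at the coordinate functionals. \<open>F\<close> is any linear function on the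
  dual, not necessarily extensional; it is applied to
  \<open>\<lambda>\<phi>. \<theta> \<phi> x\<close> for an endomorphism \<open>\<theta>\<close> of a
  dual module.\<close>

lemma double_dual:
  fixes V :: "('k::field, 'v) module"
  assumes V: "fdim V"
    and add: "\<And>\<phi> \<psi>. \<phi> \<in> carrier (vdual V) \<Longrightarrow> \<psi> \<in> carrier (vdual V) \<Longrightarrow>
      F (\<phi> \<oplus>\<^bsub>vdual V\<^esub> \<psi>) = F \<phi> + F \<psi>"
    and smult: "\<And>c \<phi>. \<phi> \<in> carrier (vdual V) \<Longrightarrow> F (c \<odot>\<^bsub>vdual V\<^esub> \<phi>) = c * F \<phi>"
  shows "\<exists>y\<in>carrier V. \<forall>\<phi>\<in>carrier (vdual V). F \<phi> = \<phi> y"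
proof -
  obtain I :: "'v set" and b and \<beta> :: "'v \<Rightarrow> 'v \<Rightarrow> 'k" where I0: "finite I" "\<beta> ` I \<subseteq> carrier (vdual V)"
    "\<forall>\<phi>\<in>carrier (vdual V). \<forall>v\<in>carrier V. \<phi> v = (\<Sum>i\<in>I. \<phi> (b i) * \<beta> i v)"
    "\<forall>c. \<exists>v\<in>carrier V. \<forall>i\<in>I. \<beta> i v = c i"
    using dual_basis[OF V] by (elim exE conjE) (rule that; assumption)
  note I = I0(1,2) I0(3)[rule_format] I0(4)[THEN spec]
  interpret D: vectorspace class_ring "vdual V" using vdual_vspace V fdim_vspace by blast
  obtain y where y: "y \<in> carrier V" "\<forall>i\<in>I. \<beta> i y = F (\<beta> i)" using I(4)[of "\<lambda>i. F (\<beta> i)"] by blast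
  have "F \<phi> = \<phi> y" if \<phi>: "\<phi> \<in> carrier (vdual V)" for \<phi>
  proof -
    define s where "s G = (\<lambda>v\<in>carrier V. \<Sum>i\<in>G. \<phi> (b i) * \<beta> i v)" for G
    have s: "s G \<in> carrier (vdual V) \<and> F (s G) = (\<Sum>i\<in>G. \<phi> (b i) * F (\<beta> i))" if "G \<subseteq> I" for G
      using finite_subset[OF that I(1)] that
    proof (induction G rule: finite_induct)
      case empty
      have z: "s {} = \<zero>\<^bsub>vdual V\<^esub>" unfolding s_def by (simp add: vdual_simps)
      have "F (0 \<odot>\<^bsub>vdual V\<^esub> \<phi>) = 0" using smult[OF \<phi>, of 0] by simp
      moreover have "0 \<odot>\<^bsub>vdual V\<^esub> \<phi> = s {}" unfolding s_def by (simp add: vdual_simps)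
      ultimately show ?case using z by simp
    next
      case (insert x G)
      have bx: "\<beta> x \<in> carrier (vdual V)" using insert.prems I(2) by auto
      have cb: "\<phi> (b x) \<odot>\<^bsub>vdual V\<^esub> \<beta> x \<in> carrier (vdual V)" using bx by simp
      have sG: "s G \<in> carrier (vdual V)" "F (s G) = (\<Sum>i\<in>G. \<phi> (b i) * F (\<beta> i))"
        using insert by auto
      have e: "s (insert x G) = \<phi> (b x) \<odot>\<^bsub>vdual V\<^esub> \<beta> x \<oplus>\<^bsub>vdual V\<^esub> s G"
        using insert.hyps unfolding s_def by (auto simp: vdual_simps fun_eq_iff)
      then show ?case using add[OF cb sG(1)] smult[OF bx] sG insert.hyps D.M.a_closed[OF cb sG(1)]
        by simp
    qed
    have "s I = \<phi>" unfolding s_def using I(3)[OF \<phi>] \<phi>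
      by (auto simp: vdual_simps extensional_def fun_eq_iff)
    then have "F \<phi> = (\<Sum>i\<in>I. \<phi> (b i) * F (\<beta> i))" using s[of I] by auto
    also have "\<dots> = \<phi> y" using I(3)[OF \<phi> y(1)] y(2) by simp
    finally show ?thesis .
  qed
  then show ?thesis using y(1) by blast
qed

lemma functionals_separate:
  fixes V :: "('b::field, 'a) module"
  assumes V: "fdim V" and "v \<in> carrier V" "w \<in> carrier V" "\<And>\<phi>. \<phi> \<in> carrier (vdual V) \<Longrightarrow> \<phi> v = \<phi> w"
  shows "v = w"
proof -
  obtain I :: "'a set" and \<beta> :: "'a \<Rightarrow> 'a \<Rightarrow> 'b" where "\<beta> ` I \<subseteq> carrier (vdual V)"
    "\<forall>v\<in>carrier V. \<forall>w\<in>carrier V. (\<forall>i\<in>I. \<beta> i v = \<beta> i w) \<longrightarrow> v = w"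
    using dual_basis[OF V] by (elim exE conjE) (rule that; assumption)
  then show ?thesis using assms(2-4) by (metis image_subset_iff)
qed

section \<open>Right modules over a ring\<close>

lemma hom_iff:
  "f \<in> module_hom A M N \<longleftrightarrow> (\<forall>x\<in>carrier M. f x \<in> carrier N) \<and>
    (\<forall>x\<in>carrier M. \<forall>y\<in>carrier M. f (x \<oplus>\<^bsub>M\<^esub> y) = f x \<oplus>\<^bsub>N\<^esub> f y) \<and>
    (\<forall>a\<in>carrier A. \<forall>x\<in>carrier M. f (a \<odot>\<^bsub>M\<^esub> x) = a \<odot>\<^bsub>N\<^esub> f x)"
  unfolding LinearCombinations.module_hom_def by auto

lemma homD:
  assumes "f \<in> module_hom A M N"
  shows "x \<in> carrier M \<Longrightarrow> f x \<in> carrier N"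
    "x \<in> carrier M \<Longrightarrow> y \<in> carrier M \<Longrightarrow> f (x \<oplus>\<^bsub>M\<^esub> y) = f x \<oplus>\<^bsub>N\<^esub> f y"
    "a \<in> carrier A \<Longrightarrow> x \<in> carrier M \<Longrightarrow> f (a \<odot>\<^bsub>M\<^esub> x) = a \<odot>\<^bsub>N\<^esub> f x"
  using assms unfolding hom_iff by blast+

lemma hom_comp:
  assumes "f \<in> module_hom A L M" "g \<in> module_hom A M N"
  shows "(\<lambda>x. g (f x)) \<in> module_hom A L N"
  using assms unfolding hom_iff by auto

text \<open>Gives preservation of zero for every additive map, since the value at zero is
  idempotent.\<close>

lemma group_idem_zero:
  assumes "abelian_group G" "x \<in> carrier G" "x \<oplus>\<^bsub>G\<^esub> x = x"
  shows "x = \<zero>\<^bsub>G\<^esub>"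
proof -
  interpret abelian_group G by fact
  have "x = (x \<oplus>\<^bsub>G\<^esub> x) \<oplus>\<^bsub>G\<^esub> (\<ominus>\<^bsub>G\<^esub> x)" using assms(2) by (simp add: a_assoc r_neg)
  then show ?thesis using assms by (simp add: r_neg)
qed

lemma right_moduleI:
  assumes "ring A" "abelian_group M"
    and "\<And>a x. a \<in> carrier A \<Longrightarrow> x \<in> carrier M \<Longrightarrow> a \<odot>\<^bsub>M\<^esub> x \<in> carrier M"
    and "\<And>a b x. a \<in> carrier A \<Longrightarrow> b \<in> carrier A \<Longrightarrow> x \<in> carrier M \<Longrightarrow>
      (a \<oplus>\<^bsub>A\<^esub> b) \<odot>\<^bsub>M\<^esub> x = a \<odot>\<^bsub>M\<^esub> x \<oplus>\<^bsub>M\<^esub> b \<odot>\<^bsub>M\<^esub> x"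
    and "\<And>a x y. a \<in> carrier A \<Longrightarrow> x \<in> carrier M \<Longrightarrow> y \<in> carrier M \<Longrightarrow>
      a \<odot>\<^bsub>M\<^esub> (x \<oplus>\<^bsub>M\<^esub> y) = a \<odot>\<^bsub>M\<^esub> x \<oplus>\<^bsub>M\<^esub> a \<odot>\<^bsub>M\<^esub> y"
    and "\<And>a b x. a \<in> carrier A \<Longrightarrow> b \<in> carrier A \<Longrightarrow> x \<in> carrier M \<Longrightarrow>
      (a \<otimes>\<^bsub>A\<^esub> b) \<odot>\<^bsub>M\<^esub> x = b \<odot>\<^bsub>M\<^esub> (a \<odot>\<^bsub>M\<^esub> x)"
    and "\<And>x. x \<in> carrier M \<Longrightarrow> \<one>\<^bsub>A\<^esub> \<odot>\<^bsub>M\<^esub> x = x"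
  shows "right_module A M"
  using assms unfolding right_module_def right_module_axioms_def by simp

lemma right_moduleD:
  assumes "right_module A M"
  shows "ring A" "abelian_group M"
    "a \<in> carrier A \<Longrightarrow> x \<in> carrier M \<Longrightarrow> a \<odot>\<^bsub>M\<^esub> x \<in> carrier M"
    "a \<in> carrier A \<Longrightarrow> b \<in> carrier A \<Longrightarrow> x \<in> carrier M \<Longrightarrow>
      (a \<oplus>\<^bsub>A\<^esub> b) \<odot>\<^bsub>M\<^esub> x = a \<odot>\<^bsub>M\<^esub> x \<oplus>\<^bsub>M\<^esub> b \<odot>\<^bsub>M\<^esub> x"
    "a \<in> carrier A \<Longrightarrow> x \<in> carrier M \<Longrightarrow> y \<in> carrier M \<Longrightarrow>
      a \<odot>\<^bsub>M\<^esub> (x \<oplus>\<^bsub>M\<^esub> y) = a \<odot>\<^bsub>M\<^esub> x \<oplus>\<^bsub>M\<^esub> a \<odot>\<^bsub>M\<^esub> y"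
    "a \<in> carrier A \<Longrightarrow> b \<in> carrier A \<Longrightarrow> x \<in> carrier M \<Longrightarrow>
      (a \<otimes>\<^bsub>A\<^esub> b) \<odot>\<^bsub>M\<^esub> x = b \<odot>\<^bsub>M\<^esub> (a \<odot>\<^bsub>M\<^esub> x)"
    "x \<in> carrier M \<Longrightarrow> \<one>\<^bsub>A\<^esub> \<odot>\<^bsub>M\<^esub> x = x"
  using assms unfolding right_module_def right_module_axioms_def by simp_all

lemma right_module_group:
  assumes "right_module A M"
  shows "\<zero>\<^bsub>M\<^esub> \<in> carrier M" "x \<in> carrier M \<Longrightarrow> y \<in> carrier M \<Longrightarrow> x \<oplus>\<^bsub>M\<^esub> y \<in> carrier M"
    "x \<in> carrier M \<Longrightarrow> \<zero>\<^bsub>M\<^esub> \<oplus>\<^bsub>M\<^esub> x = x" "x \<in> carrier M \<Longrightarrow> x \<oplus>\<^bsub>M\<^esub> \<zero>\<^bsub>M\<^esub> = x"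
    "x \<in> carrier M \<Longrightarrow> \<ominus>\<^bsub>M\<^esub> x \<in> carrier M" "x \<in> carrier M \<Longrightarrow> x \<oplus>\<^bsub>M\<^esub> (\<ominus>\<^bsub>M\<^esub> x) = \<zero>\<^bsub>M\<^esub>"
proof -
  interpret abelian_group M using assms by (rule right_moduleD)
  show "\<zero>\<^bsub>M\<^esub> \<in> carrier M" "x \<in> carrier M \<Longrightarrow> y \<in> carrier M \<Longrightarrow> x \<oplus>\<^bsub>M\<^esub> y \<in> carrier M"
    "x \<in> carrier M \<Longrightarrow> \<zero>\<^bsub>M\<^esub> \<oplus>\<^bsub>M\<^esub> x = x" "x \<in> carrier M \<Longrightarrow> x \<oplus>\<^bsub>M\<^esub> \<zero>\<^bsub>M\<^esub> = x"
    "x \<in> carrier M \<Longrightarrow> \<ominus>\<^bsub>M\<^esub> x \<in> carrier M" "x \<in> carrier M \<Longrightarrow> x \<oplus>\<^bsub>M\<^esub> (\<ominus>\<^bsub>M\<^esub> x) = \<zero>\<^bsub>M\<^esub>"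
    by (simp_all add: r_neg)
qed

lemma smult_zero_right:
  assumes M: "right_module A M" and a: "a \<in> carrier A"
  shows "a \<odot>\<^bsub>M\<^esub> \<zero>\<^bsub>M\<^esub> = \<zero>\<^bsub>M\<^esub>"
proof -
  note z = right_module_group(1)[OF M]
  have "a \<odot>\<^bsub>M\<^esub> \<zero>\<^bsub>M\<^esub> \<oplus>\<^bsub>M\<^esub> a \<odot>\<^bsub>M\<^esub> \<zero>\<^bsub>M\<^esub> = a \<odot>\<^bsub>M\<^esub> \<zero>\<^bsub>M\<^esub>"
    using right_moduleD(5)[OF M a z z] right_module_group(3)[OF M z] by simp
  then show ?thesis
    by (rule group_idem_zero[OF right_moduleD(2)[OF M] right_moduleD(3)[OF M a z]])
qed

lemma smult_zero_left:
  assumes M: "right_module A M" and x: "x \<in> carrier M"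
  shows "\<zero>\<^bsub>A\<^esub> \<odot>\<^bsub>M\<^esub> x = \<zero>\<^bsub>M\<^esub>"
proof -
  interpret A: ring A using M by (rule right_moduleD)
  have "\<zero>\<^bsub>A\<^esub> \<odot>\<^bsub>M\<^esub> x \<oplus>\<^bsub>M\<^esub> \<zero>\<^bsub>A\<^esub> \<odot>\<^bsub>M\<^esub> x = \<zero>\<^bsub>A\<^esub> \<odot>\<^bsub>M\<^esub> x"
    using right_moduleD(4)[OF M A.zero_closed A.zero_closed x] by simp
  then show ?thesis
    using group_idem_zero[OF right_moduleD(2)[OF M] right_moduleD(3)[OF M A.zero_closed x]] by blast
qed

lemma hom_zero:
  assumes M: "right_module A M" and N: "right_module A N" and f: "f \<in> module_hom A M N"
  shows "f \<zero>\<^bsub>M\<^esub> = \<zero>\<^bsub>N\<^esub>"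
proof -
  note z = right_module_group(1)[OF M]
  have "f \<zero>\<^bsub>M\<^esub> \<oplus>\<^bsub>N\<^esub> f \<zero>\<^bsub>M\<^esub> = f \<zero>\<^bsub>M\<^esub>"
    using homD(2)[OF f z z] right_module_group(3)[OF M z] by simp
  then show ?thesis
    by (rule group_idem_zero[OF right_moduleD(2)[OF N] homD(1)[OF f z]])
qed

lemma hom_neg:
  assumes M: "right_module A M" and N: "right_module A N" and f: "f \<in> module_hom A M N"
    and x: "x \<in> carrier M"
  shows "f (\<ominus>\<^bsub>M\<^esub> x) = \<ominus>\<^bsub>N\<^esub> f x"
proof -
  interpret N: abelian_group N using N by (rule right_moduleD)
  note g = right_module_group[OF M]
  have "f x \<oplus>\<^bsub>N\<^esub> f (\<ominus>\<^bsub>M\<^esub> x) = \<zero>\<^bsub>N\<^esub>"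
    using homD(2)[OF f x g(5)[OF x]] g(6)[OF x] hom_zero[OF M N f] by simp
  then show ?thesis using homD(1)[OF f] x g(5)[OF x] N.minus_equality N.a_comm by metis
qed

lemma hom_inj_iff:
  assumes M: "right_module A M" and N: "right_module A N" and f: "f \<in> module_hom A M N"
  shows "inj_on f (carrier M) \<longleftrightarrow> (\<forall>x\<in>carrier M. f x = \<zero>\<^bsub>N\<^esub> \<longrightarrow> x = \<zero>\<^bsub>M\<^esub>)"
proof
  assume "inj_on f (carrier M)"
  then show "\<forall>x\<in>carrier M. f x = \<zero>\<^bsub>N\<^esub> \<longrightarrow> x = \<zero>\<^bsub>M\<^esub>"
    using hom_zero[OF M N f] right_module_group(1)[OF M] by (auto simp: inj_on_def)
next
  assume z: "\<forall>x\<in>carrier M. f x = \<zero>\<^bsub>N\<^esub> \<longrightarrow> x = \<zero>\<^bsub>M\<^esub>"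
  interpret M: abelian_group M using M by (rule right_moduleD)
  interpret N: abelian_group N using N by (rule right_moduleD)
  show "inj_on f (carrier M)"
  proof (rule inj_onI)
    fix x y assume xy: "x \<in> carrier M" "y \<in> carrier M" "f x = f y"
    have "f (x \<oplus>\<^bsub>M\<^esub> (\<ominus>\<^bsub>M\<^esub> y)) = \<zero>\<^bsub>N\<^esub>"
      using homD(2)[OF f xy(1) M.a_inv_closed[OF xy(2)]] hom_neg[OF M N f xy(2)] xy homD(1)[OF f xy(2)]
      by (simp add: N.r_neg)
    then have "x \<oplus>\<^bsub>M\<^esub> (\<ominus>\<^bsub>M\<^esub> y) = \<zero>\<^bsub>M\<^esub>" using z xy by simp
    then show "x = y" using xy M.minus_equality M.minus_minus by (metis M.a_inv_closed)
  qed
qed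

lemma inv_hom:
  assumes M: "right_module A M" and f: "f \<in> module_hom A M N"
    and bij: "bij_betw f (carrier M) (carrier N)"
  shows "the_inv_into (carrier M) f \<in> module_hom A N M"
proof -
  let ?g = "the_inv_into (carrier M) f"
  have inj: "inj_on f (carrier M)" and im: "f ` carrier M = carrier N"
    using bij by (auto simp: bij_betw_def)
  have fg: "f (?g y) = y" if "y \<in> carrier N" for y using f_the_inv_into_f[OF inj] that im by blast
  have g: "?g y \<in> carrier M" if "y \<in> carrier N" for y using the_inv_into_into[OF inj] that im by blast
  have gf: "?g (f x) = x" if "x \<in> carrier M" for x by (rule the_inv_into_f_f[OF inj that])
  show ?thesis
    unfolding hom_iff
  proof (intro conjI ballI)
    fix x y assume x: "x \<in> carrier N"
    show "?g x \<in> carrier M" by (rule g[OF x])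
    assume y: "y \<in> carrier N"
    show "?g (x \<oplus>\<^bsub>N\<^esub> y) = ?g x \<oplus>\<^bsub>M\<^esub> ?g y"
      using gf[OF right_module_group(2)[OF M g[OF x] g[OF y]]] homD(2)[OF f g[OF x] g[OF y]] fg[OF x] fg[OF y]
      by simp
  next
    fix a x assume a: "a \<in> carrier A" and x: "x \<in> carrier N"
    show "?g (a \<odot>\<^bsub>N\<^esub> x) = a \<odot>\<^bsub>M\<^esub> ?g x"
      using gf[OF right_moduleD(3)[OF M a g[OF x]]] homD(3)[OF f a g[OF x]] fg[OF x] by simp
  qed
qed

lemma opp_simps [simp]:
  "carrier (opp A) = carrier A" "\<zero>\<^bsub>opp A\<^esub> = \<zero>\<^bsub>A\<^esub>" "\<one>\<^bsub>opp A\<^esub> = \<one>\<^bsub>A\<^esub>"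
  "add (opp A) = add A" "smult (opp A) = smult A" "mult (opp A) a b = mult A b a"
  by (simp_all add: opp_def)

lemma opp_opp: "opp (opp A) = A"
  by (simp add: opp_def)

lemma kspace_opp [simp]: "kspace (opp A) M = kspace A M"
  by (simp add: kspace_def)

lemma opp_ring:
  assumes "ring A"
  shows "ring (opp A)"
proof -
  interpret ring A by fact
  show ?thesis
  proof (rule ringI)
    show "abelian_group (opp A)"
      using abelian_group_axioms
      by (auto intro!: abelian_groupI simp: a_assoc a_comm a_lcomm intro: bexI[of _ "\<ominus>\<^bsub>A\<^esub> _"] l_neg)
    show "monoid (opp A)" by (rule monoidI) (simp_all add: m_assoc)
  qed (simp_all add: l_distr r_distr)
qed

section \<open>Free and finitely generated projective modules\<close>

definition single :: "('k::field, 'a) module \<Rightarrow> nat \<Rightarrow> nat \<Rightarrow> 'a \<Rightarrow> nat \<Rightarrow> 'a" where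
  "single A n i a = (\<lambda>j\<in>{..<n}. if j = i then a else \<zero>\<^bsub>A\<^esub>)"

lemma free_mod_simps:
  "carrier (free_mod A n) = {..<n} \<rightarrow>\<^sub>E carrier A"
  "\<zero>\<^bsub>free_mod A n\<^esub> = (\<lambda>i\<in>{..<n}. \<zero>\<^bsub>A\<^esub>)"
  "f \<oplus>\<^bsub>free_mod A n\<^esub> g = (\<lambda>i\<in>{..<n}. f i \<oplus>\<^bsub>A\<^esub> g i)"
  "a \<odot>\<^bsub>free_mod A n\<^esub> f = (\<lambda>i\<in>{..<n}. f i \<otimes>\<^bsub>A\<^esub> a)"
  by (simp_all add: free_mod_def)

lemma free_mod_right_module:
  assumes "ring A"
  shows "right_module A (free_mod A n)"
proof -
  interpret ring A by fact
  let ?F = "free_mod A n"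
  have eqI: "u = w" if "u \<in> carrier ?F" "w \<in> carrier ?F" "\<And>i. i < n \<Longrightarrow> u i = w i" for u w
    using that by (auto simp: free_mod_simps intro: PiE_ext)
  have m: "w i \<in> carrier A" if "w \<in> carrier ?F" "i < n" for w i
    using that by (auto simp: free_mod_simps)
  have z: "\<zero>\<^bsub>?F\<^esub> \<in> carrier ?F" by (auto simp: free_mod_simps)
  have add: "u \<oplus>\<^bsub>?F\<^esub> w \<in> carrier ?F" if "u \<in> carrier ?F" "w \<in> carrier ?F" for u w
    using m[OF that(1)] m[OF that(2)] by (auto simp: free_mod_simps)
  have smult: "a \<odot>\<^bsub>?F\<^esub> w \<in> carrier ?F" if "a \<in> carrier A" "w \<in> carrier ?F" for a w
    using that(1) m[OF that(2)] by (auto simp: free_mod_simps)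
  have ev: "\<zero>\<^bsub>?F\<^esub> i = \<zero>\<^bsub>A\<^esub>" "(u \<oplus>\<^bsub>?F\<^esub> w) i = u i \<oplus>\<^bsub>A\<^esub> w i" "(a \<odot>\<^bsub>?F\<^esub> w) i = w i \<otimes>\<^bsub>A\<^esub> a"
    if "i < n" for i u w a using that by (simp_all add: free_mod_simps)
  show ?thesis
  proof (rule right_moduleI)
    show "abelian_group ?F"
    proof (rule abelian_groupI)
      fix u v w assume u: "u \<in> carrier ?F" and v: "v \<in> carrier ?F"
      show "u \<oplus>\<^bsub>?F\<^esub> v \<in> carrier ?F" by (rule add[OF u v])
      show "u \<oplus>\<^bsub>?F\<^esub> v = v \<oplus>\<^bsub>?F\<^esub> u"
        by (rule eqI[OF add[OF u v] add[OF v u]]) (simp add: ev m[OF u] m[OF v] a_comm)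
      assume w: "w \<in> carrier ?F"
      show "u \<oplus>\<^bsub>?F\<^esub> v \<oplus>\<^bsub>?F\<^esub> w = u \<oplus>\<^bsub>?F\<^esub> (v \<oplus>\<^bsub>?F\<^esub> w)"
        by (rule eqI[OF add[OF add[OF u v] w] add[OF u add[OF v w]]])
          (simp add: ev m[OF u] m[OF v] m[OF w] a_assoc)
    next
      fix w assume w: "w \<in> carrier ?F"
      show "\<zero>\<^bsub>?F\<^esub> \<oplus>\<^bsub>?F\<^esub> w = w" by (rule eqI[OF add[OF z w] w]) (simp add: ev m[OF w])
      have i: "(\<lambda>i\<in>{..<n}. \<ominus>\<^bsub>A\<^esub> w i) \<in> carrier ?F" using m[OF w] by (auto simp: free_mod_simps)
      show "\<exists>u\<in>carrier ?F. u \<oplus>\<^bsub>?F\<^esub> w = \<zero>\<^bsub>?F\<^esub>"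
        by (rule bexI[OF _ i], rule eqI[OF add[OF i w] z]) (simp add: ev m[OF w] l_neg)
    qed (rule z)
  next
    fix w assume w: "w \<in> carrier ?F"
    show "\<one>\<^bsub>A\<^esub> \<odot>\<^bsub>?F\<^esub> w = w" by (rule eqI[OF smult[OF one_closed w] w]) (simp add: ev m[OF w])
    fix a b assume a: "a \<in> carrier A" and b: "b \<in> carrier A"
    show "(a \<oplus>\<^bsub>A\<^esub> b) \<odot>\<^bsub>?F\<^esub> w = a \<odot>\<^bsub>?F\<^esub> w \<oplus>\<^bsub>?F\<^esub> b \<odot>\<^bsub>?F\<^esub> w"
      by (rule eqI[OF smult[OF a_closed[OF a b] w] add[OF smult[OF a w] smult[OF b w]]])
        (simp add: ev m[OF w] a b r_distr)
    show "(a \<otimes>\<^bsub>A\<^esub> b) \<odot>\<^bsub>?F\<^esub> w = b \<odot>\<^bsub>?F\<^esub> (a \<odot>\<^bsub>?F\<^esub> w)"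
      by (rule eqI[OF smult[OF m_closed[OF a b] w] smult[OF b smult[OF a w]]])
        (simp add: ev m[OF w] a b m_assoc)
  next
    fix a u w assume a: "a \<in> carrier A" and u: "u \<in> carrier ?F" and w: "w \<in> carrier ?F"
    show "a \<odot>\<^bsub>?F\<^esub> w \<in> carrier ?F" by (rule smult[OF a w])
    show "a \<odot>\<^bsub>?F\<^esub> (u \<oplus>\<^bsub>?F\<^esub> w) = a \<odot>\<^bsub>?F\<^esub> u \<oplus>\<^bsub>?F\<^esub> a \<odot>\<^bsub>?F\<^esub> w"
      by (rule eqI[OF smult[OF a add[OF u w]] add[OF smult[OF a u] smult[OF a w]]])
        (simp add: ev m[OF w] m[OF u] a l_distr)
  qed (rule ring_axioms)
qed

lemma single_closed:
  assumes "ring A" "a \<in> carrier A"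
  shows "single A n i a \<in> carrier (free_mod A n)"
proof -
  interpret ring A by fact
  show ?thesis using assms(2) unfolding single_def free_mod_simps by auto
qed

lemma smult_single:
  assumes "ring A" "a \<in> carrier A" "b \<in> carrier A"
  shows "b \<odot>\<^bsub>free_mod A n\<^esub> single A n i a = single A n i (a \<otimes>\<^bsub>A\<^esub> b)"
proof -
  interpret ring A by fact
  show ?thesis using assms(2,3) unfolding single_def free_mod_simps by (auto cong: restrict_cong)
qed

text \<open>Truncations build an element of the free module one coordinate at a time, so that
  statements about it follow by induction on \<open>k\<close> instead of through finite sums in the
  ring.\<close>

definition trunc :: "('k::field, 'a) module \<Rightarrow> nat \<Rightarrow> nat \<Rightarrow> (nat \<Rightarrow> 'a) \<Rightarrow> nat \<Rightarrow> 'a" where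
  "trunc A n k w = (\<lambda>j\<in>{..<n}. if j < k then w j else \<zero>\<^bsub>A\<^esub>)"

lemma trunc_props:
  assumes "ring A" "w \<in> carrier (free_mod A n)"
  shows "trunc A n 0 w = \<zero>\<^bsub>free_mod A n\<^esub>" "trunc A n n w = w"
    "trunc A n k w \<in> carrier (free_mod A n)"
    "k < n \<Longrightarrow> trunc A n (Suc k) w = trunc A n k w \<oplus>\<^bsub>free_mod A n\<^esub> single A n k (w k)"
proof -
  interpret ring A by fact
  have m: "w i \<in> carrier A" if "i < n" for i using assms(2) that by (auto simp: free_mod_simps)
  show "trunc A n 0 w = \<zero>\<^bsub>free_mod A n\<^esub>" by (simp add: trunc_def free_mod_simps)
  show "trunc A n n w = w" using assms(2)
    by (auto simp: trunc_def free_mod_simps fun_eq_iff PiE_def extensional_def)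
  show "trunc A n k w \<in> carrier (free_mod A n)" using m by (auto simp: trunc_def free_mod_simps)
  show "k < n \<Longrightarrow> trunc A n (Suc k) w = trunc A n k w \<oplus>\<^bsub>free_mod A n\<^esub> single A n k (w k)"
    using m by (auto simp: trunc_def single_def free_mod_simps fun_eq_iff)
qed

lemma free_induct:
  assumes A: "ring A" and w: "w \<in> carrier (free_mod A n)" and zero: "P \<zero>\<^bsub>free_mod A n\<^esub>"
    and single: "\<And>i a. i < n \<Longrightarrow> a \<in> carrier A \<Longrightarrow> P (single A n i a)"
    and add: "\<And>u v. u \<in> carrier (free_mod A n) \<Longrightarrow> v \<in> carrier (free_mod A n) \<Longrightarrow>
      P u \<Longrightarrow> P v \<Longrightarrow> P (u \<oplus>\<^bsub>free_mod A n\<^esub> v)"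
  shows "P w"
proof -
  have m: "w i \<in> carrier A" if "i < n" for i using w that by (auto simp: free_mod_simps)
  note t = trunc_props[OF A w]
  have "P (trunc A n k w)" if "k \<le> n" for k
    using that
  proof (induction k)
    case 0
    then show ?case using zero t(1) by simp
  next
    case (Suc k)
    then have k: "k < n" by simp
    show ?case
      unfolding t(4)[OF k]
      by (rule add[OF t(3) single_closed[OF A m[OF k]] Suc.IH single[OF k m[OF k]]]) (use k in simp)
  qed
  from this[of n] show ?thesis using t(2) by simp
qed

primrec psum :: "('a, 'm) module \<Rightarrow> (nat \<Rightarrow> 'm) \<Rightarrow> nat \<Rightarrow> 'm" where
  "psum M f 0 = \<zero>\<^bsub>M\<^esub>"
| "psum M f (Suc k) = psum M f k \<oplus>\<^bsub>M\<^esub> f k"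

text \<open>Universal property of the free module. The unit vectors go to the \<open>t i\<close>,
  which forces the value on \<open>w\<close> to be the sum of the \<open>t k\<close> multiplied by
  the \<open>w k\<close>.\<close>

lemma free_lift:
  assumes M: "right_module A M" and t: "\<And>i. i < n \<Longrightarrow> t i \<in> carrier M"
  shows "\<exists>\<Phi>\<in>module_hom A (free_mod A n) M.
    \<forall>i<n. \<forall>a\<in>carrier A. \<Phi> (single A n i a) = a \<odot>\<^bsub>M\<^esub> t i"
proof -
  interpret A: ring A using M by (rule right_moduleD)
  interpret M: abelian_group M using M by (rule right_moduleD)
  define \<Phi> where "\<Phi> w = psum M (\<lambda>k. w k \<odot>\<^bsub>M\<^esub> t k) n" for w
  have m: "w i \<in> carrier A" if "w \<in> carrier (free_mod A n)" "i < n" for w i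
    using that by (auto simp: free_mod_simps)
  have cl: "psum M (\<lambda>k. w k \<odot>\<^bsub>M\<^esub> t k) k \<in> carrier M" if "w \<in> carrier (free_mod A n)" "k \<le> n" for w k
    using that(2) by (induction k) (auto simp: m[OF that(1)] t right_moduleD(3)[OF M])
  have add: "psum M (\<lambda>k. (u \<oplus>\<^bsub>free_mod A n\<^esub> v) k \<odot>\<^bsub>M\<^esub> t k) k =
      psum M (\<lambda>k. u k \<odot>\<^bsub>M\<^esub> t k) k \<oplus>\<^bsub>M\<^esub> psum M (\<lambda>k. v k \<odot>\<^bsub>M\<^esub> t k) k"
    if u: "u \<in> carrier (free_mod A n)" and v: "v \<in> carrier (free_mod A n)" and "k \<le> n" for u v k
    using that(3)
  proof (induction k)
    case (Suc k)
    have k: "k < n" "k \<le> n" using Suc.prems by auto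
    have c: "u k \<odot>\<^bsub>M\<^esub> t k \<in> carrier M" "v k \<odot>\<^bsub>M\<^esub> t k \<in> carrier M"
      using m[OF u k(1)] m[OF v k(1)] t[OF k(1)] right_moduleD(3)[OF M] by auto
    have "(u \<oplus>\<^bsub>free_mod A n\<^esub> v) k \<odot>\<^bsub>M\<^esub> t k = u k \<odot>\<^bsub>M\<^esub> t k \<oplus>\<^bsub>M\<^esub> v k \<odot>\<^bsub>M\<^esub> t k"
      using right_moduleD(4)[OF M m[OF u k(1)] m[OF v k(1)] t[OF k(1)]] k by (simp add: free_mod_simps)
    then show ?case using Suc.IH[OF k(2)] cl[OF u k(2)] cl[OF v k(2)] c by (simp add: M.a_ac)
  qed simp
  have smult: "psum M (\<lambda>k. (a \<odot>\<^bsub>free_mod A n\<^esub> u) k \<odot>\<^bsub>M\<^esub> t k) k = a \<odot>\<^bsub>M\<^esub> psum M (\<lambda>k. u k \<odot>\<^bsub>M\<^esub> t k) k"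
    if a: "a \<in> carrier A" and u: "u \<in> carrier (free_mod A n)" and "k \<le> n" for a u k
    using that(3)
  proof (induction k)
    case 0
    then show ?case using smult_zero_right[OF M a] by simp
  next
    case (Suc k)
    have k: "k < n" "k \<le> n" using Suc.prems by auto
    have "(a \<odot>\<^bsub>free_mod A n\<^esub> u) k \<odot>\<^bsub>M\<^esub> t k = a \<odot>\<^bsub>M\<^esub> (u k \<odot>\<^bsub>M\<^esub> t k)"
      using right_moduleD(6)[OF M m[OF u k(1)] a t[OF k(1)]] k by (simp add: free_mod_simps)
    then show ?case
      using Suc.IH[OF k(2)] right_moduleD(5)[OF M a cl[OF u k(2)] right_moduleD(3)[OF M m[OF u k(1)] t[OF k(1)]]]
      by simp
  qed
  have sing: "psum M (\<lambda>k. single A n i a k \<odot>\<^bsub>M\<^esub> t k) k = (if i < k then a \<odot>\<^bsub>M\<^esub> t i else \<zero>\<^bsub>M\<^esub>)"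
    if i: "i < n" and a: "a \<in> carrier A" and "k \<le> n" for i a k
    using that(3)
  proof (induction k)
    case (Suc k)
    have k: "k < n" "k \<le> n" using Suc.prems by auto
    have "single A n i a k \<odot>\<^bsub>M\<^esub> t k = (if k = i then a \<odot>\<^bsub>M\<^esub> t k else \<zero>\<^bsub>M\<^esub>)"
      using k smult_zero_left[OF M t[OF k(1)]] by (simp add: single_def)
    then show ?case using Suc.IH[OF k(2)] right_moduleD(3)[OF M a t[OF i]] by (auto simp: less_Suc_eq)
  qed simp
  show ?thesis
  proof (rule bexI[of _ \<Phi>])
    show "\<Phi> \<in> module_hom A (free_mod A n) M"
      unfolding hom_iff \<Phi>_def using cl add smult by blast
    show "\<forall>i<n. \<forall>a\<in>carrier A. \<Phi> (single A n i a) = a \<odot>\<^bsub>M\<^esub> t i"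
      unfolding \<Phi>_def using sing by simp
  qed
qed

lemma fg_projectiveE:
  assumes "fg_projective A P"
  obtains n s r where "right_module A P" "s \<in> module_hom A P (free_mod A n)"
    "r \<in> module_hom A (free_mod A n) P" "\<And>x. x \<in> carrier P \<Longrightarrow> r (s x) = x"
  using assms unfolding fg_projective_def by blast

lemma fg_projective_right_module: "fg_projective A P \<Longrightarrow> right_module A P"
  by (simp add: fg_projective_def)

lemma fg_mod_right_module: "fg_mod A P \<Longrightarrow> right_module A P"
  by (simp add: fg_mod_def)

lemma fg_projective_fg:
  assumes "fg_projective A P"
  shows "fg_mod A P"
proof -
  obtain n s r where P: "right_module A P" and s: "s \<in> module_hom A P (free_mod A n)"
    and r: "r \<in> module_hom A (free_mod A n) P" and rs: "\<And>x. x \<in> carrier P \<Longrightarrow> r (s x) = x"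
    using fg_projectiveE[OF assms] by metis
  have "r ` carrier (free_mod A n) = carrier P"
  proof (intro equalityI subsetI)
    fix x assume x: "x \<in> carrier P"
    then show "x \<in> r ` carrier (free_mod A n)"
      using rs[OF x] homD(1)[OF s x] by (metis imageI)
  qed (use homD(1)[OF r] in auto)
  then show ?thesis unfolding fg_mod_def using P r by blast
qed

text \<open>On the free module the images of the unit vectors can be lifted at will; the section
  \<open>s\<close> carries the lift over to the summand \<open>P\<close>.\<close>

lemma projective_lift:
  assumes P: "fg_projective A P" and M: "right_module A M" and N: "right_module A N"
    and g: "g \<in> module_hom A M N" and onto: "g ` carrier M = carrier N" and h: "h \<in> module_hom A P N"
  shows "\<exists>h'\<in>module_hom A P M. \<forall>x\<in>carrier P. g (h' x) = h x"
proof -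
  obtain n s r where PM: "right_module A P" and s: "s \<in> module_hom A P (free_mod A n)"
    and r: "r \<in> module_hom A (free_mod A n) P" and rs: "\<And>x. x \<in> carrier P \<Longrightarrow> r (s x) = x"
    using fg_projectiveE[OF P] by metis
  interpret A: ring A using M by (rule right_moduleD)
  let ?F = "free_mod A n" and ?e = "\<lambda>i. single A n i \<one>\<^bsub>A\<^esub>"
  have F: "right_module A ?F" by (rule free_mod_right_module) (rule A.ring_axioms)
  have e: "?e i \<in> carrier ?F" for i by (rule single_closed[OF A.ring_axioms]) simp
  have "\<exists>t\<in>carrier M. g t = h (r (?e i))" for i
    using homD(1)[OF h homD(1)[OF r e]] onto by (metis imageE)
  then obtain t where t: "\<And>i. t i \<in> carrier M" "\<And>i. g (t i) = h (r (?e i))" by metis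
  obtain \<Phi> where \<Phi>: "\<Phi> \<in> module_hom A ?F M"
    "\<And>i a. i < n \<Longrightarrow> a \<in> carrier A \<Longrightarrow> \<Phi> (single A n i a) = a \<odot>\<^bsub>M\<^esub> t i"
    using free_lift[OF M, of n t] t(1) by blast
  have eq: "g (\<Phi> w) = h (r w)" if "w \<in> carrier ?F" for w
  proof (rule free_induct[OF A.ring_axioms that])
    show "g (\<Phi> \<zero>\<^bsub>?F\<^esub>) = h (r \<zero>\<^bsub>?F\<^esub>)"
      using hom_zero[OF F M \<Phi>(1)] hom_zero[OF F PM r] hom_zero[OF M N g] hom_zero[OF PM N h] by simp
    show "g (\<Phi> (single A n i a)) = h (r (single A n i a))" if "i < n" "a \<in> carrier A" for i a
    proof -
      have "single A n i a = a \<odot>\<^bsub>?F\<^esub> ?e i"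
        using smult_single[OF A.ring_axioms A.one_closed that(2)] that(2) by simp
      then have "h (r (single A n i a)) = a \<odot>\<^bsub>N\<^esub> h (r (?e i))"
        using homD(3)[OF h that(2) homD(1)[OF r e]] homD(3)[OF r that(2) e] by simp
      then show ?thesis using \<Phi>(2)[OF that] homD(3)[OF g that(2) t(1)] t(2) by simp
    qed
    show "g (\<Phi> (u \<oplus>\<^bsub>?F\<^esub> v)) = h (r (u \<oplus>\<^bsub>?F\<^esub> v))"
      if "u \<in> carrier ?F" "v \<in> carrier ?F" "g (\<Phi> u) = h (r u)" "g (\<Phi> v) = h (r v)" for u v
      using homD(2)[OF \<Phi>(1) that(1,2)] homD(2)[OF r that(1,2)] that(3,4)
        homD(2)[OF g homD(1)[OF \<Phi>(1) that(1)] homD(1)[OF \<Phi>(1) that(2)]]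
        homD(2)[OF h homD(1)[OF r that(1)] homD(1)[OF r that(2)]] by simp
  qed
  show ?thesis
    by (rule bexI[of _ "\<lambda>x. \<Phi> (s x)"])
      (use eq homD(1)[OF s] rs hom_comp[OF s \<Phi>(1)] in auto)
qed

section \<open>The dual Hom(P, A) as a left module\<close>

lemma adual_simps:
  "f \<in> carrier (adual A P) \<longleftrightarrow> f \<in> extensional (carrier P) \<and>
        (\<forall>x \<in> carrier P. f x \<in> carrier A) \<and>
        (\<forall>x \<in> carrier P. \<forall>y \<in> carrier P. f (x \<oplus>\<^bsub>P\<^esub> y) = f x \<oplus>\<^bsub>A\<^esub> f y) \<and>
        (\<forall>a \<in> carrier A. \<forall>x \<in> carrier P. f (a \<odot>\<^bsub>P\<^esub> x) = f x \<otimes>\<^bsub>A\<^esub> a)"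
  "\<zero>\<^bsub>adual A P\<^esub> = (\<lambda>x \<in> carrier P. \<zero>\<^bsub>A\<^esub>)"
  "f \<oplus>\<^bsub>adual A P\<^esub> g = (\<lambda>x \<in> carrier P. f x \<oplus>\<^bsub>A\<^esub> g x)"
  "a \<odot>\<^bsub>adual A P\<^esub> f = (\<lambda>x \<in> carrier P. a \<otimes>\<^bsub>A\<^esub> f x)"
  by (simp_all add: adual_def)

lemma adual_eqI:
  assumes "f \<in> carrier (adual A P)" "g \<in> carrier (adual A P)" "\<And>x. x \<in> carrier P \<Longrightarrow> f x = g x"
  shows "f = g"
  by (rule extensionalityI[of _ "carrier P"]) (use assms in \<open>auto simp: adual_simps(1)\<close>)

lemma adual_right_module:
  assumes P: "right_module A P"
  shows "right_module (opp A) (adual A P)"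
proof -
  interpret A: ring A using P by (rule right_moduleD)
  note cl = right_module_group(2)[OF P] right_moduleD(3)[OF P]
  show ?thesis
  proof (rule right_moduleI)
    show "ring (opp A)" by (rule opp_ring) (rule A.ring_axioms)
    show "abelian_group (adual A P)"
    proof (rule abelian_groupI)
      fix f assume f: "f \<in> carrier (adual A P)"
      show "\<exists>g\<in>carrier (adual A P). g \<oplus>\<^bsub>adual A P\<^esub> f = \<zero>\<^bsub>adual A P\<^esub>"
      proof (rule bexI[of _ "\<lambda>x\<in>carrier P. \<ominus>\<^bsub>A\<^esub> f x"])
        show "(\<lambda>x\<in>carrier P. \<ominus>\<^bsub>A\<^esub> f x) \<in> carrier (adual A P)"
          using f cl by (auto simp: adual_simps(1) A.minus_add A.l_minus)
        show "(\<lambda>x\<in>carrier P. \<ominus>\<^bsub>A\<^esub> f x) \<oplus>\<^bsub>adual A P\<^esub> f = \<zero>\<^bsub>adual A P\<^esub>"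
          using f by (auto simp: adual_simps A.l_neg cong: restrict_cong)
      qed
      show "\<zero>\<^bsub>adual A P\<^esub> \<oplus>\<^bsub>adual A P\<^esub> f = f"
        using f by (auto simp: adual_simps fun_eq_iff extensional_def)
      fix g assume g: "g \<in> carrier (adual A P)"
      show "f \<oplus>\<^bsub>adual A P\<^esub> g \<in> carrier (adual A P)"
        using f g cl by (auto simp: adual_simps A.a_ac A.l_distr)
      show "f \<oplus>\<^bsub>adual A P\<^esub> g = g \<oplus>\<^bsub>adual A P\<^esub> f"
        using f g by (auto simp: adual_simps A.a_ac cong: restrict_cong)
      fix h assume h: "h \<in> carrier (adual A P)"
      show "f \<oplus>\<^bsub>adual A P\<^esub> g \<oplus>\<^bsub>adual A P\<^esub> h = f \<oplus>\<^bsub>adual A P\<^esub> (g \<oplus>\<^bsub>adual A P\<^esub> h)"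
        using f g h by (auto simp: adual_simps A.a_ac cong: restrict_cong)
    next
      show "\<zero>\<^bsub>adual A P\<^esub> \<in> carrier (adual A P)" using cl by (auto simp: adual_simps)
    qed
  next
    fix f assume f: "f \<in> carrier (adual A P)"
    show "\<one>\<^bsub>opp A\<^esub> \<odot>\<^bsub>adual A P\<^esub> f = f"
      using f by (auto simp: adual_simps fun_eq_iff extensional_def)
    fix a assume a: "a \<in> carrier (opp A)"
    show "a \<odot>\<^bsub>adual A P\<^esub> f \<in> carrier (adual A P)"
      using f a cl by (auto simp: adual_simps A.r_distr A.m_assoc)
    fix b assume b: "b \<in> carrier (opp A)"
    show "(a \<oplus>\<^bsub>opp A\<^esub> b) \<odot>\<^bsub>adual A P\<^esub> f = a \<odot>\<^bsub>adual A P\<^esub> f \<oplus>\<^bsub>adual A P\<^esub> b \<odot>\<^bsub>adual A P\<^esub> f"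
      using f a b by (auto simp: adual_simps A.l_distr cong: restrict_cong)
    show "(a \<otimes>\<^bsub>opp A\<^esub> b) \<odot>\<^bsub>adual A P\<^esub> f = b \<odot>\<^bsub>adual A P\<^esub> (a \<odot>\<^bsub>adual A P\<^esub> f)"
      using f a b by (auto simp: adual_simps A.m_assoc cong: restrict_cong)
  next
    fix a f g assume "a \<in> carrier (opp A)" "f \<in> carrier (adual A P)" "g \<in> carrier (adual A P)"
    then show "a \<odot>\<^bsub>adual A P\<^esub> (f \<oplus>\<^bsub>adual A P\<^esub> g) = a \<odot>\<^bsub>adual A P\<^esub> f \<oplus>\<^bsub>adual A P\<^esub> a \<odot>\<^bsub>adual A P\<^esub> g"
      by (auto simp: adual_simps A.r_distr cong: restrict_cong)
  qed
qed

section \<open>The path algebra of a bipartite quiver\<close>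

definition unit_at :: "'b \<Rightarrow> 'b \<Rightarrow> 'k::field" where
  "unit_at b = (\<lambda>z. if z = b then 1 else 0)"

text \<open>For an idempotent \<open>a\<close> this is the component \<open>M a\<close>; with the
  trivial path at a vertex it is the space at that vertex in the representation attached to
  \<open>M\<close>.\<close>

definition cpt :: "('a, 'm) module \<Rightarrow> 'a \<Rightarrow> 'm set" where
  "cpt M a = (\<lambda>x. a \<odot>\<^bsub>M\<^esub> x) ` carrier M"

text \<open>\<open>A\<close> as a right module over itself. An element of Hom(P, A) is then an
  ordinary \<open>module_hom\<close>, and the general lifting and factoring lemmas apply to
  it.\<close>

definition regular_mod :: "('k::field, 'a) module \<Rightarrow> ('a, 'a) module" where
  "regular_mod A = \<lparr> carrier = carrier A, mult = undefined, one = undefined,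
    zero = \<zero>\<^bsub>A\<^esub>, add = (\<oplus>\<^bsub>A\<^esub>), smult = (\<lambda>a x. x \<otimes>\<^bsub>A\<^esub> a) \<rparr>"

lemma regular_mod_simps:
  "carrier (regular_mod A) = carrier A" "\<zero>\<^bsub>regular_mod A\<^esub> = \<zero>\<^bsub>A\<^esub>"
  "x \<oplus>\<^bsub>regular_mod A\<^esub> y = x \<oplus>\<^bsub>A\<^esub> y" "a \<odot>\<^bsub>regular_mod A\<^esub> x = x \<otimes>\<^bsub>A\<^esub> a"
  by (simp_all add: regular_mod_def)

lemma regular_right_module:
  assumes "ring A"
  shows "right_module A (regular_mod A)"
proof -
  interpret ring A by fact
  show ?thesis
    by (rule right_moduleI)
      (auto simp: regular_mod_simps a_ac l_distr r_distr m_assoc ring_axioms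
        intro!: abelian_groupI bexI[of _ "\<ominus>\<^bsub>A\<^esub> _"] l_neg)
qed

text \<open>
  The basis of the algebra consists of \<open>eb v\<close>, the trivial path at \<open>v\<close>, and \<open>ab (x, y)\<close>,
  the arrow from \<open>x\<close> to \<open>y\<close>.  Since all arrows run from \<open>X\<close> to \<open>Y\<close>, no two arrows compose.
  The locale is self-dual: the opposite algebra is the path algebra of the opposite quiver.
\<close>

locale bip =
  fixes A :: "('k::field, 'b \<Rightarrow> 'k) module" and X Y :: "'v set" and E :: "('v \<times> 'v) set"
    and eb :: "'v \<Rightarrow> 'b" and ab :: "'v \<times> 'v \<Rightarrow> 'b"
  assumes finX: "finite X" and finY: "finite Y" and XY: "X \<inter> Y = {}" and EXY: "E \<subseteq> X \<times> Y"
    and inj_eb: "inj_on eb (X \<union> Y)" and inj_ab: "inj_on ab E"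
    and eb_ab: "eb ` (X \<union> Y) \<inter> ab ` E = {}"
    and carrier_A: "carrier A = {f. \<forall>z. z \<notin> eb ` (X \<union> Y) \<union> ab ` E \<longrightarrow> f z = 0}"
    and zero_A: "\<zero>\<^bsub>A\<^esub> = (\<lambda>_. 0)"
    and one_A: "\<one>\<^bsub>A\<^esub> = (\<lambda>z. if z \<in> eb ` (X \<union> Y) then 1 else 0)"
    and add_A: "add A = (\<lambda>f g z. f z + g z)"
    and smult_A: "smult A = (\<lambda>c f z. c * f z)"
    and mult_closed: "f \<in> carrier A \<Longrightarrow> g \<in> carrier A \<Longrightarrow> f \<otimes>\<^bsub>A\<^esub> g \<in> carrier A"
    and mult_eb: "f \<in> carrier A \<Longrightarrow> g \<in> carrier A \<Longrightarrow> v \<in> X \<union> Y \<Longrightarrow>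
      (f \<otimes>\<^bsub>A\<^esub> g) (eb v) = f (eb v) * g (eb v)"
    and mult_ab: "f \<in> carrier A \<Longrightarrow> g \<in> carrier A \<Longrightarrow> (x, y) \<in> E \<Longrightarrow>
      (f \<otimes>\<^bsub>A\<^esub> g) (ab (x, y)) = f (eb x) * g (ab (x, y)) + f (ab (x, y)) * g (eb y)"
begin

abbreviation V :: "'v set" where "V \<equiv> X \<union> Y"

abbreviation ee :: "'v \<Rightarrow> 'b \<Rightarrow> 'k" where "ee v \<equiv> unit_at (eb v)"

abbreviation aa :: "'v \<times> 'v \<Rightarrow> 'b \<Rightarrow> 'k" where "aa e \<equiv> unit_at (ab e)"

abbreviation scal :: "'k \<Rightarrow> 'b \<Rightarrow> 'k" where "scal c \<equiv> c \<odot>\<^bsub>A\<^esub> \<one>\<^bsub>A\<^esub>"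

abbreviation kd :: "('b \<Rightarrow> 'k, 'm) module \<Rightarrow> 'v \<Rightarrow> nat" where
  "kd M v \<equiv> kdim ((kspace A M)\<lparr>carrier := cpt M (ee v)\<rparr>)"

lemma E_V: "(x, y) \<in> E \<Longrightarrow> x \<in> X" "(x, y) \<in> E \<Longrightarrow> y \<in> Y" "(x, y) \<in> E \<Longrightarrow> x \<noteq> y"
  "x \<in> X \<Longrightarrow> x \<notin> Y" "y \<in> Y \<Longrightarrow> y \<notin> X"
  using EXY XY by auto

lemma finE: "finite E"
  using finite_subset[OF EXY] finX finY by blast

lemma A_eqI:
  assumes "f \<in> carrier A" "g \<in> carrier A" "\<And>v. v \<in> V \<Longrightarrow> f (eb v) = g (eb v)"
    "\<And>x y. (x, y) \<in> E \<Longrightarrow> f (ab (x, y)) = g (ab (x, y))"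
  shows "f = g"
proof
  fix z
  show "f z = g z"
    using assms unfolding carrier_A by (cases "z \<in> eb ` V \<union> ab ` E") auto
qed

lemma ev:
  "\<zero>\<^bsub>A\<^esub> z = 0" "(f \<oplus>\<^bsub>A\<^esub> g) z = f z + g z" "(c \<odot>\<^bsub>A\<^esub> f) z = c * f z"
  "v \<in> V \<Longrightarrow> \<one>\<^bsub>A\<^esub> (eb v) = 1" "e \<in> E \<Longrightarrow> \<one>\<^bsub>A\<^esub> (ab e) = 0"
  "v \<in> V \<Longrightarrow> u \<in> V \<Longrightarrow> ee v (eb u) = (if u = v then 1 else 0)"
  "v \<in> V \<Longrightarrow> e \<in> E \<Longrightarrow> ee v (ab e) = 0" "v \<in> V \<Longrightarrow> e \<in> E \<Longrightarrow> aa e (eb v) = 0"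
  "d \<in> E \<Longrightarrow> e \<in> E \<Longrightarrow> aa d (ab e) = (if e = d then 1 else 0)"
  using eb_ab inj_eb inj_ab
  by (auto simp: zero_A add_A smult_A one_A unit_at_def inj_on_def)

lemma A_closed [intro]:
  "\<zero>\<^bsub>A\<^esub> \<in> carrier A" "\<one>\<^bsub>A\<^esub> \<in> carrier A"
  "f \<in> carrier A \<Longrightarrow> g \<in> carrier A \<Longrightarrow> f \<oplus>\<^bsub>A\<^esub> g \<in> carrier A"
  "f \<in> carrier A \<Longrightarrow> c \<odot>\<^bsub>A\<^esub> f \<in> carrier A"
  "v \<in> V \<Longrightarrow> ee v \<in> carrier A" "e \<in> E \<Longrightarrow> aa e \<in> carrier A"
  by (auto simp: carrier_A zero_A one_A add_A smult_A unit_at_def)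

lemma ring_A: "ring A"
proof (rule ringI)
  show "abelian_group A"
  proof (rule abelian_groupI)
    fix f assume f: "f \<in> carrier A"
    show "\<exists>g\<in>carrier A. g \<oplus>\<^bsub>A\<^esub> f = \<zero>\<^bsub>A\<^esub>"
      by (rule bexI[of _ "\<lambda>z. - f z"]) (use f in \<open>auto simp: add_A zero_A carrier_A\<close>)
  qed (auto simp: add_A zero_A carrier_A)
  show "monoid A"
  proof (rule monoidI)
    fix f g h assume f: "f \<in> carrier A" and g: "g \<in> carrier A" and h: "h \<in> carrier A"
    show "f \<otimes>\<^bsub>A\<^esub> g \<otimes>\<^bsub>A\<^esub> h = f \<otimes>\<^bsub>A\<^esub> (g \<otimes>\<^bsub>A\<^esub> h)"
      by (rule A_eqI) (auto simp: mult_eb mult_ab mult_closed f g h E_V algebra_simps)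
    show "\<one>\<^bsub>A\<^esub> \<otimes>\<^bsub>A\<^esub> f = f" by (rule A_eqI) (auto simp: mult_eb mult_ab mult_closed f E_V ev A_closed)
    show "f \<otimes>\<^bsub>A\<^esub> \<one>\<^bsub>A\<^esub> = f" by (rule A_eqI) (auto simp: mult_eb mult_ab mult_closed f E_V ev A_closed)
  qed (auto intro: mult_closed)
next
  fix f g h assume f: "f \<in> carrier A" and g: "g \<in> carrier A" and h: "h \<in> carrier A"
  show "(f \<oplus>\<^bsub>A\<^esub> g) \<otimes>\<^bsub>A\<^esub> h = f \<otimes>\<^bsub>A\<^esub> h \<oplus>\<^bsub>A\<^esub> g \<otimes>\<^bsub>A\<^esub> h"
    by (rule A_eqI) (auto simp: mult_eb mult_ab mult_closed f g h E_V ev A_closed algebra_simps)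
  show "h \<otimes>\<^bsub>A\<^esub> (f \<oplus>\<^bsub>A\<^esub> g) = h \<otimes>\<^bsub>A\<^esub> f \<oplus>\<^bsub>A\<^esub> h \<otimes>\<^bsub>A\<^esub> g"
    by (rule A_eqI) (auto simp: mult_eb mult_ab mult_closed f g h E_V ev A_closed algebra_simps)
qed

lemma mult_rules:
  assumes "a \<in> carrier A"
  shows "u \<in> V \<Longrightarrow> v \<in> V \<Longrightarrow> ee u \<otimes>\<^bsub>A\<^esub> ee v = (if u = v then ee u else \<zero>\<^bsub>A\<^esub>)"
    "x \<in> X \<Longrightarrow> a \<otimes>\<^bsub>A\<^esub> ee x = a (eb x) \<odot>\<^bsub>A\<^esub> ee x"
    "y \<in> Y \<Longrightarrow> ee y \<otimes>\<^bsub>A\<^esub> a = a (eb y) \<odot>\<^bsub>A\<^esub> ee y"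
    "(x, y) \<in> E \<Longrightarrow> aa (x, y) \<otimes>\<^bsub>A\<^esub> a = a (eb y) \<odot>\<^bsub>A\<^esub> aa (x, y)"
    "(x, y) \<in> E \<Longrightarrow> a \<otimes>\<^bsub>A\<^esub> aa (x, y) = a (eb x) \<odot>\<^bsub>A\<^esub> aa (x, y)"
    "(x, y) \<in> E \<Longrightarrow> v \<in> V \<Longrightarrow> ee v \<otimes>\<^bsub>A\<^esub> aa (x, y) = (if v = x then aa (x, y) else \<zero>\<^bsub>A\<^esub>)"
    "(x, y) \<in> E \<Longrightarrow> v \<in> V \<Longrightarrow> aa (x, y) \<otimes>\<^bsub>A\<^esub> ee v = (if v = y then aa (x, y) else \<zero>\<^bsub>A\<^esub>)"
    "b \<in> carrier A \<Longrightarrow> (c \<odot>\<^bsub>A\<^esub> a) \<otimes>\<^bsub>A\<^esub> b = c \<odot>\<^bsub>A\<^esub> (a \<otimes>\<^bsub>A\<^esub> b)"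
    "b \<in> carrier A \<Longrightarrow> a \<otimes>\<^bsub>A\<^esub> (c \<odot>\<^bsub>A\<^esub> b) = c \<odot>\<^bsub>A\<^esub> (a \<otimes>\<^bsub>A\<^esub> b)"
    "scal c \<otimes>\<^bsub>A\<^esub> a = c \<odot>\<^bsub>A\<^esub> a" "a \<otimes>\<^bsub>A\<^esub> scal c = c \<odot>\<^bsub>A\<^esub> a"
  using assms
  by (auto intro!: A_eqI simp: mult_eb mult_ab mult_closed E_V ev A_closed algebra_simps split: if_splits)

text \<open>The basis is finite, so \<open>f\<close> is built up one basis element at a time;
  \<open>t S\<close> is its restriction to \<open>S\<close>.\<close>

lemma alg_induct:
  assumes f: "f \<in> carrier A" and zero: "P \<zero>\<^bsub>A\<^esub>"
    and ee: "\<And>c v. v \<in> V \<Longrightarrow> P (c \<odot>\<^bsub>A\<^esub> ee v)" and aa: "\<And>c e. e \<in> E \<Longrightarrow> P (c \<odot>\<^bsub>A\<^esub> aa e)"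
    and add: "\<And>f g. f \<in> carrier A \<Longrightarrow> g \<in> carrier A \<Longrightarrow> P f \<Longrightarrow> P g \<Longrightarrow> P (f \<oplus>\<^bsub>A\<^esub> g)"
  shows "P f"
proof -
  let ?B = "eb ` V \<union> ab ` E"
  have fin: "finite ?B" using finX finY finE by simp
  define t where "t S = (\<lambda>z. if z \<in> S then f z else 0)" for S
  have tc: "t S \<in> carrier A" for S using f by (auto simp: t_def carrier_A)
  have "P (t S)" if "S \<subseteq> ?B" for S
    using finite_subset[OF that fin] that
  proof (induction S rule: finite_induct)
    case empty
    then show ?case using zero by (simp add: t_def zero_A)
  next
    case (insert b S)
    have e: "t (insert b S) = f b \<odot>\<^bsub>A\<^esub> unit_at b \<oplus>\<^bsub>A\<^esub> t S"
      using insert.hyps by (auto simp: t_def add_A smult_A unit_at_def)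
    have "f b \<odot>\<^bsub>A\<^esub> unit_at b \<in> carrier A \<and> P (f b \<odot>\<^bsub>A\<^esub> unit_at b)"
      using insert.prems ee aa by auto
    then show ?case unfolding e using add[OF _ tc] insert by auto
  qed
  moreover have "t ?B = f" using f by (auto simp: t_def carrier_A)
  ultimately show ?thesis by (metis subset_refl)
qed

text \<open>Sources and sinks change places. The labels \<open>ab\<close> are only precomposed with
  \<open>prod.swap\<close>, so the algebra keeps its underlying set of functions, and every result
  about right modules can be read for left modules.\<close>

lemma bip_opp: "bip (opp A) Y X (E\<inverse>) eb (\<lambda>e. ab (prod.swap e))"
proof
  have sw: "prod.swap ` (E\<inverse>) = E" by force
  show "inj_on (\<lambda>e. ab (prod.swap e)) (E\<inverse>)"
    using comp_inj_on[of prod.swap "E\<inverse>" ab] inj_ab unfolding sw by (simp add: comp_def)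
  have im: "(\<lambda>e. ab (prod.swap e)) ` (E\<inverse>) = ab ` E"
    using image_comp[of ab prod.swap "E\<inverse>"] unfolding sw by (simp add: comp_def)
  have VV: "Y \<union> X = V" by auto
  show "eb ` (Y \<union> X) \<inter> (\<lambda>e. ab (prod.swap e)) ` (E\<inverse>) = {}" unfolding im VV by (rule eb_ab)
  show "carrier (opp A) = {f. \<forall>z. z \<notin> eb ` (Y \<union> X) \<union> (\<lambda>e. ab (prod.swap e)) ` (E\<inverse>) \<longrightarrow> f z = 0}"
    unfolding im VV by (simp add: carrier_A)
  show "E\<inverse> \<subseteq> Y \<times> X" using EXY by auto
qed (use finX finY XY inj_eb zero_A one_A add_A smult_A mult_closed mult_eb mult_ab
    in \<open>auto simp: Un_commute mult.commute add.commute\<close>)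

text \<open>\<open>scal c\<close> is central, so scalars may be moved past the action of any
  \<open>a\<close>.\<close>

lemma smult_scal:
  assumes M: "right_module A M" and a: "a \<in> carrier A" and x: "x \<in> carrier M"
  shows "(c \<odot>\<^bsub>A\<^esub> a) \<odot>\<^bsub>M\<^esub> x = scal c \<odot>\<^bsub>M\<^esub> (a \<odot>\<^bsub>M\<^esub> x)"
    "(c \<odot>\<^bsub>A\<^esub> a) \<odot>\<^bsub>M\<^esub> x = a \<odot>\<^bsub>M\<^esub> (scal c \<odot>\<^bsub>M\<^esub> x)"
proof -
  have s: "scal c \<in> carrier A" by blast
  show "(c \<odot>\<^bsub>A\<^esub> a) \<odot>\<^bsub>M\<^esub> x = scal c \<odot>\<^bsub>M\<^esub> (a \<odot>\<^bsub>M\<^esub> x)"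
    using right_moduleD(6)[OF M a s x] mult_rules(11)[OF a] by simp
  show "(c \<odot>\<^bsub>A\<^esub> a) \<odot>\<^bsub>M\<^esub> x = a \<odot>\<^bsub>M\<^esub> (scal c \<odot>\<^bsub>M\<^esub> x)"
    using right_moduleD(6)[OF M s a x] mult_rules(10)[OF a] by simp
qed

lemma scal_rules: "scal (c + d) = scal c \<oplus>\<^bsub>A\<^esub> scal d" "scal (c * d) = scal d \<otimes>\<^bsub>A\<^esub> scal c" "scal 1 = \<one>\<^bsub>A\<^esub>"
  by (auto intro!: A_eqI mult_closed simp: ev mult_eb mult_ab A_closed E_V algebra_simps)

lemma kspace_simps:
  "carrier (kspace A M) = carrier M" "\<zero>\<^bsub>kspace A M\<^esub> = \<zero>\<^bsub>M\<^esub>" "add (kspace A M) = add M"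
  "c \<odot>\<^bsub>kspace A M\<^esub> x = scal c \<odot>\<^bsub>M\<^esub> x"
  by (simp_all add: kspace_def)

lemma kspace_vspace:
  assumes M: "right_module A M"
  shows "vspace (kspace A M)"
proof (rule vspaceI)
  interpret M: abelian_group M using M by (rule right_moduleD)
  show "abelian_group (kspace A M)"
    by (rule abelian_groupI) (auto simp: kspace_simps M.a_ac intro!: bexI[of _ "\<ominus>\<^bsub>M\<^esub> _"] M.l_neg)
qed (use right_moduleD[OF M] in \<open>auto simp: kspace_simps scal_rules A_closed\<close>)

lemma hom_khom:
  assumes f: "f \<in> module_hom A M N"
  shows "f \<in> module_hom class_ring (kspace A M) (kspace A N)"
  using f A_closed(2,4) unfolding khom_iff hom_iff kspace_simps by blast

text \<open>Trivial paths and arrows span \<open>A\<close> over the field, so compatibility with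
  these and with scalars suffices.\<close>

lemma homI:
  assumes M: "right_module A M" and N: "right_module A N"
    and cl: "\<And>x. x \<in> carrier M \<Longrightarrow> f x \<in> carrier N"
    and add: "\<And>x y. x \<in> carrier M \<Longrightarrow> y \<in> carrier M \<Longrightarrow> f (x \<oplus>\<^bsub>M\<^esub> y) = f x \<oplus>\<^bsub>N\<^esub> f y"
    and sc: "\<And>c x. x \<in> carrier M \<Longrightarrow> f (scal c \<odot>\<^bsub>M\<^esub> x) = scal c \<odot>\<^bsub>N\<^esub> f x"
    and ee: "\<And>v x. v \<in> V \<Longrightarrow> x \<in> carrier M \<Longrightarrow> f (ee v \<odot>\<^bsub>M\<^esub> x) = ee v \<odot>\<^bsub>N\<^esub> f x"
    and aa: "\<And>e x. e \<in> E \<Longrightarrow> x \<in> carrier M \<Longrightarrow> f (aa e \<odot>\<^bsub>M\<^esub> x) = aa e \<odot>\<^bsub>N\<^esub> f x"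
  shows "f \<in> module_hom A M N"
proof -
  have "f (a \<odot>\<^bsub>M\<^esub> x) = a \<odot>\<^bsub>N\<^esub> f x" if a: "a \<in> carrier A" and x: "x \<in> carrier M" for a x
  proof (rule alg_induct[OF a])
    have "f \<zero>\<^bsub>M\<^esub> = \<zero>\<^bsub>N\<^esub>"
    proof (rule group_idem_zero[OF right_moduleD(2)[OF N]])
      note z = right_module_group(1)[OF M]
      show "f \<zero>\<^bsub>M\<^esub> \<in> carrier N" by (rule cl[OF z])
      show "f \<zero>\<^bsub>M\<^esub> \<oplus>\<^bsub>N\<^esub> f \<zero>\<^bsub>M\<^esub> = f \<zero>\<^bsub>M\<^esub>" using add[OF z z] right_module_group(3)[OF M z] by simp
    qed
    then show "f (\<zero>\<^bsub>A\<^esub> \<odot>\<^bsub>M\<^esub> x) = \<zero>\<^bsub>A\<^esub> \<odot>\<^bsub>N\<^esub> f x"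
      using smult_zero_left[OF M x] smult_zero_left[OF N cl[OF x]] by simp
    show "f ((c \<odot>\<^bsub>A\<^esub> ee v) \<odot>\<^bsub>M\<^esub> x) = (c \<odot>\<^bsub>A\<^esub> ee v) \<odot>\<^bsub>N\<^esub> f x" if v: "v \<in> V" for c v
      using smult_scal(1)[OF M A_closed(5)[OF v] x] smult_scal(1)[OF N A_closed(5)[OF v] cl[OF x]]
        sc[OF right_moduleD(3)[OF M A_closed(5)[OF v] x]] ee[OF v x] by simp
    show "f ((c \<odot>\<^bsub>A\<^esub> aa e) \<odot>\<^bsub>M\<^esub> x) = (c \<odot>\<^bsub>A\<^esub> aa e) \<odot>\<^bsub>N\<^esub> f x" if e: "e \<in> E" for c e
      using smult_scal(1)[OF M A_closed(6)[OF e] x] smult_scal(1)[OF N A_closed(6)[OF e] cl[OF x]]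
        sc[OF right_moduleD(3)[OF M A_closed(6)[OF e] x]] aa[OF e x] by simp
    show "f ((a \<oplus>\<^bsub>A\<^esub> b) \<odot>\<^bsub>M\<^esub> x) = (a \<oplus>\<^bsub>A\<^esub> b) \<odot>\<^bsub>N\<^esub> f x"
      if "a \<in> carrier A" "b \<in> carrier A" "f (a \<odot>\<^bsub>M\<^esub> x) = a \<odot>\<^bsub>N\<^esub> f x" "f (b \<odot>\<^bsub>M\<^esub> x) = b \<odot>\<^bsub>N\<^esub> f x" for a b
      using right_moduleD(4)[OF M that(1,2) x] right_moduleD(4)[OF N that(1,2) cl[OF x]] that(3,4)
        add[OF right_moduleD(3)[OF M that(1) x] right_moduleD(3)[OF M that(2) x]] by simp
  qed
  then show ?thesis unfolding hom_iff using cl add by blast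
qed

text \<open>The unit is the sum of the \<open>ee v\<close>, so \<open>x\<close> is the sum of its
  components; \<open>t S\<close> in the proof is the partial sum over \<open>S\<close>.\<close>

lemma component_induct:
  assumes M: "right_module A M" and x: "x \<in> carrier M" and zero: "\<zero>\<^bsub>M\<^esub> \<in> U"
    and ee: "\<And>v. v \<in> V \<Longrightarrow> ee v \<odot>\<^bsub>M\<^esub> x \<in> U"
    and add: "\<And>y z. y \<in> U \<Longrightarrow> z \<in> U \<Longrightarrow> y \<oplus>\<^bsub>M\<^esub> z \<in> U"
  shows "x \<in> U"
proof -
  define t where "t S = (\<lambda>z. if z \<in> eb ` S then 1 else 0 :: 'k)" for S
  have tc: "t S \<in> carrier A" if "S \<subseteq> V" for S using that by (auto simp: t_def carrier_A)
  have "t S \<odot>\<^bsub>M\<^esub> x \<in> U" if "S \<subseteq> V" for S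
    using finite_subset[OF that] finX finY that
  proof (induction S rule: infinite_finite_induct)
    case empty
    have "t {} = \<zero>\<^bsub>A\<^esub>" by (simp add: t_def zero_A)
    then show ?case using zero smult_zero_left[OF M x] by simp
  next
    case (insert v S)
    have vS: "v \<in> V" "S \<subseteq> V" using insert.prems by auto
    have "eb v \<notin> eb ` S" using inj_eb insert.hyps vS by (auto simp: inj_on_def)
    then have "t (insert v S) = ee v \<oplus>\<^bsub>A\<^esub> t S" by (auto simp: t_def add_A unit_at_def)
    then show ?case
      using right_moduleD(4)[OF M A_closed(5)[OF vS(1)] tc[OF vS(2)] x] add ee[OF vS(1)] insert vS by auto
  qed auto
  from this[OF subset_refl] have "t V \<odot>\<^bsub>M\<^esub> x \<in> U" .
  moreover have "t V = \<one>\<^bsub>A\<^esub>" by (simp add: t_def one_A)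
  ultimately show ?thesis using right_moduleD(7)[OF M x] by simp
qed

lemma cpt_iff:
  assumes M: "right_module A M" and v: "v \<in> V"
  shows "x \<in> cpt M (ee v) \<longleftrightarrow> x \<in> carrier M \<and> ee v \<odot>\<^bsub>M\<^esub> x = x"
proof -
  have e: "ee v \<in> carrier A" using v by blast
  have "ee v \<odot>\<^bsub>M\<^esub> (ee v \<odot>\<^bsub>M\<^esub> y) = ee v \<odot>\<^bsub>M\<^esub> y" if "y \<in> carrier M" for y
    using right_moduleD(6)[OF M e e that] mult_rules(1)[OF e v v] by simp
  then show ?thesis unfolding cpt_def using right_moduleD(3)[OF M e] by (auto simp: image_iff) metis
qed

lemma cpt_subsp:
  assumes M: "right_module A M" and v: "v \<in> V"
  shows "subsp (cpt M (ee v)) (kspace A M)"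
proof -
  have e: "ee v \<in> carrier A" using v by blast
  have s: "scal c \<in> carrier A" for c by blast
  have "ee v \<odot>\<^bsub>M\<^esub> (scal c \<odot>\<^bsub>M\<^esub> x) = scal c \<odot>\<^bsub>M\<^esub> (ee v \<odot>\<^bsub>M\<^esub> x)" if "x \<in> carrier M" for c x
    using smult_scal[OF M e that] by simp
  then show ?thesis
    unfolding subsp_iff[OF kspace_vspace[OF M]] kspace_simps
    using right_module_group[OF M] smult_zero_right[OF M e] right_moduleD(5)[OF M e] right_moduleD(3)[OF M s]
    by (auto simp: cpt_iff[OF M v])
qed

lemma fdim_free: "fdim (kspace A (free_mod A n))"
proof -
  let ?B = "eb ` V \<union> ab ` E" and ?F = "free_mod A n"
  let ?I = "{..<n} \<times> ?B"
  have F: "right_module A ?F" by (rule free_mod_right_module[OF ring_A])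
  have fin: "finite ?I" using finX finY finE by simp
  let ?W = "fn_space ?I :: ('k, nat \<times> 'b \<Rightarrow> 'k) module"
  let ?T = "\<lambda>w. \<lambda>p\<in>?I. w (fst p) (snd p)"
  have m: "w i \<in> carrier A" if "w \<in> carrier ?F" "i < n" for w i
    using that by (auto simp: free_mod_simps)
  show ?thesis
  proof (rule kdim_bij'(1)[OF kspace_vspace[OF F] fn_space_dim(1)[OF fin]])
    show "?T \<in> module_hom class_ring (kspace A ?F) ?W"
      unfolding khom_iff kspace_simps
    proof (intro conjI ballI allI)
      fix u w c assume u: "u \<in> carrier ?F"
      show "?T u \<in> carrier ?W" by (simp add: fn_space_simps)
      show "?T (scal c \<odot>\<^bsub>?F\<^esub> u) = c \<odot>\<^bsub>?W\<^esub> ?T u"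
        using mult_rules(11)[OF m[OF u]] by (auto simp: fn_space_simps free_mod_simps smult_A fun_eq_iff)
      show "?T (u \<oplus>\<^bsub>?F\<^esub> w) = ?T u \<oplus>\<^bsub>?W\<^esub> ?T w"
        by (auto simp: fn_space_simps free_mod_simps add_A fun_eq_iff)
    qed
    show "bij_betw ?T (carrier (kspace A ?F)) (carrier ?W)"
      unfolding bij_betw_def kspace_simps
    proof (intro conjI inj_onI equalityI subsetI)
      fix u w assume u: "u \<in> carrier ?F" and w: "w \<in> carrier ?F" and eq: "?T u = ?T w"
      have "u i z = w i z" if "i < n" for i z
      proof (cases "z \<in> ?B")
        case True
        then have "?T u (i, z) = ?T w (i, z)" using eq by simp
        then show ?thesis using True that by simp
      next
        case False
        then show ?thesis using m[OF u that] m[OF w that] by (auto simp: carrier_A)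
      qed
      then show "u = w" using u w unfolding free_mod_simps by (intro PiE_ext) auto
    next
      fix g assume g: "g \<in> carrier ?W"
      let ?w = "\<lambda>i\<in>{..<n}. \<lambda>z. if z \<in> ?B then g (i, z) else 0"
      have "?w \<in> carrier ?F" by (auto simp: free_mod_simps carrier_A)
      moreover have "?T ?w = g" using g by (auto simp: fn_space_simps fun_eq_iff PiE_def extensional_def)
      ultimately show "g \<in> ?T ` carrier ?F" by (intro image_eqI[where x = ?w]) simp_all
    qed (auto simp: fn_space_simps split: if_splits)
  qed
qed

lemma fg_fdim:
  assumes "fg_mod A M"
  shows "fdim (kspace A M)"
proof -
  have M: "right_module A M" using assms by (rule fg_mod_right_module)
  obtain n f where f: "f \<in> module_hom A (free_mod A n) M" "f ` carrier (free_mod A n) = carrier M"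
    using assms unfolding fg_mod_def by blast
  show ?thesis
    by (rule rank_nullity_onto(1)[OF fdim_free kspace_vspace[OF M] hom_khom[OF f(1)]])
      (use f(2) in \<open>simp add: kspace_simps\<close>)
qed

lemma fdim_cpt:
  assumes "right_module A M" "fdim (kspace A M)" "v \<in> V"
  shows "fdim ((kspace A M)\<lparr>carrier := cpt M (ee v)\<rparr>)"
  by (rule fdim_subsp[OF assms(2) cpt_subsp[OF assms(1,3)]])

text \<open>Passing to the component at \<open>v\<close> is exact: a preimage of a vector of the
  component may be multiplied by \<open>ee v\<close> without changing its image. Rank-nullity then
  applies to the restricted surjection.\<close>

lemma kd_exact:
  assumes N: "right_module A N" and M: "right_module A M" and L: "right_module A L"
    and fd: "fdim (kspace A M)"
    and f: "f \<in> module_hom A N M" and inj: "inj_on f (carrier N)"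
    and p: "p \<in> module_hom A M L" and onto: "p ` carrier M = carrier L"
    and exact: "f ` carrier N = mod_kernel M L p" and v: "v \<in> V"
  shows "kd M v = kd N v + kd L v"
proof -
  let ?M = "(kspace A M)\<lparr>carrier := cpt M (ee v)\<rparr>" and ?L = "(kspace A L)\<lparr>carrier := cpt L (ee v)\<rparr>"
  let ?N = "(kspace A N)\<lparr>carrier := cpt N (ee v)\<rparr>"
  have e: "ee v \<in> carrier A" using v by blast
  have fM: "fdim ?M" by (rule fdim_cpt[OF M fd v])
  have vL: "vspace ?L" by (rule subsp_vspace[OF kspace_vspace[OF L] cpt_subsp[OF L v]])
  have vN: "vspace ?N" by (rule subsp_vspace[OF kspace_vspace[OF N] cpt_subsp[OF N v]])
  have pc: "p x \<in> cpt L (ee v)" if "x \<in> cpt M (ee v)" for x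
    using that homD(1)[OF p] homD(3)[OF p e] unfolding cpt_iff[OF M v] cpt_iff[OF L v] by metis
  have fc: "f x \<in> cpt M (ee v)" if "x \<in> cpt N (ee v)" for x
    using that homD(1)[OF f] homD(3)[OF f e] unfolding cpt_iff[OF M v] cpt_iff[OF N v] by metis
  have ph: "p \<in> module_hom class_ring ?M ?L"
    using hom_khom[OF p] pc unfolding khom_iff by (auto simp: kspace_simps cpt_iff[OF M v])
  have ponto: "p ` carrier ?M = carrier ?L"
  proof (intro equalityI subsetI)
    fix l assume "l \<in> carrier ?L"
    then have l: "l \<in> carrier L" "ee v \<odot>\<^bsub>L\<^esub> l = l" by (simp_all add: cpt_iff[OF L v])
    obtain x where x: "x \<in> carrier M" "l = p x" using l(1) onto by blast
    have "l = p (ee v \<odot>\<^bsub>M\<^esub> x)" using homD(3)[OF p e x(1)] x(2) l(2) by simp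
    then show "l \<in> p ` carrier ?M" using x(1) by (auto simp: cpt_def)
  qed (use pc in auto)
  have 1: "kdim ?M = kdim ?L + kdim (?M\<lparr>carrier := mod_kernel ?M ?L p\<rparr>)"
    by (rule rank_nullity_onto(2)[OF fM vL ph ponto])
  have ker: "mod_kernel ?M ?L p = f ` cpt N (ee v)"
  proof (intro equalityI subsetI)
    fix x assume "x \<in> mod_kernel ?M ?L p"
    then have x: "x \<in> carrier M" "ee v \<odot>\<^bsub>M\<^esub> x = x" "p x = \<zero>\<^bsub>L\<^esub>"
      by (auto simp: mod_kernel_def cpt_iff[OF M v] kspace_simps)
    then have "x \<in> f ` carrier N" unfolding exact by (simp add: mod_kernel_def)
    then obtain z where z: "z \<in> carrier N" "x = f z" by blast
    have "x = f (ee v \<odot>\<^bsub>N\<^esub> z)" using homD(3)[OF f e z(1)] x(2) z(2) by simp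
    then show "x \<in> f ` cpt N (ee v)" using z(1) by (auto simp: cpt_def)
  next
    fix x assume "x \<in> f ` cpt N (ee v)"
    then obtain z where z: "z \<in> cpt N (ee v)" "x = f z" by blast
    then have "x \<in> mod_kernel M L p" using exact by (auto simp: cpt_iff[OF N v])
    then show "x \<in> mod_kernel ?M ?L p" using fc[OF z(1)] z(2) by (simp add: mod_kernel_def kspace_simps)
  qed
  have ks: "subsp (mod_kernel ?M ?L p) ?M" by (rule kernel_subsp[OF fdim_vspace[OF fM] vL ph])
  have fk: "fdim (?M\<lparr>carrier := mod_kernel ?M ?L p\<rparr>)" by (rule fdim_subsp[OF fM ks])
  have "kdim ?N = kdim (?M\<lparr>carrier := mod_kernel ?M ?L p\<rparr>)"
  proof (rule kdim_bij'(2)[OF vN fk])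
    show "f \<in> module_hom class_ring ?N (?M\<lparr>carrier := mod_kernel ?M ?L p\<rparr>)"
      using hom_khom[OF f] unfolding ker khom_iff by (auto simp: kspace_simps cpt_iff[OF N v])
    have "inj_on f (cpt N (ee v))" using inj by (rule inj_on_subset) (auto simp: cpt_iff[OF N v])
    then show "bij_betw f (carrier ?N) (carrier (?M\<lparr>carrier := mod_kernel ?M ?L p\<rparr>))"
      unfolding ker bij_betw_def by simp
  qed
  then show ?thesis using 1 by simp
qed

lemma kd_iso:
  assumes M: "right_module A M" and N: "right_module A N" and fd: "fdim (kspace A M)"
    and f: "f \<in> module_hom A M N" and bij: "bij_betw f (carrier M) (carrier N)" and v: "v \<in> V"
  shows "kd M v = kd N v"
proof -
  let ?M = "(kspace A M)\<lparr>carrier := cpt M (ee v)\<rparr>" and ?N = "(kspace A N)\<lparr>carrier := cpt N (ee v)\<rparr>"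
  have e: "ee v \<in> carrier A" using v by blast
  have vN: "vspace ?N" by (rule subsp_vspace[OF kspace_vspace[OF N] cpt_subsp[OF N v]])
  show ?thesis
  proof (rule kdim_bij(2)[OF fdim_cpt[OF M fd v] vN])
    show "f \<in> module_hom class_ring ?M ?N"
      using hom_khom[OF f] homD(3)[OF f e] unfolding khom_iff
      by (auto simp: kspace_simps cpt_iff[OF M v] cpt_iff[OF N v]) metis
    have "inj_on f (cpt M (ee v))"
      using bij by (auto simp: bij_betw_def cpt_iff[OF M v] intro: inj_on_subset)
    moreover have "f ` cpt M (ee v) = cpt N (ee v)"
    proof (intro equalityI subsetI)
      fix y assume "y \<in> cpt N (ee v)"
      then obtain z where z: "z \<in> carrier N" "y = ee v \<odot>\<^bsub>N\<^esub> z" unfolding cpt_def by blast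
      obtain x where x: "x \<in> carrier M" "z = f x" using z(1) bij unfolding bij_betw_def by blast
      have "y = f (ee v \<odot>\<^bsub>M\<^esub> x)" using homD(3)[OF f e x(1)] x z by simp
      then show "y \<in> f ` cpt M (ee v)" using x(1) unfolding cpt_def by blast
    next
      fix y assume "y \<in> f ` cpt M (ee v)"
      then obtain x where x: "x \<in> carrier M" "y = f (ee v \<odot>\<^bsub>M\<^esub> x)" unfolding cpt_def by blast
      have "y = ee v \<odot>\<^bsub>N\<^esub> f x" using homD(3)[OF f e x(1)] x(2) by simp
      then show "y \<in> cpt N (ee v)" using homD(1)[OF f x(1)] unfolding cpt_def by blast
    qed
    ultimately show "bij_betw f (carrier ?M) (carrier ?N)" by (simp add: bij_betw_def)
  qed
qed

lemma kdual_simps: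
  "carrier (kdual A M) = carrier (vdual (kspace A M))"
  "\<zero>\<^bsub>kdual A M\<^esub> = (\<lambda>x \<in> carrier M. 0)"
  "\<phi> \<oplus>\<^bsub>kdual A M\<^esub> \<psi> = (\<lambda>x \<in> carrier M. \<phi> x + \<psi> x)"
  "a \<odot>\<^bsub>kdual A M\<^esub> \<phi> = (\<lambda>x \<in> carrier M. \<phi> (a \<odot>\<^bsub>M\<^esub> x))"
  by (simp_all add: kdual_def vdual_def kspace_def)

lemma kdual_mem:
  "\<phi> \<in> carrier (kdual A M) \<longleftrightarrow> \<phi> \<in> extensional (carrier M) \<and>
    (\<forall>x \<in> carrier M. \<forall>y \<in> carrier M. \<phi> (x \<oplus>\<^bsub>M\<^esub> y) = \<phi> x + \<phi> y) \<and>
    (\<forall>c. \<forall>x \<in> carrier M. \<phi> (scal c \<odot>\<^bsub>M\<^esub> x) = c * \<phi> x)"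
  by (simp add: kdual_simps(1) vdual_simps(1) kspace_simps)

lemma kdual_right_module:
  assumes M: "right_module A M"
  shows "right_module (opp A) (kdual A M)"
proof (rule right_moduleI)
  note cl = right_module_group(2)[OF M] right_moduleD(3)[OF M]
  have s: "scal c \<in> carrier A" for c by blast
  have sm: "a \<odot>\<^bsub>M\<^esub> (scal c \<odot>\<^bsub>M\<^esub> x) = scal c \<odot>\<^bsub>M\<^esub> (a \<odot>\<^bsub>M\<^esub> x)" if "a \<in> carrier A" "x \<in> carrier M" for a c x
    using smult_scal[OF M that] by simp
  show "ring (opp A)" by (rule opp_ring[OF ring_A])
  interpret D: vectorspace class_ring "vdual (kspace A M)" using vdual_vspace kspace_vspace[OF M] by blast
  show "abelian_group (kdual A M)"
  proof (rule abelian_groupI)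
    fix f assume f: "f \<in> carrier (kdual A M)"
    show "\<exists>g\<in>carrier (kdual A M). g \<oplus>\<^bsub>kdual A M\<^esub> f = \<zero>\<^bsub>kdual A M\<^esub>"
      by (rule bexI[of _ "\<lambda>x\<in>carrier M. - f x"]) (use f cl s in \<open>auto simp: kdual_simps(2,3) kdual_mem\<close>)
    show "\<zero>\<^bsub>kdual A M\<^esub> \<oplus>\<^bsub>kdual A M\<^esub> f = f"
      using f by (auto simp: kdual_simps(2,3) kdual_mem fun_eq_iff extensional_def)
  qed (use cl s in \<open>auto simp: kdual_simps(2,3) kdual_mem algebra_simps cong: restrict_cong\<close>)
  fix f assume f: "f \<in> carrier (kdual A M)"
  show "\<one>\<^bsub>opp A\<^esub> \<odot>\<^bsub>kdual A M\<^esub> f = f"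
    using f right_moduleD(7)[OF M] by (auto simp: kdual_simps(4) kdual_mem fun_eq_iff extensional_def)
  fix a assume "a \<in> carrier (opp A)"
  then have a: "a \<in> carrier A" by simp
  show "a \<odot>\<^bsub>kdual A M\<^esub> f \<in> carrier (kdual A M)"
    using f a cl s right_moduleD(5)[OF M a] sm[OF a] by (auto simp: kdual_simps(4) kdual_mem)
  show "a \<odot>\<^bsub>kdual A M\<^esub> (f \<oplus>\<^bsub>kdual A M\<^esub> g) = a \<odot>\<^bsub>kdual A M\<^esub> f \<oplus>\<^bsub>kdual A M\<^esub> a \<odot>\<^bsub>kdual A M\<^esub> g" for g
    using a cl by (auto simp: kdual_simps(3,4) cong: restrict_cong)
  fix b assume "b \<in> carrier (opp A)"
  then have b: "b \<in> carrier A" by simp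
  show "(a \<oplus>\<^bsub>opp A\<^esub> b) \<odot>\<^bsub>kdual A M\<^esub> f = a \<odot>\<^bsub>kdual A M\<^esub> f \<oplus>\<^bsub>kdual A M\<^esub> b \<odot>\<^bsub>kdual A M\<^esub> f"
    using f a b cl right_moduleD(4)[OF M a b] by (auto simp: kdual_simps(3,4) kdual_mem cong: restrict_cong)
  show "(a \<otimes>\<^bsub>opp A\<^esub> b) \<odot>\<^bsub>kdual A M\<^esub> f = b \<odot>\<^bsub>kdual A M\<^esub> (a \<odot>\<^bsub>kdual A M\<^esub> f)"
    using a b cl right_moduleD(6)[OF M b a] by (auto simp: kdual_simps(4) cong: restrict_cong)
qed

end

lemma fdim_inj:
  assumes V: "vspace V" and W: "fdim W" and T: "T \<in> module_hom class_ring V W"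
    and inj: "inj_on T (carrier V)"
  shows "fdim V"
proof -
  have "subsp (T ` carrier V) W" by (rule image_subsp[OF V fdim_vspace[OF W] T])
  then have f: "fdim (W\<lparr>carrier := T ` carrier V\<rparr>)" by (rule fdim_subsp[OF W])
  show ?thesis
    by (rule kdim_bij'(1)[OF V f, of T]) (use T inj in \<open>auto simp: khom_iff bij_betw_def\<close>)
qed

context bip
begin

abbreviation cs :: "('b \<Rightarrow> 'k, 'm) module \<Rightarrow> 'v \<Rightarrow> ('k, 'm) module" where
  "cs M v \<equiv> (kspace A M)\<lparr>carrier := cpt M (ee v)\<rparr>"

lemma cs_simps:
  "carrier (cs M v) = cpt M (ee v)" "\<zero>\<^bsub>cs M v\<^esub> = \<zero>\<^bsub>M\<^esub>" "add (cs M v) = add M"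
  "c \<odot>\<^bsub>cs M v\<^esub> x = scal c \<odot>\<^bsub>M\<^esub> x"
  by (simp_all add: kspace_simps)

lemma cs_vspace: "right_module A M \<Longrightarrow> v \<in> V \<Longrightarrow> vspace (cs M v)"
  by (rule subsp_vspace[OF kspace_vspace cpt_subsp])

lemma cs_dualD:
  assumes "\<psi> \<in> carrier (vdual (cs M v))"
  shows "p \<in> cpt M (ee v) \<Longrightarrow> q \<in> cpt M (ee v) \<Longrightarrow> \<psi> (p \<oplus>\<^bsub>M\<^esub> q) = \<psi> p + \<psi> q"
    "p \<in> cpt M (ee v) \<Longrightarrow> \<psi> (scal c \<odot>\<^bsub>M\<^esub> p) = c * \<psi> p"
  using assms unfolding vdual_simps(1) cs_simps by blast+

lemma cpt_closed:
  assumes M: "right_module A M" and v: "v \<in> V"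
  shows "x \<in> carrier M \<Longrightarrow> ee v \<odot>\<^bsub>M\<^esub> x \<in> cpt M (ee v)" "\<zero>\<^bsub>M\<^esub> \<in> cpt M (ee v)"
    "x \<in> cpt M (ee v) \<Longrightarrow> y \<in> cpt M (ee v) \<Longrightarrow> x \<oplus>\<^bsub>M\<^esub> y \<in> cpt M (ee v)"
    "x \<in> cpt M (ee v) \<Longrightarrow> scal c \<odot>\<^bsub>M\<^esub> x \<in> cpt M (ee v)"
    "x \<in> cpt M (ee v) \<Longrightarrow> x \<in> carrier M" "x \<in> cpt M (ee v) \<Longrightarrow> ee v \<odot>\<^bsub>M\<^esub> x = x"
proof -
  note c = cpt_subsp[OF M v, unfolded subsp_iff[OF kspace_vspace[OF M]] kspace_simps]
  show "x \<in> carrier M \<Longrightarrow> ee v \<odot>\<^bsub>M\<^esub> x \<in> cpt M (ee v)" unfolding cpt_def by blast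
  show "\<zero>\<^bsub>M\<^esub> \<in> cpt M (ee v)" "x \<in> cpt M (ee v) \<Longrightarrow> y \<in> cpt M (ee v) \<Longrightarrow> x \<oplus>\<^bsub>M\<^esub> y \<in> cpt M (ee v)"
    "x \<in> cpt M (ee v) \<Longrightarrow> scal c \<odot>\<^bsub>M\<^esub> x \<in> cpt M (ee v)" using c by blast+
  show "x \<in> cpt M (ee v) \<Longrightarrow> x \<in> carrier M" "x \<in> cpt M (ee v) \<Longrightarrow> ee v \<odot>\<^bsub>M\<^esub> x = x"
    unfolding cpt_iff[OF M v] by blast+
qed

lemma arrow_cpt:
  assumes M: "right_module A M" and e: "(x, y) \<in> E" and p: "p \<in> carrier M"
  shows "aa (x, y) \<odot>\<^bsub>M\<^esub> p \<in> cpt M (ee y)" "aa (x, y) \<odot>\<^bsub>M\<^esub> (ee x \<odot>\<^bsub>M\<^esub> p) = aa (x, y) \<odot>\<^bsub>M\<^esub> p"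
    "ee y \<odot>\<^bsub>M\<^esub> (aa (x, y) \<odot>\<^bsub>M\<^esub> p) = aa (x, y) \<odot>\<^bsub>M\<^esub> p"
    "v \<in> V \<Longrightarrow> v \<noteq> y \<Longrightarrow> ee v \<odot>\<^bsub>M\<^esub> (aa (x, y) \<odot>\<^bsub>M\<^esub> p) = \<zero>\<^bsub>M\<^esub>"
proof -
  have V: "x \<in> V" "y \<in> V" using E_V(1,2) e by auto
  have c: "aa (x, y) \<in> carrier A" "ee x \<in> carrier A" "ee y \<in> carrier A" using A_closed e V by auto
  show 1: "ee y \<odot>\<^bsub>M\<^esub> (aa (x, y) \<odot>\<^bsub>M\<^esub> p) = aa (x, y) \<odot>\<^bsub>M\<^esub> p"
    using right_moduleD(6)[OF M c(1,3) p] mult_rules(7)[OF c(1) e V(2)] by simp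
  show "aa (x, y) \<odot>\<^bsub>M\<^esub> p \<in> cpt M (ee y)"
    unfolding cpt_iff[OF M V(2)] using 1 right_moduleD(3)[OF M c(1) p] by simp
  show "aa (x, y) \<odot>\<^bsub>M\<^esub> (ee x \<odot>\<^bsub>M\<^esub> p) = aa (x, y) \<odot>\<^bsub>M\<^esub> p"
    using right_moduleD(6)[OF M c(2,1) p] mult_rules(6)[OF c(1) e V(1)] by simp
  show "ee v \<odot>\<^bsub>M\<^esub> (aa (x, y) \<odot>\<^bsub>M\<^esub> p) = \<zero>\<^bsub>M\<^esub>" if "v \<in> V" "v \<noteq> y"
    using right_moduleD(6)[OF M c(1) A_closed(5)[OF that(1)] p] mult_rules(7)[OF c(1) e that(1)] that(2)
      smult_zero_left[OF M p] by simp
qed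

section \<open>The dimension vector of Hom(P, A) for a projective P\<close>

lemma adualD:
  assumes "f \<in> carrier (adual A P)"
  shows "p \<in> carrier P \<Longrightarrow> f p \<in> carrier A"
    "p \<in> carrier P \<Longrightarrow> q \<in> carrier P \<Longrightarrow> f (p \<oplus>\<^bsub>P\<^esub> q) = f p \<oplus>\<^bsub>A\<^esub> f q"
    "a \<in> carrier A \<Longrightarrow> p \<in> carrier P \<Longrightarrow> f (a \<odot>\<^bsub>P\<^esub> p) = f p \<otimes>\<^bsub>A\<^esub> a"
  using assms unfolding adual_simps(1) by blast+

lemma adualI:
  assumes P: "right_module A P" and cl: "\<And>p. p \<in> carrier P \<Longrightarrow> f p \<in> carrier A"
    and add: "\<And>p q. p \<in> carrier P \<Longrightarrow> q \<in> carrier P \<Longrightarrow> f (p \<oplus>\<^bsub>P\<^esub> q) = f p \<oplus>\<^bsub>A\<^esub> f q"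
    and sc: "\<And>c p. p \<in> carrier P \<Longrightarrow> f (scal c \<odot>\<^bsub>P\<^esub> p) = c \<odot>\<^bsub>A\<^esub> f p"
    and ee: "\<And>v p. v \<in> V \<Longrightarrow> p \<in> carrier P \<Longrightarrow> f (ee v \<odot>\<^bsub>P\<^esub> p) = f p \<otimes>\<^bsub>A\<^esub> ee v"
    and aa: "\<And>x y p. (x, y) \<in> E \<Longrightarrow> p \<in> carrier P \<Longrightarrow> f (aa (x, y) \<odot>\<^bsub>P\<^esub> p) = f p \<otimes>\<^bsub>A\<^esub> aa (x, y)"
  shows "restrict f (carrier P) \<in> carrier (adual A P)"
proof -
  have "f \<in> module_hom A P (regular_mod A)"
    by (rule homI[OF P regular_right_module[OF ring_A]])
      (use cl add sc ee aa mult_rules(11) in \<open>auto simp: regular_mod_simps\<close>)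
  then show ?thesis
    using right_module_group(2)[OF P] right_moduleD(3)[OF P]
    unfolding hom_iff adual_simps(1) by (simp add: regular_mod_simps)
qed

text \<open>Projectivity enters the dimension count only through the following extension property.\<close>

lemma projective_extend:
  assumes P: "fg_projective A P" and x: "x \<in> X" and \<psi>: "\<psi> \<in> carrier (vdual (cs P x))"
  shows "\<exists>f\<in>carrier (adual A P). \<forall>p\<in>carrier P. ee x \<otimes>\<^bsub>A\<^esub> f p = f p \<and> f p (eb x) = \<psi> (ee x \<odot>\<^bsub>P\<^esub> p)"
proof -
  obtain n s r where PM: "right_module A P" and s: "s \<in> module_hom A P (free_mod A n)"
    and r: "r \<in> module_hom A (free_mod A n) P" and rs: "\<And>p. p \<in> carrier P \<Longrightarrow> r (s p) = p"
    using fg_projectiveE[OF P] by metis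
  let ?F = "free_mod A n" and ?R = "regular_mod A"
  interpret A: ring A by (rule ring_A)
  have xV: "x \<in> V" using x by simp
  have e: "ee x \<in> carrier A" using A_closed xV by blast
  have F: "right_module A ?F" by (rule free_mod_right_module[OF ring_A])
  have R: "right_module A ?R" by (rule regular_right_module[OF ring_A])
  define u where "u i = single A n i \<one>\<^bsub>A\<^esub>" for i
  have u: "u i \<in> carrier ?F" for i unfolding u_def by (rule single_closed[OF ring_A]) simp
  \<comment> \<open>The constant is forced: \<open>c i\<close> will be the coefficient at
    \<open>eb x\<close> of the image of the \<open>i\<close>-th unit vector, and this has to be
    \<open>\<psi>\<close> of the component of \<open>r (u i)\<close> at \<open>x\<close>.\<close>
  define c where "c i = \<psi> (ee x \<odot>\<^bsub>P\<^esub> r (u i))" for i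
  obtain \<Phi> where \<Phi>: "\<Phi> \<in> module_hom A ?F ?R"
    and \<Phi>s: "\<And>i a. i < n \<Longrightarrow> a \<in> carrier A \<Longrightarrow> \<Phi> (single A n i a) = a \<odot>\<^bsub>?R\<^esub> (c i \<odot>\<^bsub>A\<^esub> ee x)"
    using free_lift[OF R, of n "\<lambda>i. c i \<odot>\<^bsub>A\<^esub> ee x"] A_closed(4)[OF e] by (auto simp: regular_mod_simps)
  have \<Phi>c: "\<Phi> w \<in> carrier A" if "w \<in> carrier ?F" for w
    using homD(1)[OF \<Phi> that] by (simp add: regular_mod_simps)
  have cp: "ee x \<odot>\<^bsub>P\<^esub> r w \<in> cpt P (ee x)" if "w \<in> carrier ?F" for w
    by (rule cpt_closed(1)[OF PM xV homD(1)[OF r that]])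
  \<comment> \<open>This uses that \<open>x\<close> is a source. No arrow ends there, so
    \<open>a\<close> times \<open>ee x\<close> is just the multiple \<open>a (eb x)\<close> of
    \<open>ee x\<close>, and \<open>\<psi>\<close> is homogeneous for this factor.\<close>
  have key: "\<Phi> w (eb x) = \<psi> (ee x \<odot>\<^bsub>P\<^esub> r w)" if "w \<in> carrier ?F" for w
  proof (rule free_induct[OF ring_A that])
    have "\<psi> (scal 0 \<odot>\<^bsub>P\<^esub> \<zero>\<^bsub>P\<^esub>) = 0" using cs_dualD(2)[OF \<psi> cpt_closed(2)[OF PM xV], of 0] by simp
    then have "\<psi> \<zero>\<^bsub>P\<^esub> = 0" using smult_zero_right[OF PM A_closed(4)[OF A_closed(2)], of 0] by simp
    then show "\<Phi> \<zero>\<^bsub>?F\<^esub> (eb x) = \<psi> (ee x \<odot>\<^bsub>P\<^esub> r \<zero>\<^bsub>?F\<^esub>)"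
      using hom_zero[OF F R \<Phi>] hom_zero[OF F PM r] smult_zero_right[OF PM e]
      by (simp add: regular_mod_simps ev)
    fix i a assume i: "i < n" and a: "a \<in> carrier A"
    have "single A n i a = a \<odot>\<^bsub>?F\<^esub> u i"
      using smult_single[OF ring_A A.one_closed a] a unfolding u_def by simp
    then have "ee x \<odot>\<^bsub>P\<^esub> r (single A n i a) = (a \<otimes>\<^bsub>A\<^esub> ee x) \<odot>\<^bsub>P\<^esub> r (u i)"
      using homD(3)[OF r a u] right_moduleD(6)[OF PM a e homD(1)[OF r u]] by simp
    also have "\<dots> = scal (a (eb x)) \<odot>\<^bsub>P\<^esub> (ee x \<odot>\<^bsub>P\<^esub> r (u i))"
      unfolding mult_rules(2)[OF a x] by (rule smult_scal(1)[OF PM e homD(1)[OF r u]])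
    finally have "\<psi> (ee x \<odot>\<^bsub>P\<^esub> r (single A n i a)) = a (eb x) * c i"
      using cs_dualD(2)[OF \<psi> cp[OF u]] unfolding c_def by simp
    moreover have "\<Phi> (single A n i a) (eb x) = c i * a (eb x)"
      using \<Phi>s[OF i a] mult_eb[OF A_closed(4)[OF e] a xV] xV by (simp add: regular_mod_simps ev)
    ultimately show "\<Phi> (single A n i a) (eb x) = \<psi> (ee x \<odot>\<^bsub>P\<^esub> r (single A n i a))" by simp
  next
    fix v w assume vw: "v \<in> carrier ?F" "w \<in> carrier ?F"
      and IH: "\<Phi> v (eb x) = \<psi> (ee x \<odot>\<^bsub>P\<^esub> r v)" "\<Phi> w (eb x) = \<psi> (ee x \<odot>\<^bsub>P\<^esub> r w)"
    have "ee x \<odot>\<^bsub>P\<^esub> r (v \<oplus>\<^bsub>?F\<^esub> w) = ee x \<odot>\<^bsub>P\<^esub> r v \<oplus>\<^bsub>P\<^esub> ee x \<odot>\<^bsub>P\<^esub> r w"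
      using homD(2)[OF r vw] right_moduleD(5)[OF PM e homD(1)[OF r vw(1)] homD(1)[OF r vw(2)]] by simp
    then show "\<Phi> (v \<oplus>\<^bsub>?F\<^esub> w) (eb x) = \<psi> (ee x \<odot>\<^bsub>P\<^esub> r (v \<oplus>\<^bsub>?F\<^esub> w))"
      using homD(2)[OF \<Phi> vw] cs_dualD(1)[OF \<psi> cp[OF vw(1)] cp[OF vw(2)]] IH
      by (simp add: regular_mod_simps ev)
  qed
  have sc: "s p \<in> carrier ?F" if "p \<in> carrier P" for p by (rule homD(1)[OF s that])
  \<comment> \<open>Left multiplication by \<open>ee x\<close> puts the values into e_x A and leaves
    the coefficient at \<open>eb x\<close> unchanged.\<close>
  let ?f = "\<lambda>p\<in>carrier P. ee x \<otimes>\<^bsub>A\<^esub> \<Phi> (s p)"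
  have "?f \<in> carrier (adual A P)"
    unfolding adual_simps(1)
    using right_module_group(2)[OF PM] right_moduleD(3)[OF PM] homD(2,3)[OF s] homD(2,3)[OF \<Phi>] sc \<Phi>c e
    by (auto simp: regular_mod_simps A.r_distr A.m_assoc)
  moreover have "ee x \<otimes>\<^bsub>A\<^esub> ?f p = ?f p \<and> ?f p (eb x) = \<psi> (ee x \<odot>\<^bsub>P\<^esub> p)" if p: "p \<in> carrier P" for p
    using p key[OF sc[OF p]] rs[OF p] mult_eb[OF e \<Phi>c[OF sc[OF p]] xV] mult_rules(1)[OF e xV xV]
      A.m_assoc[OF e e \<Phi>c[OF sc[OF p]]] xV by (simp add: ev)
  ultimately show ?thesis by blast
qed

text \<open>The dual of the cokernel of the arrow maps from the components at \<open>F\<close> to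
  the component at the sink \<open>y\<close>. When \<open>F\<close> consists of all sources with an
  arrow to \<open>y\<close>, it is Hom(P, e_y A), because e_y A is one-dimensional.\<close>

definition Ann :: "('b \<Rightarrow> 'k, 'm) module \<Rightarrow> 'v \<Rightarrow> 'v set \<Rightarrow> ('m \<Rightarrow> 'k) set" where
  "Ann P y F = {\<phi> \<in> carrier (vdual (cs P y)). \<forall>x\<in>F. \<forall>p\<in>carrier P. \<phi> (aa (x, y) \<odot>\<^bsub>P\<^esub> p) = 0}"

text \<open>For projective \<open>P\<close> the arrow maps into the component at \<open>y\<close>
  are jointly injective. Dually, each further source \<open>x\<close> imposes independent
  conditions, as many as the dimension of the component at \<open>x\<close>; hence induction over
  \<open>F\<close>.\<close>

lemma kdim_Ann:
  assumes P: "fg_projective A P" and y: "y \<in> Y" and F: "F \<subseteq> {x. (x, y) \<in> E}"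
  shows "fdim ((vdual (cs P y))\<lparr>carrier := Ann P y F\<rparr>) \<and>
    kdim ((vdual (cs P y))\<lparr>carrier := Ann P y F\<rparr>) + (\<Sum>x\<in>F. kd P x) = kd P y"
proof -
  have PM: "right_module A P" by (rule fg_projective_right_module[OF P])
  have fP: "fdim (kspace A P)" by (rule fg_fdim[OF fg_projective_fg[OF P]])
  have yV: "y \<in> V" using y by simp
  let ?D = "vdual (cs P y)"
  have D: "fdim ?D" "kdim ?D = kd P y"
    using kdim_vdual[OF fdim_cpt[OF PM fP yV]] by auto
  have "F \<subseteq> X" using F E_V by blast
  then have "finite F" using finite_subset finX by blast
  then show ?thesis
    using F
  proof (induction F rule: finite_induct)
    case empty
    have "?D\<lparr>carrier := Ann P y {}\<rparr> = ?D" unfolding Ann_def by simp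
    then show ?case using D by simp
  next
    case (insert x F)
    have e: "(x, y) \<in> E" and xX: "x \<in> X" and xV: "x \<in> V" using insert.prems E_V by auto
    have aac: "aa (x', y) \<odot>\<^bsub>P\<^esub> p \<in> cpt P (ee y)" if "x' \<in> insert x F" "p \<in> carrier P" for x' p
      using arrow_cpt(1)[OF PM _ that(2)] insert.prems that(1) by blast
    let ?A = "?D\<lparr>carrier := Ann P y F\<rparr>" and ?W = "vdual (cs P x)"
    let ?T = "\<lambda>\<phi>. \<lambda>p\<in>cpt P (ee x). \<phi> (aa (x, y) \<odot>\<^bsub>P\<^esub> p)"
    have IH: "fdim ?A" "kdim ?A + (\<Sum>x\<in>F. kd P x) = kd P y" using insert by auto
    have W: "fdim ?W" "kdim ?W = kd P x"
      using kdim_vdual[OF fdim_cpt[OF PM fP xV]] by auto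
    have a: "aa (x, y) \<in> carrier A" using A_closed e by blast
    have aadd: "aa (x, y) \<odot>\<^bsub>P\<^esub> (p \<oplus>\<^bsub>P\<^esub> q) = aa (x, y) \<odot>\<^bsub>P\<^esub> p \<oplus>\<^bsub>P\<^esub> aa (x, y) \<odot>\<^bsub>P\<^esub> q"
      if "p \<in> carrier P" "q \<in> carrier P" for p q by (rule right_moduleD(5)[OF PM a that])
    have asc: "aa (x, y) \<odot>\<^bsub>P\<^esub> (scal c \<odot>\<^bsub>P\<^esub> p) = scal c \<odot>\<^bsub>P\<^esub> (aa (x, y) \<odot>\<^bsub>P\<^esub> p)"
      if "p \<in> carrier P" for c p using smult_scal[OF PM a that] by simp
    have sub: "cpt P (ee x) \<subseteq> carrier P" using cpt_closed(5)[OF PM xV] by blast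
    have Th: "?T \<in> module_hom class_ring ?A ?W"
      unfolding khom_iff
    proof (intro conjI ballI allI)
      fix \<phi> assume p: "\<phi> \<in> carrier ?A"
      then have \<phi>: "\<phi> \<in> carrier ?D" unfolding Ann_def by simp
      show "?T \<phi> \<in> carrier ?W"
        unfolding vdual_simps(1) cs_simps
      proof (intro conjI ballI allI)
        fix p q c assume p: "p \<in> cpt P (ee x)"
        have pP: "p \<in> carrier P" using p sub by blast
        show "?T \<phi> (scal c \<odot>\<^bsub>P\<^esub> p) = c * ?T \<phi> p"
          using p cpt_closed(4)[OF PM xV p] asc[OF pP] cs_dualD(2)[OF \<phi> aac[OF insertI1 pP]] by simp
        assume q: "q \<in> cpt P (ee x)"
        have qP: "q \<in> carrier P" using q sub by blast
        show "?T \<phi> (p \<oplus>\<^bsub>P\<^esub> q) = ?T \<phi> p + ?T \<phi> q"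
          using p q cpt_closed(3)[OF PM xV p q] aadd[OF pP qP]
            cs_dualD(1)[OF \<phi> aac[OF insertI1 pP] aac[OF insertI1 qP]] by simp
      qed simp
      show "?T (\<phi> \<oplus>\<^bsub>?A\<^esub> \<psi>) = ?T \<phi> \<oplus>\<^bsub>?W\<^esub> ?T \<psi>" for \<psi>
        using aac[OF insertI1] sub by (auto simp: vdual_simps cs_simps fun_eq_iff)
      show "?T (c \<odot>\<^bsub>?A\<^esub> \<phi>) = c \<odot>\<^bsub>?W\<^esub> ?T \<phi>" for c
        using aac[OF insertI1] sub by (auto simp: vdual_simps cs_simps fun_eq_iff)
    qed
    have onto: "?T ` carrier ?A = carrier ?W"
    proof (intro equalityI subsetI)
      fix \<psi> assume \<psi>: "\<psi> \<in> carrier ?W"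
      \<comment> \<open>The extension \<open>f\<close> of \<open>\<psi>\<close> takes values in e_x
        A. Its coefficient at the arrow from \<open>x\<close> to \<open>y\<close> is a functional on
        the component at \<open>y\<close> that restricts to \<open>\<psi>\<close> along this arrow
        and vanishes along the arrows from \<open>F\<close>.\<close>
      obtain f where f: "f \<in> carrier (adual A P)"
        and fx: "\<And>p. p \<in> carrier P \<Longrightarrow> ee x \<otimes>\<^bsub>A\<^esub> f p = f p \<and> f p (eb x) = \<psi> (ee x \<odot>\<^bsub>P\<^esub> p)"
        using projective_extend[OF P xX \<psi>] by blast
      let ?\<phi> = "\<lambda>p\<in>cpt P (ee y). f p (ab (x, y))"
      have fa: "f (aa (x', y) \<odot>\<^bsub>P\<^esub> p) (ab (x, y)) = (if x' = x then \<psi> (ee x \<odot>\<^bsub>P\<^esub> p) else 0)"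
        if "x' \<in> insert x F" "p \<in> carrier P" for x' p
      proof -
        have e': "(x', y) \<in> E" using insert.prems that by auto
        have "f (aa (x', y) \<odot>\<^bsub>P\<^esub> p) = f p (eb x') \<odot>\<^bsub>A\<^esub> aa (x', y)"
          using adualD(3)[OF f A_closed(6)[OF e'] that(2)] mult_rules(5)[OF adualD(1)[OF f that(2)] e'] by simp
        then show ?thesis using fx[OF that(2)] e e' by (auto simp: ev)
      qed
      have cy: "cpt P (ee y) \<subseteq> carrier P" using cpt_closed(5)[OF PM yV] by blast
      have "?\<phi> \<in> carrier ?D"
        unfolding vdual_simps(1) cs_simps
      proof (intro conjI ballI allI)
        fix p q c assume p: "p \<in> cpt P (ee y)"
        have pP: "p \<in> carrier P" using p cy by blast
        have "f (scal c \<odot>\<^bsub>P\<^esub> p) = c \<odot>\<^bsub>A\<^esub> f p"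
          using adualD(3)[OF f A_closed(4)[OF A_closed(2)] pP] mult_rules(11)[OF adualD(1)[OF f pP]] by simp
        then show "?\<phi> (scal c \<odot>\<^bsub>P\<^esub> p) = c * ?\<phi> p"
          using p cpt_closed(4)[OF PM yV p] by (simp add: ev)
        assume q: "q \<in> cpt P (ee y)"
        have qP: "q \<in> carrier P" using q cy by blast
        show "?\<phi> (p \<oplus>\<^bsub>P\<^esub> q) = ?\<phi> p + ?\<phi> q"
          using p q cpt_closed(3)[OF PM yV p q] adualD(2)[OF f pP qP] by (simp add: ev)
      qed simp
      then have "?\<phi> \<in> carrier ?A"
        unfolding Ann_def using fa aac insert.hyps by auto
      moreover have "?T ?\<phi> = \<psi>"
      proof (rule vdual_eqI[of _ "cs P x"])
        show "?T ?\<phi> \<in> carrier ?W" using Th calculation unfolding khom_iff by blast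
        fix p assume "p \<in> carrier (cs P x)"
        then have p: "p \<in> cpt P (ee x)" by simp
        then have pP: "p \<in> carrier P" using sub by blast
        show "?T ?\<phi> p = \<psi> p" using p fa[OF insertI1 pP] aac[OF insertI1 pP] cpt_closed(6)[OF PM xV p] by simp
      qed (rule \<psi>)
      ultimately show "\<psi> \<in> ?T ` carrier ?A" by (intro image_eqI[where x = ?\<phi>]) simp_all
    next
      fix \<psi> assume "\<psi> \<in> ?T ` carrier ?A"
      then show "\<psi> \<in> carrier ?W" using Th unfolding khom_iff by blast
    qed
    have ker: "mod_kernel ?A ?W ?T = Ann P y (insert x F)"
    proof (intro equalityI subsetI)
      fix \<phi> assume "\<phi> \<in> mod_kernel ?A ?W ?T"
      then have \<phi>: "\<phi> \<in> Ann P y F" and z: "?T \<phi> = (\<lambda>p\<in>cpt P (ee x). 0)"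
        by (auto simp: mod_kernel_def vdual_simps cs_simps)
      have "\<phi> (aa (x, y) \<odot>\<^bsub>P\<^esub> p) = 0" if p: "p \<in> carrier P" for p
        using fun_cong[OF z, of "ee x \<odot>\<^bsub>P\<^esub> p"] cpt_closed(1)[OF PM xV p] arrow_cpt(2)[OF PM e p] by simp
      then show "\<phi> \<in> Ann P y (insert x F)" using \<phi> unfolding Ann_def by auto
    next
      fix \<phi> assume "\<phi> \<in> Ann P y (insert x F)"
      then show "\<phi> \<in> mod_kernel ?A ?W ?T"
        using sub by (auto simp: mod_kernel_def Ann_def vdual_simps cs_simps fun_eq_iff)
    qed
    have "?A\<lparr>carrier := mod_kernel ?A ?W ?T\<rparr> = ?D\<lparr>carrier := Ann P y (insert x F)\<rparr>" unfolding ker by simp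
    moreover have "fdim (?A\<lparr>carrier := mod_kernel ?A ?W ?T\<rparr>)"
      by (rule fdim_subsp[OF IH(1) kernel_subsp[OF fdim_vspace[OF IH(1)] fdim_vspace[OF W(1)] Th]])
    moreover have "kdim ?A = kd P x + kdim (?A\<lparr>carrier := mod_kernel ?A ?W ?T\<rparr>)"
      using rank_nullity_onto(2)[OF IH(1) fdim_vspace[OF W(1)] Th onto] W(2) by simp
    ultimately show ?case using IH(2) insert.hyps by simp
  qed
qed

lemma dual_zero:
  assumes M: "right_module A M" and v: "v \<in> V" and \<psi>: "\<psi> \<in> carrier (vdual (cs M v))"
  shows "\<psi> \<zero>\<^bsub>M\<^esub> = 0"
proof -
  have "\<psi> (scal 0 \<odot>\<^bsub>M\<^esub> \<zero>\<^bsub>M\<^esub>) = 0" using cs_dualD(2)[OF \<psi> cpt_closed(2)[OF M v], of 0] by simp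
  then show ?thesis using smult_zero_right[OF M A_closed(4)[OF A_closed(2)], of 0] by simp
qed

text \<open>The component of the dual at \<open>v\<close> consists of the functionals that factor
  through multiplication by \<open>ee v\<close>, so it is the dual of the component of
  \<open>M\<close> at \<open>v\<close>.\<close>

lemma kd_kdual:
  assumes M: "right_module A M" and fM: "fdim (kspace A M)" and v: "v \<in> V"
  shows "kd (kdual A M) v = kd M v"
proof -
  interpret op: bip "opp A" Y X "E\<inverse>" eb "\<lambda>e. ab (prod.swap e)" by (rule bip_opp)
  let ?D = "kdual A M"
  have D: "right_module (opp A) ?D" by (rule kdual_right_module[OF M])
  have v': "v \<in> Y \<union> X" using v by blast
  have W: "fdim (vdual (cs M v))" "kdim (vdual (cs M v)) = kd M v"
    using kdim_vdual[OF fdim_cpt[OF M fM v]] by auto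
  have vs: "vspace (cs ?D v)" using op.cs_vspace[OF D v'] by simp
  have e: "ee v \<in> carrier A" using v by blast
  have sub: "cpt M (ee v) \<subseteq> carrier M" using cpt_closed(5)[OF M v] by blast
  have mem: "\<phi> \<in> cpt ?D (ee v) \<longleftrightarrow> \<phi> \<in> carrier ?D \<and> (\<forall>x\<in>carrier M. \<phi> (ee v \<odot>\<^bsub>M\<^esub> x) = \<phi> x)" for \<phi>
  proof -
    have "(\<lambda>x\<in>carrier M. \<phi> (ee v \<odot>\<^bsub>M\<^esub> x)) = \<phi> \<longleftrightarrow> (\<forall>x\<in>carrier M. \<phi> (ee v \<odot>\<^bsub>M\<^esub> x) = \<phi> x)"
      if "\<phi> \<in> carrier ?D"
      using that unfolding kdual_mem by (auto simp: fun_eq_iff extensional_def)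
    then show ?thesis unfolding op.cpt_iff[OF D v'] kdual_simps(4) by blast
  qed
  let ?T = "\<lambda>\<phi>. restrict \<phi> (cpt M (ee v))"
  have T: "?T \<in> module_hom class_ring (cs ?D v) (vdual (cs M v))"
    unfolding khom_iff
  proof (intro conjI ballI allI)
    fix \<phi> assume "\<phi> \<in> carrier (cs ?D v)"
    then have \<phi>: "\<phi> \<in> carrier ?D" using mem by simp
    show "?T \<phi> \<in> carrier (vdual (cs M v))"
      using \<phi> cpt_closed(3-5)[OF M v] unfolding vdual_simps(1) cs_simps kdual_mem by auto
    show "?T (c \<odot>\<^bsub>cs ?D v\<^esub> \<phi>) = c \<odot>\<^bsub>vdual (cs M v)\<^esub> ?T \<phi>" for c
      using \<phi> sub unfolding kdual_mem by (auto simp: vdual_simps cs_simps kdual_simps kspace_simps fun_eq_iff)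
    show "?T (\<phi> \<oplus>\<^bsub>cs ?D v\<^esub> \<psi>) = ?T \<phi> \<oplus>\<^bsub>vdual (cs M v)\<^esub> ?T \<psi>" for \<psi>
      using sub by (auto simp: vdual_simps cs_simps kdual_simps kspace_simps fun_eq_iff)
  qed
  have bT: "bij_betw ?T (carrier (cs ?D v)) (carrier (vdual (cs M v)))"
    unfolding bij_betw_def
  proof (intro conjI inj_onI equalityI subsetI)
    fix \<phi> \<psi> assume p: "\<phi> \<in> carrier (cs ?D v)" "\<psi> \<in> carrier (cs ?D v)" and eq: "?T \<phi> = ?T \<psi>"
    have "\<phi> x = \<psi> x" if x: "x \<in> carrier M" for x
    proof -
      have "\<phi> (ee v \<odot>\<^bsub>M\<^esub> x) = \<psi> (ee v \<odot>\<^bsub>M\<^esub> x)"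
        using fun_cong[OF eq, of "ee v \<odot>\<^bsub>M\<^esub> x"] cpt_closed(1)[OF M v x] by simp
      then show ?thesis using p mem x by simp
    qed
    then show "\<phi> = \<psi>" using p mem unfolding kdual_mem
      by (intro extensionalityI[of \<phi> "carrier M" \<psi>]) auto
  next
    fix \<psi> assume \<psi>: "\<psi> \<in> carrier (vdual (cs M v))"
    let ?\<phi> = "\<lambda>x\<in>carrier M. \<psi> (ee v \<odot>\<^bsub>M\<^esub> x)"
    have "?\<phi> \<in> carrier ?D"
      unfolding kdual_mem
    proof (intro conjI ballI allI)
      fix x y c assume x: "x \<in> carrier M"
      have s: "scal c \<in> carrier A" by blast
      have "ee v \<odot>\<^bsub>M\<^esub> (scal c \<odot>\<^bsub>M\<^esub> x) = scal c \<odot>\<^bsub>M\<^esub> (ee v \<odot>\<^bsub>M\<^esub> x)"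
        using smult_scal[OF M e x] by simp
      then show "?\<phi> (scal c \<odot>\<^bsub>M\<^esub> x) = c * ?\<phi> x"
        using cs_dualD(2)[OF \<psi> cpt_closed(1)[OF M v x]] x right_moduleD(3)[OF M s x] by simp
      assume y: "y \<in> carrier M"
      show "?\<phi> (x \<oplus>\<^bsub>M\<^esub> y) = ?\<phi> x + ?\<phi> y"
        using right_moduleD(5)[OF M e x y] right_module_group(2)[OF M x y] x y
          cs_dualD(1)[OF \<psi> cpt_closed(1)[OF M v x] cpt_closed(1)[OF M v y]] by simp
    qed simp
    moreover have "?\<phi> (ee v \<odot>\<^bsub>M\<^esub> x) = ?\<phi> x" if x: "x \<in> carrier M" for x
      using x right_moduleD(3)[OF M e x] cpt_closed(6)[OF M v cpt_closed(1)[OF M v x]] by simp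
    ultimately have "?\<phi> \<in> carrier (cs ?D v)" using mem by simp
    moreover have "?T ?\<phi> = \<psi>"
    proof (rule vdual_eqI[of _ "cs M v"])
      show "?T ?\<phi> \<in> carrier (vdual (cs M v))" using T calculation unfolding khom_iff by blast
      show "?T ?\<phi> x = \<psi> x" if "x \<in> carrier (cs M v)" for x
        using that sub cpt_closed(6)[OF M v] by auto
    qed (rule \<psi>)
    ultimately show "\<psi> \<in> ?T ` carrier (cs ?D v)" by (intro image_eqI[where x = ?\<phi>]) simp_all
  next
    fix \<psi> assume "\<psi> \<in> ?T ` carrier (cs ?D v)"
    then show "\<psi> \<in> carrier (vdual (cs M v))" using T unfolding khom_iff by blast
  qed
  show ?thesis using kdim_bij'(2)[OF vs W(1) T bT] W(2) by simp
qed

lemma adual_scal: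
  assumes "g \<in> carrier (adual A P)"
  shows "scal c \<odot>\<^bsub>adual A P\<^esub> g = (\<lambda>p\<in>carrier P. c \<odot>\<^bsub>A\<^esub> g p)"
  unfolding adual_simps using mult_rules(10)[OF adualD(1)[OF assms]] by (auto cong: restrict_cong)

text \<open>A homomorphism out of \<open>P\<close> is determined by its values on the generators
  \<open>r (u i)\<close>, so Hom(P, A) embeds linearly over the field into a free module of finite
  rank.\<close>

lemma adual_fdim:
  assumes P: "fg_projective A P"
  shows "fdim (kspace A (adual A P))"
proof -
  obtain n s r where PM: "right_module A P" and s: "s \<in> module_hom A P (free_mod A n)"
    and r: "r \<in> module_hom A (free_mod A n) P" and rs: "\<And>p. p \<in> carrier P \<Longrightarrow> r (s p) = p"
    using fg_projectiveE[OF P] by metis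
  interpret op: bip "opp A" Y X "E\<inverse>" eb "\<lambda>e. ab (prod.swap e)" by (rule bip_opp)
  interpret A: ring A by (rule ring_A)
  let ?F = "free_mod A n"
  have F: "right_module A ?F" by (rule free_mod_right_module[OF ring_A])
  define u where "u i = single A n i \<one>\<^bsub>A\<^esub>" for i
  have u: "u i \<in> carrier ?F" for i unfolding u_def by (rule single_closed[OF ring_A]) simp
  have ru: "r (u i) \<in> carrier P" for i by (rule homD(1)[OF r u])
  have vs: "vspace (kspace A (adual A P))"
    using op.kspace_vspace[OF adual_right_module[OF PM]] by simp
  let ?T = "\<lambda>g. \<lambda>i\<in>{..<n}. g (r (u i))"
  show ?thesis
  proof (rule fdim_inj[OF vs fdim_free, of ?T])
    show "?T \<in> module_hom class_ring (kspace A (adual A P)) (kspace A ?F)"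
      unfolding khom_iff kspace_simps
    proof (intro conjI ballI allI)
      fix g c assume g: "g \<in> carrier (adual A P)"
      show "?T g \<in> carrier ?F" using adualD(1)[OF g ru] by (auto simp: free_mod_simps)
      show "?T (scal c \<odot>\<^bsub>adual A P\<^esub> g) = scal c \<odot>\<^bsub>?F\<^esub> ?T g"
        using ru mult_rules(11)[OF adualD(1)[OF g ru]]
        by (simp add: adual_scal[OF g] free_mod_simps cong: restrict_cong)
      show "?T (g \<oplus>\<^bsub>adual A P\<^esub> h) = ?T g \<oplus>\<^bsub>?F\<^esub> ?T h" for h
        using ru by (simp add: adual_simps free_mod_simps cong: restrict_cong)
    qed
    show "inj_on ?T (carrier (kspace A (adual A P)))"
      unfolding kspace_simps
    proof (rule inj_onI)
      fix g h assume g: "g \<in> carrier (adual A P)" and h: "h \<in> carrier (adual A P)" and eq: "?T g = ?T h"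
      have zero: "f \<zero>\<^bsub>P\<^esub> = \<zero>\<^bsub>A\<^esub>" if "f \<in> carrier (adual A P)" for f
        using adualD(3)[OF that A.zero_closed right_module_group(1)[OF PM]]
          smult_zero_left[OF PM right_module_group(1)[OF PM]] adualD(1)[OF that right_module_group(1)[OF PM]] by simp
      have "g (r w) = h (r w)" if "w \<in> carrier ?F" for w
      proof (rule free_induct[OF ring_A that])
        show "g (r \<zero>\<^bsub>?F\<^esub>) = h (r \<zero>\<^bsub>?F\<^esub>)"
          using hom_zero[OF F PM r] zero[OF g] zero[OF h] by simp
        fix i a assume i: "i < n" and a: "a \<in> carrier A"
        have "single A n i a = a \<odot>\<^bsub>?F\<^esub> u i"
          using smult_single[OF ring_A A.one_closed a] a unfolding u_def by simp
        then have e: "r (single A n i a) = a \<odot>\<^bsub>P\<^esub> r (u i)" using homD(3)[OF r a u] by simp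
        show "g (r (single A n i a)) = h (r (single A n i a))"
          unfolding e adualD(3)[OF g a ru] adualD(3)[OF h a ru] using fun_cong[OF eq, of i] i by simp
      next
        fix v w assume vw: "v \<in> carrier ?F" "w \<in> carrier ?F" "g (r v) = h (r v)" "g (r w) = h (r w)"
        show "g (r (v \<oplus>\<^bsub>?F\<^esub> w)) = h (r (v \<oplus>\<^bsub>?F\<^esub> w))"
          using homD(2)[OF r vw(1,2)] adualD(2)[OF g homD(1)[OF r vw(1)] homD(1)[OF r vw(2)]]
            adualD(2)[OF h homD(1)[OF r vw(1)] homD(1)[OF r vw(2)]] vw(3,4) by simp
      qed
      then show "g = h" using adual_eqI[OF g h] rs homD(1)[OF s] by metis
    qed
  qed
qed

lemma adual_cpt_iff:
  assumes P: "right_module A P" and v: "v \<in> V"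
  shows "g \<in> cpt (adual A P) (ee v) \<longleftrightarrow>
    g \<in> carrier (adual A P) \<and> (\<forall>p\<in>carrier P. ee v \<otimes>\<^bsub>A\<^esub> g p = g p)"
proof -
  interpret op: bip "opp A" Y X "E\<inverse>" eb "\<lambda>e. ab (prod.swap e)" by (rule bip_opp)
  have v': "v \<in> Y \<union> X" using v by blast
  have "(\<lambda>p\<in>carrier P. ee v \<otimes>\<^bsub>A\<^esub> g p) = g \<longleftrightarrow> (\<forall>p\<in>carrier P. ee v \<otimes>\<^bsub>A\<^esub> g p = g p)"
    if "g \<in> carrier (adual A P)"
    using that unfolding adual_simps(1) by (auto simp: fun_eq_iff extensional_def)
  then show ?thesis unfolding op.cpt_iff[OF adual_right_module[OF P] v'] adual_simps(4) by blast
qed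

text \<open>At a sink, e_y A is spanned by \<open>ee y\<close>. A homomorphism into it is therefore
  a functional on the component at \<open>y\<close> that vanishes on the images of all arrows ending
  at \<open>y\<close>, and those are counted by \<open>kdim_Ann\<close>.\<close>

lemma kd_adual_sink:
  assumes P: "fg_projective A P" and y: "y \<in> Y"
  shows "kdim ((vdual (cs P y))\<lparr>carrier := Ann P y {x. (x, y) \<in> E}\<rparr>) = kd (adual A P) y"
    "kd (adual A P) y + (\<Sum>x | (x, y) \<in> E. kd P x) = kd P y"
proof -
  interpret op: bip "opp A" Y X "E\<inverse>" eb "\<lambda>e. ab (prod.swap e)" by (rule bip_opp)
  have PM: "right_module A P" by (rule fg_projective_right_module[OF P])
  have yV: "y \<in> V" and yV': "y \<in> Y \<union> X" using y by auto
  let ?W = "(vdual (cs P y))\<lparr>carrier := Ann P y {x. (x, y) \<in> E}\<rparr>" and ?D = "cs (adual A P) y"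
  have W: "fdim ?W" "kdim ?W + (\<Sum>x | (x, y) \<in> E. kd P x) = kd P y"
    using kdim_Ann[OF P y subset_refl] by auto
  have vs: "vspace ?D" using op.cs_vspace[OF adual_right_module[OF PM] yV'] by simp
  have e: "ee y \<in> carrier A" using yV by blast
  have sub: "cpt P (ee y) \<subseteq> carrier P" using cpt_closed(5)[OF PM yV] by blast
  note mem = adual_cpt_iff[OF PM yV]
  have val: "g p = g p (eb y) \<odot>\<^bsub>A\<^esub> ee y" if "g \<in> cpt (adual A P) (ee y)" "p \<in> carrier P" for g p
    using that mult_rules(3)[OF _ y, of "g p"] adualD(1)[of g P p] unfolding mem by auto
  let ?T = "\<lambda>g. \<lambda>p\<in>cpt P (ee y). g p (eb y)"
  have T: "?T \<in> module_hom class_ring ?D ?W"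
    unfolding khom_iff
  proof (intro conjI ballI allI)
    fix g assume "g \<in> carrier ?D"
    then have g: "g \<in> cpt (adual A P) (ee y)" and g': "g \<in> carrier (adual A P)" using mem by auto
    have sc: "g (scal c \<odot>\<^bsub>P\<^esub> p) = c \<odot>\<^bsub>A\<^esub> g p" if "p \<in> carrier P" for c p
      using adualD(3)[OF g' A_closed(4)[OF A_closed(2)] that] mult_rules(11)[OF adualD(1)[OF g' that]] by simp
    have "?T g \<in> carrier (vdual (cs P y))"
      unfolding vdual_simps(1) cs_simps
    proof (intro conjI ballI allI)
      fix p q c assume p: "p \<in> cpt P (ee y)"
      show "?T g (scal c \<odot>\<^bsub>P\<^esub> p) = c * ?T g p"
        using p cpt_closed(4)[OF PM yV p] sc sub by (auto simp: ev)
      assume q: "q \<in> cpt P (ee y)"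
      show "?T g (p \<oplus>\<^bsub>P\<^esub> q) = ?T g p + ?T g q"
        using p q cpt_closed(3)[OF PM yV p q] adualD(2)[OF g'] sub by (auto simp: ev subset_iff)
    qed simp
    moreover have "?T g (aa (x, y) \<odot>\<^bsub>P\<^esub> p) = 0" if "(x, y) \<in> E" "p \<in> carrier P" for x p
    proof -
      have xV: "x \<in> V" "x \<noteq> y" using that(1) E_V by auto
      have "g (aa (x, y) \<odot>\<^bsub>P\<^esub> p) = g p (eb x) \<odot>\<^bsub>A\<^esub> aa (x, y)"
        using adualD(3)[OF g' A_closed(6)[OF that(1)] that(2)] mult_rules(5)[OF adualD(1)[OF g' that(2)] that(1)] by simp
      then show ?thesis using arrow_cpt(1)[OF PM that] that(1) yV by (simp add: ev)
    qed
    ultimately show "?T g \<in> carrier ?W" unfolding Ann_def by auto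
    show "?T (c \<odot>\<^bsub>?D\<^esub> g) = c \<odot>\<^bsub>?W\<^esub> ?T g" for c
      using sub unfolding cs_simps adual_scal[OF g'] by (auto simp: vdual_simps ev fun_eq_iff kspace_simps)
    show "?T (g \<oplus>\<^bsub>?D\<^esub> h) = ?T g \<oplus>\<^bsub>?W\<^esub> ?T h" for h
      using sub by (auto simp: cs_simps adual_simps vdual_simps ev fun_eq_iff kspace_simps)
  qed
  have bT: "bij_betw ?T (carrier ?D) (carrier ?W)"
    unfolding bij_betw_def
  proof (intro conjI inj_onI equalityI subsetI)
    fix g h assume "g \<in> carrier ?D" "h \<in> carrier ?D" and eq: "?T g = ?T h"
    then have g: "g \<in> cpt (adual A P) (ee y)" "h \<in> cpt (adual A P) (ee y)" by auto
    then have g': "g \<in> carrier (adual A P)" "h \<in> carrier (adual A P)" using mem by auto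
    have "g p = h p" if p: "p \<in> carrier P" for p
    proof -
      have q: "ee y \<odot>\<^bsub>P\<^esub> p \<in> cpt P (ee y)" by (rule cpt_closed(1)[OF PM yV p])
      have v: "f (ee y \<odot>\<^bsub>P\<^esub> p) (eb y) = f p (eb y)" if "f \<in> carrier (adual A P)" for f
        using adualD(3)[OF that e p] mult_eb[OF adualD(1)[OF that p] e yV] yV by (simp add: ev)
      have "g p (eb y) = h p (eb y)"
        using fun_cong[OF eq, of "ee y \<odot>\<^bsub>P\<^esub> p"] q v[OF g'(1)] v[OF g'(2)] by simp
      then show ?thesis using val[OF g(1) p] val[OF g(2) p] by simp
    qed
    then show "g = h" by (rule adual_eqI[OF g'])
  next
    fix \<phi> assume "\<phi> \<in> carrier ?W"
    then have \<phi>: "\<phi> \<in> carrier (vdual (cs P y))"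
      and z: "\<And>x p. (x, y) \<in> E \<Longrightarrow> p \<in> carrier P \<Longrightarrow> \<phi> (aa (x, y) \<odot>\<^bsub>P\<^esub> p) = 0"
      unfolding Ann_def by auto
    note \<phi>0 = dual_zero[OF PM yV \<phi>]
    let ?f = "\<lambda>p. \<phi> (ee y \<odot>\<^bsub>P\<^esub> p) \<odot>\<^bsub>A\<^esub> ee y"
    have q: "ee y \<odot>\<^bsub>P\<^esub> p \<in> cpt P (ee y)" if "p \<in> carrier P" for p by (rule cpt_closed(1)[OF PM yV that])
    have g: "restrict ?f (carrier P) \<in> carrier (adual A P)"
    proof (rule adualI[OF PM])
      fix p assume p: "p \<in> carrier P"
      show "?f p \<in> carrier A" using A_closed(4)[OF e] .
      show "?f (p \<oplus>\<^bsub>P\<^esub> r) = ?f p \<oplus>\<^bsub>A\<^esub> ?f r" if r: "r \<in> carrier P" for r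
        using right_moduleD(5)[OF PM e p r] cs_dualD(1)[OF \<phi> q[OF p] q[OF r]]
        by (simp add: smult_A add_A fun_eq_iff algebra_simps)
      show "?f (scal c \<odot>\<^bsub>P\<^esub> p) = c \<odot>\<^bsub>A\<^esub> ?f p" for c
        using smult_scal[OF PM e p, of c] cs_dualD(2)[OF \<phi> q[OF p], of c]
        by (simp add: smult_A fun_eq_iff)
      show "?f (ee v \<odot>\<^bsub>P\<^esub> p) = ?f p \<otimes>\<^bsub>A\<^esub> ee v" if v: "v \<in> V" for v
      proof -
        have ev': "ee v \<in> carrier A" using v by blast
        have "ee y \<odot>\<^bsub>P\<^esub> (ee v \<odot>\<^bsub>P\<^esub> p) = (if v = y then ee y \<odot>\<^bsub>P\<^esub> p else \<zero>\<^bsub>P\<^esub>)"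
          using right_moduleD(6)[OF PM ev' e p] mult_rules(1)[OF e v yV] smult_zero_left[OF PM p] by auto
        moreover have "?f p \<otimes>\<^bsub>A\<^esub> ee v = \<phi> (ee y \<odot>\<^bsub>P\<^esub> p) \<odot>\<^bsub>A\<^esub> (if v = y then ee y else \<zero>\<^bsub>A\<^esub>)"
          using mult_rules(8)[OF e ev'] mult_rules(1)[OF e yV v] by auto
        ultimately show ?thesis using \<phi>0 by (simp add: smult_A zero_A)
      qed
      show "?f (aa (x, y') \<odot>\<^bsub>P\<^esub> p) = ?f p \<otimes>\<^bsub>A\<^esub> aa (x, y')" if xy: "(x, y') \<in> E" for x y'
      proof -
        have xV: "x \<in> V" "x \<noteq> y" using xy y E_V by auto
        have "\<phi> (ee y \<odot>\<^bsub>P\<^esub> (aa (x, y') \<odot>\<^bsub>P\<^esub> p)) = 0"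
          using arrow_cpt(3,4)[OF PM xy p] z[OF _ p, of x] xy yV \<phi>0 by (cases "y' = y") auto
        moreover have "?f p \<otimes>\<^bsub>A\<^esub> aa (x, y') = \<zero>\<^bsub>A\<^esub>"
          using mult_rules(5)[OF A_closed(4)[OF e] xy] xV yV by (simp add: ev) (simp add: smult_A zero_A)
        ultimately show ?thesis by (simp add: smult_A zero_A)
      qed
    qed
    have "ee y \<otimes>\<^bsub>A\<^esub> ?f p = ?f p" for p
      using mult_rules(9)[OF e e] mult_rules(1)[OF e yV yV] by simp
    then have g': "restrict ?f (carrier P) \<in> carrier ?D" using g mem by simp
    moreover have "?T (restrict ?f (carrier P)) = \<phi>"
    proof (rule vdual_eqI[of _ "cs P y"])
      show "?T (restrict ?f (carrier P)) \<in> carrier (vdual (cs P y))"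
        using T g' unfolding khom_iff Ann_def by auto
      show "?T (restrict ?f (carrier P)) p = \<phi> p" if "p \<in> carrier (cs P y)" for p
        using that sub cpt_closed(6)[OF PM yV] yV by (auto simp: ev)
    qed (rule \<phi>)
    ultimately show "\<phi> \<in> ?T ` carrier ?D" by (intro image_eqI[where x = "restrict ?f (carrier P)"]) simp_all
  next
    fix \<phi> assume "\<phi> \<in> ?T ` carrier ?D"
    then show "\<phi> \<in> carrier ?W" using T unfolding khom_iff by blast
  qed
  show eq: "kdim ?W = kd (adual A P) y" using kdim_bij'(2)[OF vs W(1) T bT] by simp
  show "kd (adual A P) y + (\<Sum>x | (x, y) \<in> E. kd P x) = kd P y" using W(2) eq by simp
qed

text \<open>e_x A has a simple top at \<open>x\<close> and, as its radical, one copy of e_y A for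
  each arrow from \<open>x\<close> to \<open>y\<close>. Filtering Hom(P, e_x A) accordingly gives
  the summands on the right: the radical part arrow by arrow, and the whole dual of the component at
  \<open>x\<close> for the top, because functionals extend from there.\<close>

lemma kd_adual_source:
  assumes P: "fg_projective A P" and x: "x \<in> X"
  shows "kd (adual A P) x = kd P x + (\<Sum>y | (x, y) \<in> E. kd (adual A P) y)"
proof -
  interpret op: bip "opp A" Y X "E\<inverse>" eb "\<lambda>e. ab (prod.swap e)" by (rule bip_opp)
  have PM: "right_module A P" by (rule fg_projective_right_module[OF P])
  have fP: "fdim (kspace A P)" by (rule fg_fdim[OF fg_projective_fg[OF P]])
  have xV: "x \<in> V" and xV': "x \<in> Y \<union> X" using x by auto
  have AD: "right_module (opp A) (adual A P)" by (rule adual_right_module[OF PM])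
  let ?D = "cs (adual A P) x" and ?S = "{y. (x, y) \<in> E}"
  have fD: "fdim ?D" using op.fdim_cpt[OF AD _ xV'] adual_fdim[OF P] by simp
  have e: "ee x \<in> carrier A" using xV by blast
  note mem = adual_cpt_iff[OF PM xV]
  \<comment> \<open>Maps into the part of the radical of e_x A that is spanned by the arrows to
    \<open>F\<close>.\<close>
  define KF where "KF F = {g \<in> cpt (adual A P) (ee x). \<forall>p\<in>carrier P. g p (eb x) = 0 \<and>
    (\<forall>y. (x, y) \<in> E \<longrightarrow> y \<notin> F \<longrightarrow> g p (ab (x, y)) = 0)}" for F
  have val: "g p \<in> carrier A" "ee x \<otimes>\<^bsub>A\<^esub> g p = g p"
    if "g \<in> cpt (adual A P) (ee x)" "p \<in> carrier P" for g p
    using that adualD(1)[of g P p] unfolding mem by auto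
  have supp1: "g p (eb v) = 0" if "g \<in> cpt (adual A P) (ee x)" "p \<in> carrier P" "v \<in> V" "v \<noteq> x" for g p v
    using mult_eb[OF e val(1)[OF that(1,2)] that(3)] val(2)[OF that(1,2)] that(3,4) xV by (simp add: ev)
  have supp2: "g p (ab (x', y)) = 0"
    if "g \<in> cpt (adual A P) (ee x)" "p \<in> carrier P" "(x', y) \<in> E" "x' \<noteq> x" for g p x' y
    using mult_ab[OF e val(1)[OF that(1,2)] that(3)] val(2)[OF that(1,2)] that(3,4) xV E_V(1)[OF that(3)]
    by (simp add: ev)
  have sub: "subsp (KF F) ?D" for F
  proof -
    have "\<zero>\<^bsub>adual A P\<^esub> \<in> cpt (adual A P) (ee x)" by (rule op.cpt_closed(2)[OF AD xV'])
    moreover have "g \<oplus>\<^bsub>adual A P\<^esub> h \<in> cpt (adual A P) (ee x)"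
      if "g \<in> cpt (adual A P) (ee x)" "h \<in> cpt (adual A P) (ee x)" for g h
      by (rule op.cpt_closed(3)[OF AD xV' that])
    moreover have "scal c \<odot>\<^bsub>adual A P\<^esub> g \<in> cpt (adual A P) (ee x)" if "g \<in> cpt (adual A P) (ee x)" for g c
      using op.cpt_closed(4)[OF AD xV' that] by simp
    moreover have "scal c \<odot>\<^bsub>adual A P\<^esub> g = (\<lambda>p\<in>carrier P. c \<odot>\<^bsub>A\<^esub> g p)" if "g \<in> cpt (adual A P) (ee x)" for g c
      using adual_scal that mem by blast
    ultimately show ?thesis
      unfolding subsp_iff[OF fdim_vspace[OF fD]] cs_simps KF_def by (auto simp: adual_simps(2,3) ev)
  qed
  have fK: "fdim (?D\<lparr>carrier := KF F\<rparr>)" for F by (rule fdim_subsp[OF fD sub])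
  have finS: "finite F" if "F \<subseteq> ?S" for F
    using finite_subset[of F Y] that finY E_V(2) by blast
  have card: "kdim (?D\<lparr>carrier := KF F\<rparr>) = (\<Sum>y\<in>F. kd (adual A P) y)" if "F \<subseteq> ?S" for F
    using finS[OF that] that
  proof (induction F rule: finite_induct)
    case empty
    have "KF {} = {\<zero>\<^bsub>adual A P\<^esub>}"
    proof (intro equalityI subsetI)
      fix g assume g: "g \<in> KF {}"
      then have g': "g \<in> cpt (adual A P) (ee x)" unfolding KF_def by simp
      have "g = \<zero>\<^bsub>adual A P\<^esub>"
      proof (rule adual_eqI)
        show "g \<in> carrier (adual A P)" using g' mem by simp
        show "\<zero>\<^bsub>adual A P\<^esub> \<in> carrier (adual A P)" by (rule right_module_group(1)[OF AD])
        fix p assume p: "p \<in> carrier P"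
        have g'': "g \<in> carrier (adual A P)" using g' mem by simp
        have "g p = \<zero>\<^bsub>A\<^esub>"
        proof (rule A_eqI)
          show "g p \<in> carrier A" by (rule adualD(1)[OF g'' p])
          show "g p (eb v) = \<zero>\<^bsub>A\<^esub> (eb v)" if "v \<in> V" for v
            using supp1[OF g' p that] g p that unfolding KF_def by (cases "v = x") (auto simp: ev)
          show "g p (ab (x', y)) = \<zero>\<^bsub>A\<^esub> (ab (x', y))" if "(x', y) \<in> E" for x' y
            using supp2[OF g' p that] g p that unfolding KF_def
            by (cases "x' = x") (auto simp: ev)
        qed blast
        then show "g p = \<zero>\<^bsub>adual A P\<^esub> p" using p by (simp add: adual_simps)
      qed
      then show "g \<in> {\<zero>\<^bsub>adual A P\<^esub>}" by simp
    next
      fix g assume "g \<in> {\<zero>\<^bsub>adual A P\<^esub>}"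
      then show "g \<in> KF {}" using sub[of "{}"] unfolding subsp_iff[OF fdim_vspace[OF fD]] cs_simps by simp
    qed
    then show ?case using kdim_zero(2)[OF fdim_vspace[OF fK[of "{}"]]] by (simp add: kspace_simps)
  next
    case (insert y F)
    have xy: "(x, y) \<in> E" and F: "F \<subseteq> ?S" using insert.prems by auto
    have y: "y \<in> Y" and yV: "y \<in> V" "y \<noteq> x" using E_V(2)[OF xy] E_V(3)[OF xy] by auto
    have a: "aa (x, y) \<in> carrier A" and ey: "ee y \<in> carrier A" using A_closed(6)[OF xy] A_closed(5)[OF yV(1)] by auto
    let ?A = "?D\<lparr>carrier := KF (insert y F)\<rparr>"
    let ?W = "(vdual (cs P y))\<lparr>carrier := Ann P y {x. (x, y) \<in> E}\<rparr>"
    have W: "fdim ?W" using kdim_Ann[OF P y subset_refl] by auto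
    have suby: "cpt P (ee y) \<subseteq> carrier P" using cpt_closed(5)[OF PM yV(1)] by blast
    \<comment> \<open>Reading the coefficient at the arrow to \<open>y\<close> maps onto Hom(P, e_y
      A), in the guise of \<open>Ann\<close>, with kernel \<open>KF F\<close>.\<close>
    let ?T = "\<lambda>g. \<lambda>p\<in>cpt P (ee y). g p (ab (x, y))"
    have T: "?T \<in> module_hom class_ring ?A ?W"
      unfolding khom_iff
    proof (intro conjI ballI allI)
      fix g assume "g \<in> carrier ?A"
      then have gK: "g \<in> KF (insert y F)" by simp
      then have g: "g \<in> cpt (adual A P) (ee x)" and g': "g \<in> carrier (adual A P)" using mem unfolding KF_def by auto
      have sc: "g (scal c \<odot>\<^bsub>P\<^esub> p) = c \<odot>\<^bsub>A\<^esub> g p" if "p \<in> carrier P" for c p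
        using adualD(3)[OF g' A_closed(4)[OF A_closed(2)] that] mult_rules(11)[OF adualD(1)[OF g' that]] by simp
      have "?T g \<in> carrier (vdual (cs P y))"
        unfolding vdual_simps(1) cs_simps
      proof (intro conjI ballI allI)
        fix p q c assume p: "p \<in> cpt P (ee y)"
        show "?T g (scal c \<odot>\<^bsub>P\<^esub> p) = c * ?T g p"
          using p cpt_closed(4)[OF PM yV(1) p] sc suby by (auto simp: ev)
        assume q: "q \<in> cpt P (ee y)"
        show "?T g (p \<oplus>\<^bsub>P\<^esub> q) = ?T g p + ?T g q"
          using p q cpt_closed(3)[OF PM yV(1) p q] adualD(2)[OF g'] suby by (auto simp: ev subset_iff)
      qed simp
      moreover have "?T g (aa (x', y) \<odot>\<^bsub>P\<^esub> p) = 0" if "(x', y) \<in> E" "p \<in> carrier P" for x' p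
      proof -
        have "g (aa (x', y) \<odot>\<^bsub>P\<^esub> p) = g p (eb x') \<odot>\<^bsub>A\<^esub> aa (x', y)"
          using adualD(3)[OF g' A_closed(6)[OF that(1)] that(2)] mult_rules(5)[OF adualD(1)[OF g' that(2)] that(1)] by simp
        then show ?thesis
          using arrow_cpt(1)[OF PM that] that xy gK unfolding KF_def by (cases "x' = x") (auto simp: ev)
      qed
      ultimately show "?T g \<in> carrier ?W" unfolding Ann_def by auto
      show "?T (c \<odot>\<^bsub>?A\<^esub> g) = c \<odot>\<^bsub>?W\<^esub> ?T g" for c
        using suby adual_scal[OF g', of c] by (auto simp: vdual_simps ev fun_eq_iff kspace_simps)
      show "?T (g \<oplus>\<^bsub>?A\<^esub> h) = ?T g \<oplus>\<^bsub>?W\<^esub> ?T h" for h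
        using suby by (auto simp: adual_simps vdual_simps ev fun_eq_iff kspace_simps)
    qed
    have onto: "?T ` carrier ?A = carrier ?W"
    proof (intro equalityI subsetI)
      fix \<phi> assume "\<phi> \<in> carrier ?W"
      then have \<phi>: "\<phi> \<in> carrier (vdual (cs P y))"
        and z: "\<And>x p. (x, y) \<in> E \<Longrightarrow> p \<in> carrier P \<Longrightarrow> \<phi> (aa (x, y) \<odot>\<^bsub>P\<^esub> p) = 0"
        unfolding Ann_def by auto
      note \<phi>0 = dual_zero[OF PM yV(1) \<phi>]
      let ?f = "\<lambda>p. \<phi> (ee y \<odot>\<^bsub>P\<^esub> p) \<odot>\<^bsub>A\<^esub> aa (x, y)"
      have q: "ee y \<odot>\<^bsub>P\<^esub> p \<in> cpt P (ee y)" if "p \<in> carrier P" for p by (rule cpt_closed(1)[OF PM yV(1) that])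
      have g: "restrict ?f (carrier P) \<in> carrier (adual A P)"
      proof (rule adualI[OF PM])
        fix p assume p: "p \<in> carrier P"
        show "?f p \<in> carrier A" using A_closed(4)[OF a] .
        show "?f (p \<oplus>\<^bsub>P\<^esub> r) = ?f p \<oplus>\<^bsub>A\<^esub> ?f r" if r: "r \<in> carrier P" for r
          using right_moduleD(5)[OF PM ey p r] cs_dualD(1)[OF \<phi> q[OF p] q[OF r]]
          by (simp add: smult_A add_A fun_eq_iff algebra_simps)
        show "?f (scal c \<odot>\<^bsub>P\<^esub> p) = c \<odot>\<^bsub>A\<^esub> ?f p" for c
          using smult_scal[OF PM ey p, of c] cs_dualD(2)[OF \<phi> q[OF p], of c]
          by (simp add: smult_A fun_eq_iff)
        show "?f (ee v \<odot>\<^bsub>P\<^esub> p) = ?f p \<otimes>\<^bsub>A\<^esub> ee v" if v: "v \<in> V" for v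
        proof -
          have ev': "ee v \<in> carrier A" using v by blast
          have "ee y \<odot>\<^bsub>P\<^esub> (ee v \<odot>\<^bsub>P\<^esub> p) = (if v = y then ee y \<odot>\<^bsub>P\<^esub> p else \<zero>\<^bsub>P\<^esub>)"
            using right_moduleD(6)[OF PM ev' ey p] mult_rules(1)[OF ey v yV(1)] smult_zero_left[OF PM p] by auto
          moreover have "?f p \<otimes>\<^bsub>A\<^esub> ee v = \<phi> (ee y \<odot>\<^bsub>P\<^esub> p) \<odot>\<^bsub>A\<^esub> (if v = y then aa (x, y) else \<zero>\<^bsub>A\<^esub>)"
            using mult_rules(8)[OF a ev'] mult_rules(7)[OF a xy v] by auto
          ultimately show ?thesis using \<phi>0 by (simp add: smult_A zero_A)
        qed
        show "?f (aa (x', y') \<odot>\<^bsub>P\<^esub> p) = ?f p \<otimes>\<^bsub>A\<^esub> aa (x', y')" if xy': "(x', y') \<in> E" for x' y'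
        proof -
          have x'V: "x' \<in> V" using E_V(1)[OF xy'] by auto
          have "\<phi> (ee y \<odot>\<^bsub>P\<^esub> (aa (x', y') \<odot>\<^bsub>P\<^esub> p)) = 0"
            using arrow_cpt(3,4)[OF PM xy' p] z[OF _ p, of x'] xy' yV \<phi>0 by (cases "y' = y") auto
          moreover have "?f p \<otimes>\<^bsub>A\<^esub> aa (x', y') = \<zero>\<^bsub>A\<^esub>"
            using mult_rules(5)[OF A_closed(4)[OF a] xy'] x'V xy by (simp add: ev) (simp add: smult_A zero_A)
          ultimately show ?thesis by (simp add: smult_A zero_A)
        qed
      qed
      have "ee x \<otimes>\<^bsub>A\<^esub> ?f p = ?f p" for p
        using mult_rules(9)[OF e a] mult_rules(6)[OF a xy xV] by simp
      then have g1: "restrict ?f (carrier P) \<in> cpt (adual A P) (ee x)" using g mem by simp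
      have "?f p (ab (x, y')) = 0" if "(x, y') \<in> E" "y' \<noteq> y" for p y'
        using that xy by (simp add: ev)
      then have g': "restrict ?f (carrier P) \<in> carrier ?A"
        using g1 xV xy unfolding KF_def by (auto simp: ev)
      moreover have "?T (restrict ?f (carrier P)) = \<phi>"
      proof (rule vdual_eqI[of _ "cs P y"])
        show "?T (restrict ?f (carrier P)) \<in> carrier (vdual (cs P y))"
          using T g' unfolding khom_iff Ann_def by auto
        show "?T (restrict ?f (carrier P)) p = \<phi> p" if "p \<in> carrier (cs P y)" for p
          using that suby cpt_closed(6)[OF PM yV(1)] xy by (auto simp: ev)
      qed (rule \<phi>)
      ultimately show "\<phi> \<in> ?T ` carrier ?A" by (intro image_eqI[where x = "restrict ?f (carrier P)"]) simp_all
    next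
      fix \<phi> assume "\<phi> \<in> ?T ` carrier ?A"
      then show "\<phi> \<in> carrier ?W" using T unfolding khom_iff by blast
    qed
    have ker: "mod_kernel ?A ?W ?T = KF F"
    proof (intro equalityI subsetI)
      fix g assume "g \<in> mod_kernel ?A ?W ?T"
      then have g: "g \<in> KF (insert y F)" and z: "?T g = (\<lambda>p\<in>cpt P (ee y). 0)"
        by (auto simp: mod_kernel_def vdual_simps cs_simps)
      have g': "g \<in> carrier (adual A P)" using g mem unfolding KF_def by simp
      have "g p (ab (x, y)) = 0" if p: "p \<in> carrier P" for p
      proof -
        have "g (ee y \<odot>\<^bsub>P\<^esub> p) (ab (x, y)) = g p (ab (x, y))"
          using adualD(3)[OF g' ey p] mult_ab[OF adualD(1)[OF g' p] ey xy] xy yV by (simp add: ev)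
        then show ?thesis using fun_cong[OF z, of "ee y \<odot>\<^bsub>P\<^esub> p"] cpt_closed(1)[OF PM yV(1) p] by simp
      qed
      then show "g \<in> KF F" using g unfolding KF_def by auto
    next
      fix g assume g: "g \<in> KF F"
      then have "?T g = (\<lambda>p\<in>cpt P (ee y). 0)"
        using suby xy insert.hyps(2) unfolding KF_def by (auto simp: fun_eq_iff)
      then show "g \<in> mod_kernel ?A ?W ?T"
        using g unfolding mod_kernel_def KF_def by (simp add: vdual_simps cs_simps)
    qed
    have "kdim ?A = kdim ?W + kdim (?A\<lparr>carrier := mod_kernel ?A ?W ?T\<rparr>)"
      by (rule rank_nullity_onto(2)[OF fK fdim_vspace[OF W] T onto])
    then have "kdim ?A = kd (adual A P) y + kdim (?D\<lparr>carrier := KF F\<rparr>)"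
      unfolding ker kd_adual_sink(1)[OF P y] by simp
    then show ?case using insert.IH[OF F] insert.hyps by simp
  qed
  \<comment> \<open>The coefficient at \<open>eb x\<close> is the top part; its kernel is the
    radical part \<open>KF ?S\<close>, already counted.\<close>
  let ?R = "\<lambda>g. \<lambda>p\<in>cpt P (ee x). g p (eb x)" and ?W = "vdual (cs P x)"
  have W: "fdim ?W" "kdim ?W = kd P x" using kdim_vdual[OF fdim_cpt[OF PM fP xV]] by auto
  have subx: "cpt P (ee x) \<subseteq> carrier P" using cpt_closed(5)[OF PM xV] by blast
  have R: "?R \<in> module_hom class_ring ?D ?W"
    unfolding khom_iff
  proof (intro conjI ballI allI)
    fix g assume "g \<in> carrier ?D"
    then have g': "g \<in> carrier (adual A P)" using mem by auto
    have sc: "g (scal c \<odot>\<^bsub>P\<^esub> p) = c \<odot>\<^bsub>A\<^esub> g p" if "p \<in> carrier P" for c p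
      using adualD(3)[OF g' A_closed(4)[OF A_closed(2)] that] mult_rules(11)[OF adualD(1)[OF g' that]] by simp
    show "?R g \<in> carrier ?W"
      unfolding vdual_simps(1) cs_simps
    proof (intro conjI ballI allI)
      fix p q c assume p: "p \<in> cpt P (ee x)"
      show "?R g (scal c \<odot>\<^bsub>P\<^esub> p) = c * ?R g p"
        using p cpt_closed(4)[OF PM xV p] sc subx by (auto simp: ev)
      assume q: "q \<in> cpt P (ee x)"
      show "?R g (p \<oplus>\<^bsub>P\<^esub> q) = ?R g p + ?R g q"
        using p q cpt_closed(3)[OF PM xV p q] adualD(2)[OF g'] subx by (auto simp: ev subset_iff)
    qed simp
    show "?R (c \<odot>\<^bsub>?D\<^esub> g) = c \<odot>\<^bsub>?W\<^esub> ?R g" for c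
      using subx unfolding cs_simps adual_scal[OF g'] by (auto simp: vdual_simps ev fun_eq_iff kspace_simps)
    show "?R (g \<oplus>\<^bsub>?D\<^esub> h) = ?R g \<oplus>\<^bsub>?W\<^esub> ?R h" for h
      using subx by (auto simp: cs_simps adual_simps vdual_simps ev fun_eq_iff kspace_simps)
  qed
  have onto: "?R ` carrier ?D = carrier ?W"
  proof (intro equalityI subsetI)
    fix \<psi> assume \<psi>: "\<psi> \<in> carrier ?W"
    obtain f where f: "f \<in> carrier (adual A P)"
      and fx: "\<And>p. p \<in> carrier P \<Longrightarrow> ee x \<otimes>\<^bsub>A\<^esub> f p = f p \<and> f p (eb x) = \<psi> (ee x \<odot>\<^bsub>P\<^esub> p)"
      using projective_extend[OF P x \<psi>] by blast
    have f': "f \<in> carrier ?D" using f fx mem by simp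
    have "?R f = \<psi>"
    proof (rule vdual_eqI[of _ "cs P x"])
      show "?R f \<in> carrier ?W" using R f' unfolding khom_iff by blast
      show "?R f p = \<psi> p" if "p \<in> carrier (cs P x)" for p
        using that subx fx cpt_closed(6)[OF PM xV] by auto
    qed (rule \<psi>)
    then show "\<psi> \<in> ?R ` carrier ?D" using f' by (intro image_eqI[where x = f]) simp_all
  next
    fix \<psi> assume "\<psi> \<in> ?R ` carrier ?D"
    then show "\<psi> \<in> carrier ?W" using R unfolding khom_iff by blast
  qed
  have ker: "mod_kernel ?D ?W ?R = KF ?S"
  proof (intro equalityI subsetI)
    fix g assume "g \<in> mod_kernel ?D ?W ?R"
    then have g: "g \<in> cpt (adual A P) (ee x)" and z: "?R g = (\<lambda>p\<in>cpt P (ee x). 0)"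
      by (auto simp: mod_kernel_def vdual_simps cs_simps)
    have g': "g \<in> carrier (adual A P)" using g mem by simp
    have "g p (eb x) = 0" if p: "p \<in> carrier P" for p
    proof -
      have "g (ee x \<odot>\<^bsub>P\<^esub> p) (eb x) = g p (eb x)"
        using adualD(3)[OF g' e p] mult_eb[OF adualD(1)[OF g' p] e xV] xV by (simp add: ev)
      then show ?thesis using fun_cong[OF z, of "ee x \<odot>\<^bsub>P\<^esub> p"] cpt_closed(1)[OF PM xV p] by simp
    qed
    then show "g \<in> KF ?S" using g unfolding KF_def by auto
  next
    fix g assume g: "g \<in> KF ?S"
    then have "?R g = (\<lambda>p\<in>cpt P (ee x). 0)"
      using subx unfolding KF_def by (auto simp: fun_eq_iff)
    then show "g \<in> mod_kernel ?D ?W ?R"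
      using g unfolding mod_kernel_def KF_def by (simp add: vdual_simps cs_simps)
  qed
  have "kdim ?D = kdim ?W + kdim (?D\<lparr>carrier := mod_kernel ?D ?W ?R\<rparr>)"
    by (rule rank_nullity_onto(2)[OF fD fdim_vspace[OF W(1)] R onto])
  then show ?thesis unfolding ker card[OF subset_refl] W(2) .
qed

end

section \<open>Minimal presentations and the transpose\<close>

text \<open>Universal property of a quotient, with \<open>L\<close> in the place of \<open>M\<close>
  modulo the kernel of \<open>p\<close>. Values are computed on chosen preimages; the kernel
  condition makes them independent of the choice.\<close>

lemma hom_factor:
  assumes M: "right_module A M" and L: "right_module A L" and N: "right_module A N"
    and p: "p \<in> module_hom A M L" and onto: "p ` carrier M = carrier L"
    and k: "k \<in> module_hom A M N" and ker: "mod_kernel M L p \<subseteq> mod_kernel M N k"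
  shows "\<exists>\<omega>\<in>module_hom A L N. \<forall>x\<in>carrier M. \<omega> (p x) = k x"
proof -
  interpret M: abelian_group M using M by (rule right_moduleD)
  interpret L: abelian_group L using L by (rule right_moduleD)
  interpret N: abelian_group N using N by (rule right_moduleD)
  have wd: "k x = k y" if x: "x \<in> carrier M" and y: "y \<in> carrier M" and eq: "p x = p y" for x y
  proof -
    let ?z = "x \<oplus>\<^bsub>M\<^esub> (\<ominus>\<^bsub>M\<^esub> y)"
    have my: "\<ominus>\<^bsub>M\<^esub> y \<in> carrier M" using y by simp
    have z: "?z \<in> carrier M" using x my by simp
    have "p ?z = \<zero>\<^bsub>L\<^esub>"
      using homD(2)[OF p x my] hom_neg[OF M L p y] eq homD(1)[OF p y] by (simp add: L.r_neg)
    then have "k ?z = \<zero>\<^bsub>N\<^esub>" using ker z unfolding mod_kernel_def by blast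
    then have "k x \<oplus>\<^bsub>N\<^esub> (\<ominus>\<^bsub>N\<^esub> k y) = \<zero>\<^bsub>N\<^esub>"
      using homD(2)[OF k x my] hom_neg[OF M N k y] by simp
    then have "\<ominus>\<^bsub>N\<^esub> (\<ominus>\<^bsub>N\<^esub> k y) = k x"
      using N.minus_equality[of "k x" "\<ominus>\<^bsub>N\<^esub> k y"] homD(1)[OF k x] homD(1)[OF k y] by simp
    then show ?thesis using homD(1)[OF k y] by simp
  qed
  define g where "g l = (SOME x. x \<in> carrier M \<and> p x = l)" for l
  have g: "g l \<in> carrier M \<and> p (g l) = l" if "l \<in> carrier L" for l
  proof -
    obtain x where "x \<in> carrier M" "l = p x" using onto \<open>l \<in> carrier L\<close> by blast
    then have "x \<in> carrier M \<and> p x = l" by simp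
    then show ?thesis unfolding g_def by (rule someI)
  qed
  let ?w = "\<lambda>l. k (g l)"
  have eq: "?w (p x) = k x" if "x \<in> carrier M" for x
    using wd[of "g (p x)" x] g[OF homD(1)[OF p that]] that by blast
  have hw: "?w \<in> module_hom A L N"
    unfolding hom_iff
  proof (intro conjI ballI)
    fix l m assume l: "l \<in> carrier L"
    note gl = g[OF l]
    show "?w l \<in> carrier N" using homD(1)[OF k] gl by blast
    assume m: "m \<in> carrier L"
    note gm = g[OF m]
    have "p (g l \<oplus>\<^bsub>M\<^esub> g m) = l \<oplus>\<^bsub>L\<^esub> m" using homD(2)[OF p] gl gm by simp
    then show "?w (l \<oplus>\<^bsub>L\<^esub> m) = ?w l \<oplus>\<^bsub>N\<^esub> ?w m"
      using eq[of "g l \<oplus>\<^bsub>M\<^esub> g m"] homD(2)[OF k] gl gm by simp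
  next
    fix a l assume a: "a \<in> carrier A" and l: "l \<in> carrier L"
    note gl = g[OF l]
    have "p (a \<odot>\<^bsub>M\<^esub> g l) = a \<odot>\<^bsub>L\<^esub> l" using homD(3)[OF p a] gl by simp
    then show "?w (a \<odot>\<^bsub>L\<^esub> l) = a \<odot>\<^bsub>N\<^esub> ?w l"
      using eq[of "a \<odot>\<^bsub>M\<^esub> g l"] homD(3)[OF k a] right_moduleD(3)[OF M a] gl by simp
  qed
  show ?thesis by (rule bexI[OF _ hw]) (simp add: eq)
qed

lemma hom_through_inj:
  assumes N: "right_module A N" and f: "f \<in> module_hom A N M" and inj: "inj_on f (carrier N)"
    and d: "d \<in> module_hom A L M" and sub: "d ` carrier L \<subseteq> f ` carrier N" and L: "right_module A L"
  shows "\<exists>s\<in>module_hom A L N. \<forall>x\<in>carrier L. f (s x) = d x"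
proof -
  let ?s = "\<lambda>x. the_inv_into (carrier N) f (d x)"
  have fs: "f (?s x) = d x" and sN: "?s x \<in> carrier N" if "x \<in> carrier L" for x
    using f_the_inv_into_f[OF inj, of "d x"] the_inv_into_into[OF inj, of "d x"] sub that by auto
  have eqI: "u = w" if "u \<in> carrier N" "w \<in> carrier N" "f u = f w" for u w
    using inj that by (auto dest: inj_onD)
  have hs: "?s \<in> module_hom A L N"
    unfolding hom_iff
  proof (intro conjI ballI)
    fix x y assume x: "x \<in> carrier L"
    show "?s x \<in> carrier N" by (rule sN[OF x])
    assume y: "y \<in> carrier L"
    have xy: "x \<oplus>\<^bsub>L\<^esub> y \<in> carrier L" by (rule right_module_group(2)[OF L x y])
    show "?s (x \<oplus>\<^bsub>L\<^esub> y) = ?s x \<oplus>\<^bsub>N\<^esub> ?s y"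
      by (rule eqI[OF sN[OF xy] right_module_group(2)[OF N sN[OF x] sN[OF y]]])
        (use fs[OF xy] fs[OF x] fs[OF y] homD(2)[OF f sN[OF x] sN[OF y]] homD(2)[OF d x y] in simp)
  next
    fix a x assume a: "a \<in> carrier A" and x: "x \<in> carrier L"
    have ax: "a \<odot>\<^bsub>L\<^esub> x \<in> carrier L" by (rule right_moduleD(3)[OF L a x])
    show "?s (a \<odot>\<^bsub>L\<^esub> x) = a \<odot>\<^bsub>N\<^esub> ?s x"
      by (rule eqI[OF sN[OF ax] right_moduleD(3)[OF N a sN[OF x]]])
        (use fs[OF ax] fs[OF x] homD(3)[OF f a sN[OF x]] homD(3)[OF d a x] in simp)
  qed
  show ?thesis by (rule bexI[OF _ hs]) (simp add: fs)
qed

lemma tuple_hom: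
  assumes P: "right_module A P" and t: "\<And>i. i < n \<Longrightarrow> t i \<in> carrier (adual A P)"
  shows "(\<lambda>x. \<lambda>i\<in>{..<n}. t i x) \<in> module_hom A P (free_mod A n)"
proof -
  have D: "t i x \<in> carrier A" "y \<in> carrier P \<Longrightarrow> t i (x \<oplus>\<^bsub>P\<^esub> y) = t i x \<oplus>\<^bsub>A\<^esub> t i y"
    "a \<in> carrier A \<Longrightarrow> t i (a \<odot>\<^bsub>P\<^esub> x) = t i x \<otimes>\<^bsub>A\<^esub> a"
    if "i < n" "x \<in> carrier P" for i x y a
    using t[OF that(1)] that(2) unfolding adual_simps(1) by blast+
  show ?thesis
    unfolding hom_iff free_mod_simps
  proof (intro conjI ballI)
    fix x y a assume x: "x \<in> carrier P"
    show "(\<lambda>i\<in>{..<n}. t i x) \<in> {..<n} \<rightarrow>\<^sub>E carrier A" using D(1)[OF _ x] by auto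
    show "(\<lambda>i\<in>{..<n}. t i (x \<oplus>\<^bsub>P\<^esub> y)) = (\<lambda>i\<in>{..<n}. (\<lambda>i\<in>{..<n}. t i x) i \<oplus>\<^bsub>A\<^esub> (\<lambda>i\<in>{..<n}. t i y) i)"
      if "y \<in> carrier P" by (rule restrict_ext) (simp add: D(2)[OF _ x that])
    show "(\<lambda>i\<in>{..<n}. t i (a \<odot>\<^bsub>P\<^esub> x)) = (\<lambda>i\<in>{..<n}. (\<lambda>i\<in>{..<n}. t i x) i \<otimes>\<^bsub>A\<^esub> a)"
      if "a \<in> carrier A" by (rule restrict_ext) (simp add: D(3)[OF _ x that])
  qed
qed

text \<open>The coordinates of a section into a free module form one half of the dual basis on which
  the lifting arguments rest.\<close>

lemma coordinate_adual:
  assumes P: "right_module A P" and s: "s \<in> module_hom A P (free_mod A n)" and i: "i < n"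
  shows "(\<lambda>x\<in>carrier P. s x i) \<in> carrier (adual A P)"
  unfolding adual_simps(1)
proof (intro conjI ballI)
  fix x y a assume x: "x \<in> carrier P"
  show "(\<lambda>x\<in>carrier P. s x i) x \<in> carrier A"
    using homD(1)[OF s x] x i by (auto simp: free_mod_simps)
  show "(\<lambda>x\<in>carrier P. s x i) (x \<oplus>\<^bsub>P\<^esub> y) = (\<lambda>x\<in>carrier P. s x i) x \<oplus>\<^bsub>A\<^esub> (\<lambda>x\<in>carrier P. s x i) y"
    if "y \<in> carrier P"
    using homD(2)[OF s x that] right_module_group(2)[OF P x that] x that i by (simp add: free_mod_simps)
  show "(\<lambda>x\<in>carrier P. s x i) (a \<odot>\<^bsub>P\<^esub> x) = (\<lambda>x\<in>carrier P. s x i) x \<otimes>\<^bsub>A\<^esub> a"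
    if "a \<in> carrier A"
    using homD(3)[OF s that x] right_moduleD(3)[OF P that x] x i by (simp add: free_mod_simps)
qed simp

lemma adual_comp:
  assumes P: "right_module A P" and f: "f \<in> module_hom A P Q" and g: "g \<in> carrier (adual A Q)"
  shows "(\<lambda>x\<in>carrier P. g (f x)) \<in> carrier (adual A P)"
proof -
  have D: "y \<in> carrier Q \<Longrightarrow> g y \<in> carrier A"
    "y \<in> carrier Q \<Longrightarrow> z \<in> carrier Q \<Longrightarrow> g (y \<oplus>\<^bsub>Q\<^esub> z) = g y \<oplus>\<^bsub>A\<^esub> g z"
    "a \<in> carrier A \<Longrightarrow> y \<in> carrier Q \<Longrightarrow> g (a \<odot>\<^bsub>Q\<^esub> y) = g y \<otimes>\<^bsub>A\<^esub> a" for y z a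
    using g unfolding adual_simps(1) by blast+
  show ?thesis
    unfolding adual_simps(1)
    by (simp add: D homD[OF f] right_module_group(2)[OF P] right_moduleD(3)[OF P])
qed

lemma min_proj_presD:
  assumes "min_proj_pres A P1 f P0 p M"
  shows "fg_projective A P1" "fg_projective A P0" "fg_mod A M"
    "right_module A P1" "right_module A P0" "right_module A M"
    "f \<in> module_hom A P1 P0" "p \<in> module_hom A P0 M"
    "p ` carrier P0 = carrier M" "f ` carrier P1 = mod_kernel P0 M p"
    "superfluous A (mod_kernel P0 M p) P0" "superfluous A (mod_kernel P1 P0 f) P1"
  using assms unfolding min_proj_pres_def
  by (simp_all add: fg_projective_right_module fg_mod_right_module)

lemma right_submodule_image:
  assumes M: "right_module A M" and N: "right_module A N" and f: "f \<in> module_hom A M N"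
  shows "right_submodule A (f ` carrier M) N"
  unfolding right_submodule_def
proof (intro conjI ballI)
  show "f ` carrier M \<subseteq> carrier N" using homD(1)[OF f] by blast
  show "\<zero>\<^bsub>N\<^esub> \<in> f ` carrier M"
    using hom_zero[OF M N f] right_module_group(1)[OF M] by (metis imageI)
  fix x y assume "x \<in> f ` carrier M" "y \<in> f ` carrier M"
  then obtain u v where "u \<in> carrier M" "v \<in> carrier M" "x = f u" "y = f v" by blast
  then show "x \<oplus>\<^bsub>N\<^esub> y \<in> f ` carrier M"
    using homD(2)[OF f, of u v] right_module_group(2)[OF M] by (metis imageI)
next
  fix a x assume "a \<in> carrier A" "x \<in> f ` carrier M"
  then obtain u where "a \<in> carrier A" "u \<in> carrier M" "x = f u" by blast
  then show "a \<odot>\<^bsub>N\<^esub> x \<in> f ` carrier M"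
    using homD(3)[OF f, of a u] right_moduleD(3)[OF M] by (metis imageI)
qed

lemma zero_submodule:
  assumes "right_module A M"
  shows "right_submodule A {\<zero>\<^bsub>M\<^esub>} M"
  using right_module_group[OF assms] smult_zero_right[OF assms] unfolding right_submodule_def by auto

lemma min_proj_pres_projective:
  assumes pres: "min_proj_pres A P1 f P0 p L" and L: "fg_projective A L"
  shows "carrier P1 = {\<zero>\<^bsub>P1\<^esub>}"
proof -
  note d = min_proj_presD[OF pres]
  interpret P0: abelian_group P0 using d(5) by (rule right_moduleD)
  interpret L: abelian_group L using d(6) by (rule right_moduleD)
  have "(\<lambda>x. x) \<in> module_hom A L L" unfolding hom_iff by simp
  then obtain \<sigma> where \<sigma>: "\<sigma> \<in> module_hom A L P0" "\<And>l. l \<in> carrier L \<Longrightarrow> p (\<sigma> l) = l"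
    using projective_lift[OF L d(5,6,8,9)] by blast
  have "\<exists>u\<in>\<sigma> ` carrier L. \<exists>l\<in>mod_kernel P0 L p. x = u \<oplus>\<^bsub>P0\<^esub> l" if x: "x \<in> carrier P0" for x
  proof -
    let ?u = "\<sigma> (p x)"
    have px: "p x \<in> carrier L" by (rule homD(1)[OF d(8) x])
    have u: "?u \<in> carrier P0" by (rule homD(1)[OF \<sigma>(1) px])
    have mu: "\<ominus>\<^bsub>P0\<^esub> ?u \<in> carrier P0" using u by simp
    have "p (\<ominus>\<^bsub>P0\<^esub> ?u \<oplus>\<^bsub>P0\<^esub> x) = \<zero>\<^bsub>L\<^esub>"
      using homD(2)[OF d(8) mu x] hom_neg[OF d(5,6,8) u] \<sigma>(2)[OF px] px by (simp add: L.l_neg)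
    then have "\<ominus>\<^bsub>P0\<^esub> ?u \<oplus>\<^bsub>P0\<^esub> x \<in> mod_kernel P0 L p" using mu x unfolding mod_kernel_def by simp
    moreover have "x = ?u \<oplus>\<^bsub>P0\<^esub> (\<ominus>\<^bsub>P0\<^esub> ?u \<oplus>\<^bsub>P0\<^esub> x)" using u x by (simp add: P0.r_neg2)
    ultimately show ?thesis using px by blast
  qed
  then have all: "\<sigma> ` carrier L = carrier P0"
    using d(11) right_submodule_image[OF d(6,5) \<sigma>(1)] unfolding superfluous_def by blast
  have k0: "x = \<zero>\<^bsub>P0\<^esub>" if "x \<in> mod_kernel P0 L p" for x
  proof -
    have x: "x \<in> carrier P0" "p x = \<zero>\<^bsub>L\<^esub>" using that unfolding mod_kernel_def by auto
    then obtain l where l: "l \<in> carrier L" "x = \<sigma> l" using all by blast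
    then have "l = \<zero>\<^bsub>L\<^esub>" using \<sigma>(2)[OF l(1)] x by simp
    then show ?thesis using l(2) hom_zero[OF d(6,5) \<sigma>(1)] by simp
  qed
  have ker: "x \<in> mod_kernel P1 P0 f" if "x \<in> carrier P1" for x
    using k0 that d(10) unfolding mod_kernel_def by blast
  have "\<exists>u\<in>{\<zero>\<^bsub>P1\<^esub>}. \<exists>l\<in>mod_kernel P1 P0 f. x = u \<oplus>\<^bsub>P1\<^esub> l" if "x \<in> carrier P1" for x
    using ker[OF that] right_module_group(3)[OF d(4) that, symmetric] by blast
  then show ?thesis
    using d(12) zero_submodule[OF d(4)] unfolding superfluous_def by blast
qed

text \<open>The transpose is a quotient of Hom(P1, A), and here \<open>P1\<close> is zero.\<close>

lemma transpose_projective: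
  fixes A :: "('k::field, 'a) module" and L :: "('a, 'm) module"
  assumes T: "is_transpose A L T" and L: "fg_projective A L"
  shows "zero_mod T"
proof -
  obtain P1 P0 :: "('a, nat \<Rightarrow> 'k) module" and f p q where pres: "min_proj_pres A P1 f P0 p L"
    and q: "q \<in> module_hom (opp A) (adual A P1) T" "q ` carrier (adual A P1) = carrier T"
    using T unfolding is_transpose_def by blast
  note d = min_proj_presD[OF pres]
  have T': "right_module (opp A) T" using T unfolding is_transpose_def fg_mod_def by blast
  have D: "right_module (opp A) (adual A P1)" by (rule adual_right_module[OF d(4)])
  interpret A: ring A using d(4) by (rule right_moduleD)
  have P1: "carrier P1 = {\<zero>\<^bsub>P1\<^esub>}" by (rule min_proj_pres_projective[OF pres L])
  have "g = \<zero>\<^bsub>adual A P1\<^esub>" if g: "g \<in> carrier (adual A P1)" for g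
  proof (rule adual_eqI[OF g right_module_group(1)[OF D]])
    fix x assume "x \<in> carrier P1"
    then have x: "x = \<zero>\<^bsub>P1\<^esub>" and z: "\<zero>\<^bsub>P1\<^esub> \<in> carrier P1" using P1 by auto
    have "g (\<zero>\<^bsub>A\<^esub> \<odot>\<^bsub>P1\<^esub> \<zero>\<^bsub>P1\<^esub>) = g \<zero>\<^bsub>P1\<^esub> \<otimes>\<^bsub>A\<^esub> \<zero>\<^bsub>A\<^esub>" and "g \<zero>\<^bsub>P1\<^esub> \<in> carrier A"
      using g z A.zero_closed unfolding adual_simps(1) by blast+
    then have "g \<zero>\<^bsub>P1\<^esub> = \<zero>\<^bsub>A\<^esub>" using smult_zero_left[OF d(4) z] by simp
    then show "g x = \<zero>\<^bsub>adual A P1\<^esub> x" using x z by (simp add: adual_simps)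
  qed
  then have "carrier (adual A P1) = {\<zero>\<^bsub>adual A P1\<^esub>}" using right_module_group(1)[OF D] by blast
  then show ?thesis
    unfolding zero_mod_def using q(2) hom_zero[OF D T' q(1)] by auto
qed

text \<open>The zero module is a summand of the free module of rank 0. This allows iterated
  translates to be followed past the point where they vanish.\<close>

lemma zero_mod_projective:
  assumes M: "right_module A M" and z: "zero_mod M"
  shows "fg_projective A M"
  unfolding fg_projective_def
proof (intro conjI exI[of _ 0])
  have F: "right_module A (free_mod A 0)" by (rule free_mod_right_module[OF right_moduleD(1)[OF M]])
  have z': "carrier M = {\<zero>\<^bsub>M\<^esub>}" using z unfolding zero_mod_def .
  have c: "carrier (free_mod A 0) = {\<zero>\<^bsub>free_mod A 0\<^esub>}" by (auto simp: free_mod_simps)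
  show "\<exists>s\<in>module_hom A M (free_mod A 0). \<exists>r\<in>module_hom A (free_mod A 0) M. \<forall>x\<in>carrier M. r (s x) = x"
  proof (intro bexI)
    show "(\<lambda>_. \<zero>\<^bsub>free_mod A 0\<^esub>) \<in> module_hom A M (free_mod A 0)"
      using right_module_group[OF F] smult_zero_right[OF F] unfolding hom_iff by simp
    show "(\<lambda>_. \<zero>\<^bsub>M\<^esub>) \<in> module_hom A (free_mod A 0) M"
      using right_module_group[OF M] smult_zero_right[OF M] unfolding hom_iff by simp
  qed (simp add: z')
qed (rule M)

section \<open>Bricks, and their behaviour under D and Tr\<close>

context bip
begin

text \<open>The zero module satisfies this as well; the vanishing of a translate is therefore
  recorded separately in the statements below.\<close>

definition brick :: "('b \<Rightarrow> 'k, 'm) module \<Rightarrow> bool" where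
  "brick M \<longleftrightarrow> (\<forall>\<theta>\<in>module_hom A M M. \<exists>c. \<forall>x\<in>carrier M. \<theta> x = scal c \<odot>\<^bsub>M\<^esub> x)"

lemma brickD:
  assumes "brick M" "\<theta> \<in> module_hom A M M"
  shows "\<exists>c. \<forall>x\<in>carrier M. \<theta> x = scal c \<odot>\<^bsub>M\<^esub> x"
  using assms(1) unfolding brick_def by (rule bspec) (rule assms(2))

lemma scal_hom:
  assumes M: "right_module A M"
  shows "(\<lambda>x. scal c \<odot>\<^bsub>M\<^esub> x) \<in> module_hom A M M"
  unfolding hom_iff
proof (intro conjI ballI)
  have s: "scal c \<in> carrier A" by blast
  fix x y assume x: "x \<in> carrier M"
  show "scal c \<odot>\<^bsub>M\<^esub> x \<in> carrier M" by (rule right_moduleD(3)[OF M s x])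
  show "scal c \<odot>\<^bsub>M\<^esub> (x \<oplus>\<^bsub>M\<^esub> y) = scal c \<odot>\<^bsub>M\<^esub> x \<oplus>\<^bsub>M\<^esub> scal c \<odot>\<^bsub>M\<^esub> y" if "y \<in> carrier M"
    by (rule right_moduleD(5)[OF M s x that])
  show "scal c \<odot>\<^bsub>M\<^esub> (a \<odot>\<^bsub>M\<^esub> x) = a \<odot>\<^bsub>M\<^esub> (scal c \<odot>\<^bsub>M\<^esub> x)" if "a \<in> carrier A" for a
    using smult_scal[OF M that x] by simp
qed

text \<open>A nonzero map \<open>L \<rightarrow> A\<close> yields a surjection of \<open>L\<close> onto some \<open>e\<^sub>v A\<close>; it splits, and a brick
  has no proper direct summands.\<close>

lemma brick_projective:
  assumes L: "right_module A L" and b: "brick L" and \<theta>: "\<theta> \<in> carrier (adual A L)"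
    and l: "l \<in> carrier L" "\<theta> l \<noteq> \<zero>\<^bsub>A\<^esub>"
  shows "fg_projective A L"
proof -
  interpret A: ring A by (rule ring_A)
  have "\<exists>g\<in>carrier (adual A L). \<exists>v\<in>V. \<exists>m\<in>carrier L. (\<forall>x\<in>carrier L. ee v \<otimes>\<^bsub>A\<^esub> g x = g x) \<and> g m = ee v"
  proof (cases "\<exists>x\<in>carrier L. \<exists>v\<in>V. \<theta> x (eb v) \<noteq> 0")
    case True
    then obtain x v where x: "x \<in> carrier L" and v: "v \<in> V" and nz: "\<theta> x (eb v) \<noteq> 0" by blast
    have e: "ee v \<in> carrier A" using v by blast
    \<comment> \<open>If some value has a nonzero coefficient at a vertex, cutting it down by
      \<open>ee v\<close> on both sides leaves a multiple of \<open>ee v\<close>, since the quiver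
      has no cycles; \<open>?c\<close> normalises it.\<close>
    let ?g = "\<lambda>x\<in>carrier L. ee v \<otimes>\<^bsub>A\<^esub> \<theta> x" and ?c = "inverse (\<theta> x (eb v))"
    let ?m = "scal ?c \<odot>\<^bsub>L\<^esub> (ee v \<odot>\<^bsub>L\<^esub> x)"
    have g: "?g \<in> carrier (adual A L)"
      using right_moduleD(3)[OF adual_right_module[OF L], of "ee v" \<theta>] e \<theta> by (simp add: adual_simps(4))
    have ex: "ee v \<odot>\<^bsub>L\<^esub> x \<in> carrier L" by (rule right_moduleD(3)[OF L e x])
    have s: "scal c \<in> carrier A" for c by blast
    have m: "?m \<in> carrier L" by (rule right_moduleD(3)[OF L s ex])
    have tx: "\<theta> x \<in> carrier A" by (rule adualD(1)[OF \<theta> x])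
    have "ee v \<otimes>\<^bsub>A\<^esub> \<theta> x \<otimes>\<^bsub>A\<^esub> ee v = \<theta> x (eb v) \<odot>\<^bsub>A\<^esub> ee v"
    proof (rule A_eqI)
      show "ee v \<otimes>\<^bsub>A\<^esub> \<theta> x \<otimes>\<^bsub>A\<^esub> ee v \<in> carrier A" using e tx by simp
      show "\<theta> x (eb v) \<odot>\<^bsub>A\<^esub> ee v \<in> carrier A" by (rule A_closed(4)[OF e])
      show "(ee v \<otimes>\<^bsub>A\<^esub> \<theta> x \<otimes>\<^bsub>A\<^esub> ee v) (eb u) = (\<theta> x (eb v) \<odot>\<^bsub>A\<^esub> ee v) (eb u)" if "u \<in> V" for u
        using mult_eb[OF A.m_closed[OF e tx] e that] mult_eb[OF e tx that] that v by (simp add: ev)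
      show "(ee v \<otimes>\<^bsub>A\<^esub> \<theta> x \<otimes>\<^bsub>A\<^esub> ee v) (ab (x', y)) = (\<theta> x (eb v) \<odot>\<^bsub>A\<^esub> ee v) (ab (x', y))"
        if "(x', y) \<in> E" for x' y
        using mult_ab[OF A.m_closed[OF e tx] e that] mult_ab[OF e tx that] that v E_V(1-3)[OF that] by (auto simp: ev)
    qed
    then have "?g (ee v \<odot>\<^bsub>L\<^esub> x) = \<theta> x (eb v) \<odot>\<^bsub>A\<^esub> ee v"
      using adualD(3)[OF \<theta> e x] ex A.m_assoc[OF e tx e] by simp
    then have "?g ?m = ?c \<odot>\<^bsub>A\<^esub> (\<theta> x (eb v) \<odot>\<^bsub>A\<^esub> ee v)"
      using adualD(3)[OF g s ex] mult_rules(11)[OF adualD(1)[OF g ex]] by simp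
    then have "?g ?m = ee v" using nz by (simp add: smult_A fun_eq_iff)
    moreover have "\<forall>x\<in>carrier L. ee v \<otimes>\<^bsub>A\<^esub> ?g x = ?g x"
      using A.m_assoc[OF e e adualD(1)[OF \<theta>]] mult_rules(1)[OF e v v] by simp
    ultimately show ?thesis using g v m by blast
  next
    case False
    then have z: "\<And>x v. x \<in> carrier L \<Longrightarrow> v \<in> V \<Longrightarrow> \<theta> x (eb v) = 0" by blast
    have "\<exists>x y. (x, y) \<in> E \<and> \<theta> l (ab (x, y)) \<noteq> 0"
    proof (rule ccontr)
      assume "\<not> (\<exists>x y. (x, y) \<in> E \<and> \<theta> l (ab (x, y)) \<noteq> 0)"
      then have "\<theta> l = \<zero>\<^bsub>A\<^esub>"
        using z[OF l(1)] by (intro A_eqI adualD(1)[OF \<theta> l(1)]) (auto simp: ev)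
      then show False using l(2) by simp
    qed
    then obtain x y where xy: "(x, y) \<in> E" and nz: "\<theta> l (ab (x, y)) \<noteq> 0" by blast
    have V': "x \<in> V" "y \<in> V" and y: "y \<in> Y" using E_V(1,2)[OF xy] by auto
    have e: "ee y \<in> carrier A" using V' by blast
    \<comment> \<open>All values lie in the span of the arrows now, so the coefficient of
      \<open>\<theta>\<close> at an arrow into the sink \<open>y\<close> transforms under
      \<open>a\<close> by the scalar \<open>a (eb y)\<close>. Multiplying it by \<open>ee y\<close>
      gives a homomorphism into e_y A.\<close>
    let ?h = "\<lambda>p. \<theta> p (ab (x, y)) \<odot>\<^bsub>A\<^esub> ee y"
    have val: "\<theta> (a \<odot>\<^bsub>L\<^esub> p) (ab (x, y)) = \<theta> p (ab (x, y)) * a (eb y)" if "a \<in> carrier A" "p \<in> carrier L" for a p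
      using adualD(3)[OF \<theta> that] mult_ab[OF adualD(1)[OF \<theta> that(2)] that(1) xy] z[OF that(2) V'(1)] by simp
    have "?h \<in> module_hom A L (regular_mod A)"
      unfolding hom_iff regular_mod_simps
    proof (intro conjI ballI)
      fix p q assume p: "p \<in> carrier L"
      show "?h p \<in> carrier A" by (rule A_closed(4)[OF e])
      show "?h (p \<oplus>\<^bsub>L\<^esub> q) = ?h p \<oplus>\<^bsub>A\<^esub> ?h q" if "q \<in> carrier L"
        using adualD(2)[OF \<theta> p that] by (simp add: ev) (simp add: smult_A add_A fun_eq_iff algebra_simps)
      show "?h (a \<odot>\<^bsub>L\<^esub> p) = ?h p \<otimes>\<^bsub>A\<^esub> a" if a: "a \<in> carrier A" for a
        unfolding val[OF a p] mult_rules(8)[OF e a] mult_rules(3)[OF a y] by (simp add: smult_A fun_eq_iff)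
    qed
    then have g: "restrict ?h (carrier L) \<in> carrier (adual A L)"
      using right_module_group(2)[OF L] right_moduleD(3)[OF L]
      unfolding hom_iff adual_simps(1) by (simp add: regular_mod_simps)
    have s: "scal c \<in> carrier A" for c by blast
    let ?m = "scal (inverse (\<theta> l (ab (x, y)))) \<odot>\<^bsub>L\<^esub> l"
    have m: "?m \<in> carrier L" by (rule right_moduleD(3)[OF L s l(1)])
    have "restrict ?h (carrier L) ?m = ee y"
      using m val[OF s l(1)] nz V' by (simp add: ev) (simp add: smult_A fun_eq_iff)
    moreover have "\<forall>p\<in>carrier L. ee y \<otimes>\<^bsub>A\<^esub> restrict ?h (carrier L) p = restrict ?h (carrier L) p"
      using mult_rules(9)[OF e e] mult_rules(1)[OF e V'(2) V'(2)] by simp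
    ultimately show ?thesis using g V' m by blast
  qed
  then obtain g v m where g: "g \<in> carrier (adual A L)" and v: "v \<in> V" and m: "m \<in> carrier L"
    and vg: "\<And>x. x \<in> carrier L \<Longrightarrow> ee v \<otimes>\<^bsub>A\<^esub> g x = g x" and gm: "g m = ee v" by blast
  have e: "ee v \<in> carrier A" using v by blast
  \<comment> \<open>The map \<open>g\<close> followed by the homomorphism A -> L that sends the unit
    to \<open>m\<close>. As an endomorphism of a brick it is a scalar, and applying \<open>g\<close>
    to the image of \<open>m\<close> gives \<open>ee v\<close> again, so the scalar is 1 and the
    identity of \<open>L\<close> factors through \<open>A\<close>.\<close>
  let ?k = "\<lambda>x. g x \<odot>\<^bsub>L\<^esub> m"
  have k: "?k \<in> module_hom A L L"
    unfolding hom_iff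
    using right_moduleD(3)[OF L adualD(1)[OF g] m] right_moduleD(4)[OF L adualD(1)[OF g] adualD(1)[OF g] m]
      right_moduleD(6)[OF L adualD(1)[OF g] _ m] adualD(2,3)[OF g] by auto
  then obtain c where "\<forall>x\<in>carrier L. ?k x = scal c \<odot>\<^bsub>L\<^esub> x" using brickD[OF b k] by (elim exE)
  then have c: "?k x = scal c \<odot>\<^bsub>L\<^esub> x" if "x \<in> carrier L" for x using that by (rule bspec)
  have s: "scal c \<in> carrier A" by blast
  have "g (?k m) = c \<odot>\<^bsub>A\<^esub> ee v"
    using c[OF m] adualD(3)[OF g s m] mult_rules(11)[OF adualD(1)[OF g m]] gm by simp
  moreover have "g (?k m) = ee v"
    using adualD(3)[OF g adualD(1)[OF g m] m] gm mult_rules(1)[OF e v v] by simp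
  ultimately have "ee v (eb v) = (c \<odot>\<^bsub>A\<^esub> ee v) (eb v)" by simp
  then have "c = 1" using v by (simp add: ev)
  then have id: "?k x = x" if "x \<in> carrier L" for x
    using c[OF that] right_moduleD(7)[OF L that] by (simp add: scal_rules)
  show ?thesis
    unfolding fg_projective_def
  proof (intro conjI exI[of _ 1] bexI ballI)
    let ?s = "\<lambda>x. \<lambda>i\<in>{..<1::nat}. g x" and ?r = "\<lambda>w. w 0 \<odot>\<^bsub>L\<^esub> m"
    show "?s \<in> module_hom A L (free_mod A 1)" using tuple_hom[OF L, of 1 "\<lambda>_. g"] g by simp
    show "?r \<in> module_hom A (free_mod A 1) L"
      using right_moduleD(3,4,6)[OF L] m unfolding hom_iff free_mod_simps by (auto simp: PiE_def Pi_def)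
    show "?r (?s x) = x" if "x \<in> carrier L" for x using id[OF that] by simp
  qed (rule L)
qed

text \<open>By double duality an endomorphism of the dual is the transpose of a map \<open>h\<close>
  on \<open>M\<close>. Functionals separate points, so \<open>h\<close> is a homomorphism and
  therefore a scalar. The conclusion is \<open>brick\<close> over the opposite algebra, written
  out.\<close>

lemma brick_kdual:
  assumes M: "right_module A M" and fM: "fdim (kspace A M)" and b: "brick M"
    and \<theta>: "\<theta> \<in> module_hom (opp A) (kdual A M) (kdual A M)"
  shows "\<exists>c. \<forall>\<phi>\<in>carrier (kdual A M). \<theta> \<phi> = scal c \<odot>\<^bsub>kdual A M\<^esub> \<phi>"
proof -
  let ?D = "kdual A M"
  have cD: "carrier ?D = carrier (vdual (kspace A M))" by (rule kdual_simps(1))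
  note D = homD[OF \<theta>]
  have "\<exists>y\<in>carrier M. \<forall>\<phi>\<in>carrier ?D. \<theta> \<phi> x = \<phi> y" if x: "x \<in> carrier M" for x
  proof -
    have "\<exists>y\<in>carrier (kspace A M). \<forall>\<phi>\<in>carrier (vdual (kspace A M)). \<theta> \<phi> x = \<phi> y"
    proof (rule double_dual[OF fM])
      fix \<phi> \<psi> c assume \<phi>: "\<phi> \<in> carrier (vdual (kspace A M))"
      have "c \<odot>\<^bsub>vdual (kspace A M)\<^esub> \<phi> = scal c \<odot>\<^bsub>?D\<^esub> \<phi>"
        using \<phi> unfolding vdual_simps(1) kdual_simps kspace_simps by (auto simp: vdual_simps kspace_simps cong: restrict_cong)
      then show "\<theta> (c \<odot>\<^bsub>vdual (kspace A M)\<^esub> \<phi>) x = c * \<theta> \<phi> x"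
        using D(3)[of "scal c" \<phi>] D(1)[of \<phi>] \<phi> x A_closed(4)[OF A_closed(2)]
        by (simp add: cD kdual_simps(4)) (simp add: cD[symmetric] kdual_mem)
      assume "\<psi> \<in> carrier (vdual (kspace A M))"
      then show "\<theta> (\<phi> \<oplus>\<^bsub>vdual (kspace A M)\<^esub> \<psi>) x = \<theta> \<phi> x + \<theta> \<psi> x"
        using D(2)[of \<phi> \<psi>] \<phi> x by (simp add: cD kdual_simps(3) vdual_simps(3) kspace_simps)
    qed
    then show ?thesis unfolding cD kspace_simps .
  qed
  then obtain h where h: "\<And>x. x \<in> carrier M \<Longrightarrow> h x \<in> carrier M"
    and h\<theta>: "\<And>x \<phi>. x \<in> carrier M \<Longrightarrow> \<phi> \<in> carrier ?D \<Longrightarrow> \<theta> \<phi> x = \<phi> (h x)" by metis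
  have sep: "x = y" if "x \<in> carrier M" "y \<in> carrier M" "\<And>\<phi>. \<phi> \<in> carrier ?D \<Longrightarrow> \<phi> x = \<phi> y" for x y
    by (rule functionals_separate[OF fM]) (use that in \<open>simp_all add: kspace_simps cD\<close>)
  have "h \<in> module_hom A M M"
    unfolding hom_iff
  proof (intro conjI ballI)
    fix x y assume x: "x \<in> carrier M"
    show "h x \<in> carrier M" by (rule h[OF x])
    assume y: "y \<in> carrier M"
    have xy: "x \<oplus>\<^bsub>M\<^esub> y \<in> carrier M" by (rule right_module_group(2)[OF M x y])
    show "h (x \<oplus>\<^bsub>M\<^esub> y) = h x \<oplus>\<^bsub>M\<^esub> h y"
    proof (rule sep[OF h[OF xy] right_module_group(2)[OF M h[OF x] h[OF y]]])
      fix \<phi> assume \<phi>: "\<phi> \<in> carrier ?D"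
      have "\<theta> \<phi> (x \<oplus>\<^bsub>M\<^esub> y) = \<theta> \<phi> x + \<theta> \<phi> y" using D(1)[OF \<phi>] x y unfolding kdual_mem by blast
      moreover have "\<phi> (h x \<oplus>\<^bsub>M\<^esub> h y) = \<phi> (h x) + \<phi> (h y)" using \<phi> h[OF x] h[OF y] unfolding kdual_mem by blast
      ultimately show "\<phi> (h (x \<oplus>\<^bsub>M\<^esub> y)) = \<phi> (h x \<oplus>\<^bsub>M\<^esub> h y)"
        using h\<theta>[OF xy \<phi>] h\<theta>[OF x \<phi>] h\<theta>[OF y \<phi>] by simp
    qed
  next
    fix a x assume a: "a \<in> carrier A" and x: "x \<in> carrier M"
    have ax: "a \<odot>\<^bsub>M\<^esub> x \<in> carrier M" by (rule right_moduleD(3)[OF M a x])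
    show "h (a \<odot>\<^bsub>M\<^esub> x) = a \<odot>\<^bsub>M\<^esub> h x"
    proof (rule sep[OF h[OF ax] right_moduleD(3)[OF M a h[OF x]]])
      fix \<phi> assume \<phi>: "\<phi> \<in> carrier ?D"
      have a': "a \<odot>\<^bsub>?D\<^esub> \<phi> \<in> carrier ?D" using right_moduleD(3)[OF kdual_right_module[OF M], of a \<phi>] a \<phi> by simp
      have "\<theta> (a \<odot>\<^bsub>?D\<^esub> \<phi>) = a \<odot>\<^bsub>?D\<^esub> \<theta> \<phi>" using D(3)[of a \<phi>] a \<phi> by simp
      then have "\<theta> (a \<odot>\<^bsub>?D\<^esub> \<phi>) x = \<theta> \<phi> (a \<odot>\<^bsub>M\<^esub> x)" using x by (simp add: kdual_simps(4))
      moreover have "\<theta> (a \<odot>\<^bsub>?D\<^esub> \<phi>) x = \<phi> (a \<odot>\<^bsub>M\<^esub> h x)"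
        using h\<theta>[OF x a'] h[OF x] by (simp add: kdual_simps(4))
      ultimately show "\<phi> (h (a \<odot>\<^bsub>M\<^esub> x)) = \<phi> (a \<odot>\<^bsub>M\<^esub> h x)" using h\<theta>[OF ax \<phi>] by simp
    qed
  qed
  then obtain c where c: "\<forall>x\<in>carrier M. h x = scal c \<odot>\<^bsub>M\<^esub> x" using brickD[OF b] by blast
  have "\<theta> \<phi> = scal c \<odot>\<^bsub>?D\<^esub> \<phi>" if \<phi>: "\<phi> \<in> carrier ?D" for \<phi>
  proof (rule extensionalityI[of _ "carrier M"])
    show "\<theta> \<phi> \<in> extensional (carrier M)" using D(1)[OF \<phi>] unfolding kdual_mem by blast
    show "scal c \<odot>\<^bsub>?D\<^esub> \<phi> \<in> extensional (carrier M)" by (simp add: kdual_simps(4))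
    show "\<theta> \<phi> x = (scal c \<odot>\<^bsub>?D\<^esub> \<phi>) x" if "x \<in> carrier M" for x
      using h\<theta>[OF that \<phi>] c that by (simp add: kdual_simps(4))
  qed
  then show ?thesis by blast
qed

text \<open>Lifting an endomorphism \<open>\<theta>\<close> of a quotient of \<open>Hom\<^sub>A(P, A)\<close> along the dual basis of \<open>P\<close>.\<close>

lemma lift_dual_endo:
  assumes P: "fg_projective A P" and T: "right_module (opp A) T"
    and q: "q \<in> module_hom (opp A) (adual A P) T" and onto: "q ` carrier (adual A P) = carrier T"
    and \<theta>: "\<theta> \<in> module_hom (opp A) T T"
  shows "\<exists>h\<in>module_hom A P P. \<forall>g\<in>carrier (adual A P). \<theta> (q g) = q (\<lambda>x\<in>carrier P. g (h x))"
proof -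
  obtain n s r where PM: "right_module A P" and s: "s \<in> module_hom A P (free_mod A n)"
    and r: "r \<in> module_hom A (free_mod A n) P" and rs: "\<And>p. p \<in> carrier P \<Longrightarrow> r (s p) = p"
    using fg_projectiveE[OF P] by metis
  interpret A: ring A by (rule ring_A)
  let ?F = "free_mod A n" and ?D = "adual A P"
  have D: "right_module (opp A) ?D" by (rule adual_right_module[OF PM])
  have F: "right_module A ?F" by (rule free_mod_right_module[OF ring_A])
  \<comment> \<open>The coordinate functions of the section \<open>s\<close>. Every \<open>g\<close>
    is the sum of the \<open>\<sigma> i\<close> with coefficients \<open>g (r (u i))\<close>, so it
    suffices to lift \<open>\<theta>\<close> on these.\<close>
  define \<sigma> where "\<sigma> i = (\<lambda>x\<in>carrier P. s x i)" for i
  have \<sigma>: "\<sigma> i \<in> carrier ?D" if "i < n" for i unfolding \<sigma>_def by (rule coordinate_adual[OF PM s that])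
  have "\<exists>t\<in>carrier ?D. q t = \<theta> (q (\<sigma> i))" if "i < n" for i
  proof -
    have "\<theta> (q (\<sigma> i)) \<in> q ` carrier ?D" unfolding onto by (rule homD(1)[OF \<theta> homD(1)[OF q \<sigma>[OF that]]])
    then show ?thesis by force
  qed
  then obtain t where t: "\<And>i. i < n \<Longrightarrow> t i \<in> carrier ?D" and qt: "\<And>i. i < n \<Longrightarrow> q (t i) = \<theta> (q (\<sigma> i))"
    by metis
  \<comment> \<open>Replacing each coordinate \<open>\<sigma> i\<close> by the chosen preimage
    \<open>t i\<close> of \<open>\<theta> (q (\<sigma> i))\<close> turns the identity, which is
    \<open>r\<close> after \<open>s\<close>, into the desired lift.\<close>
  let ?\<tau> = "\<lambda>x. \<lambda>i\<in>{..<n}. t i x"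
  have \<tau>: "?\<tau> \<in> module_hom A P ?F" by (rule tuple_hom[OF PM t])
  have h: "(\<lambda>x. r (?\<tau> x)) \<in> module_hom A P P" by (rule hom_comp[OF \<tau> r])
  have "\<theta> (q g) = q (\<lambda>x\<in>carrier P. g (r (?\<tau> x)))" if g: "g \<in> carrier ?D" for g
  proof -
    define u where "u i = single A n i \<one>\<^bsub>A\<^esub>" for i
    have u: "u i \<in> carrier ?F" for i unfolding u_def by (rule single_closed[OF ring_A]) simp
    have ru: "r (u i) \<in> carrier P" for i by (rule homD(1)[OF r u])
    have gru: "g (r (u i)) \<in> carrier A" for i by (rule adualD(1)[OF g ru])
    have step: "(\<lambda>x\<in>carrier P. g (r (trunc A n (Suc k) (w x)))) =
        (\<lambda>x\<in>carrier P. g (r (trunc A n k (w x)))) \<oplus>\<^bsub>?D\<^esub> g (r (u k)) \<odot>\<^bsub>?D\<^esub> (\<lambda>x\<in>carrier P. w x k)"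
      if k: "k < n" and w: "\<And>x. x \<in> carrier P \<Longrightarrow> w x \<in> carrier ?F" for k w
    proof -
      have "g (r (trunc A n (Suc k) (w x))) = g (r (trunc A n k (w x))) \<oplus>\<^bsub>A\<^esub> g (r (u k)) \<otimes>\<^bsub>A\<^esub> w x k"
        if x: "x \<in> carrier P" for x
      proof -
        note tp = trunc_props[OF ring_A w[OF x]]
        have wk: "w x k \<in> carrier A" using w[OF x] k by (auto simp: free_mod_simps)
        have sg: "single A n k (w x k) = w x k \<odot>\<^bsub>?F\<^esub> u k"
          using smult_single[OF ring_A A.one_closed wk] wk unfolding u_def by simp
        have "r (trunc A n (Suc k) (w x)) = r (trunc A n k (w x)) \<oplus>\<^bsub>P\<^esub> w x k \<odot>\<^bsub>P\<^esub> r (u k)"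
          unfolding tp(4)[OF k] sg
          using homD(2)[OF r tp(3) right_moduleD(3)[OF F wk u]] homD(3)[OF r wk u] by simp
        then show ?thesis
          using adualD(2)[OF g homD(1)[OF r tp(3)] right_moduleD(3)[OF PM wk ru]] adualD(3)[OF g wk ru] by simp
      qed
      then show ?thesis by (simp add: adual_simps cong: restrict_cong)
    qed
    have base: "(\<lambda>x\<in>carrier P. g (r (trunc A n 0 (w x)))) = \<zero>\<^bsub>?D\<^esub>"
      if w: "\<And>x. x \<in> carrier P \<Longrightarrow> w x \<in> carrier ?F" for w
    proof -
      have "g \<zero>\<^bsub>P\<^esub> = \<zero>\<^bsub>A\<^esub>"
        using adualD(3)[OF g A.zero_closed right_module_group(1)[OF PM]]
          smult_zero_left[OF PM right_module_group(1)[OF PM]] adualD(1)[OF g right_module_group(1)[OF PM]] by simp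
      then show ?thesis
        using trunc_props(1)[OF ring_A w] hom_zero[OF F PM r] by (simp add: adual_simps cong: restrict_cong)
    qed
    \<comment> \<open>Partial sums of the expansions along \<open>t\<close> and along
      \<open>\<sigma>\<close>; induction on \<open>k\<close> compares them under
      \<open>q\<close>.\<close>
    define ga where "ga k = (\<lambda>x\<in>carrier P. g (r (trunc A n k (?\<tau> x))))" for k
    define gb where "gb k = (\<lambda>x\<in>carrier P. g (r (trunc A n k (s x))))" for k
    note \<tau>c = homD(1)[OF \<tau>] and sc = homD(1)[OF s]
    have "ga k \<in> carrier ?D \<and> gb k \<in> carrier ?D \<and> q (ga k) = \<theta> (q (gb k))" if "k \<le> n" for k
      using that
    proof (induction k)
      case 0
      have a: "ga 0 = \<zero>\<^bsub>?D\<^esub>" unfolding ga_def by (rule base[of ?\<tau>, OF \<tau>c])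
      have b: "gb 0 = \<zero>\<^bsub>?D\<^esub>" unfolding gb_def by (rule base[of s, OF sc])
      show ?case
        unfolding a b using right_module_group(1)[OF D] hom_zero[OF D T q] hom_zero[OF T T \<theta>] by simp
    next
      case (Suc k)
      then have k: "k < n" and IH: "ga k \<in> carrier ?D" "gb k \<in> carrier ?D" "q (ga k) = \<theta> (q (gb k))" by auto
      let ?g = "g (r (u k))"
      have tk: "(\<lambda>x\<in>carrier P. ?\<tau> x k) = t k"
        using k t[OF k] unfolding adual_simps(1) by (auto simp: fun_eq_iff extensional_def)
      have sk: "(\<lambda>x\<in>carrier P. s x k) = \<sigma> k" by (simp add: \<sigma>_def)
      have a: "ga (Suc k) = ga k \<oplus>\<^bsub>?D\<^esub> ?g \<odot>\<^bsub>?D\<^esub> t k" using step[of k ?\<tau>, OF k \<tau>c] unfolding tk ga_def .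
      have b: "gb (Suc k) = gb k \<oplus>\<^bsub>?D\<^esub> ?g \<odot>\<^bsub>?D\<^esub> \<sigma> k" using step[of k s, OF k sc] unfolding sk gb_def .
      have g': "?g \<in> carrier (opp A)" using gru by simp
      have ta: "?g \<odot>\<^bsub>?D\<^esub> t k \<in> carrier ?D" by (rule right_moduleD(3)[OF D g' t[OF k]])
      have sa: "?g \<odot>\<^bsub>?D\<^esub> \<sigma> k \<in> carrier ?D" by (rule right_moduleD(3)[OF D g' \<sigma>[OF k]])
      have "q (ga (Suc k)) = q (ga k) \<oplus>\<^bsub>T\<^esub> ?g \<odot>\<^bsub>T\<^esub> q (t k)"
        unfolding a using homD(2)[OF q IH(1) ta] homD(3)[OF q g' t[OF k]] by simp
      also have "\<dots> = \<theta> (q (gb k)) \<oplus>\<^bsub>T\<^esub> \<theta> (?g \<odot>\<^bsub>T\<^esub> q (\<sigma> k))"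
        using IH(3) qt[OF k] homD(3)[OF \<theta> g' homD(1)[OF q \<sigma>[OF k]]] by simp
      also have "\<dots> = \<theta> (q (gb k) \<oplus>\<^bsub>T\<^esub> q (?g \<odot>\<^bsub>?D\<^esub> \<sigma> k))"
        using homD(2)[OF \<theta> homD(1)[OF q IH(2)] homD(1)[OF q sa]] homD(3)[OF q g' \<sigma>[OF k]] by simp
      also have "\<dots> = \<theta> (q (gb (Suc k)))" unfolding b using homD(2)[OF q IH(2) sa] by simp
      finally show ?case
        using right_module_group(2)[OF D IH(1) ta] right_module_group(2)[OF D IH(2) sa] a b by simp
    qed
    from this[of n] have "q (ga n) = \<theta> (q (gb n))" by simp
    moreover have "ga n = (\<lambda>x\<in>carrier P. g (r (?\<tau> x)))"
      unfolding ga_def using trunc_props(2)[OF ring_A \<tau>c] by (simp cong: restrict_cong)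
    moreover have "gb n = g"
    proof -
      have "gb n = (\<lambda>x\<in>carrier P. g x)"
        unfolding gb_def using trunc_props(2)[OF ring_A sc] rs by (simp cong: restrict_cong)
      then show ?thesis using g unfolding adual_simps(1) by (auto simp: fun_eq_iff extensional_def)
    qed
    ultimately show ?thesis by simp
  qed
  then show ?thesis using h by (intro bexI[of _ "\<lambda>x. r (?\<tau> x)"]) auto
qed

text \<open>An endomorphism of the transpose lifts to \<open>h1\<close> on \<open>P1\<close>,
  extends to \<open>h0\<close> on \<open>P0\<close> and induces an endomorphism of \<open>L\<close>,
  which is a scalar \<open>c\<close>. Then \<open>h0 - c\<close> has its image in the kernel of
  \<open>p\<close> and factors through the injective \<open>f\<close>, so \<open>h1 - c\<close>
  factors through \<open>f\<close> and acts as zero on the cokernel.\<close>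

lemma brick_transpose:
  assumes pres: "min_proj_pres A P1 f P0 p L" and inj: "inj_on f (carrier P1)" and b: "brick L"
    and T: "right_module (opp A) T"
    and q: "q \<in> module_hom (opp A) (adual A P1) T" and onto: "q ` carrier (adual A P1) = carrier T"
    and ker: "mod_kernel (adual A P1) T q = adual_map P1 P0 f ` carrier (adual A P0)"
    and \<theta>: "\<theta> \<in> module_hom (opp A) T T"
  shows "\<exists>c. \<forall>x\<in>carrier T. \<theta> x = scal c \<odot>\<^bsub>T\<^esub> x"
proof -
  note d = min_proj_presD[OF pres]
  note P1 = d(4) and P0 = d(5) and L = d(6) and f = d(7) and p = d(8)
  interpret A: ring A by (rule ring_A)
  have D1: "right_module (opp A) (adual A P1)" by (rule adual_right_module[OF P1])
  have kerI: "q (\<lambda>x\<in>carrier P1. g (f x)) = \<zero>\<^bsub>T\<^esub>" if "g \<in> carrier (adual A P0)" for g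
    using ker that unfolding mod_kernel_def adual_map_def by auto
  obtain h1 where h1: "h1 \<in> module_hom A P1 P1"
    and qh: "\<And>g. g \<in> carrier (adual A P1) \<Longrightarrow> \<theta> (q g) = q (\<lambda>x\<in>carrier P1. g (h1 x))"
    using lift_dual_endo[OF d(1) T q onto \<theta>] by metis
  obtain n s r where s: "s \<in> module_hom A P0 (free_mod A n)"
    and r: "r \<in> module_hom A (free_mod A n) P0" and rs: "\<And>x. x \<in> carrier P0 \<Longrightarrow> r (s x) = x"
    using fg_projectiveE[OF d(2)] by metis
  define \<sigma> where "\<sigma> i = (\<lambda>x\<in>carrier P0. s x i)" for i
  have \<sigma>: "\<sigma> i \<in> carrier (adual A P0)" if "i < n" for i
    unfolding \<sigma>_def by (rule coordinate_adual[OF P0 s that])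
  \<comment> \<open>The composite of \<open>f\<close> and \<open>\<sigma> i\<close> is zero in
    \<open>T\<close>, hence so is its image under the lift of \<open>\<theta>\<close>. Lying in the
    kernel of \<open>q\<close>, that image is again a composite of \<open>f\<close> with some
    \<open>g\<close>.\<close>
  have "\<exists>g\<in>carrier (adual A P0). \<forall>x\<in>carrier P1. g (f x) = \<sigma> i (f (h1 x))" if i: "i < n" for i
  proof -
    let ?g = "\<lambda>x\<in>carrier P1. \<sigma> i (f x)"
    have g: "?g \<in> carrier (adual A P1)" by (rule adual_comp[OF P1 f \<sigma>[OF i]])
    have hg: "(\<lambda>x\<in>carrier P1. ?g (h1 x)) \<in> carrier (adual A P1)" by (rule adual_comp[OF P1 h1 g])
    have "q (\<lambda>x\<in>carrier P1. ?g (h1 x)) = \<theta> \<zero>\<^bsub>T\<^esub>" using qh[OF g] kerI[OF \<sigma>[OF i]] by simp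
    then have "(\<lambda>x\<in>carrier P1. ?g (h1 x)) \<in> mod_kernel (adual A P1) T q"
      using hg hom_zero[OF T T \<theta>] unfolding mod_kernel_def by simp
    then obtain g' where g': "g' \<in> carrier (adual A P0)"
      and eq: "(\<lambda>x\<in>carrier P1. ?g (h1 x)) = (\<lambda>x\<in>carrier P1. g' (f x))"
      unfolding ker adual_map_def by blast
    have "g' (f x) = \<sigma> i (f (h1 x))" if "x \<in> carrier P1" for x
      using fun_cong[OF eq, of x] that homD(1)[OF h1 that] by simp
    then show ?thesis using g' by blast
  qed
  then obtain g where g: "\<And>i. i < n \<Longrightarrow> g i \<in> carrier (adual A P0)"
    and gf: "\<And>i x. i < n \<Longrightarrow> x \<in> carrier P1 \<Longrightarrow> g i (f x) = \<sigma> i (f (h1 x))" by metis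
  \<comment> \<open>Assembling the \<open>g i\<close> by \<open>r\<close> extends \<open>h1\<close>
    to \<open>P0\<close>: at \<open>f x\<close> the coordinates are those of
    \<open>f (h1 x)\<close>, and \<open>r\<close> recovers this element from them.\<close>
  let ?h0 = "\<lambda>y. r (\<lambda>i\<in>{..<n}. g i y)"
  have h0: "?h0 \<in> module_hom A P0 P0" by (rule hom_comp[OF tuple_hom[OF P0 g] r])
  have h0f: "?h0 (f x) = f (h1 x)" if x: "x \<in> carrier P1" for x
  proof -
    have y: "f (h1 x) \<in> carrier P0" by (rule homD(1)[OF f homD(1)[OF h1 x]])
    have "(\<lambda>i\<in>{..<n}. g i (f x)) = s (f (h1 x))"
      using gf[OF _ x] homD(1)[OF s y] y
      by (auto simp: \<sigma>_def free_mod_simps fun_eq_iff PiE_def extensional_def)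
    then show ?thesis using rs[OF y] by simp
  qed
  have "mod_kernel P0 L p \<subseteq> mod_kernel P0 L (\<lambda>y. p (?h0 y))"
  proof
    fix y assume y: "y \<in> mod_kernel P0 L p"
    then obtain x where x: "x \<in> carrier P1" "y = f x" using d(10) by blast
    have "f (h1 x) \<in> mod_kernel P0 L p" using homD(1)[OF h1 x(1)] d(10) by blast
    then show "y \<in> mod_kernel P0 L (\<lambda>y. p (?h0 y))" using h0f[OF x(1)] x(2) y unfolding mod_kernel_def by simp
  qed
  then obtain \<omega> where \<omega>: "\<omega> \<in> module_hom A L L" and \<omega>p: "\<And>y. y \<in> carrier P0 \<Longrightarrow> \<omega> (p y) = p (?h0 y)"
    using hom_factor[OF P0 L L p d(9) hom_comp[OF h0 p]] by blast
  obtain c where c: "\<forall>x\<in>carrier L. \<omega> x = scal c \<odot>\<^bsub>L\<^esub> x" using brickD[OF b \<omega>] by blast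
  have sc: "scal k \<in> carrier A" for k by blast
  let ?d = "\<lambda>y. ?h0 y \<oplus>\<^bsub>P0\<^esub> scal (- c) \<odot>\<^bsub>P0\<^esub> y"
  have scal_add: "scal c \<odot>\<^bsub>M\<^esub> x \<oplus>\<^bsub>M\<^esub> scal (- c) \<odot>\<^bsub>M\<^esub> x = \<zero>\<^bsub>M\<^esub>"
    if "right_module A M" "x \<in> carrier M" for M :: "('b \<Rightarrow> 'k, 'z) module" and x
  proof -
    have "scal c \<oplus>\<^bsub>A\<^esub> scal (- c) = \<zero>\<^bsub>A\<^esub>" by (simp add: smult_A add_A zero_A fun_eq_iff)
    then show ?thesis using right_moduleD(4)[OF that(1) sc sc that(2), of c "- c"] smult_zero_left[OF that] by simp
  qed
  interpret P0: abelian_group P0 using P0 by (rule right_moduleD)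
  have dh: "?d \<in> module_hom A P0 P0"
    unfolding hom_iff
  proof (intro conjI ballI)
    note h = homD[OF h0] and k = homD[OF scal_hom[OF P0, of "- c"]]
    fix x y assume x: "x \<in> carrier P0"
    show "?d x \<in> carrier P0" using h(1)[OF x] k(1)[OF x] by (rule right_module_group(2)[OF P0])
    show "?d (x \<oplus>\<^bsub>P0\<^esub> y) = ?d x \<oplus>\<^bsub>P0\<^esub> ?d y" if y: "y \<in> carrier P0"
      using h(1)[OF x] h(1)[OF y] k(1)[OF x] k(1)[OF y] h(2)[OF x y] k(2)[OF x y] by (simp add: P0.a_ac)
    show "?d (a \<odot>\<^bsub>P0\<^esub> x) = a \<odot>\<^bsub>P0\<^esub> ?d x" if a: "a \<in> carrier A" for a
      using h(3)[OF a x] k(3)[OF a x] right_moduleD(5)[OF P0 a h(1)[OF x] k(1)[OF x]] by simp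
  qed
  have "?d ` carrier P0 \<subseteq> f ` carrier P1"
  proof
    fix z assume "z \<in> ?d ` carrier P0"
    then obtain y where y: "y \<in> carrier P0" "z = ?d y" by blast
    have hy: "?h0 y \<in> carrier P0" and sy: "scal (- c) \<odot>\<^bsub>P0\<^esub> y \<in> carrier P0"
      using homD(1)[OF h0 y(1)] right_moduleD(3)[OF P0 sc y(1)] by auto
    have py: "p y \<in> carrier L" by (rule homD(1)[OF p y(1)])
    have "p z = p (?h0 y) \<oplus>\<^bsub>L\<^esub> scal (- c) \<odot>\<^bsub>L\<^esub> p y"
      using homD(2)[OF p hy sy] homD(3)[OF p sc y(1)] y(2) by simp
    also have "\<dots> = \<zero>\<^bsub>L\<^esub>" using \<omega>p[OF y(1)] c py scal_add[OF L py] by simp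
    finally show "z \<in> f ` carrier P1"
      using homD(1)[OF dh y(1)] y(2) unfolding d(10) mod_kernel_def by simp
  qed
  then obtain S where S: "S \<in> module_hom A P0 P1" and fS: "\<And>y. y \<in> carrier P0 \<Longrightarrow> f (S y) = ?d y"
    using hom_through_inj[OF P1 f inj dh _ P0] by blast
  \<comment> \<open>Injectivity cancels \<open>f\<close> on the left of
    \<open>f h1 = h0 f = f S f + c f\<close>.\<close>
  have h1eq: "h1 x = S (f x) \<oplus>\<^bsub>P1\<^esub> scal c \<odot>\<^bsub>P1\<^esub> x" if x: "x \<in> carrier P1" for x
  proof -
    have fx: "f x \<in> carrier P0" by (rule homD(1)[OF f x])
    have Sx: "S (f x) \<in> carrier P1" by (rule homD(1)[OF S fx])
    have cx: "scal c \<odot>\<^bsub>P1\<^esub> x \<in> carrier P1" by (rule right_moduleD(3)[OF P1 sc x])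
    have "f (S (f x) \<oplus>\<^bsub>P1\<^esub> scal c \<odot>\<^bsub>P1\<^esub> x) = ?d (f x) \<oplus>\<^bsub>P0\<^esub> scal c \<odot>\<^bsub>P0\<^esub> f x"
      using homD(2)[OF f Sx cx] homD(3)[OF f sc x] fS[OF fx] by simp
    also have "\<dots> = ?h0 (f x) \<oplus>\<^bsub>P0\<^esub> (scal c \<odot>\<^bsub>P0\<^esub> f x \<oplus>\<^bsub>P0\<^esub> scal (- c) \<odot>\<^bsub>P0\<^esub> f x)"
      using homD(1)[OF h0 fx] right_moduleD(3)[OF P0 sc fx] by (simp add: P0.a_ac)
    also have "\<dots> = f (h1 x)"
      using scal_add[OF P0 fx] homD(1)[OF h0 fx] h0f[OF x] by simp
    finally show ?thesis
      using inj right_module_group(2)[OF P1 Sx cx] homD(1)[OF h1 x] by (auto dest: inj_onD)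
  qed
  have "\<theta> (q g) = scal c \<odot>\<^bsub>T\<^esub> q g" if g: "g \<in> carrier (adual A P1)" for g
  proof -
    let ?u = "\<lambda>x\<in>carrier P1. (\<lambda>y\<in>carrier P0. g (S y)) (f x)" and ?w = "scal c \<odot>\<^bsub>adual A P1\<^esub> g"
    have gS: "(\<lambda>y\<in>carrier P0. g (S y)) \<in> carrier (adual A P0)" by (rule adual_comp[OF P0 S g])
    have u: "?u \<in> carrier (adual A P1)" by (rule adual_comp[OF P1 f gS])
    have sc': "scal c \<in> carrier (opp A)" using sc by simp
    have w: "?w \<in> carrier (adual A P1)" by (rule right_moduleD(3)[OF D1 sc' g])
    have "g (h1 x) = ?u x \<oplus>\<^bsub>A\<^esub> ?w x" if x: "x \<in> carrier P1" for x
    proof -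
      have fx: "f x \<in> carrier P0" by (rule homD(1)[OF f x])
      show ?thesis
        using h1eq[OF x] adualD(2)[OF g homD(1)[OF S fx] right_moduleD(3)[OF P1 sc x]]
          adualD(3)[OF g sc x] mult_rules(11)[OF adualD(1)[OF g x]] x fx by (simp add: adual_scal[OF g])
    qed
    then have "(\<lambda>x\<in>carrier P1. g (h1 x)) = ?u \<oplus>\<^bsub>adual A P1\<^esub> ?w"
      unfolding adual_simps(3) by (rule restrict_ext)
    then have "\<theta> (q g) = q ?u \<oplus>\<^bsub>T\<^esub> q ?w" using qh[OF g] homD(2)[OF q u w] by simp
    also have "q ?u = \<zero>\<^bsub>T\<^esub>" by (rule kerI[OF gS])
    also have "q ?w = scal c \<odot>\<^bsub>T\<^esub> q g" by (rule homD(3)[OF q sc' g])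
    finally show ?thesis
      using right_module_group(3)[OF T right_moduleD(3)[OF T sc' homD(1)[OF q g]]] by simp
  qed
  note key = this
  show ?thesis
  proof (intro exI[of _ c] ballI)
    fix x assume "x \<in> carrier T"
    then have "x \<in> q ` carrier (adual A P1)" unfolding onto .
    then obtain g where "x = q g" "g \<in> carrier (adual A P1)" by (rule imageE)
    then show "\<theta> x = scal c \<odot>\<^bsub>T\<^esub> x" using key by simp
  qed
qed

end

section \<open>The radical, and the injectivity of minimal presentations\<close>

lemma finsum_map:
  assumes M: "abelian_group M" and N: "abelian_group N" and fin: "finite F"
    and f: "\<And>i. i \<in> F \<Longrightarrow> f i \<in> carrier M" and cl: "\<And>x. x \<in> carrier M \<Longrightarrow> h x \<in> carrier N"
    and add: "\<And>x y. x \<in> carrier M \<Longrightarrow> y \<in> carrier M \<Longrightarrow> h (x \<oplus>\<^bsub>M\<^esub> y) = h x \<oplus>\<^bsub>N\<^esub> h y"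
  shows "h (finsum M f F) = finsum N (\<lambda>i. h (f i)) F"
  using fin f
proof (induction F rule: finite_induct)
  case empty
  interpret M: abelian_group M by fact
  interpret N: abelian_group N by fact
  have "h \<zero>\<^bsub>M\<^esub> \<oplus>\<^bsub>N\<^esub> h \<zero>\<^bsub>M\<^esub> = h \<zero>\<^bsub>M\<^esub>" using add[OF M.zero_closed M.zero_closed] by simp
  then show ?case using group_idem_zero[OF N cl[OF M.zero_closed]] by simp
next
  case (insert i F)
  interpret M: abelian_group M by fact
  interpret N: abelian_group N by fact
  have f: "f \<in> F \<rightarrow> carrier M" "f i \<in> carrier M" using insert.prems by auto
  then have hf: "(\<lambda>i. h (f i)) \<in> F \<rightarrow> carrier N" using cl by auto
  show ?case
    using insert.IH insert.prems M.finsum_insert[OF insert.hyps f] N.finsum_insert[OF insert.hyps hf cl[OF f(2)]]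
      add[OF f(2) M.finsum_closed[OF f(1)]] by simp
qed

lemma finsum_functional:
  fixes h :: "'m \<Rightarrow> 'k::field"
  assumes M: "abelian_group M" and fin: "finite F" and f: "\<And>i. i \<in> F \<Longrightarrow> f i \<in> carrier M"
    and add: "\<And>x y. x \<in> carrier M \<Longrightarrow> y \<in> carrier M \<Longrightarrow> h (x \<oplus>\<^bsub>M\<^esub> y) = h x + h y"
  shows "h (finsum M f F) = (\<Sum>i\<in>F. h (f i))"
  using fin f
proof (induction F rule: finite_induct)
  case empty
  interpret M: abelian_group M by fact
  have "h \<zero>\<^bsub>M\<^esub> + h \<zero>\<^bsub>M\<^esub> = h \<zero>\<^bsub>M\<^esub> + 0"
    using add[OF M.zero_closed M.zero_closed] by (simp only: M.l_zero[OF M.zero_closed] add_0_right)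
  then have "h \<zero>\<^bsub>M\<^esub> = 0" by (rule add_left_imp_eq)
  then show ?case by simp
next
  case (insert i F)
  interpret M: abelian_group M by fact
  have f: "f \<in> F \<rightarrow> carrier M" "f i \<in> carrier M" using insert.prems by auto
  show ?case
    using insert.IH insert.prems insert.hyps M.finsum_insert[OF insert.hyps f]
      add[OF f(2) M.finsum_closed[OF f(1)]] by simp
qed

context bip
begin

text \<open>The radical of \<open>M\<close>, spanned by the images of the arrows. One vector per
  arrow suffices, since each of these images is a subgroup.\<close>

definition rad :: "('b \<Rightarrow> 'k, 'm) module \<Rightarrow> 'm set" where
  "rad M = {finsum M (\<lambda>e. aa e \<odot>\<^bsub>M\<^esub> q e) E |q. \<forall>e\<in>E. q e \<in> carrier M}"

lemma rad_submodule:
  assumes M: "right_module A M"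
  shows "right_submodule A (rad M) M"
    "e \<in> E \<Longrightarrow> p \<in> carrier M \<Longrightarrow> aa e \<odot>\<^bsub>M\<^esub> p \<in> rad M"
proof -
  interpret M: abelian_group M using M by (rule right_moduleD)
  have a: "aa e \<in> carrier A" if "e \<in> E" for e using A_closed that by blast
  have radI: "finsum M (\<lambda>e. aa e \<odot>\<^bsub>M\<^esub> q e) E \<in> rad M" if "\<forall>e\<in>E. q e \<in> carrier M" for q
    unfolding rad_def using that by blast
  have Pi: "(\<lambda>e. aa e \<odot>\<^bsub>M\<^esub> q e) \<in> E \<rightarrow> carrier M" if "\<forall>e\<in>E. q e \<in> carrier M" for q
    using that right_moduleD(3)[OF M a] by auto
  show "right_submodule A (rad M) M"
    unfolding right_submodule_def
  proof (intro conjI ballI)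
    show "rad M \<subseteq> carrier M" unfolding rad_def using M.finsum_closed[OF Pi] by auto
    have "finsum M (\<lambda>e. aa e \<odot>\<^bsub>M\<^esub> \<zero>\<^bsub>M\<^esub>) E = finsum M (\<lambda>e. \<zero>\<^bsub>M\<^esub>) E"
      by (rule M.finsum_cong') (auto simp: smult_zero_right[OF M a])
    then show "\<zero>\<^bsub>M\<^esub> \<in> rad M" using radI[of "\<lambda>_. \<zero>\<^bsub>M\<^esub>"] by simp
    fix x y assume "x \<in> rad M" "y \<in> rad M"
    then obtain q r where q: "\<forall>e\<in>E. q e \<in> carrier M" "x = finsum M (\<lambda>e. aa e \<odot>\<^bsub>M\<^esub> q e) E"
      and r: "\<forall>e\<in>E. r e \<in> carrier M" "y = finsum M (\<lambda>e. aa e \<odot>\<^bsub>M\<^esub> r e) E" unfolding rad_def by blast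
    have "x \<oplus>\<^bsub>M\<^esub> y = finsum M (\<lambda>e. aa e \<odot>\<^bsub>M\<^esub> q e \<oplus>\<^bsub>M\<^esub> aa e \<odot>\<^bsub>M\<^esub> r e) E"
      unfolding q(2) r(2) using M.finsum_addf[OF Pi[OF q(1)] Pi[OF r(1)]] by simp
    also have "\<dots> = finsum M (\<lambda>e. aa e \<odot>\<^bsub>M\<^esub> (q e \<oplus>\<^bsub>M\<^esub> r e)) E"
      by (rule M.finsum_cong') (use q(1) r(1) a right_moduleD(3,5)[OF M] in auto)
    also have "\<dots> \<in> rad M" by (rule radI) (use q(1) r(1) in auto)
    finally show "x \<oplus>\<^bsub>M\<^esub> y \<in> rad M" .
  next
    fix b x assume b: "b \<in> carrier A" and "x \<in> rad M"
    then obtain q where q: "\<forall>e\<in>E. q e \<in> carrier M" "x = finsum M (\<lambda>e. aa e \<odot>\<^bsub>M\<^esub> q e) E"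
      unfolding rad_def by blast
    have s: "scal c \<in> carrier A" for c by blast
    have "b \<odot>\<^bsub>M\<^esub> x = finsum M (\<lambda>e. b \<odot>\<^bsub>M\<^esub> (aa e \<odot>\<^bsub>M\<^esub> q e)) E"
      unfolding q(2)
      by (rule finsum_map[OF M.abelian_group_axioms M.abelian_group_axioms finE])
        (use q(1) a b right_moduleD(3,5)[OF M] in auto)
    \<comment> \<open>Multiplying an arrow on the right by \<open>b\<close> only scales it, because
      its end is a sink.\<close>
    also have "\<dots> = finsum M (\<lambda>e. aa e \<odot>\<^bsub>M\<^esub> (scal (b (eb (snd e))) \<odot>\<^bsub>M\<^esub> q e)) E"
    proof (rule M.finsum_cong'[OF refl])
      show "(\<lambda>e. aa e \<odot>\<^bsub>M\<^esub> (scal (b (eb (snd e))) \<odot>\<^bsub>M\<^esub> q e)) \<in> E \<rightarrow> carrier M"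
        using q(1) a right_moduleD(3)[OF M] s by auto
      fix e assume e: "e \<in> E"
      have qe: "q e \<in> carrier M" using q(1) e by blast
      obtain x y where xy: "e = (x, y)" by (cases e)
      have "b \<odot>\<^bsub>M\<^esub> (aa e \<odot>\<^bsub>M\<^esub> q e) = (aa e \<otimes>\<^bsub>A\<^esub> b) \<odot>\<^bsub>M\<^esub> q e"
        using right_moduleD(6)[OF M a[OF e] b qe] by simp
      also have "aa e \<otimes>\<^bsub>A\<^esub> b = b (eb (snd e)) \<odot>\<^bsub>A\<^esub> aa e" using mult_rules(4)[OF b, of x y] e xy by simp
      finally show "b \<odot>\<^bsub>M\<^esub> (aa e \<odot>\<^bsub>M\<^esub> q e) = aa e \<odot>\<^bsub>M\<^esub> (scal (b (eb (snd e))) \<odot>\<^bsub>M\<^esub> q e)"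
        using smult_scal(2)[OF M a[OF e] qe] by simp
    qed
    also have "\<dots> \<in> rad M" by (rule radI) (use q(1) right_moduleD(3)[OF M s] in auto)
    finally show "b \<odot>\<^bsub>M\<^esub> x \<in> rad M" .
  qed
  show "aa e \<odot>\<^bsub>M\<^esub> p \<in> rad M" if e: "e \<in> E" and p: "p \<in> carrier M"
  proof -
    have "finsum M (\<lambda>d. aa d \<odot>\<^bsub>M\<^esub> (if e = d then p else \<zero>\<^bsub>M\<^esub>)) E =
      finsum M (\<lambda>d. if e = d then aa d \<odot>\<^bsub>M\<^esub> p else \<zero>\<^bsub>M\<^esub>) E"
      by (rule M.finsum_cong') (use p a right_moduleD(3)[OF M] smult_zero_right[OF M] in auto)
    also have "\<dots> = aa e \<odot>\<^bsub>M\<^esub> p"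
      by (rule M.add.finprod_singleton[OF e finE]) (use p a right_moduleD(3)[OF M] in auto)
    finally show ?thesis using radI[of "\<lambda>d. if e = d then p else \<zero>\<^bsub>M\<^esub>"] p by simp
  qed
qed

lemma rad_source:
  assumes M: "right_module A M" and x: "x \<in> X" and w: "w \<in> rad M"
  shows "ee x \<odot>\<^bsub>M\<^esub> w = \<zero>\<^bsub>M\<^esub>"
proof -
  interpret M: abelian_group M using M by (rule right_moduleD)
  have e: "ee x \<in> carrier A" using x by blast
  obtain q where q: "\<forall>e\<in>E. q e \<in> carrier M" "w = finsum M (\<lambda>e. aa e \<odot>\<^bsub>M\<^esub> q e) E"
    using w unfolding rad_def by blast
  have "ee x \<odot>\<^bsub>M\<^esub> w = finsum M (\<lambda>d. ee x \<odot>\<^bsub>M\<^esub> (aa d \<odot>\<^bsub>M\<^esub> q d)) E"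
    unfolding q(2)
    by (rule finsum_map[OF M.abelian_group_axioms M.abelian_group_axioms finE])
      (use q(1) e right_moduleD(3,5)[OF M] A_closed(6) in auto)
  also have "\<dots> = finsum M (\<lambda>d. \<zero>\<^bsub>M\<^esub>) E"
  proof (rule M.finsum_cong'[OF refl])
    fix d assume d: "d \<in> E"
    obtain a b where ab': "d = (a, b)" by (cases d)
    have "b \<in> Y" using d ab' E_V(2) by blast
    then have "x \<noteq> b" using x E_V(4) by blast
    then show "ee x \<odot>\<^bsub>M\<^esub> (aa d \<odot>\<^bsub>M\<^esub> q d) = \<zero>\<^bsub>M\<^esub>"
      using arrow_cpt(4)[OF M, of a b "q d" x] d q(1) x ab' by auto
  qed auto
  finally show ?thesis by simp
qed

lemma min_proj_pres_kernel_rad: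
  assumes pres: "min_proj_pres A P1 f P0 p L" and v: "v \<in> V"
    and z: "z \<in> carrier P1" "f z = \<zero>\<^bsub>P0\<^esub>" and vz: "ee v \<odot>\<^bsub>P1\<^esub> z = z"
  shows "z \<in> rad P1"
proof (rule ccontr)
  assume nz: "z \<notin> rad P1"
  note d = min_proj_presD[OF pres]
  note P1 = d(4)
  interpret P1: abelian_group P1 using P1 by (rule right_moduleD)
  define \<C> where "\<C> = {U. right_submodule A U P1 \<and> rad P1 \<subseteq> U \<and> z \<notin> U}"
  have "\<exists>U\<in>\<C>. \<forall>W\<in>\<C>. U \<subseteq> W \<longrightarrow> W = U"
  proof (rule subset_Zorn_nonempty)
    show "\<C> \<noteq> {}" using nz rad_submodule(1)[OF P1] unfolding \<C>_def by blast
    fix \<D> assume ne: "\<D> \<noteq> {}" and ch: "subset.chain \<C> \<D>"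
    have sub: "right_submodule A U P1 \<and> rad P1 \<subseteq> U \<and> z \<notin> U" if "U \<in> \<D>" for U
      using ch that unfolding subset_chain_def \<C>_def by blast
    have "right_submodule A (\<Union>\<D>) P1"
      unfolding right_submodule_def
    proof (intro conjI ballI)
      show "\<Union>\<D> \<subseteq> carrier P1" using sub unfolding right_submodule_def by blast
      show "\<zero>\<^bsub>P1\<^esub> \<in> \<Union>\<D>" using sub ne unfolding right_submodule_def by blast
      fix x y assume "x \<in> \<Union>\<D>" "y \<in> \<Union>\<D>"
      then obtain U W where UW: "U \<in> \<D>" "W \<in> \<D>" "x \<in> U" "y \<in> W" by blast
      have "U \<subseteq> W \<or> W \<subseteq> U" using ch UW unfolding subset_chain_def by blast
      then obtain Z where "Z \<in> \<D>" "x \<in> Z" "y \<in> Z" using UW by blast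
      then show "x \<oplus>\<^bsub>P1\<^esub> y \<in> \<Union>\<D>" using sub unfolding right_submodule_def by blast
    next
      fix a x assume "a \<in> carrier A" "x \<in> \<Union>\<D>"
      then show "a \<odot>\<^bsub>P1\<^esub> x \<in> \<Union>\<D>" using sub unfolding right_submodule_def by blast
    qed
    then show "\<Union>\<D> \<in> \<C>" using sub ne unfolding \<C>_def by blast
  qed
  then obtain U where U: "U \<in> \<C>" and max: "\<And>W. W \<in> \<C> \<Longrightarrow> U \<subseteq> W \<Longrightarrow> W = U" by blast
  have Us: "U \<subseteq> carrier P1" "\<zero>\<^bsub>P1\<^esub> \<in> U" "\<And>x y. x \<in> U \<Longrightarrow> y \<in> U \<Longrightarrow> x \<oplus>\<^bsub>P1\<^esub> y \<in> U"
    "\<And>a x. a \<in> carrier A \<Longrightarrow> x \<in> U \<Longrightarrow> a \<odot>\<^bsub>P1\<^esub> x \<in> U" and rU: "rad P1 \<subseteq> U" and zU: "z \<notin> U"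
    using U unfolding \<C>_def right_submodule_def by blast+
  have s: "scal c \<in> carrier A" for c by blast
  let ?K = "mod_kernel P1 P0 f"
  have Ks: "\<zero>\<^bsub>P1\<^esub> \<in> ?K" "x \<in> ?K \<Longrightarrow> y \<in> ?K \<Longrightarrow> x \<oplus>\<^bsub>P1\<^esub> y \<in> ?K" for x y
    using hom_zero[OF P1 d(5,7)] homD(2)[OF d(7)] right_module_group(3)[OF d(5) right_module_group(1)[OF d(5)]]
    unfolding mod_kernel_def by auto
  define W where "W = {x. \<exists>u\<in>U. \<exists>l\<in>?K. x = u \<oplus>\<^bsub>P1\<^esub> l}"
  have U_W: "u \<in> W" if "u \<in> U" for u
    unfolding W_def using that Ks(1) Us(1) by (intro CollectI bexI[of _ u] bexI[of _ "\<zero>\<^bsub>P1\<^esub>"]) auto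
  have W_add: "x \<oplus>\<^bsub>P1\<^esub> y \<in> W" if xW: "x \<in> W" and yW: "y \<in> W" for x y
  proof -
    obtain u l where u: "u \<in> U" "l \<in> ?K" "x = u \<oplus>\<^bsub>P1\<^esub> l" using xW unfolding W_def by blast
    obtain u' l' where u': "u' \<in> U" "l' \<in> ?K" "y = u' \<oplus>\<^bsub>P1\<^esub> l'" using yW unfolding W_def by blast
    have c: "u \<in> carrier P1" "u' \<in> carrier P1" "l \<in> carrier P1" "l' \<in> carrier P1"
      using u u' Us(1) unfolding mod_kernel_def by auto
    have "x \<oplus>\<^bsub>P1\<^esub> y = (u \<oplus>\<^bsub>P1\<^esub> u') \<oplus>\<^bsub>P1\<^esub> (l \<oplus>\<^bsub>P1\<^esub> l')"
      unfolding u(3) u'(3) using c by (simp add: P1.a_ac)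
    then show ?thesis unfolding W_def using Us(3)[OF u(1) u'(1)] Ks(2)[OF u(2) u'(2)] by blast
  qed
  have "x \<in> W" if x: "x \<in> carrier P1" for x
  proof (rule component_induct[OF P1 x])
    show "\<zero>\<^bsub>P1\<^esub> \<in> W" by (rule U_W[OF Us(2)])
    show "a \<oplus>\<^bsub>P1\<^esub> b \<in> W" if "a \<in> W" "b \<in> W" for a b by (rule W_add[OF that])
    fix t assume t: "t \<in> V"
    have et: "ee t \<in> carrier A" using t by blast
    define h where "h = ee t \<odot>\<^bsub>P1\<^esub> x"
    have h: "h \<in> carrier P1" unfolding h_def by (rule right_moduleD(3)[OF P1 et x])
    have "h \<in> W"
    proof (cases "h \<in> U")
      case True
      then show ?thesis by (rule U_W)
    next
      case False
      \<comment> \<open>Because \<open>U\<close> contains the radical, arrows send \<open>h\<close>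
        into \<open>U\<close>, while trivial paths fix or kill it. Adding the line through
        \<open>h\<close> therefore already gives a submodule, and maximality of \<open>U\<close>
        puts \<open>z\<close> into it.\<close>
      define U' where "U' = {y. \<exists>u\<in>U. \<exists>c. y = u \<oplus>\<^bsub>P1\<^esub> scal c \<odot>\<^bsub>P1\<^esub> h}"
      have ch: "scal c \<odot>\<^bsub>P1\<^esub> h \<in> carrier P1" for c by (rule right_moduleD(3)[OF P1 s h])
      have zh: "scal 0 \<odot>\<^bsub>P1\<^esub> h = \<zero>\<^bsub>P1\<^esub>"
      proof -
        have "scal 0 = \<zero>\<^bsub>A\<^esub>" by (simp add: smult_A zero_A)
        then show ?thesis using smult_zero_left[OF P1 h] by simp
      qed
      have UU': "u \<in> U'" if "u \<in> U" for u
        unfolding U'_def using that zh Us(1) by (intro CollectI bexI[of _ u] exI[of _ 0]) auto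
      have chU': "scal c \<odot>\<^bsub>P1\<^esub> h \<in> U'" for c
        unfolding U'_def using Us(2) ch by (intro CollectI bexI[of _ "\<zero>\<^bsub>P1\<^esub>"] exI[of _ c]) auto
      have add': "y \<oplus>\<^bsub>P1\<^esub> w \<in> U'" if yU: "y \<in> U'" and wU: "w \<in> U'" for y w
      proof -
        obtain u c where u1: "u \<in> U" and y1: "y = u \<oplus>\<^bsub>P1\<^esub> scal c \<odot>\<^bsub>P1\<^esub> h"
          using yU unfolding U'_def by blast
        obtain u' c' where u2: "u' \<in> U" and y2: "w = u' \<oplus>\<^bsub>P1\<^esub> scal c' \<odot>\<^bsub>P1\<^esub> h"
          using wU unfolding U'_def by blast
        note u = u1 u2 and y = y1 y2
        have "y \<oplus>\<^bsub>P1\<^esub> w = (u \<oplus>\<^bsub>P1\<^esub> u') \<oplus>\<^bsub>P1\<^esub> scal (c + c') \<odot>\<^bsub>P1\<^esub> h"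
        proof -
          have c: "u \<in> carrier P1" "u' \<in> carrier P1" using u Us(1) by auto
          show ?thesis unfolding y scal_rules(1) right_moduleD(4)[OF P1 s s h] using c ch by (simp add: P1.a_ac)
        qed
        then show ?thesis unfolding U'_def using Us(3)[OF u] by blast
      qed
      have ah: "a \<odot>\<^bsub>P1\<^esub> h \<in> U'" if a: "a \<in> carrier A" for a
      proof (rule alg_induct[OF a])
        show "\<zero>\<^bsub>A\<^esub> \<odot>\<^bsub>P1\<^esub> h \<in> U'" unfolding smult_zero_left[OF P1 h] by (rule UU'[OF Us(2)])
        fix c r assume r: "r \<in> V"
        have er: "ee r \<in> carrier A" using r by blast
        have "ee r \<odot>\<^bsub>P1\<^esub> h = (if r = t then h else \<zero>\<^bsub>P1\<^esub>)"
          unfolding h_def using right_moduleD(6)[OF P1 et er x] mult_rules(1)[OF et t r] smult_zero_left[OF P1 x] by auto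
        then show "(c \<odot>\<^bsub>A\<^esub> ee r) \<odot>\<^bsub>P1\<^esub> h \<in> U'"
          using smult_scal(1)[OF P1 er h] chU' UU'[OF Us(2)] smult_zero_right[OF P1 s] by auto
      next
        fix c e assume e: "e \<in> E"
        have ae: "aa e \<in> carrier A" using e by blast
        show "(c \<odot>\<^bsub>A\<^esub> aa e) \<odot>\<^bsub>P1\<^esub> h \<in> U'"
          unfolding smult_scal(2)[OF P1 ae h] using rad_submodule(2)[OF P1 e ch] rU UU' by blast
      next
        fix a b assume "a \<in> carrier A" "b \<in> carrier A" "a \<odot>\<^bsub>P1\<^esub> h \<in> U'" "b \<odot>\<^bsub>P1\<^esub> h \<in> U'"
        then show "(a \<oplus>\<^bsub>A\<^esub> b) \<odot>\<^bsub>P1\<^esub> h \<in> U'" using right_moduleD(4)[OF P1 _ _ h] add' by simp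
      qed
      have "right_submodule A U' P1"
        unfolding right_submodule_def
      proof (intro conjI ballI)
        show "U' \<subseteq> carrier P1" unfolding U'_def using Us(1) ch by auto
        show "\<zero>\<^bsub>P1\<^esub> \<in> U'" by (rule UU'[OF Us(2)])
        show "y \<oplus>\<^bsub>P1\<^esub> w \<in> U'" if "y \<in> U'" "w \<in> U'" for y w by (rule add'[OF that])
        fix a y assume a: "a \<in> carrier A" and "y \<in> U'"
        then obtain u c where u: "u \<in> U" and y: "y = u \<oplus>\<^bsub>P1\<^esub> scal c \<odot>\<^bsub>P1\<^esub> h" unfolding U'_def by blast
        have uc: "u \<in> carrier P1" using u Us(1) by blast
        have "a \<odot>\<^bsub>P1\<^esub> (scal c \<odot>\<^bsub>P1\<^esub> h) = (c \<odot>\<^bsub>A\<^esub> a) \<odot>\<^bsub>P1\<^esub> h" using smult_scal(2)[OF P1 a h] by simp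
        then have "a \<odot>\<^bsub>P1\<^esub> y = a \<odot>\<^bsub>P1\<^esub> u \<oplus>\<^bsub>P1\<^esub> (c \<odot>\<^bsub>A\<^esub> a) \<odot>\<^bsub>P1\<^esub> h"
          unfolding y using right_moduleD(5)[OF P1 a uc ch] by simp
        then show "a \<odot>\<^bsub>P1\<^esub> y \<in> U'" using add'[OF UU'[OF Us(4)[OF a u]] ah[OF A_closed(4)[OF a]]] by simp
      qed
      moreover have "h \<in> U'" using chU'[of 1] right_moduleD(7)[OF P1 h] by (simp add: scal_rules)
      ultimately have "z \<in> U'"
        using max[of U'] UU' rU False unfolding \<C>_def by blast
      \<comment> \<open>The coefficient \<open>c\<close> is nonzero because
        \<open>z \<notin> U\<close>. Solving for \<open>h\<close> writes it as an element of
        \<open>U\<close> plus a multiple of \<open>z\<close>, and \<open>z\<close> is in the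
        kernel.\<close>
      then obtain u c where u: "u \<in> U" and zc: "z = u \<oplus>\<^bsub>P1\<^esub> scal c \<odot>\<^bsub>P1\<^esub> h" unfolding U'_def by blast
      have uc: "u \<in> carrier P1" using u Us(1) by blast
      have c0: "c \<noteq> 0"
      proof
        assume "c = 0"
        then have "z = u" using zc zh uc by simp
        then show False using u zU by simp
      qed
      let ?i = "scal (inverse c)"
      have iu: "?i \<odot>\<^bsub>P1\<^esub> u \<in> U" by (rule Us(4)[OF s u])
      have "?i \<odot>\<^bsub>P1\<^esub> (scal c \<odot>\<^bsub>P1\<^esub> h) = h"
      proof -
        have "?i \<odot>\<^bsub>P1\<^esub> (scal c \<odot>\<^bsub>P1\<^esub> h) = (scal (inverse c * c)) \<odot>\<^bsub>P1\<^esub> h"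
          unfolding scal_rules(2) by (rule right_moduleD(6)[OF P1 s s h, symmetric])
        then show ?thesis using c0 right_moduleD(7)[OF P1 h] by (simp add: scal_rules)
      qed
      then have iz: "?i \<odot>\<^bsub>P1\<^esub> z = ?i \<odot>\<^bsub>P1\<^esub> u \<oplus>\<^bsub>P1\<^esub> h"
        using right_moduleD(5)[OF P1 s uc ch] zc by simp
      have izK: "?i \<odot>\<^bsub>P1\<^esub> z \<in> ?K"
        using homD(3)[OF d(7) s z(1)] z smult_zero_right[OF d(5) s] right_moduleD(3)[OF P1 s z(1)]
        unfolding mod_kernel_def by simp
      have mu: "scal (- 1) \<odot>\<^bsub>P1\<^esub> (?i \<odot>\<^bsub>P1\<^esub> u) \<in> U" by (rule Us(4)[OF s iu])
      have "scal (- 1) \<odot>\<^bsub>P1\<^esub> (?i \<odot>\<^bsub>P1\<^esub> u) \<oplus>\<^bsub>P1\<^esub> ?i \<odot>\<^bsub>P1\<^esub> u = \<zero>\<^bsub>P1\<^esub>"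
      proof -
        have iuc: "?i \<odot>\<^bsub>P1\<^esub> u \<in> carrier P1" using iu Us(1) by blast
        have "scal (- 1) \<oplus>\<^bsub>A\<^esub> scal 1 = \<zero>\<^bsub>A\<^esub>" by (simp add: smult_A add_A zero_A fun_eq_iff)
        then have "scal (- 1) \<odot>\<^bsub>P1\<^esub> (?i \<odot>\<^bsub>P1\<^esub> u) \<oplus>\<^bsub>P1\<^esub> scal 1 \<odot>\<^bsub>P1\<^esub> (?i \<odot>\<^bsub>P1\<^esub> u) = \<zero>\<^bsub>P1\<^esub>"
          using right_moduleD(4)[OF P1 s s iuc, of "- 1" 1] smult_zero_left[OF P1 iuc] by simp
        then show ?thesis using right_moduleD(7)[OF P1 iuc] by (simp add: scal_rules)
      qed
      then have "h = scal (- 1) \<odot>\<^bsub>P1\<^esub> (?i \<odot>\<^bsub>P1\<^esub> u) \<oplus>\<^bsub>P1\<^esub> ?i \<odot>\<^bsub>P1\<^esub> z"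
      proof -
        have c: "scal (- 1) \<odot>\<^bsub>P1\<^esub> (?i \<odot>\<^bsub>P1\<^esub> u) \<in> carrier P1" "?i \<odot>\<^bsub>P1\<^esub> u \<in> carrier P1"
          using mu iu Us(1) by auto
        show ?thesis
          unfolding iz P1.a_assoc[OF c h, symmetric] \<open>_ \<oplus>\<^bsub>P1\<^esub> _ = \<zero>\<^bsub>P1\<^esub>\<close> using h by simp
      qed
      then show ?thesis unfolding W_def using mu izK by blast
    qed
    then show "ee t \<odot>\<^bsub>P1\<^esub> x \<in> W" unfolding h_def .
  qed
  then have "U = carrier P1"
    using d(12) U unfolding superfluous_def \<C>_def W_def by blast
  then show False using z(1) zU by blast
qed

text \<open>By minimality each component of a kernel element lies in the radical, which has no
  component at sources, so \<open>f\<close> is injective at sources. An element of the radical is a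
  sum of arrow images of vectors at sources, and the arrow maps of the projective \<open>P0\<close>
  are jointly injective; so if \<open>f\<close> kills the sum, it kills each of these
  vectors.\<close>

lemma min_proj_pres_inj:
  assumes pres: "min_proj_pres A P1 f P0 p L"
  shows "inj_on f (carrier P1)"
proof -
  note d = min_proj_presD[OF pres]
  note P1 = d(4) and P0 = d(5) and f = d(7)
  interpret P0: abelian_group P0 using P0 by (rule right_moduleD)
  interpret P1: abelian_group P1 using P1 by (rule right_moduleD)
  have hom_rad: "z \<in> rad P1" if "v \<in> V" "z \<in> carrier P1" "f z = \<zero>\<^bsub>P0\<^esub>" "ee v \<odot>\<^bsub>P1\<^esub> z = z" for v z
    by (rule min_proj_pres_kernel_rad[OF pres that])
  have idem: "ee v \<odot>\<^bsub>P1\<^esub> (ee v \<odot>\<^bsub>P1\<^esub> u) = ee v \<odot>\<^bsub>P1\<^esub> u" if "v \<in> V" "u \<in> carrier P1" for v u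
    by (rule cpt_closed(6)[OF P1 that(1) cpt_closed(1)[OF P1 that]])
  have comp: "ee v \<odot>\<^bsub>P1\<^esub> u \<in> carrier P1" if "v \<in> V" "u \<in> carrier P1" for v u
    by (rule right_moduleD(3)[OF P1 A_closed(5)[OF that(1)] that(2)])
  have source: "ee x \<odot>\<^bsub>P1\<^esub> u = \<zero>\<^bsub>P1\<^esub>" if "x \<in> X" "u \<in> carrier P1" "f (ee x \<odot>\<^bsub>P1\<^esub> u) = \<zero>\<^bsub>P0\<^esub>" for x u
  proof -
    have xV: "x \<in> V" using that(1) by simp
    have "ee x \<odot>\<^bsub>P1\<^esub> u \<in> rad P1" by (rule hom_rad[OF xV comp[OF xV that(2)] that(3) idem[OF xV that(2)]])
    then show ?thesis using rad_source[OF P1 that(1)] idem[OF xV that(2)] by simp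
  qed
  have rad_ker: "w = \<zero>\<^bsub>P1\<^esub>" if w: "w \<in> rad P1" and fw: "f w = \<zero>\<^bsub>P0\<^esub>" for w
  proof -
    obtain q where q: "\<forall>e\<in>E. q e \<in> carrier P1" "w = finsum P1 (\<lambda>e. aa e \<odot>\<^bsub>P1\<^esub> q e) E"
      using w unfolding rad_def by blast
    have aq: "aa e \<odot>\<^bsub>P1\<^esub> q e \<in> carrier P1" if "e \<in> E" for e
      using right_moduleD(3)[OF P1 A_closed(6)[OF that]] q(1) that by blast
    have fq: "f (q e) \<in> carrier P0" if "e \<in> E" for e using homD(1)[OF f] q(1) that by blast
    have "aa (x, y) \<odot>\<^bsub>P1\<^esub> q (x, y) = \<zero>\<^bsub>P1\<^esub>" if e: "(x, y) \<in> E" for x y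
    proof -
      have xX: "x \<in> X" and xV: "x \<in> V" using E_V(1)[OF e] by auto
      have ex: "ee x \<in> carrier A" using xV by blast
      have qc: "q (x, y) \<in> carrier P1" using q(1) e by blast
      have fd: "fdim (cs P0 x)" by (rule fdim_cpt[OF P0 fg_fdim[OF fg_projective_fg[OF d(2)]] xV])
      have "ee x \<odot>\<^bsub>P0\<^esub> f (q (x, y)) = \<zero>\<^bsub>P0\<^esub>"
      proof (rule functionals_separate[OF fd])
        show "ee x \<odot>\<^bsub>P0\<^esub> f (q (x, y)) \<in> carrier (cs P0 x)" using cpt_closed(1)[OF P0 xV fq[OF e]] by simp
        show "\<zero>\<^bsub>P0\<^esub> \<in> carrier (cs P0 x)" using cpt_closed(2)[OF P0 xV] by simp
        fix \<psi> assume \<psi>: "\<psi> \<in> carrier (vdual (cs P0 x))"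
        \<comment> \<open>Extending \<open>\<psi>\<close> to \<open>g\<close> and reading the
          coefficient at the arrow from \<open>x\<close> to \<open>y\<close> isolates one summand of
          \<open>f w\<close>, since \<open>g\<close> takes the summand of an arrow to a multiple of
          that arrow.\<close>
        obtain g where g: "g \<in> carrier (adual A P0)"
          and gx: "\<And>p. p \<in> carrier P0 \<Longrightarrow> ee x \<otimes>\<^bsub>A\<^esub> g p = g p \<and> g p (eb x) = \<psi> (ee x \<odot>\<^bsub>P0\<^esub> p)"
          using projective_extend[OF d(2) xX \<psi>] by blast
        have "g (f w) (ab (x, y)) = (\<Sum>e\<in>E. g (f (aa e \<odot>\<^bsub>P1\<^esub> q e)) (ab (x, y)))"
          unfolding q(2)
          by (rule finsum_functional[OF P1.abelian_group_axioms finE aq, where h = "\<lambda>u. g (f u) (ab (x, y))"])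
            (simp_all add: homD(2)[OF f] adualD(2)[OF g] homD(1)[OF f] ev)
        also have "\<dots> = (\<Sum>e\<in>E. if e = (x, y) then \<psi> (ee x \<odot>\<^bsub>P0\<^esub> f (q (x, y))) else 0)"
        proof (rule sum.cong[OF refl])
          fix e' assume e': "e' \<in> E"
          obtain x' y' where xy': "e' = (x', y')" by (cases e')
          have "g (f (aa e' \<odot>\<^bsub>P1\<^esub> q e')) = g (f (q e')) (eb x') \<odot>\<^bsub>A\<^esub> aa e'"
            using homD(3)[OF f A_closed(6)[OF e']] q(1) e' adualD(3)[OF g A_closed(6)[OF e'] fq[OF e']]
              mult_rules(5)[OF adualD(1)[OF g fq[OF e']], of x' y'] xy' by simp
          then show "g (f (aa e' \<odot>\<^bsub>P1\<^esub> q e')) (ab (x, y)) = (if e' = (x, y) then \<psi> (ee x \<odot>\<^bsub>P0\<^esub> f (q (x, y))) else 0)"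
            using gx[OF fq[OF e]] e e' xy' by (auto simp: ev)
        qed
        also have "\<dots> = \<psi> (ee x \<odot>\<^bsub>P0\<^esub> f (q (x, y)))" using e finE by simp
        finally have "\<psi> (ee x \<odot>\<^bsub>P0\<^esub> f (q (x, y))) = g \<zero>\<^bsub>P0\<^esub> (ab (x, y))" using fw by simp
        moreover have "g \<zero>\<^bsub>P0\<^esub> = \<zero>\<^bsub>A\<^esub>"
        proof -
          interpret A: ring A by (rule ring_A)
          show ?thesis
            using adualD(3)[OF g A.zero_closed right_module_group(1)[OF P0]]
              smult_zero_left[OF P0 right_module_group(1)[OF P0]] adualD(1)[OF g right_module_group(1)[OF P0]] by simp
        qed
        ultimately show "\<psi> (ee x \<odot>\<^bsub>P0\<^esub> f (q (x, y))) = \<psi> \<zero>\<^bsub>P0\<^esub>"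
          using dual_zero[OF P0 xV \<psi>] by (simp add: ev)
      qed
      then have "ee x \<odot>\<^bsub>P1\<^esub> q (x, y) = \<zero>\<^bsub>P1\<^esub>"
        using source[OF xX qc] homD(3)[OF f ex qc] by simp
      then show ?thesis
        using arrow_cpt(2)[OF P1 e qc] smult_zero_right[OF P1 A_closed(6)[OF e]] by simp
    qed
    then have "w = finsum P1 (\<lambda>e. \<zero>\<^bsub>P1\<^esub>) E"
      unfolding q(2) by (intro P1.finsum_cong') auto
    then show ?thesis by simp
  qed
  show ?thesis
    unfolding hom_inj_iff[OF P1 P0 f]
  proof (intro ballI impI)
    fix z assume z: "z \<in> carrier P1" "f z = \<zero>\<^bsub>P0\<^esub>"
    have "ee v \<odot>\<^bsub>P1\<^esub> z = \<zero>\<^bsub>P1\<^esub>" if v: "v \<in> V" for v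
    proof -
      have "f (ee v \<odot>\<^bsub>P1\<^esub> z) = \<zero>\<^bsub>P0\<^esub>"
        using homD(3)[OF f A_closed(5)[OF v] z(1)] z(2) smult_zero_right[OF P0 A_closed(5)[OF v]] by simp
      then show ?thesis using rad_ker hom_rad[OF v comp[OF v z(1)] _ idem[OF v z(1)]] by blast
    qed
    then have "z \<in> {\<zero>\<^bsub>P1\<^esub>}"
      using component_induct[OF P1 z(1), of "{\<zero>\<^bsub>P1\<^esub>}"] by simp
    then show "z = \<zero>\<^bsub>P1\<^esub>" by simp
  qed
qed

end

section \<open>The Auslander--Reiten translate on dimension vectors\<close>

lemma zero_mod_iso:
  assumes "mod_iso A M N" "right_module A M" "right_module A N" "zero_mod M"
  shows "zero_mod N"
proof -
  obtain f where f: "f \<in> module_hom A M N" "bij_betw f (carrier M) (carrier N)"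
    using assms(1) unfolding mod_iso_def by blast
  have "carrier N = f ` {\<zero>\<^bsub>M\<^esub>}" using f(2) assms(4) unfolding bij_betw_def zero_mod_def by simp
  then show ?thesis using hom_zero[OF assms(2,3) f(1)] unfolding zero_mod_def by simp
qed

context bip
begin

text \<open>\<open>nak p\<close> is the dimension vector of \<open>Hom\<^sub>A(P, A)\<close> for a projective \<open>P\<close> of dimension vector \<open>p\<close>;
  the Coxeter transformation is \<open>- nak\<close>.\<close>

definition nak :: "('v \<Rightarrow> int) \<Rightarrow> 'v \<Rightarrow> int" where
  "nak p v = (if v \<in> Y then p v - (\<Sum>x | (x, v) \<in> E. p x)
    else p v + (\<Sum>y | (v, y) \<in> E. p y - (\<Sum>x | (x, y) \<in> E. p x)))"

lemma nak_cong:
  assumes "\<And>u. u \<in> V \<Longrightarrow> p u = q u" "v \<in> V"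
  shows "nak p v = nak q v"
proof -
  have p: "p x = q x" "p y = q y" if "(x, y) \<in> E" for x y using assms(1) E_V(1,2)[OF that] by auto
  have "(\<Sum>x | (x, y) \<in> E. p x) = (\<Sum>x | (x, y) \<in> E. q x)" for y
    by (rule sum.cong) (use p(1) in auto)
  then show ?thesis unfolding nak_def using assms p(2) by (auto intro!: sum.cong)
qed

lemma nak_add: "nak (\<lambda>u. p u + q u) v = nak p v + nak q v"
  by (simp add: nak_def sum.distrib sum_subtractf algebra_simps)

lemma nak_scale: "nak (\<lambda>u. c * p u) v = c * nak p v"
  by (simp add: nak_def sum_distrib_left sum_subtractf algebra_simps)

lemma nak_sum: "finite S \<Longrightarrow> nak (\<lambda>u. \<Sum>n\<in>S. p n u) v = (\<Sum>n\<in>S. nak (p n) v)"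
proof (induction S rule: finite_induct)
  case empty
  show ?case using nak_scale[of 0 "\<lambda>_. 0"] by simp
next
  case (insert n S)
  then show ?case using nak_add[of "p n" "\<lambda>u. \<Sum>n\<in>S. p n u"] by simp
qed

lemma kd_adual:
  assumes P: "fg_projective A P" and v: "v \<in> V"
  shows "int (kd (adual A P) v) = nak (\<lambda>u. int (kd P u)) v"
proof -
  have sink: "int (kd (adual A P) y) = int (kd P y) - (\<Sum>x | (x, y) \<in> E. int (kd P x))" if "y \<in> Y" for y
    using kd_adual_sink(2)[OF P that] by (simp flip: of_nat_sum)
  show ?thesis
  proof (cases "v \<in> Y")
    case True
    then show ?thesis using sink by (simp add: nak_def)
  next
    case False
    then have x: "v \<in> X" using v by blast
    have "int (kd (adual A P) v) = int (kd P v) + (\<Sum>y | (v, y) \<in> E. int (kd (adual A P) y))"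
      using kd_adual_source[OF P x] by simp
    also have "(\<Sum>y | (v, y) \<in> E. int (kd (adual A P) y)) =
        (\<Sum>y | (v, y) \<in> E. int (kd P y) - (\<Sum>x | (x, y) \<in> E. int (kd P x)))"
      by (rule sum.cong[OF refl]) (use sink E_V(2) in auto)
    finally show ?thesis using False by (simp add: nak_def)
  qed
qed

lemma kd_zero_mod:
  assumes M: "right_module A M" and z: "zero_mod M" and v: "v \<in> V"
  shows "kd M v = 0"
proof -
  have "carrier (cs M v) = {\<zero>\<^bsub>cs M v\<^esub>}"
    using z smult_zero_right[OF M A_closed(5)[OF v]] unfolding zero_mod_def cpt_def by (simp add: kspace_simps)
  then show ?thesis by (rule kdim_zero(2)[OF cs_vspace[OF M v]])
qed

text \<open>The alternatives are the cases of nonzero and of zero Hom(L, A). In the second,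
  \<open>nak\<close> turns the dimension vectors of \<open>P1\<close> and \<open>P0\<close> into
  those of their duals, and the vector of \<open>P0\<close> is the sum of those of \<open>P1\<close>
  and \<open>L\<close>; the difference leaves \<open>- nak\<close> of the vector of
  \<open>L\<close>.\<close>

lemma transpose_brick:
  fixes L :: "('b \<Rightarrow> 'k, 'm) module" and T :: "('b \<Rightarrow> 'k, nat \<Rightarrow> 'k) module"
  assumes T: "is_transpose A L T" and b: "brick L"
  shows "zero_mod T \<or>
    ((\<forall>\<theta>\<in>module_hom (opp A) T T. \<exists>c. \<forall>x\<in>carrier T. \<theta> x = scal c \<odot>\<^bsub>T\<^esub> x) \<and>
     (\<forall>v\<in>V. int (kd T v) = - nak (\<lambda>u. int (kd L u)) v))"
proof -
  obtain P1 P0 :: "('b \<Rightarrow> 'k, nat \<Rightarrow> 'k) module" and f p q where pres: "min_proj_pres A P1 f P0 p L"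
    and q: "q \<in> module_hom (opp A) (adual A P1) T" and onto: "q ` carrier (adual A P1) = carrier T"
    and ker: "mod_kernel (adual A P1) T q = adual_map P1 P0 f ` carrier (adual A P0)"
    using T unfolding is_transpose_def by blast
  have Tm: "right_module (opp A) T" using T unfolding is_transpose_def fg_mod_def by blast
  note d = min_proj_presD[OF pres]
  note P1 = d(4) and P0 = d(5) and L = d(6) and f = d(7) and p = d(8)
  interpret op: bip "opp A" Y X "E\<inverse>" eb "\<lambda>e. ab (prod.swap e)" by (rule bip_opp)
  interpret A: ring A by (rule ring_A)
  show ?thesis
  proof (cases "\<exists>\<theta>\<in>carrier (adual A L). \<exists>l\<in>carrier L. \<theta> l \<noteq> \<zero>\<^bsub>A\<^esub>")
    case True
    then show ?thesis using brick_projective[OF L b] transpose_projective[OF T] by blast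
  next
    case False
    have inj: "inj_on f (carrier P1)" by (rule min_proj_pres_inj[OF pres])
    have brT: "\<exists>c. \<forall>x\<in>carrier T. \<theta> x = scal c \<odot>\<^bsub>T\<^esub> x" if "\<theta> \<in> module_hom (opp A) T T" for \<theta>
      by (rule brick_transpose[OF pres inj b Tm q onto ker that])
    have D1: "right_module (opp A) (adual A P1)" and D0: "right_module (opp A) (adual A P0)"
      by (rule adual_right_module[OF P1], rule adual_right_module[OF P0])
    let ?m = "adual_map P1 P0 f"
    have m: "?m \<in> module_hom (opp A) (adual A P0) (adual A P1)"
      unfolding hom_iff adual_map_def
    proof (intro conjI ballI)
      fix g h a assume g: "g \<in> carrier (adual A P0)"
      show "(\<lambda>x\<in>carrier P1. g (f x)) \<in> carrier (adual A P1)" by (rule adual_comp[OF P1 f g])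
      show "(\<lambda>x\<in>carrier P1. (g \<oplus>\<^bsub>adual A P0\<^esub> h) (f x)) =
        (\<lambda>x\<in>carrier P1. g (f x)) \<oplus>\<^bsub>adual A P1\<^esub> (\<lambda>x\<in>carrier P1. h (f x))"
        using homD(1)[OF f] by (simp add: adual_simps cong: restrict_cong)
      show "(\<lambda>x\<in>carrier P1. (a \<odot>\<^bsub>adual A P0\<^esub> g) (f x)) = a \<odot>\<^bsub>adual A P1\<^esub> (\<lambda>x\<in>carrier P1. g (f x))"
        using homD(1)[OF f] by (simp add: adual_simps cong: restrict_cong)
    qed
    have zeroL: "\<theta> l = \<zero>\<^bsub>A\<^esub>" if "\<theta> \<in> carrier (adual A L)" "l \<in> carrier L" for \<theta> l
      using False that by blast
    \<comment> \<open>A map that becomes zero on composition with \<open>f\<close> vanishes on the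
      kernel of \<open>p\<close> and so factors through \<open>L\<close>, from which there are only
      zero maps to \<open>A\<close> in this case.\<close>
    have minj: "inj_on ?m (carrier (adual A P0))"
      unfolding hom_inj_iff[OF D0 D1 m]
    proof (intro ballI impI)
      fix g assume g: "g \<in> carrier (adual A P0)" and mg: "?m g = \<zero>\<^bsub>adual A P1\<^esub>"
      have gf: "g (f x) = \<zero>\<^bsub>A\<^esub>" if "x \<in> carrier P1" for x
        using fun_cong[OF mg, of x] that by (simp add: adual_map_def adual_simps)
      have R: "right_module A (regular_mod A)" by (rule regular_right_module[OF ring_A])
      have gh: "g \<in> module_hom A P0 (regular_mod A)"
        unfolding hom_iff regular_mod_simps using adualD[OF g] by blast
      have kg: "mod_kernel P0 L p \<subseteq> mod_kernel P0 (regular_mod A) g"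
      proof (rule subsetI)
        fix y assume y: "y \<in> mod_kernel P0 L p"
        then have "y \<in> f ` carrier P1" using d(10) by simp
        then obtain x where x: "x \<in> carrier P1" "y = f x" by (elim imageE)
        have "y \<in> carrier P0" using y unfolding mod_kernel_def by simp
        then show "y \<in> mod_kernel P0 (regular_mod A) g"
          using gf[OF x(1)] x(2) unfolding mod_kernel_def regular_mod_simps by simp
      qed
      obtain \<omega> where \<omega>: "\<omega> \<in> module_hom A L (regular_mod A)" and \<omega>p: "\<forall>x\<in>carrier P0. \<omega> (p x) = g x"
        using hom_factor[OF P0 L R p d(9) gh kg] by (elim bexE)
      have r: "restrict \<omega> (carrier L) \<in> carrier (adual A L)"
        using homD[OF \<omega>] right_module_group(2)[OF L] right_moduleD(3)[OF L]
        unfolding adual_simps(1) regular_mod_simps by simp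
      show "g = \<zero>\<^bsub>adual A P0\<^esub>"
      proof (rule adual_eqI[OF g right_module_group(1)[OF D0]])
        fix x assume x: "x \<in> carrier P0"
        have "g x = restrict \<omega> (carrier L) (p x)" using \<omega>p x homD(1)[OF p x] by simp
        also have "\<dots> = \<zero>\<^bsub>A\<^esub>" by (rule zeroL[OF r homD(1)[OF p x]])
        finally show "g x = \<zero>\<^bsub>adual A P0\<^esub> x" using x by (simp add: adual_simps)
      qed
    qed
    have "int (kd T v) = - nak (\<lambda>u. int (kd L u)) v" if v: "v \<in> V" for v
    proof -
      have v': "v \<in> Y \<union> X" using v by blast
      have f1: "fdim (kspace (opp A) (adual A P1))" using adual_fdim[OF d(1)] by simp
      have "kd (adual A P1) v = kd (adual A P0) v + kd T v"
        using op.kd_exact[OF D0 D1 Tm f1 m minj q onto ker[symmetric] v'] by simp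
      then have "int (kd T v) = nak (\<lambda>u. int (kd P1 u)) v - nak (\<lambda>u. int (kd P0 u)) v"
        using kd_adual[OF d(1) v] kd_adual[OF d(2) v] by simp
      moreover have "nak (\<lambda>u. int (kd P0 u)) v = nak (\<lambda>u. int (kd P1 u) + int (kd L u)) v"
        by (rule nak_cong[OF _ v])
          (use kd_exact[OF P1 P0 L fg_fdim[OF fg_projective_fg[OF d(2)]] f inj p d(9,10)] in simp)
      ultimately show ?thesis by (simp add: nak_add)
    qed
    then show ?thesis using brT by blast
  qed
qed

lemma kdual_zero:
  assumes M: "right_module A M" and z: "zero_mod M"
  shows "zero_mod (kdual A M)"
proof -
  have D: "right_module (opp A) (kdual A M)" by (rule kdual_right_module[OF M])
  have c: "carrier M = {\<zero>\<^bsub>M\<^esub>}" using z unfolding zero_mod_def .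
  have "\<phi> = \<zero>\<^bsub>kdual A M\<^esub>" if \<phi>: "\<phi> \<in> carrier (kdual A M)" for \<phi>
  proof (rule extensionalityI[of _ "carrier M"])
    show "\<phi> \<in> extensional (carrier M)" using \<phi> unfolding kdual_mem by blast
    show "\<zero>\<^bsub>kdual A M\<^esub> \<in> extensional (carrier M)" by (simp add: kdual_simps(2))
    fix x assume x: "x \<in> carrier M"
    then have x0: "x = \<zero>\<^bsub>M\<^esub>" using c by blast
    have "\<phi> (x \<oplus>\<^bsub>M\<^esub> x) = \<phi> x + \<phi> x" using \<phi> x unfolding kdual_mem by blast
    moreover have "x \<oplus>\<^bsub>M\<^esub> x = x" using right_module_group(3)[OF M x] x0 by simp
    ultimately have "\<phi> x + \<phi> x = \<phi> x + 0" by simp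
    then have "\<phi> x = 0" by (rule add_left_imp_eq)
    then show "\<phi> x = \<zero>\<^bsub>kdual A M\<^esub> x" using x by (simp add: kdual_simps(2))
  qed
  then show ?thesis unfolding zero_mod_def using right_module_group(1)[OF D] by blast
qed

lemma tau_projective:
  assumes P: "fg_projective A M" and t: "is_tau A M N"
  shows "zero_mod N"
proof -
  interpret op: bip "opp A" Y X "E\<inverse>" eb "\<lambda>e. ab (prod.swap e)" by (rule bip_opp)
  obtain T where T: "is_transpose A M T" and iso: "mod_iso A (kdual (opp A) T) N" and N: "fg_mod A N"
    using t unfolding is_tau_def by blast
  have Tm: "right_module (opp A) T" using T unfolding is_transpose_def fg_mod_def by blast
  have D: "right_module A (kdual (opp A) T)" using op.kdual_right_module[OF Tm] by (simp add: opp_opp)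
  have "zero_mod (kdual (opp A) T)" by (rule op.kdual_zero[OF Tm transpose_projective[OF T P]])
  then show ?thesis by (rule zero_mod_iso[OF iso D fg_mod_right_module[OF N]])
qed

text \<open>Once a translate vanishes all later ones do: the dual of zero is zero, hence projective,
  and has zero transpose.\<close>

lemma tau_inv_zero:
  assumes M: "right_module A M" and z: "zero_mod M" and t: "is_tau_inv A M N"
  shows "zero_mod N"
  by (rule transpose_projective[OF t[unfolded is_tau_inv_def]
    zero_mod_projective[OF kdual_right_module[OF M] kdual_zero[OF M z]]])

text \<open>\<open>is_tau_inv\<close> is the transpose over the opposite algebra applied to the
  dual, which is a brick there and has the dimension vector of \<open>M\<close>. The
  \<open>nak\<close> of the reversed quiver is the inverse of \<open>nak\<close>: it undoes the two
  steps, sinks and then sources, in reverse order.\<close>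

lemma tau_inv_brick:
  assumes M: "fg_mod A M" and b: "brick M" and t: "is_tau_inv A M N"
  shows "fg_mod A N" "zero_mod N \<or> brick N \<and>
    (\<forall>v\<in>V. int (kd N v) = - bip.nak X (E\<inverse>) (\<lambda>u. int (kd M u)) v)"
proof -
  interpret op: bip "opp A" Y X "E\<inverse>" eb "\<lambda>e. ab (prod.swap e)" by (rule bip_opp)
  have Mm: "right_module A M" by (rule fg_mod_right_module[OF M])
  have fM: "fdim (kspace A M)" by (rule fg_fdim[OF M])
  have T: "is_transpose (opp A) (kdual A M) N" using t unfolding is_tau_inv_def .
  show "fg_mod A N" using T unfolding is_transpose_def by (simp add: opp_opp)
  have bD: "op.brick (kdual A M)"
    unfolding op.brick_def using brick_kdual[OF Mm fM b] by simp
  have "zero_mod N \<or> brick N \<and> (\<forall>v\<in>Y \<union> X. int (kd N v) = - op.nak (\<lambda>u. int (kd (kdual A M) u)) v)"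
    using op.transpose_brick[OF T bD] unfolding brick_def by (simp add: opp_opp)
  moreover have "op.nak (\<lambda>u. int (kd (kdual A M) u)) v = op.nak (\<lambda>u. int (kd M u)) v" if "v \<in> V" for v
    by (rule op.nak_cong) (use kd_kdual[OF Mm fM] that in auto)
  ultimately show "zero_mod N \<or> brick N \<and> (\<forall>v\<in>V. int (kd N v) = - op.nak (\<lambda>u. int (kd M u)) v)"
    by auto
qed

end

section \<open>The Euler characteristic of a complex\<close>

lemma derived_isoD:
  assumes "derived_iso A C D"
  shows "bounded_complex A C" "bounded_complex A D"
    "\<exists>(Z :: ('a, nat \<Rightarrow> 'k::field) cochain_complex) f g.
      bounded_complex (A :: ('k, 'a) module) Z \<and> quasi_iso A Z C f \<and> quasi_iso A Z D g"
  using assms unfolding derived_iso_def by simp_all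

lemma derived_iso_roof:
  fixes A :: "('k::field, 'a) module" and C :: "('a, 'm) cochain_complex" and D :: "('a, 'n) cochain_complex"
  assumes "derived_iso A C D"
  obtains Z :: "('a, nat \<Rightarrow> 'k) cochain_complex" and f g
  where "bounded_complex A Z" "quasi_iso A Z C f" "quasi_iso A Z D g"
  using derived_isoD(3)[OF assms] by (elim exE conjE)

text \<open>Bounded complexes of modules give such complexes componentwise, one for each vertex.
  Boundedness is imposed separately, where alternating sums are formed.\<close>

definition vcomplex :: "('k::field, 'm) cochain_complex \<Rightarrow> bool" where
  "vcomplex C \<longleftrightarrow> (\<forall>n. fdim (obj C n)) \<and>
    (\<forall>n. diff C n \<in> module_hom class_ring (obj C n) (obj C (n + 1))) \<and>
    (\<forall>n. \<forall>x\<in>carrier (obj C n). diff C (n + 1) (diff C n x) = \<zero>\<^bsub>obj C (n + 2)\<^esub>)"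

definition zdim :: "('k::field, 'm) cochain_complex \<Rightarrow> int \<Rightarrow> nat" where
  "zdim C n = kdim ((obj C n)\<lparr>carrier := cocycles C n\<rparr>)"

definition bdim :: "('k::field, 'm) cochain_complex \<Rightarrow> int \<Rightarrow> nat" where
  "bdim C n = kdim ((obj C n)\<lparr>carrier := coboundaries C n\<rparr>)"

lemma vcomplexD:
  assumes "vcomplex C"
  shows "fdim (obj C n)" "diff C n \<in> module_hom class_ring (obj C n) (obj C (n + 1))"
    "x \<in> carrier (obj C n) \<Longrightarrow> diff C (n + 1) (diff C n x) = \<zero>\<^bsub>obj C (n + 2)\<^esub>"
    "vspace (obj C n)"
  using assms fdim_vspace unfolding vcomplex_def by blast+

lemma vcomplex_subsp:
  assumes C: "vcomplex C"
  shows "subsp (cocycles C n) (obj C n)" "subsp (coboundaries C n) (obj C n)"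
    "coboundaries C n \<subseteq> cocycles C n" "subsp (coboundaries C n) ((obj C n)\<lparr>carrier := cocycles C n\<rparr>)"
proof -
  show z: "subsp (cocycles C n) (obj C n)"
    unfolding cocycles_def by (rule kernel_subsp[OF vcomplexD(4)[OF C] vcomplexD(4)[OF C] vcomplexD(2)[OF C]])
  have h: "diff C (n - 1) \<in> module_hom class_ring (obj C (n - 1)) (obj C n)"
    using vcomplexD(2)[OF C, of "n - 1"] by simp
  show b: "subsp (coboundaries C n) (obj C n)"
    unfolding coboundaries_def by (rule image_subsp[OF vcomplexD(4)[OF C] vcomplexD(4)[OF C] h])
  show bz: "coboundaries C n \<subseteq> cocycles C n"
  proof
    fix y assume "y \<in> coboundaries C n"
    then obtain x where x: "x \<in> carrier (obj C (n - 1))" "y = diff C (n - 1) x"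
      unfolding coboundaries_def by (elim imageE)
    have "y \<in> carrier (obj C n)" using h x unfolding khom_iff by simp
    moreover have e: "n - 1 + 1 = n" "n - 1 + 2 = n + 1" by simp_all
    have "diff C n y = \<zero>\<^bsub>obj C (n + 1)\<^esub>" using vcomplexD(3)[OF C x(1)] unfolding e x(2) .
    ultimately show "y \<in> cocycles C n" unfolding cocycles_def mod_kernel_def by simp
  qed
  show "subsp (coboundaries C n) ((obj C n)\<lparr>carrier := cocycles C n\<rparr>)"
    using b bz unfolding subsp_iff[OF subsp_vspace[OF vcomplexD(4)[OF C] z]] subsp_iff[OF vcomplexD(4)[OF C]]
    by simp
qed

lemma kdim_cocycles_coboundaries:
  assumes C: "vcomplex C"
  shows "kdim (obj C n) = zdim C n + bdim C (n + 1)"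
proof -
  let ?W = "(obj C (n + 1))\<lparr>carrier := coboundaries C (n + 1)\<rparr>"
  have W: "vspace ?W" by (rule subsp_vspace[OF vcomplexD(4)[OF C] vcomplex_subsp(2)[OF C]])
  have cb: "coboundaries C (n + 1) = diff C n ` carrier (obj C n)" unfolding coboundaries_def by simp
  have h: "diff C n \<in> module_hom class_ring (obj C n) ?W"
    using vcomplexD(2)[OF C, of n] unfolding khom_iff cb by simp
  have "kdim (obj C n) = kdim ?W + kdim ((obj C n)\<lparr>carrier := mod_kernel (obj C n) ?W (diff C n)\<rparr>)"
    by (rule rank_nullity_onto(2)[OF vcomplexD(1)[OF C] W h]) (simp add: cb)
  moreover have "mod_kernel (obj C n) ?W (diff C n) = cocycles C n"
    unfolding cocycles_def mod_kernel_def by simp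
  ultimately show ?thesis unfolding zdim_def bdim_def by simp
qed

text \<open>\<open>f\<close> induces an isomorphism in the \<open>n\<close>-th cohomology. Its
  composite with the quotient of the cocycles of \<open>D\<close> by the coboundaries is onto, with
  kernel the coboundaries of \<open>C\<close>. The equality of two differences is stated with sums
  to stay in \<open>nat\<close>.\<close>

lemma cohomology_dim:
  fixes C :: "('k::field, 'm) cochain_complex" and D :: "('k, 'n) cochain_complex"
  assumes C: "vcomplex C" and D: "vcomplex D"
    and f: "f \<in> module_hom class_ring (obj C n) (obj D n)"
    and fz: "\<And>x. x \<in> cocycles C n \<Longrightarrow> f x \<in> cocycles D n"
    and fb: "\<And>x. x \<in> cocycles C n \<Longrightarrow> f x \<in> coboundaries D n \<longleftrightarrow> x \<in> coboundaries C n"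
    and onto: "\<And>y. y \<in> cocycles D n \<Longrightarrow> \<exists>x\<in>cocycles C n. \<exists>b\<in>coboundaries D n. y = f x \<oplus>\<^bsub>obj D n\<^esub> b"
  shows "zdim C n + bdim D n = zdim D n + bdim C n"
proof -
  let ?Z = "(obj D n)\<lparr>carrier := cocycles D n\<rparr>" and ?Zc = "(obj C n)\<lparr>carrier := cocycles C n\<rparr>"
  have Z: "fdim ?Z" by (rule fdim_subsp[OF vcomplexD(1)[OF D] vcomplex_subsp(1)[OF D]])
  have Zc: "fdim ?Zc" by (rule fdim_subsp[OF vcomplexD(1)[OF C] vcomplex_subsp(1)[OF C]])
  obtain I :: "'n set" and \<pi> where \<pi>: "\<pi> \<in> module_hom class_ring ?Z (fn_space I)"
    and \<pi>o: "\<pi> ` carrier ?Z = carrier (fn_space I :: ('k, 'n \<Rightarrow> 'k) module)"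
    and \<pi>k: "mod_kernel ?Z (fn_space I) \<pi> = coboundaries D n"
    by (rule quotient_map[OF Z vcomplex_subsp(4)[OF D]])
  let ?F = "fn_space I :: ('k, 'n \<Rightarrow> 'k) module"
  have F: "vspace ?F" by (rule fn_space_vspace)
  have "kdim ?Z = kdim ?F + kdim (?Z\<lparr>carrier := mod_kernel ?Z (fn_space I) \<pi>\<rparr>)"
    by (rule rank_nullity_onto(2)[OF Z F \<pi> \<pi>o])
  then have 1: "zdim D n = kdim ?F + bdim D n" unfolding \<pi>k zdim_def bdim_def by simp
  have \<pi>a: "\<pi> (x \<oplus>\<^bsub>obj D n\<^esub> y) = \<pi> x \<oplus>\<^bsub>?F\<^esub> \<pi> y" if "x \<in> cocycles D n" "y \<in> cocycles D n" for x y
    using \<pi> that unfolding khom_iff by simp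
  have zc: "x \<in> carrier (obj C n)" if "x \<in> cocycles C n" for x
    using that unfolding cocycles_def mod_kernel_def by simp
  have g: "(\<lambda>x. \<pi> (f x)) \<in> module_hom class_ring ?Zc ?F"
    using \<pi> f fz zc unfolding khom_iff by simp
  have go: "(\<lambda>x. \<pi> (f x)) ` carrier ?Zc = carrier ?F"
  proof (intro equalityI subsetI)
    fix w assume "w \<in> carrier ?F"
    then have "w \<in> \<pi> ` carrier ?Z" unfolding \<pi>o .
    then obtain y where y: "y \<in> cocycles D n" "w = \<pi> y" by (elim imageE) simp
    obtain x b where x: "x \<in> cocycles C n" and b: "b \<in> coboundaries D n" and yx: "y = f x \<oplus>\<^bsub>obj D n\<^esub> b"
      using onto[OF y(1)] by (elim bexE)
    have b': "b \<in> cocycles D n" using b vcomplex_subsp(3)[OF D] by (rule subsetD[rotated])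
    have "\<pi> b = \<zero>\<^bsub>?F\<^esub>" using b unfolding \<pi>k[symmetric] mod_kernel_def by simp
    moreover have "\<pi> (f x) \<in> carrier ?F" using \<pi> fz[OF x] unfolding khom_iff by simp
    moreover have "\<pi> (f x) \<oplus>\<^bsub>?F\<^esub> \<zero>\<^bsub>?F\<^esub> = \<pi> (f x)" if "\<pi> (f x) \<in> carrier ?F"
      using that by (auto simp: fn_space_simps fun_eq_iff PiE_def extensional_def)
    ultimately have "w = \<pi> (f x)" using \<pi>a[OF fz[OF x] b'] y(2) yx by simp
    then show "w \<in> (\<lambda>x. \<pi> (f x)) ` carrier ?Zc" using x by simp
  next
    fix w assume "w \<in> (\<lambda>x. \<pi> (f x)) ` carrier ?Zc"
    then show "w \<in> carrier ?F" using \<pi> fz unfolding khom_iff by auto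
  qed
  have "kdim ?Zc = kdim ?F + kdim (?Zc\<lparr>carrier := mod_kernel ?Zc ?F (\<lambda>x. \<pi> (f x))\<rparr>)"
    by (rule rank_nullity_onto(2)[OF Zc F g go])
  moreover have "mod_kernel ?Zc ?F (\<lambda>x. \<pi> (f x)) = coboundaries C n"
  proof (intro equalityI subsetI)
    fix x assume "x \<in> mod_kernel ?Zc ?F (\<lambda>x. \<pi> (f x))"
    then have x: "x \<in> cocycles C n" "\<pi> (f x) = \<zero>\<^bsub>?F\<^esub>" unfolding mod_kernel_def by simp_all
    then have "f x \<in> coboundaries D n" unfolding \<pi>k[symmetric] mod_kernel_def using fz by simp
    then show "x \<in> coboundaries C n" using fb[OF x(1)] by simp
  next
    fix x assume x: "x \<in> coboundaries C n"
    then have z: "x \<in> cocycles C n" using vcomplex_subsp(3)[OF C] by (rule subsetD[rotated])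
    then have "f x \<in> coboundaries D n" using fb x by simp
    then show "x \<in> mod_kernel ?Zc ?F (\<lambda>x. \<pi> (f x))"
      using z unfolding \<pi>k[symmetric] mod_kernel_def by simp
  qed
  ultimately have "zdim C n = kdim ?F + bdim C n" unfolding zdim_def bdim_def by simp
  then show ?thesis using 1 by simp
qed

abbreviation sg :: "int \<Rightarrow> int" where "sg n \<equiv> (if even n then 1 else - 1)"

text \<open>An index shift by one changes every sign. The two windows differ by the terms at
  \<open>- N\<close> and \<open>N + 1\<close>, both of which vanish.\<close>

lemma euler_telescope:
  fixes b :: "int \<Rightarrow> int"
  assumes "\<And>n. n \<notin> {- N..N} \<Longrightarrow> b n = 0" "b (- N) = 0"
  shows "(\<Sum>n\<in>{- N..N}. sg n * b (n + 1)) = - (\<Sum>n\<in>{- N..N}. sg n * b n)"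
proof -
  have "(\<Sum>n\<in>{- N..N}. sg n * b (n + 1)) = (\<Sum>n\<in>{- N + 1..N + 1}. - (sg n * b n))"
    by (rule sum.reindex_bij_witness[where i = "\<lambda>n. n - 1" and j = "\<lambda>n. n + 1"]) auto
  also have "\<dots> = (\<Sum>n\<in>{- N..N}. - (sg n * b n))"
  proof -
    have "(\<Sum>n\<in>{- N + 1..N + 1}. - (sg n * b n)) = (\<Sum>n\<in>{- N..N + 1}. - (sg n * b n))"
    proof (rule sum.mono_neutral_left)
      show "\<forall>i\<in>{- N..N + 1} - {- N + 1..N + 1}. - (sg i * b i) = 0"
      proof
        fix i assume "i \<in> {- N..N + 1} - {- N + 1..N + 1}"
        then have "i = - N" by auto
        then show "- (sg i * b i) = 0" using assms(2) by simp
      qed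
    qed auto
    also have "\<dots> = (\<Sum>n\<in>{- N..N}. - (sg n * b n))"
      by (rule sum.mono_neutral_right) (auto simp: assms(1))
    finally show ?thesis .
  qed
  finally show ?thesis by (simp add: sum_negf)
qed

text \<open>Each degree splits into its cocycles and the coboundaries one degree higher, and the
  latter are shifted back with the opposite sign. The objects vanish outside the open interval, so
  the coboundaries vanish at the end \<open>- N\<close> of the closed one as well.\<close>

lemma euler_cohomology:
  assumes C: "vcomplex C" and z: "\<And>n. n \<notin> {- N<..<N} \<Longrightarrow> kdim (obj C n) = 0"
  shows "(\<Sum>n\<in>{- N..N}. sg n * int (kdim (obj C n))) =
    (\<Sum>n\<in>{- N..N}. sg n * (int (zdim C n) - int (bdim C n)))"
proof -
  have b0: "bdim C n = 0" if "n - 1 \<notin> {- N<..<N}" for n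
    using z[OF that] kdim_cocycles_coboundaries[OF C, of "n - 1"] by simp
  have b1: "bdim C n = 0" if "n \<notin> {- N..N}" for n
    by (rule b0) (use that in auto)
  have "(\<Sum>n\<in>{- N..N}. sg n * int (kdim (obj C n))) =
      (\<Sum>n\<in>{- N..N}. sg n * int (zdim C n)) + (\<Sum>n\<in>{- N..N}. sg n * int (bdim C (n + 1)))"
    unfolding kdim_cocycles_coboundaries[OF C] of_nat_add distrib_left sum.distrib ..
  also have "(\<Sum>n\<in>{- N..N}. sg n * int (bdim C (n + 1))) = - (\<Sum>n\<in>{- N..N}. sg n * int (bdim C n))"
    by (rule euler_telescope) (use b0 b1 in auto)
  finally show ?thesis unfolding right_diff_distrib sum_subtractf by (rule trans) simp
qed

section \<open>Dimension vectors of complexes and the derived translate\<close>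

context bip
begin

text \<open>The alternating sum of dimension vectors, that is, the class in the Grothendieck group.
  Summing over the nonzero degrees keeps the index set finite for a bounded complex.\<close>

definition chi :: "('b \<Rightarrow> 'k, 'm) cochain_complex \<Rightarrow> 'v \<Rightarrow> int" where
  "chi C v = (\<Sum>n | \<not> zero_mod (obj C n). sg n * int (kd (obj C n) v))"

abbreviation component :: "('b \<Rightarrow> 'k, 'm) cochain_complex \<Rightarrow> 'v \<Rightarrow> ('k, 'm) cochain_complex" where
  "component C v \<equiv> \<lparr>obj = \<lambda>n. cs (obj C n) v, diff = diff C\<rparr>"

lemma bounded_complexD:
  assumes "bounded_complex A C"
  shows "fg_mod A (obj C n)" "right_module A (obj C n)" "diff C n \<in> module_hom A (obj C n) (obj C (n + 1))"
    "x \<in> carrier (obj C n) \<Longrightarrow> diff C (n + 1) (diff C n x) = \<zero>\<^bsub>obj C (n + 2)\<^esub>"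
    "finite {n. \<not> zero_mod (obj C n)}"
  using assms unfolding bounded_complex_def fg_mod_def by blast+

lemma hom_cpt:
  assumes M: "right_module A M" and N: "right_module A N" and f: "f \<in> module_hom A M N" and v: "v \<in> V"
  shows "f \<in> module_hom class_ring (cs M v) (cs N v)"
    "x \<in> carrier M \<Longrightarrow> f (ee v \<odot>\<^bsub>M\<^esub> x) = ee v \<odot>\<^bsub>N\<^esub> f x"
proof -
  have e: "ee v \<in> carrier A" using v by (rule A_closed(5))
  show *: "f (ee v \<odot>\<^bsub>M\<^esub> x) = ee v \<odot>\<^bsub>N\<^esub> f x" if "x \<in> carrier M" for x
    by (rule homD(3)[OF f e that])
  have "f x \<in> cpt N (ee v)" if "x \<in> cpt M (ee v)" for x
    using that *[of x] homD(1)[OF f, of x] unfolding cpt_iff[OF M v] cpt_iff[OF N v] by simp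
  then show "f \<in> module_hom class_ring (cs M v) (cs N v)"
    using hom_khom[OF f] cpt_closed(5)[OF M v] unfolding khom_iff cs_simps kspace_simps by simp
qed

lemma component_vcomplex:
  assumes C: "bounded_complex A C" and v: "v \<in> V"
  shows "vcomplex (component C v)"
  unfolding vcomplex_def cochain_complex.simps
proof (intro conjI allI ballI)
  fix n x
  show "fdim (cs (obj C n) v)"
    by (rule fdim_cpt[OF bounded_complexD(2)[OF C] fg_fdim[OF bounded_complexD(1)[OF C]] v])
  show "diff C n \<in> module_hom class_ring (cs (obj C n) v) (cs (obj C (n + 1)) v)"
    by (rule hom_cpt(1)[OF bounded_complexD(2)[OF C] bounded_complexD(2)[OF C] bounded_complexD(3)[OF C] v])
  assume "x \<in> carrier (cs (obj C n) v)"
  then have "x \<in> carrier (obj C n)" unfolding cs_simps by (rule cpt_closed(5)[OF bounded_complexD(2)[OF C] v])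
  then show "diff C (n + 1) (diff C n x) = \<zero>\<^bsub>cs (obj C (n + 2)) v\<^esub>"
    unfolding cs_simps by (rule bounded_complexD(4)[OF C])
qed

text \<open>The differential commutes with \<open>ee v\<close>, so cocycles and coboundaries of the
  component are the components of those of \<open>C\<close>.\<close>

lemma component_cocycles:
  assumes C: "bounded_complex A C" and v: "v \<in> V"
  shows "x \<in> cocycles (component C v) n \<longleftrightarrow> x \<in> cocycles C n \<and> ee v \<odot>\<^bsub>obj C n\<^esub> x = x"
    "x \<in> coboundaries (component C v) n \<longleftrightarrow> x \<in> coboundaries C n \<and> ee v \<odot>\<^bsub>obj C n\<^esub> x = x"
    "x \<in> cocycles C n \<Longrightarrow> ee v \<odot>\<^bsub>obj C n\<^esub> x \<in> cocycles (component C v) n"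
    "x \<in> coboundaries C n \<Longrightarrow> ee v \<odot>\<^bsub>obj C n\<^esub> x \<in> coboundaries (component C v) n"
proof -
  note M = bounded_complexD(2)[OF C]
  have h: "diff C (n - 1) \<in> module_hom A (obj C (n - 1)) (obj C n)"
    using bounded_complexD(3)[OF C, of "n - 1"] by simp
  have h': "diff C (n - 1) (ee v \<odot>\<^bsub>obj C (n - 1)\<^esub> x) = ee v \<odot>\<^bsub>obj C n\<^esub> diff C (n - 1) x"
    if "x \<in> carrier (obj C (n - 1))" for x
    by (rule hom_cpt(2)[OF M M h v that])
  have e: "ee v \<in> carrier A" using v by (rule A_closed(5))
  have ei: "ee v \<odot>\<^bsub>obj C n\<^esub> (ee v \<odot>\<^bsub>obj C n\<^esub> x) = ee v \<odot>\<^bsub>obj C n\<^esub> x" if "x \<in> carrier (obj C n)" for x n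
    by (rule cpt_closed(6)[OF M v cpt_closed(1)[OF M v that]])
  show c: "x \<in> cocycles (component C v) n \<longleftrightarrow> x \<in> cocycles C n \<and> ee v \<odot>\<^bsub>obj C n\<^esub> x = x" for x
    unfolding cocycles_def mod_kernel_def by (auto simp: cs_simps cpt_iff[OF M v])
  show b: "x \<in> coboundaries (component C v) n \<longleftrightarrow> x \<in> coboundaries C n \<and> ee v \<odot>\<^bsub>obj C n\<^esub> x = x" for x
  proof
    assume "x \<in> coboundaries (component C v) n"
    then obtain z where z: "z \<in> carrier (obj C (n - 1))" "ee v \<odot>\<^bsub>obj C (n - 1)\<^esub> z = z" "x = diff C (n - 1) z"
      unfolding coboundaries_def by (auto simp: cs_simps cpt_iff[OF M v])
    then show "x \<in> coboundaries C n \<and> ee v \<odot>\<^bsub>obj C n\<^esub> x = x"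
      using h'[OF z(1)] unfolding coboundaries_def by simp
  next
    assume a: "x \<in> coboundaries C n \<and> ee v \<odot>\<^bsub>obj C n\<^esub> x = x"
    then have "x \<in> diff C (n - 1) ` carrier (obj C (n - 1))" unfolding coboundaries_def by simp
    then obtain z where z: "z \<in> carrier (obj C (n - 1))" "x = diff C (n - 1) z" by (elim imageE)
    have "x = diff C (n - 1) (ee v \<odot>\<^bsub>obj C (n - 1)\<^esub> z)" using h'[OF z(1)] a z(2) by simp
    then show "x \<in> coboundaries (component C v) n"
      unfolding coboundaries_def cochain_complex.simps cs_simps
      by (rule image_eqI) (rule cpt_closed(1)[OF M v z(1)])
  qed
  show "ee v \<odot>\<^bsub>obj C n\<^esub> x \<in> cocycles (component C v) n" if x: "x \<in> cocycles C n"
  proof -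
    have x': "x \<in> carrier (obj C n)" "diff C n x = \<zero>\<^bsub>obj C (n + 1)\<^esub>"
      using x unfolding cocycles_def mod_kernel_def by simp_all
    have "diff C n (ee v \<odot>\<^bsub>obj C n\<^esub> x) = \<zero>\<^bsub>obj C (n + 1)\<^esub>"
      using hom_cpt(2)[OF M M bounded_complexD(3)[OF C] v x'(1)] x'(2) smult_zero_right[OF M e] by simp
    then show ?thesis
      unfolding c using ei[OF x'(1)] right_moduleD(3)[OF M e x'(1)]
      unfolding cocycles_def mod_kernel_def by simp
  qed
  show "ee v \<odot>\<^bsub>obj C n\<^esub> x \<in> coboundaries (component C v) n" if x: "x \<in> coboundaries C n"
  proof -
    obtain z where z: "z \<in> carrier (obj C (n - 1))" "x = diff C (n - 1) z"
      using x unfolding coboundaries_def by (elim imageE)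
    have xc: "x \<in> carrier (obj C n)" using homD(1)[OF h z(1)] z(2) by simp
    have "ee v \<odot>\<^bsub>obj C n\<^esub> x \<in> coboundaries C n"
      unfolding coboundaries_def
      by (rule image_eqI[where x = "ee v \<odot>\<^bsub>obj C (n - 1)\<^esub> z"])
        (use h'[OF z(1)] z(2) right_moduleD(3)[OF M e z(1)] in simp_all)
    then show ?thesis unfolding b using ei[OF xc] by simp
  qed
qed

lemma chi_eq_sum:
  assumes C: "bounded_complex A C" and v: "v \<in> V" and S: "finite S" "{n. \<not> zero_mod (obj C n)} \<subseteq> S"
  shows "chi C v = (\<Sum>n\<in>S. sg n * int (kd (obj C n) v))"
  unfolding chi_def
  by (rule sum.mono_neutral_left[OF S]) (use kd_zero_mod[OF bounded_complexD(2)[OF C] _ v] in auto)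

lemma finite_int_bound:
  assumes "finite (S :: int set)"
  obtains N where "S \<subseteq> {- N<..<N}"
proof -
  have "bdd_above (abs ` S)" using assms by simp
  then obtain B where "\<And>n. n \<in> S \<Longrightarrow> \<bar>n\<bar> \<le> B" unfolding bdd_above_def by auto
  then have "S \<subseteq> {- (B + 1)<..<B + 1}" by force
  then show ?thesis by (rule that)
qed

text \<open>Multiplication by \<open>ee v\<close> splits cohomology into components, so a
  quasi-isomorphism is one at each vertex, and the Euler characteristic depends on cohomology
  only.\<close>

lemma chi_quasi_iso:
  assumes C: "bounded_complex A C" and Z: "bounded_complex A Z" and f: "quasi_iso A C Z f" and v: "v \<in> V"
  shows "chi C v = chi Z v"
proof -
  \<comment> \<open>A common window for both complexes; the open interval leaves the margin that
    \<open>euler_cohomology\<close> requires.\<close>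
  obtain N where N: "{n. \<not> zero_mod (obj C n)} \<union> {n. \<not> zero_mod (obj Z n)} \<subseteq> {- N<..<N}"
    using finite_int_bound[OF finite_UnI[OF bounded_complexD(5)[OF C] bounded_complexD(5)[OF Z]]] .
  have sub: "{- N<..<N} \<subseteq> {- N..N}" by auto
  have e: "ee v \<in> carrier A" using v by (rule A_closed(5))
  have cm: "f n \<in> module_hom A (obj C n) (obj Z n)"
    "x \<in> carrier (obj C n) \<Longrightarrow> f (n + 1) (diff C n x) = diff Z n (f n x)" for n x
    using f unfolding quasi_iso_def chain_map_def by blast+
  have inj: "x \<in> cocycles C n \<Longrightarrow> f n x \<in> coboundaries Z n \<Longrightarrow> x \<in> coboundaries C n" for n x
    using f unfolding quasi_iso_def by blast
  have onto: "y \<in> cocycles Z n \<Longrightarrow> \<exists>x\<in>cocycles C n. \<exists>b\<in>coboundaries Z n. y = f n x \<oplus>\<^bsub>obj Z n\<^esub> b" for n y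
    using f unfolding quasi_iso_def by blast
  note MX = bounded_complexD(2)[OF C] and MZ = bounded_complexD(2)[OF Z]
  have cX: "x \<in> carrier (obj C n)" if "x \<in> cocycles C n" for x n
    using that unfolding cocycles_def mod_kernel_def by simp
  have eq: "int (zdim (component C v) n) - int (bdim (component C v) n) =
      int (zdim (component Z v) n) - int (bdim (component Z v) n)" for n
  proof -
    have "zdim (component C v) n + bdim (component Z v) n = zdim (component Z v) n + bdim (component C v) n"
    proof (rule cohomology_dim[OF component_vcomplex[OF C v] component_vcomplex[OF Z v]])
      show "f n \<in> module_hom class_ring (obj (component C v) n) (obj (component Z v) n)"
        unfolding cochain_complex.simps by (rule hom_cpt(1)[OF MX MZ cm(1) v])
      fix x assume x: "x \<in> cocycles (component C v) n"
      then have x1: "x \<in> cocycles C n" "ee v \<odot>\<^bsub>obj C n\<^esub> x = x"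
        unfolding component_cocycles(1)[OF C v] by simp_all
      have ef: "ee v \<odot>\<^bsub>obj Z n\<^esub> f n x = f n x" using hom_cpt(2)[OF MX MZ cm(1) v cX[OF x1(1)]] x1(2) by simp
      have "diff Z n (f n x) = f (n + 1) (diff C n x)" by (rule cm(2)[OF cX[OF x1(1)], symmetric])
      also have "\<dots> = f (n + 1) \<zero>\<^bsub>obj C (n + 1)\<^esub>"
        using x1(1) unfolding cocycles_def mod_kernel_def by simp
      also have "\<dots> = \<zero>\<^bsub>obj Z (n + 1)\<^esub>" by (rule hom_zero[OF MX MZ cm(1)])
      finally show "f n x \<in> cocycles (component Z v) n"
        unfolding component_cocycles(1)[OF Z v]
        using ef homD(1)[OF cm(1) cX[OF x1(1)]] unfolding cocycles_def mod_kernel_def by simp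
      show "f n x \<in> coboundaries (component Z v) n \<longleftrightarrow> x \<in> coboundaries (component C v) n"
        unfolding component_cocycles(2)[OF Z v] component_cocycles(2)[OF C v]
      proof
        assume "f n x \<in> coboundaries Z n \<and> ee v \<odot>\<^bsub>obj Z n\<^esub> f n x = f n x"
        then show "x \<in> coboundaries C n \<and> ee v \<odot>\<^bsub>obj C n\<^esub> x = x" using inj[OF x1(1)] x1(2) by simp
      next
        assume "x \<in> coboundaries C n \<and> ee v \<odot>\<^bsub>obj C n\<^esub> x = x"
        then have "x \<in> diff C (n - 1) ` carrier (obj C (n - 1))" unfolding coboundaries_def by simp
        then obtain z where z: "z \<in> carrier (obj C (n - 1))" "x = diff C (n - 1) z" by (elim imageE)
        have "f n x = diff Z (n - 1) (f (n - 1) z)" using cm(2)[OF z(1)] z(2) by simp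
        then have "f n x \<in> coboundaries Z n"
          unfolding coboundaries_def by (rule image_eqI) (rule homD(1)[OF cm(1) z(1)])
        then show "f n x \<in> coboundaries Z n \<and> ee v \<odot>\<^bsub>obj Z n\<^esub> f n x = f n x" using ef by simp
      qed
    next
      fix y assume "y \<in> cocycles (component Z v) n"
      then have y: "y \<in> cocycles Z n" "ee v \<odot>\<^bsub>obj Z n\<^esub> y = y"
        unfolding component_cocycles(1)[OF Z v] by simp_all
      obtain x b where x: "x \<in> cocycles C n" and b: "b \<in> coboundaries Z n" and yx: "y = f n x \<oplus>\<^bsub>obj Z n\<^esub> b"
        using onto[OF y(1)] by (elim bexE)
      have bc: "b \<in> carrier (obj Z n)"
        using b homD(1)[OF bounded_complexD(3)[OF Z, of "n - 1"]] unfolding coboundaries_def by auto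
      have "y = ee v \<odot>\<^bsub>obj Z n\<^esub> f n x \<oplus>\<^bsub>obj Z n\<^esub> ee v \<odot>\<^bsub>obj Z n\<^esub> b"
        using y(2) yx right_moduleD(5)[OF MZ e homD(1)[OF cm(1) cX[OF x]] bc] by simp
      then have "y = f n (ee v \<odot>\<^bsub>obj C n\<^esub> x) \<oplus>\<^bsub>obj Z n\<^esub> ee v \<odot>\<^bsub>obj Z n\<^esub> b"
        using hom_cpt(2)[OF MX MZ cm(1) v cX[OF x]] by simp
      then have "\<exists>b\<in>coboundaries (component Z v) n. y = f n (ee v \<odot>\<^bsub>obj C n\<^esub> x) \<oplus>\<^bsub>obj (component Z v) n\<^esub> b"
        unfolding cochain_complex.simps cs_simps by (rule bexI) (rule component_cocycles(4)[OF Z v b])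
      then show "\<exists>x\<in>cocycles (component C v) n. \<exists>b\<in>coboundaries (component Z v) n.
          y = f n x \<oplus>\<^bsub>obj (component Z v) n\<^esub> b"
        by (rule bexI) (rule component_cocycles(3)[OF C v x])
    qed
    then show ?thesis by simp
  qed
  have kX: "chi C v = (\<Sum>n\<in>{- N..N}. sg n * int (kd (obj C n) v))"
    by (rule chi_eq_sum[OF C v]) (use N sub in auto)
  have kZ: "chi Z v = (\<Sum>n\<in>{- N..N}. sg n * int (kd (obj Z n) v))"
    by (rule chi_eq_sum[OF Z v]) (use N sub in auto)
  have "(\<Sum>n\<in>{- N..N}. sg n * int (kdim (obj (component C v) n))) =
      (\<Sum>n\<in>{- N..N}. sg n * (int (zdim (component C v) n) - int (bdim (component C v) n)))"
    by (rule euler_cohomology[OF component_vcomplex[OF C v]])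
      (simp only: cochain_complex.simps, rule kd_zero_mod[OF MX _ v], use N in blast)
  moreover have "(\<Sum>n\<in>{- N..N}. sg n * int (kdim (obj (component Z v) n))) =
      (\<Sum>n\<in>{- N..N}. sg n * (int (zdim (component Z v) n) - int (bdim (component Z v) n)))"
    by (rule euler_cohomology[OF component_vcomplex[OF Z v]])
      (simp only: cochain_complex.simps, rule kd_zero_mod[OF MZ _ v], use N in blast)
  ultimately show ?thesis unfolding kX kZ eq by simp
qed

lemma chi_derived_iso:
  assumes i: "derived_iso A C Z" and v: "v \<in> V"
  shows "chi C v = chi Z v"
proof -
  obtain W :: "('b \<Rightarrow> 'k, nat \<Rightarrow> 'k) cochain_complex" and f g
    where W: "bounded_complex A W" and f: "quasi_iso A W C f" and g: "quasi_iso A W Z g"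
    by (rule derived_iso_roof[OF i])
  have "chi C v = chi W v" by (rule chi_quasi_iso[OF W derived_isoD(1)[OF i] f v, symmetric])
  also have "\<dots> = chi Z v" by (rule chi_quasi_iso[OF W derived_isoD(2)[OF i] g v])
  finally show ?thesis .
qed

lemma chi_stalk: "v \<in> V \<Longrightarrow> right_module A M \<Longrightarrow> chi (stalk M) v = int (kd M v)"
proof -
  assume v: "v \<in> V" and M: "right_module A M"
  have z: "zero_mod (M\<lparr>carrier := {\<zero>\<^bsub>M\<^esub>}\<rparr>)" by (simp add: zero_mod_def)
  have o: "obj (stalk M) n = (if n = 0 then M else M\<lparr>carrier := {\<zero>\<^bsub>M\<^esub>}\<rparr>)" for n
    by (simp add: stalk_def sum_of_shifts_def)
  have s: "{n. \<not> zero_mod (obj (stalk M) n)} = (if zero_mod M then {} else {0})"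
    unfolding o using z by (simp split: if_splits)
  have "chi (stalk M) v = (if zero_mod M then 0 else int (kd M v))"
    unfolding chi_def s by (simp add: o)
  then show "chi (stalk M) v = int (kd M v)" using kd_zero_mod[OF M _ v] by simp
qed

text \<open>The summand \<open>M j\<close> sits in degree \<open>- j\<close>, which has the parity
  of \<open>j\<close>.\<close>

lemma chi_sum_of_shifts:
  assumes "bounded_complex A (sum_of_shifts M)"
  shows "chi (sum_of_shifts M) v =
    (\<Sum>j | \<not> zero_mod (M j) \<and> even j. int (kd (M j) v)) - (\<Sum>j | \<not> zero_mod (M j) \<and> odd j. int (kd (M j) v))"
proof -
  have "finite {n. \<not> zero_mod (obj (sum_of_shifts M) n)}" by (rule bounded_complexD(5)[OF assms])
  then have "finite {n. \<not> zero_mod (M (- n))}" by (simp add: sum_of_shifts_def)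
  then have "finite (uminus ` {n. \<not> zero_mod (M (- n))})" by (rule finite_imageI)
  moreover have "uminus ` {n. \<not> zero_mod (M (- n))} = {j. \<not> zero_mod (M j)}"
  proof (intro equalityI subsetI)
    fix j assume "j \<in> {j. \<not> zero_mod (M j)}"
    then show "j \<in> uminus ` {n. \<not> zero_mod (M (- n))}"
      by (intro image_eqI[where x = "- j"]) simp_all
  qed auto
  ultimately have fin: "finite {j. \<not> zero_mod (M j)}" by simp
  have "chi (sum_of_shifts M) v = (\<Sum>j | \<not> zero_mod (M j). sg j * int (kd (M j) v))"
    unfolding chi_def
    by (rule sum.reindex_bij_witness[where i = uminus and j = uminus]) (auto simp: sum_of_shifts_def)
  also have "{j. \<not> zero_mod (M j)} = {j. \<not> zero_mod (M j) \<and> even j} \<union> {j. \<not> zero_mod (M j) \<and> odd j}"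
    by auto
  also have "(\<Sum>j\<in>{j. \<not> zero_mod (M j) \<and> even j} \<union> {j. \<not> zero_mod (M j) \<and> odd j}. sg j * int (kd (M j) v)) =
      (\<Sum>j | \<not> zero_mod (M j) \<and> even j. sg j * int (kd (M j) v)) +
      (\<Sum>j | \<not> zero_mod (M j) \<and> odd j. sg j * int (kd (M j) v))"
    by (rule sum.union_disjoint) (auto intro: finite_subset[OF _ fin])
  finally show ?thesis by (simp add: sum_negf)
qed

lemma chi_shift:
  assumes C: "bounded_complex A (shift (- 1) C)"
  shows "chi (shift (- 1) C) v = - (\<Sum>n | \<not> zero_mod (obj C n). sg n * int (kd (obj C n) v))"
proof -
  have "chi (shift (- 1) C) v = (\<Sum>n | \<not> zero_mod (obj C n). - (sg n * int (kd (obj C n) v)))"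
    unfolding chi_def
    by (rule sum.reindex_bij_witness[where i = "\<lambda>n. n + 1" and j = "\<lambda>n. n - 1"]) (auto simp: shift_def)
  then show ?thesis by (simp add: sum_negf)
qed

text \<open>On a complex of projectives the Nakayama functor acts on dimension vectors by
  \<open>nak\<close> in each degree. As \<open>nak\<close> is linear, it passes to the alternating
  sum; the shift contributes the sign.\<close>

lemma chi_derived_tau:
  assumes t: "is_derived_tau A C Z" and v: "v \<in> V"
  shows "chi Z v = - nak (chi C) v"
proof -
  interpret op: bip "opp A" Y X "E\<inverse>" eb "\<lambda>e. ab (prod.swap e)" by (rule bip_opp)
  obtain P :: "('b \<Rightarrow> 'k, nat \<Rightarrow> 'k) cochain_complex" where P: "\<And>n. fg_projective A (obj P n)"
    and PX: "derived_iso A P C" and NZ: "derived_iso A (shift (- 1) (nakayama_complex A P)) Z"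
    using t unfolding is_derived_tau_def by blast
  have bP: "bounded_complex A P" using PX unfolding derived_iso_def by simp
  have bN: "bounded_complex A (shift (- 1) (nakayama_complex A P))" using NZ unfolding derived_iso_def by simp
  let ?N = "nakayama_complex A P"
  have obj: "obj ?N n = kdual (opp A) (adual A (obj P n))" for n by (simp add: nakayama_complex_def)
  have D: "right_module (opp A) (adual A (obj P n))" for n
    by (rule adual_right_module[OF fg_projective_right_module[OF P]])
  have DD: "right_module A (obj ?N n)" for n using op.kdual_right_module[OF D[of n]] by (simp add: obj opp_opp)
  have v': "v \<in> Y \<union> X" using v by blast
  have k: "int (kd (obj ?N n) v) = nak (\<lambda>u. int (kd (obj P n) u)) v" for n
  proof -
    have "fdim (kspace (opp A) (adual A (obj P n)))" using adual_fdim[OF P] by simp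
    then show ?thesis using op.kd_kdual[OF D _ v', of n] kd_adual[OF P v, of n] by (simp add: obj)
  qed
  \<comment> \<open>The degrees where \<open>P\<close> and its Nakayama complex are nonzero are not
    compared; both sums are taken over the union instead.\<close>
  let ?s = "{n. \<not> zero_mod (obj P n)}" and ?t = "{n. \<not> zero_mod (obj ?N n)}"
  have fs: "finite ?s" by (rule bounded_complexD(5)[OF bP])
  have "?t \<subseteq> (\<lambda>n. n - 1) ` {n. \<not> zero_mod (obj (shift (- 1) ?N) n)}"
  proof (rule subsetI)
    fix n assume "n \<in> ?t"
    then show "n \<in> (\<lambda>n. n - 1) ` {n. \<not> zero_mod (obj (shift (- 1) ?N) n)}"
      by (intro image_eqI[where x = "n + 1"]) (simp_all add: shift_def)
  qed
  then have ft: "finite ?t" using bounded_complexD(5)[OF bN] by (rule finite_surj[rotated])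
  have "chi Z v = chi (shift (- 1) ?N) v" by (rule chi_derived_iso[OF NZ v, symmetric])
  also have "\<dots> = - (\<Sum>n\<in>?t. sg n * int (kd (obj ?N n) v))" by (rule chi_shift[OF bN])
  also have "(\<Sum>n\<in>?t. sg n * int (kd (obj ?N n) v)) = (\<Sum>n\<in>?s \<union> ?t. sg n * int (kd (obj ?N n) v))"
    by (rule sum.mono_neutral_left) (use fs ft kd_zero_mod[OF DD _ v] in auto)
  also have "\<dots> = (\<Sum>n\<in>?s \<union> ?t. nak (\<lambda>u. sg n * int (kd (obj P n) u)) v)"
    unfolding k nak_scale ..
  also have "\<dots> = nak (\<lambda>u. \<Sum>n\<in>?s \<union> ?t. sg n * int (kd (obj P n) u)) v"
    by (rule nak_sum[symmetric]) (use fs ft in simp)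
  also have "\<dots> = nak (chi P) v"
    by (rule nak_cong[OF _ v]) (rule chi_eq_sum[OF bP, symmetric], use fs ft in auto)
  also have "\<dots> = nak (chi C) v" by (rule nak_cong[OF chi_derived_iso[OF PX] v])
  finally show ?thesis .
qed

end

section \<open>The invariant quadratic form\<close>

lemma fg_projective_iso:
  assumes P: "fg_projective A P" and N: "right_module A N"
    and f: "f \<in> module_hom A P N" and bij: "bij_betw f (carrier P) (carrier N)"
  shows "fg_projective A N"
proof -
  obtain n s r where Pm: "right_module A P" and s: "s \<in> module_hom A P (free_mod A n)"
    and r: "r \<in> module_hom A (free_mod A n) P" and rs: "\<And>x. x \<in> carrier P \<Longrightarrow> r (s x) = x"
    using fg_projectiveE[OF P] by metis
  let ?g = "the_inv_into (carrier P) f"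
  have g: "?g \<in> module_hom A N P" by (rule inv_hom[OF Pm f bij])
  have fg: "f (?g y) = y" if "y \<in> carrier N" for y
    using f_the_inv_into_f_bij_betw[OF bij] that by simp
  have "\<forall>y\<in>carrier N. f (r (s (?g y))) = y" using rs homD(1)[OF g] fg by simp
  then have "\<exists>r'\<in>module_hom A (free_mod A n) N. \<forall>y\<in>carrier N. r' (s (?g y)) = y"
    by (rule bexI[where x = "\<lambda>x. f (r x)"]) (rule hom_comp[OF r f])
  then have "\<exists>s'\<in>module_hom A N (free_mod A n). \<exists>r'\<in>module_hom A (free_mod A n) N. \<forall>y\<in>carrier N. r' (s' y) = y"
    by (rule bexI[where x = "\<lambda>y. s (?g y)"]) (rule hom_comp[OF g s])
  then show ?thesis unfolding fg_projective_def using N by blast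
qed

context bip
begin

lemma brick_iso:
  assumes M: "right_module A M" and N: "right_module A N"
    and f: "f \<in> module_hom A M N" and bij: "bij_betw f (carrier M) (carrier N)" and b: "brick M"
  shows "brick N"
  unfolding brick_def
proof
  fix \<theta> assume \<theta>: "\<theta> \<in> module_hom A N N"
  let ?g = "the_inv_into (carrier M) f"
  have g: "?g \<in> module_hom A N M" by (rule inv_hom[OF M f bij])
  have fg: "f (?g y) = y" if "y \<in> carrier N" for y
    using f_the_inv_into_f_bij_betw[OF bij] that by simp
  obtain c where c: "\<forall>x\<in>carrier M. ?g (\<theta> (f x)) = scal c \<odot>\<^bsub>M\<^esub> x"
    using brickD[OF b hom_comp[OF hom_comp[OF f \<theta>] g]] by (elim exE)
  have s: "scal c \<in> carrier A" by blast
  have "\<theta> y = scal c \<odot>\<^bsub>N\<^esub> y" if y: "y \<in> carrier N" for y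
  proof -
    have gy: "?g y \<in> carrier M" by (rule homD(1)[OF g y])
    have "\<theta> y = f (?g (\<theta> y))" by (rule fg[OF homD(1)[OF \<theta> y], symmetric])
    also have "?g (\<theta> y) = scal c \<odot>\<^bsub>M\<^esub> ?g y" using bspec[OF c gy] fg[OF y] by simp
    also have "f (scal c \<odot>\<^bsub>M\<^esub> ?g y) = scal c \<odot>\<^bsub>N\<^esub> y" using homD(3)[OF f s gy] fg[OF y] by simp
    finally show ?thesis .
  qed
  then show "\<exists>c. \<forall>y\<in>carrier N. \<theta> y = scal c \<odot>\<^bsub>N\<^esub> y" by blast
qed

end

locale weighted_bip = bip A X Y E eb ab
  for A :: "('k::field, 'b \<Rightarrow> 'k) module" and X Y :: "'v set" and E eb ab +
  fixes \<kappa> :: "'v \<Rightarrow> real" and c :: real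
  assumes eigen_X: "x \<in> X \<Longrightarrow> (\<Sum>y | (x, y) \<in> E. \<kappa> y) = 2 * c * \<kappa> x"
    and eigen_Y: "y \<in> Y \<Longrightarrow> (\<Sum>x | (x, y) \<in> E. \<kappa> x) = 2 * c * \<kappa> y"
begin

definition wt :: "'v set \<Rightarrow> ('v \<Rightarrow> int) \<Rightarrow> real" where
  "wt S p = (\<Sum>v\<in>S. \<kappa> v * of_int (p v))"

text \<open>By the law of cosines, the squared length of the sum of a vector of length
  \<open>wt X p\<close> and one of length \<open>wt Y p\<close>, when their directions enclose an
  angle of cosine \<open>- c\<close>, as the two simple roots do.\<close>

definition form :: "('v \<Rightarrow> int) \<Rightarrow> real" where
  "form p = (wt X p)\<^sup>2 + (wt Y p)\<^sup>2 - 2 * c * wt X p * wt Y p"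

lemma form_cong: "(\<And>v. v \<in> V \<Longrightarrow> p v = q v) \<Longrightarrow> form p = form q"
  by (simp add: form_def wt_def)

lemma form_minus: "form (\<lambda>v. - p v) = form p"
  by (simp add: form_def wt_def sum_negf)

text \<open>The two steps of the Coxeter transformation are the reflections
  \<open>b \<mapsto> 2 c a - b\<close> and \<open>a \<mapsto> 2 c b - a\<close> on the weights \<open>(a, b)\<close>.\<close>

lemma form_nak: "form (nak p) = form p"
proof -
  let ?a = "wt X p" and ?b = "wt Y p"
  \<comment> \<open>Both sides sum over all arrows. This moves the neighbour sums onto the weights,
    where the eigenvector equations apply.\<close>
  have swapXY: "(\<Sum>y\<in>Y. \<Sum>x | (x, y) \<in> E. h x y) = (\<Sum>x\<in>X. \<Sum>y | (x, y) \<in> E. h x y)" for h :: "'v \<Rightarrow> 'v \<Rightarrow> real"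
  proof -
    have "(\<Sum>y\<in>Y. \<Sum>x | (x, y) \<in> E. h x y) = (\<Sum>y\<in>Y. \<Sum>x | x \<in> X \<and> (x, y) \<in> E. h x y)"
      by (intro sum.cong refl) (use EXY in auto)
    also have "\<dots> = (\<Sum>x\<in>X. \<Sum>y | y \<in> Y \<and> (x, y) \<in> E. h x y)"
      by (rule sum.swap_restrict[OF finY finX])
    also have "\<dots> = (\<Sum>x\<in>X. \<Sum>y | (x, y) \<in> E. h x y)"
      by (intro sum.cong refl) (use EXY in auto)
    finally show ?thesis .
  qed
  have nY: "nak p y = p y - (\<Sum>x | (x, y) \<in> E. p x)" if "y \<in> Y" for y
    using that by (simp add: nak_def)
  have nX: "nak p x = p x + (\<Sum>y | (x, y) \<in> E. nak p y)" if "x \<in> X" for x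
  proof -
    have "x \<notin> Y" using that XY by blast
    moreover have "(\<Sum>y | (x, y) \<in> E. p y - (\<Sum>x | (x, y) \<in> E. p x)) = (\<Sum>y | (x, y) \<in> E. nak p y)"
      by (rule sum.cong) (use nY EXY in auto)
    ultimately show ?thesis by (simp add: nak_def)
  qed
  have "wt Y (nak p) = (\<Sum>y\<in>Y. \<kappa> y * of_int (p y) - (\<Sum>x | (x, y) \<in> E. \<kappa> y * of_int (p x)))"
    unfolding wt_def by (rule sum.cong) (simp_all add: nY sum_distrib_left right_diff_distrib)
  also have "\<dots> = ?b - (\<Sum>x\<in>X. \<Sum>y | (x, y) \<in> E. \<kappa> y * of_int (p x))"
    by (simp add: wt_def sum_subtractf swapXY)
  also have "(\<Sum>x\<in>X. \<Sum>y | (x, y) \<in> E. \<kappa> y * of_int (p x)) = (\<Sum>x\<in>X. 2 * c * (\<kappa> x * of_int (p x)))"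
    by (rule sum.cong) (simp_all add: eigen_X flip: sum_distrib_right)
  also have "\<dots> = 2 * c * ?a" by (simp add: wt_def sum_distrib_left)
  finally have b: "wt Y (nak p) = ?b - 2 * c * ?a" .
  have "wt X (nak p) = (\<Sum>x\<in>X. \<kappa> x * of_int (p x) + (\<Sum>y | (x, y) \<in> E. \<kappa> x * of_int (nak p y)))"
    unfolding wt_def by (rule sum.cong) (simp_all add: nX sum_distrib_left distrib_left)
  also have "\<dots> = ?a + (\<Sum>y\<in>Y. \<Sum>x | (x, y) \<in> E. \<kappa> x * of_int (nak p y))"
    by (simp add: wt_def sum.distrib swapXY)
  also have "(\<Sum>y\<in>Y. \<Sum>x | (x, y) \<in> E. \<kappa> x * of_int (nak p y)) = (\<Sum>y\<in>Y. 2 * c * (\<kappa> y * of_int (nak p y)))"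
    by (rule sum.cong) (simp_all add: eigen_Y flip: sum_distrib_right)
  also have "\<dots> = 2 * c * wt Y (nak p)" by (simp add: wt_def sum_distrib_left)
  finally have a: "wt X (nak p) = ?a + 2 * c * wt Y (nak p)" .
  show ?thesis unfolding form_def a b by (simp add: power2_eq_square algebra_simps)
qed

lemma weighted_opp: "weighted_bip (opp A) Y X (E\<inverse>) eb (\<lambda>e. ab (prod.swap e)) \<kappa> c"
  by (intro weighted_bip.intro bip_opp weighted_bip_axioms.intro) (simp_all add: eigen_X eigen_Y)

text \<open>\<open>form\<close> is symmetric in the two parts, so it is the same for the reversed
  quiver, and \<open>form_nak\<close> can be used there.\<close>

lemma form_nak_opp: "form (bip.nak X (E\<inverse>) p) = form p"
proof -
  interpret op: weighted_bip "opp A" Y X "E\<inverse>" eb "\<lambda>e. ab (prod.swap e)" \<kappa> c by (rule weighted_opp)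
  have "op.form q = form q" for q
    unfolding op.form_def form_def op.wt_def wt_def by (simp add: algebra_simps)
  then show ?thesis using op.form_nak[of p] by simp
qed

abbreviation dimv :: "('b \<Rightarrow> 'k, 'm) module \<Rightarrow> 'v \<Rightarrow> int" where
  "dimv M \<equiv> \<lambda>v. int (kd M v)"

text \<open>The iterates are arbitrary representatives chosen step by step, so each direction
  carries an invariant: for \<open>m \<ge> 0\<close>, being projective and either zero or of the
  correct form; for \<open>m < 0\<close>, being finitely generated and either zero or a brick of the
  correct form.\<close>

lemma tau_power_form:
  fixes P :: "('b \<Rightarrow> 'k, 'm) module"
  assumes P: "fg_projective A P" and b: "brick P" and t: "is_tau_power A m P M" and nz: "\<not> zero_mod M"
  shows "form (dimv M) = form (dimv P)"
proof -
  let ?E = "\<lambda>(M :: ('b \<Rightarrow> 'k, 'm) module) (N :: ('b \<Rightarrow> 'k, nat \<Rightarrow> 'k) module). fg_mod A M \<and> fg_mod A N \<and> mod_iso A M N"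
  have Pm: "right_module A P" by (rule fg_projective_right_module[OF P])
  have fP: "fdim (kspace A P)" by (rule fg_fdim[OF fg_projective_fg[OF P]])
  \<comment> \<open>The starting module may live in a type of its own; \<open>?E\<close> replaces it
    by an isomorphic copy in the universe of the iteration.\<close>
  have base: "fg_projective A N \<and> brick N \<and> form (dimv N) = form (dimv P)" if E: "?E P N" for N
  proof -
    have N: "right_module A N" using E by (simp add: fg_mod_def)
    obtain f where f: "f \<in> module_hom A P N" and bij: "bij_betw f (carrier P) (carrier N)"
      using E unfolding mod_iso_def by (elim conjE bexE)
    have "form (dimv N) = form (dimv P)"
      by (rule form_cong) (use kd_iso[OF Pm N fP f bij] in simp)
    then show ?thesis using fg_projective_iso[OF P N f bij] brick_iso[OF Pm N f bij b] by simp
  qed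
  show ?thesis
  proof (cases "0 \<le> m")
    case True
    have inv: "iterate_rel ?E (is_tau A) k P N \<Longrightarrow> fg_projective A N \<and> (zero_mod N \<or> form (dimv N) = form (dimv P))"
      for k N
    proof (induction k arbitrary: N)
      case 0
      then have "?E P N" by simp
      from base[OF this] show ?case by simp
    next
      case (Suc k)
      then obtain Z where Z: "iterate_rel ?E (is_tau A) k P Z" and t: "is_tau A Z N" by auto
      \<comment> \<open>The translate of a projective is zero, and zero is projective again, so the
        invariant survives.\<close>
      have z: "zero_mod N" by (rule tau_projective[OF _ t]) (use Suc.IH[OF Z] in simp)
      have "right_module A N" using t by (simp add: is_tau_def fg_mod_def)
      then show ?case using zero_mod_projective z by simp
    qed
    have "iterate_rel ?E (is_tau A) (nat \<bar>m\<bar>) P M" using t True unfolding is_tau_power_def by simp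
    then show ?thesis using inv nz by blast
  next
    case False
    have inv: "iterate_rel ?E (is_tau_inv A) k P N \<Longrightarrow>
        fg_mod A N \<and> (zero_mod N \<or> brick N \<and> form (dimv N) = form (dimv P))" for k N
    proof (induction k arbitrary: N)
      case 0
      then have E: "?E P N" by simp
      from base[OF this] E show ?case by simp
    next
      case (Suc k)
      then obtain Z where Z: "iterate_rel ?E (is_tau_inv A) k P Z" and t: "is_tau_inv A Z N" by auto
      note IH = Suc.IH[OF Z]
      have Zm: "right_module A Z" using IH by (simp add: fg_mod_def)
      have N: "fg_mod A N" using t by (simp add: is_tau_inv_def is_transpose_def opp_opp)
      show ?case
      proof (cases "zero_mod Z")
        case True
        then show ?thesis using tau_inv_zero[OF Zm True t] N by simp
      next
        case False
        then have Zb: "brick Z" and Zf: "form (dimv Z) = form (dimv P)" and Zg: "fg_mod A Z" using IH by simp_all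
        have "form (dimv N) = form (dimv P)" if "\<forall>v\<in>V. dimv N v = - bip.nak X (E\<inverse>) (dimv Z) v"
        proof -
          have "form (dimv N) = form (\<lambda>v. - bip.nak X (E\<inverse>) (dimv Z) v)"
            by (rule form_cong) (use that in blast)
          then show ?thesis using Zf by (simp add: form_minus form_nak_opp)
        qed
        then show ?thesis using tau_inv_brick(2)[OF Zg Zb t] N by blast
      qed
    qed
    have "iterate_rel ?E (is_tau_inv A) (nat \<bar>m\<bar>) P M" using t False unfolding is_tau_power_def by simp
    then show ?thesis using inv nz by blast
  qed
qed

lemma derived_tau_form: "is_derived_tau A C Z \<Longrightarrow> form (chi Z) = form (chi C)"
proof -
  assume "is_derived_tau A C Z"
  then have "form (chi Z) = form (\<lambda>v. - nak (chi C) v)" by (intro form_cong chi_derived_tau)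
  then show ?thesis by (simp add: form_minus form_nak)
qed

text \<open>Equality of the values of \<open>form\<close> is symmetric, so the converse relation
  that encodes \<open>\<tau>\<^sup>-\<^sup>1\<close> is covered by \<open>derived_tau_form\<close>
  as well.\<close>

lemma derived_tau_power_form:
  fixes C :: "('b \<Rightarrow> 'k, 'm) cochain_complex"
  assumes t: "is_derived_tau_power A m C Z"
  shows "form (chi Z) = form (chi C)"
proof -
  let ?T = "if 0 \<le> m then is_derived_tau A else (\<lambda>Y Z. is_derived_tau A Z Y)"
  have "iterate_rel (derived_iso A) ?T k C Z \<Longrightarrow> form (chi Z) = form (chi C)" for k Z
  proof (induction k arbitrary: Z)
    case 0
    then show ?case by (intro form_cong chi_derived_iso[symmetric]) simp_all
  next
    case (Suc k)
    then obtain W where W: "iterate_rel (derived_iso A) ?T k C W" and t: "?T W Z" by auto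
    have "form (chi Z) = form (chi W)"
      using t derived_tau_form[of W Z] derived_tau_form[of Z W] by (simp split: if_splits)
    then show ?case using Suc.IH[OF W] by simp
  qed
  then show ?thesis using t unfolding is_derived_tau_power_def by simp
qed

end

section \<open>The weighted foldings\<close>

definition weight_cos :: "folding \<Rightarrow> real" where
  "weight_cos \<Delta> = cos (pi / (2 * fold_n \<Delta>))"

definition nbrs :: "folding \<Rightarrow> vertex \<Rightarrow> vertex set" where
  "nbrs \<Delta> v = {u. (v, u) \<in> fold_arrows \<Delta> \<or> (u, v) \<in> fold_arrows \<Delta>}"

lemma cheb_U_pos:
  assumes "0 < \<theta>" "\<theta> < pi" "real (i + 1) * \<theta> \<le> pi"
  shows "0 \<le> poly (cheb_U i) (cos \<theta>)"
proof -
  have s: "0 < sin \<theta>" using assms(1,2) by (rule sin_gt_zero)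
  have "0 \<le> sin (real (i + 1) * \<theta>)" using assms by (intro sin_ge_zero) auto
  then have "0 \<le> poly (cheb_U i) (cos \<theta>) * sin \<theta>" by (simp only: cheb_U_cos)
  then show ?thesis using s by (simp add: zero_le_mult_iff)
qed

lemma cheb_U_numerals:
  "poly (cheb_U 1) x = 2 * x" "poly (cheb_U 2) x = 4 * (x * x) - 1"
  "poly (cheb_U 3) x = 8 * (x * (x * x)) - 4 * x"
  "poly (cheb_U 4) x = 16 * (x * (x * (x * x))) - 12 * (x * x) + 1"
  by (simp_all add: numeral_eq_Suc algebra_simps)

lemma cheb_U_step: "poly (cheb_U (i + 2)) x = 2 * x * poly (cheb_U (i + 1)) x - poly (cheb_U i) x"
  by (simp add: algebra_simps)

lemma fold_angle:
  assumes "valid_folding \<Delta>"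
  shows "0 < pi / (2 * real (fold_n \<Delta>))" "pi / (2 * real (fold_n \<Delta>)) < pi / 2" "2 \<le> fold_n \<Delta>"
proof -
  show n: "2 \<le> fold_n \<Delta>" using assms by (cases \<Delta>) auto
  then show "0 < pi / (2 * real (fold_n \<Delta>))" by simp
  have "pi * 2 < pi * (2 * real (fold_n \<Delta>))" using n by simp
  then show "pi / (2 * real (fold_n \<Delta>)) < pi / 2" using n by (simp add: field_simps)
qed

lemma weight_cos_pos: "valid_folding \<Delta> \<Longrightarrow> 0 < weight_cos \<Delta>"
  unfolding weight_cos_def using fold_angle[of \<Delta>] by (intro cos_gt_zero) auto

section \<open>The eigenvector equations, family by family\<close>

lemma nbrs_A:
  assumes "i \<le> 2 * n - 2"
  shows "nbrs (Fold_A n) (Vtx i) =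
    (if i = 0 then {} else {Vtx (i - 1)}) \<union> (if i + 1 \<le> 2 * n - 2 then {Vtx (i + 1)} else {})"
  using assms by (cases "even i") (auto simp: nbrs_def even_to_odd_def)

text \<open>The equation is the three-term recursion of the Chebyshev polynomials. At the right end
  one neighbour is missing, and its would-be weight \<open>U_(2n-1)\<close> vanishes because sin(2n
  t) = 0 for t = \<pi>/2n.\<close>

lemma eigen_A:
  assumes n: "n \<ge> 2" and v: "v \<in> fold_verts (Fold_A n)"
  shows "(\<Sum>u\<in>nbrs (Fold_A n) v. kappa (Fold_A n) u) = 2 * weight_cos (Fold_A n) * kappa (Fold_A n) v"
proof -
  obtain i where i: "v = Vtx i" "i \<le> 2 * n - 2" using v by auto
  let ?c = "cos (pi / (2 * n))"
  have s: "sin (pi / (2 * n)) \<noteq> 0"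
    using fold_angle[of "Fold_A n"] n sin_gt_zero[of "pi / (2 * n)"] pi_gt_zero by auto
  have "poly (cheb_U (2 * n - 1)) ?c * sin (pi / (2 * n)) = sin (real (2 * n - 1 + 1) * (pi / (2 * n)))"
    by (rule cheb_U_cos)
  also have "real (2 * n - 1 + 1) * (pi / (2 * n)) = pi" using n by (simp add: of_nat_diff)
  finally have z: "poly (cheb_U (2 * n - 1)) ?c = 0" using s by simp
  show ?thesis
  proof (cases i)
    case 0
    then show ?thesis using n i by (simp add: nbrs_A weight_cos_def)
  next
    case (Suc j)
    have st: "poly (cheb_U (i + 1)) ?c = 2 * ?c * poly (cheb_U i) ?c - poly (cheb_U (i - 1)) ?c"
      using cheb_U_step[of j ?c] Suc by simp
    show ?thesis
    proof (cases "i + 1 \<le> 2 * n - 2")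
      case True
      then show ?thesis using st i Suc unfolding i(1) nbrs_A[OF i(2)] by (simp add: weight_cos_def)
    next
      case False
      then have "i + 1 = 2 * n - 1" using i(2) n by simp
      then have "poly (cheb_U (i - 1)) ?c = 2 * ?c * poly (cheb_U i) ?c" using st z by simp
      then show ?thesis using False Suc unfolding i(1) nbrs_A[OF i(2)] by (simp add: weight_cos_def)
    qed
  qed
qed

lemma nbrs_D:
  assumes "n \<ge> 3"
  shows "i \<le> n - 3 \<Longrightarrow> nbrs (Fold_D n) (Vtx i) = (if i = 0 then {} else {Vtx (i - 1)}) \<union> {Vtx (i + 1)}"
    "nbrs (Fold_D n) (Vtx (n - 2)) = {Vtx (n - 3), Plus (n - 1), Minus (n - 1)}"
    "nbrs (Fold_D n) (Plus (n - 1)) = {Vtx (n - 2)}"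
    "nbrs (Fold_D n) (Minus (n - 1)) = {Vtx (n - 2)}"
proof -
  obtain k where k: "n = k + 3" using assms by (metis add.commute le_Suc_ex)
  show "i \<le> n - 3 \<Longrightarrow> nbrs (Fold_D n) (Vtx i) = (if i = 0 then {} else {Vtx (i - 1)}) \<union> {Vtx (i + 1)}"
    unfolding k by (cases "even i") (auto simp: nbrs_def even_to_odd_def)
  show "nbrs (Fold_D n) (Vtx (n - 2)) = {Vtx (n - 3), Plus (n - 1), Minus (n - 1)}"
    "nbrs (Fold_D n) (Plus (n - 1)) = {Vtx (n - 2)}"
    "nbrs (Fold_D n) (Minus (n - 1)) = {Vtx (n - 2)}"
    unfolding k by (cases "even k"; auto simp: nbrs_def even_to_odd_def)+
qed

text \<open>Along the stem the recursion applies, doubled; at the fork the two undoubled tips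
  together supply the next term. A tip itself needs \<open>2 U_(n-2) = 2 c U_(n-1)\<close>, which is
  the recursion combined with \<open>U_n = U_(n-2)\<close>; the latter holds since n t = \<pi>/2
  makes sin((n+1) t) and sin((n-1) t) equal.\<close>

lemma eigen_D:
  assumes n: "n \<ge> 3" and v: "v \<in> fold_verts (Fold_D n)"
  shows "(\<Sum>u\<in>nbrs (Fold_D n) v. kappa (Fold_D n) u) = 2 * weight_cos (Fold_D n) * kappa (Fold_D n) v"
proof -
  let ?t = "pi / (2 * n)"
  let ?c = "cos ?t"
  have s: "sin ?t \<noteq> 0"
    using fold_angle[of "Fold_D n"] n sin_gt_zero[of "pi / (2 * n)"] pi_gt_zero by auto
  have "real n * ?t = pi / 2" using n by simp
  moreover have "real (n - 2 + 1) = real n - 1" using n by (simp add: of_nat_diff)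
  ultimately have "real (n + 1) * ?t = pi / 2 + ?t" "real (n - 2 + 1) * ?t = pi / 2 - ?t"
    by (simp_all only: of_nat_add of_nat_1 distrib_right left_diff_distrib mult_1_left)
  then have "poly (cheb_U n) ?c * sin ?t = cos ?t" "poly (cheb_U (n - 2)) ?c * sin ?t = cos ?t"
    unfolding cheb_U_cos by (simp_all add: sin_add sin_diff)
  then have e: "poly (cheb_U n) ?c = poly (cheb_U (n - 2)) ?c" using s by (metis mult_right_cancel)
  have i: "n - 2 + 2 = n" "n - 2 + 1 = n - 1" "n - 3 + 2 = n - 1" "n - 3 + 1 = n - 2" using n by simp_all
  have "poly (cheb_U n) ?c = 2 * ?c * poly (cheb_U (n - 1)) ?c - poly (cheb_U (n - 2)) ?c"
    using cheb_U_step[of "n - 2" ?c] unfolding i .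
  then have top: "2 * poly (cheb_U (n - 2)) ?c = 2 * ?c * poly (cheb_U (n - 1)) ?c" using e by simp
  consider i where "v = Vtx i" "i \<le> n - 3" | "v = Vtx (n - 2)" | "v = Plus (n - 1) \<or> v = Minus (n - 1)"
  proof -
    assume a: "\<And>i. v = Vtx i \<Longrightarrow> i \<le> n - 3 \<Longrightarrow> thesis" "v = Vtx (n - 2) \<Longrightarrow> thesis"
      "v = Plus (n - 1) \<or> v = Minus (n - 1) \<Longrightarrow> thesis"
    show thesis
    proof (cases "\<exists>i. v = Vtx i")
      case True
      then obtain i where i: "v = Vtx i" "i \<le> n - 2" using v by auto
      then show thesis using a(1)[of i] a(2) by (cases "i = n - 2") auto
    next
      case False
      then show thesis using v a(3) by auto
    qed
  qed
  then show ?thesis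
  proof cases
    case 1
    then have vi: "v = Vtx i" and i: "i \<le> n - 3" by simp_all
    show ?thesis
    proof (cases i)
      case 0
      then show ?thesis unfolding vi nbrs_D(1)[OF n i] by (simp add: weight_cos_def)
    next
      case (Suc j)
      then show ?thesis using cheb_U_step[of j ?c] unfolding vi nbrs_D(1)[OF n i]
        by (simp add: weight_cos_def algebra_simps)
    qed
  next
    case 2
    have "poly (cheb_U (n - 1)) ?c = 2 * ?c * poly (cheb_U (n - 2)) ?c - poly (cheb_U (n - 3)) ?c"
      using cheb_U_step[of "n - 3" ?c] unfolding i .
    then show ?thesis unfolding 2 nbrs_D(2)[OF n] by (simp add: weight_cos_def algebra_simps)
  next
    case 3
    then show ?thesis using top by (auto simp: nbrs_D(3,4)[OF n] weight_cos_def simp del: One_nat_def)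
  qed
qed

lemma two_cos_mult: "2 * cos a * (2 * cos b) = 2 * cos (a + b) + 2 * cos (a - b)" for a b :: real
  by (simp add: cos_add cos_diff)

text \<open>By \<pi>/12 = \<pi>/3 - \<pi>/4 the cosine \<open>c\<close> is expressed by square roots
  of 2 and 3. The end \<open>Extra\<close> needs \<open>2 c sqrt 2 = U_2\<close>, from
  \<open>c2\<close> and \<open>c3\<close>, and the branch vertex needs \<open>c4\<close>; the other
  equations are instances of the recursion.\<close>

lemma eigen_E6:
  assumes v: "v \<in> fold_verts Fold_E6"
  shows "(\<Sum>u\<in>nbrs Fold_E6 v. kappa Fold_E6 u) = 2 * weight_cos Fold_E6 * kappa Fold_E6 v"
proof -
  define c where "c = cos (pi / 12)"
  have "pi / 12 = pi / 3 - pi / 4" by simp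
  then have "c = cos (pi / 3) * cos (pi / 4) + sin (pi / 3) * sin (pi / 4)" unfolding c_def by (simp only: cos_diff)
  then have c: "4 * c = sqrt 2 * (1 + sqrt 3)"
    by (simp add: cos_60 cos_45 sin_60 sin_45 algebra_simps)
  then have "4 * c * (4 * c) = sqrt 2 * sqrt 2 * ((1 + sqrt 3) * (1 + sqrt 3))" by (simp only: ac_simps)
  then have c2: "4 * (c * c) = 2 + sqrt 3" by (simp add: algebra_simps)
  have c3: "2 * c * sqrt 2 = 1 + sqrt 3"
  proof -
    have "4 * c * sqrt 2 = sqrt 2 * sqrt 2 * (1 + sqrt 3)" unfolding c by (simp only: ac_simps)
    then show ?thesis by simp
  qed
  have c4: "4 * c + sqrt 2 = 2 * c * (4 * (c * c) - 1)"
  proof -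
    have "2 * c * (4 * (c * c) - 1) = 2 * c + 2 * (c * sqrt 3)" unfolding c2 by (simp add: algebra_simps)
    moreover have "4 * c * sqrt 3 = sqrt 2 * (sqrt 3 + sqrt 3 * sqrt 3)"
      unfolding c by (simp only: algebra_simps mult_1_left)
    then have "4 * (c * sqrt 3) = sqrt 2 * sqrt 3 + 3 * sqrt 2" by (simp add: algebra_simps)
    moreover have "4 * c = sqrt 2 + sqrt 2 * sqrt 3" unfolding c by (simp add: algebra_simps)
    ultimately show ?thesis by linarith
  qed
  have nb: "nbrs Fold_E6 (Plus 0) = {Plus 1}" "nbrs Fold_E6 (Minus 0) = {Minus 1}"
    "nbrs Fold_E6 (Plus 1) = {Plus 0, Vtx 2}" "nbrs Fold_E6 (Minus 1) = {Minus 0, Vtx 2}"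
    "nbrs Fold_E6 (Vtx 2) = {Plus 1, Minus 1, Extra}" "nbrs Fold_E6 Extra = {Vtx 2}"
    by (auto simp: nbrs_def)
  have w: "weight_cos Fold_E6 = c" by (simp add: weight_cos_def c_def)
  consider "v = Plus 0" | "v = Minus 0" | "v = Plus 1" | "v = Minus 1" | "v = Vtx 2" | "v = Extra"
    using v by auto
  then show ?thesis
    by cases (use c2 c3 c4 in \<open>simp_all add: nb w cheb_U_numerals c_def[symmetric] algebra_simps del: One_nat_def\<close>)
qed

text \<open>In \<open>x = 2 cos t\<close> and \<open>y = 2 cos 2t\<close> all weights are
  polynomials in \<open>y\<close> or \<open>x\<close> times such, by repeated use of the product
  formula. Besides \<open>x * x = y + 2\<close> one relation is needed, the cubic \<open>y3\<close>,
  which comes from 2 cos 6t = 1.\<close>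

lemma eigen_E7:
  assumes v: "v \<in> fold_verts Fold_E7"
  shows "(\<Sum>u\<in>nbrs Fold_E7 v. kappa Fold_E7 u) = 2 * weight_cos Fold_E7 * kappa Fold_E7 v"
proof -
  define t :: real where "t = pi / 18"
  define x where "x = 2 * cos t"
  define y where "y = 2 * cos (2 * t)"
  have y: "y = x\<^sup>2 - 2" using two_cos_mult[of t t] by (simp add: x_def y_def power2_eq_square)
  have x3: "2 * cos (3 * t) = x * y - x"
    using two_cos_mult[of t "2 * t"] by (simp add: x_def y_def)
  have "2 * cos (3 * t) * y = 2 * cos (5 * t) + x" unfolding y_def x_def two_cos_mult by simp
  then have x5: "2 * cos (5 * t) = (x * y - x) * y - x" unfolding x3 by simp
  have y4: "2 * cos (4 * t) = y * y - 2"
    using two_cos_mult[of "2 * t" "2 * t"] by (simp add: y_def)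
  have "2 * cos (4 * t) * y = 2 * cos (6 * t) + y" unfolding y_def two_cos_mult by simp
  then have "2 * cos (6 * t) = y * (y * y - 2) - y" unfolding y4 by (simp add: mult.commute)
  moreover have "6 * t = pi / 3" by (simp add: t_def)
  ultimately have y3: "y * (y * y - 2) - y = 1" by (simp add: cos_60)
  have nb: "nbrs Fold_E7 (Vtx 0) = {Vtx 1}" "nbrs Fold_E7 (Vtx 1) = {Vtx 0, Vtx 2}"
    "nbrs Fold_E7 (Vtx 2) = {Vtx 1, Vtx 3}" "nbrs Fold_E7 (Vtx 3) = {Vtx 2, Tilde 1, Tilde 2}"
    "nbrs Fold_E7 (Tilde 1) = {Vtx 3}" "nbrs Fold_E7 (Tilde 2) = {Vtx 3, Extra}"
    "nbrs Fold_E7 Extra = {Tilde 2}"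
    by (auto simp: nbrs_def)
  have c: "cos (pi / 18) = x / 2" "cos (pi / 9) = y / 2" by (simp_all add: x_def y_def t_def)
  have k: "kappa Fold_E7 (Vtx 0) = 1" "kappa Fold_E7 (Vtx 1) = x" "kappa Fold_E7 (Vtx 2) = x * x - 1"
    "kappa Fold_E7 (Vtx 3) = x * y" "kappa Fold_E7 (Tilde 1) = y" "kappa Fold_E7 (Tilde 2) = y * y - 1"
    by (simp_all add: c cheb_U_numerals y power2_eq_square field_simps)
  have e: "cos (5 * pi / 18) = cos (5 * t)" by (simp add: t_def)
  have k': "kappa Fold_E7 Extra = x * (y * y - y - 1)" unfolding kappa.simps e x5 by (simp add: algebra_simps)
  have w: "weight_cos Fold_E7 = x / 2" by (simp add: weight_cos_def c)
  have xx: "x * x = y + 2" by (simp add: y power2_eq_square)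
  have xx': "x * (x * z) = (y + 2) * z" for z using xx by (simp add: mult.assoc[symmetric])
  consider "v = Vtx 0" | "v = Vtx 1" | "v = Vtx 2" | "v = Vtx 3" | "v = Tilde 1" | "v = Tilde 2" | "v = Extra"
    using v by auto
  then show ?thesis
    by cases (use y3 in \<open>simp_all add: nb w k k' xx xx' algebra_simps del: kappa.simps One_nat_def\<close>)
qed

text \<open>The identity cos 3t = - cos 2t at t = \<pi>/5 gives a cubic equation; its factor
  \<open>golden + 2\<close> is nonzero by positivity.\<close>

lemma golden_props: "golden * golden = golden + 1" "0 < golden"
proof -
  let ?t = "pi / 5"
  show pos: "0 < golden" unfolding golden_def using pi_gt_zero by (simp add: cos_gt_zero)
  have 2: "2 * cos (2 * ?t) = golden * golden - 2"
    using two_cos_mult[of ?t ?t] by (simp add: golden_def)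
  have "2 * cos (2 * ?t) * golden = 2 * cos (3 * ?t) + golden" unfolding golden_def two_cos_mult by simp
  then have 3: "2 * cos (3 * ?t) = golden * (golden * golden - 2) - golden" unfolding 2 by (simp add: mult.commute)
  have "3 * ?t = pi - 2 * ?t" by simp
  then have "cos (3 * ?t) = - cos (2 * ?t)" by (simp only: cos_pi_minus)
  then have "golden * (golden * golden - 2) - golden = - (golden * golden - 2)" using 2 3 by simp
  then have "(golden + 2) * (golden * golden - golden - 1) = 0" by (simp add: algebra_simps)
  then show "golden * golden = golden + 1" using pos by auto
qed

text \<open>Around the branch vertex the equations reduce to \<open>U 4 = golden * U 2\<close>. By
  the sine formula for Chebyshev polynomials this says sin 5t = \<open>golden\<close> sin 3t, where
  5t = \<pi>/6 and 3t = \<pi>/10.\<close>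

lemma eigen_E8:
  assumes v: "v \<in> fold_verts Fold_E8"
  shows "(\<Sum>u\<in>nbrs Fold_E8 v. kappa Fold_E8 u) = 2 * weight_cos Fold_E8 * kappa Fold_E8 v"
proof -
  define t :: real where "t = pi / 30"
  define c where "c = cos t"
  define U where "U i = poly (cheb_U i) c" for i
  have U: "U 0 = 1" "U 1 = 2 * c" "U 2 = 2 * c * U 1 - 1" "U 3 = 2 * c * U 2 - U 1" "U 4 = 2 * c * U 3 - U 2"
    by (simp_all add: U_def cheb_U_numerals algebra_simps)
  have s: "sin t > 0" unfolding t_def by (intro sin_gt_zero) auto
  have s5: "2 * sin (5 * t) = 1"
  proof -
    have "5 * t = pi / 6" by (simp add: t_def)
    show ?thesis unfolding \<open>5 * t = pi / 6\<close> sin_30 by simp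
  qed
  have s3: "2 * sin (3 * t) = golden - 1"
  proof -
    have e: "3 * t = pi / 2 - 2 * (pi / 5)" by (simp add: t_def)
    have "2 * sin (3 * t) = 2 * cos (2 * (pi / 5))" unfolding e sin_diff by simp
    also have "\<dots> = golden * golden - 2"
      using two_cos_mult[of "pi / 5" "pi / 5"] by (simp add: golden_def)
    finally show ?thesis using golden_props by simp
  qed
  have "2 * (golden * sin (3 * t)) = golden * (2 * sin (3 * t))" by (simp only: ac_simps)
  also have "\<dots> = 1" unfolding s3 using golden_props(1) by (simp add: algebra_simps)
  finally have "sin (5 * t) = golden * sin (3 * t)" using s5 by simp
  then have "U 4 * sin t = golden * U 2 * sin t"
    using cheb_U_cos[of 4 t] cheb_U_cos[of 2 t] by (simp add: U_def c_def)
  then have 4: "U 4 = golden * U 2" using s by simp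
  let ?i = "inverse golden"
  have i: "?i = golden - 1"
    by (rule inverse_unique) (use golden_props(1) in \<open>simp add: algebra_simps\<close>)
  have nb: "nbrs Fold_E8 (Vtx 0) = {Vtx 1}" "nbrs Fold_E8 (Vtx 1) = {Vtx 0, Vtx 2}"
    "nbrs Fold_E8 (Vtx 2) = {Vtx 1, Vtx 3}" "nbrs Fold_E8 (Vtx 3) = {Vtx 2, Vtx 4}"
    "nbrs Fold_E8 (Vtx 4) = {Vtx 3, Extra, Phi 1}" "nbrs Fold_E8 (Phi 1) = {Vtx 4, Phi 0}"
    "nbrs Fold_E8 (Phi 0) = {Phi 1}" "nbrs Fold_E8 Extra = {Vtx 4}"
    by (auto simp: nbrs_def)
  have ct: "cos (pi / 30) = c" by (simp add: c_def t_def)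
  have k: "kappa Fold_E8 (Vtx i) = U i" "kappa Fold_E8 (Phi i) = golden * U i"
    "kappa Fold_E8 Extra = (golden - 1) * U 3" for i
    unfolding i[symmetric] by (simp_all add: U_def ct)
  have w: "weight_cos Fold_E8 = c" by (simp add: weight_cos_def ct)
  have 3: "2 * c * U 3 = golden * U 2 + U 2" using U(5) 4 by simp
  consider "v = Vtx 0" | "v = Vtx 1" | "v = Vtx 2" | "v = Vtx 3" | "v = Vtx 4" | "v = Phi 1" | "v = Phi 0"
    | "v = Extra"
    using v by auto
  then show ?thesis
  proof cases
    case 5
    have "U 3 + (golden - 1) * U 3 + golden * U 1 = golden * (U 3 + U 1)" by (simp add: algebra_simps)
    also have "U 3 + U 1 = 2 * c * U 2" using U(4) by simp
    finally show ?thesis unfolding 5 w k 4 by (simp add: nb k 4 ac_simps del: kappa.simps One_nat_def)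
  next
    case 6
    have "U 4 + golden * U 0 = golden * (U 2 + 1)" unfolding 4 U(1) by (simp add: algebra_simps)
    also have "U 2 + 1 = 2 * c * U 1" using U(3) by simp
    finally show ?thesis unfolding 6 w k by (simp add: nb k del: kappa.simps One_nat_def)
  next
    case 8
    have "(golden - 1) * (2 * c * U 3) = (golden - 1) * (golden + 1) * U 2" unfolding 3 by (simp add: algebra_simps)
    also have "(golden - 1) * (golden + 1) = golden" using golden_props by (simp add: algebra_simps)
    finally show ?thesis unfolding 8 w k using 4 by (simp add: nb k algebra_simps del: kappa.simps One_nat_def)
  qed (use U in \<open>simp_all add: nb k w algebra_simps del: kappa.simps One_nat_def\<close>)
qed

lemma eigen:
  assumes "valid_folding \<Delta>" "v \<in> fold_verts \<Delta>"
  shows "(\<Sum>u\<in>nbrs \<Delta> v. kappa \<Delta> u) = 2 * weight_cos \<Delta> * kappa \<Delta> v"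
proof (cases \<Delta>)
  case (Fold_A n)
  then show ?thesis using assms eigen_A by auto
next
  case (Fold_D n)
  then show ?thesis using assms eigen_D by auto
next
  case Fold_E6
  then show ?thesis using assms eigen_E6 by blast
next
  case Fold_E7
  then show ?thesis using assms eigen_E7 by blast
next
  case Fold_E8
  then show ?thesis using assms eigen_E8 by blast
qed

text \<open>The form yields only the square of the length, so the sign of \<open>kappa\<close> is
  needed to take the root. The angle (i + 1) \<theta> does not exceed \<pi> for the vertices that
  occur.\<close>

lemma kappa_nonneg:
  assumes \<Delta>: "valid_folding \<Delta>" and v: "v \<in> fold_verts \<Delta>"
  shows "0 \<le> kappa \<Delta> v"
proof -
  have U: "0 \<le> poly (cheb_U i) (cos (pi / real n))" if "i + 1 \<le> n" "n \<ge> 2" for i n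
    by (rule cheb_U_pos) (use that in \<open>simp_all add: field_simps del: of_nat_Suc of_nat_add\<close>)
  have c: "0 \<le> cos (pi / real n)" if "n \<ge> 2" for n
  proof (rule cos_ge_zero)
    show "- (pi / 2) \<le> pi / real n" by (rule order_trans[of _ 0]) simp_all
    show "pi / real n \<le> pi / 2" using that by (simp add: field_simps)
  qed
  show ?thesis
  proof (cases \<Delta>)
    case (Fold_A n)
    then show ?thesis using v \<Delta> U[of _ "2 * n"] by auto
  next
    case (Fold_D n)
    then show ?thesis using v \<Delta> U[of _ "2 * n"] by auto
  next
    case Fold_E6
    then show ?thesis using v U[of _ 12] c[of 12] by auto
  next
    case Fold_E7
    have "0 \<le> cos (5 * pi / 18)" by (rule cos_ge_zero) auto
    then show ?thesis using v Fold_E7 U[of _ 18] U[of _ 9] c[of 18] c[of 9] by auto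
  next
    case Fold_E8
    then show ?thesis using v U[of _ 30] c[of 30] golden_props(2) by auto
  qed
qed

section \<open>Sources, sinks and the length of a projected vector\<close>

lemma fold_bipartite:
  assumes "valid_folding \<Delta>"
  shows "finite (fold_verts \<Delta>)" "fold_arrows \<Delta> \<subseteq> fold_verts \<Delta> \<times> fold_verts \<Delta>"
    "(u, v) \<in> fold_arrows \<Delta> \<Longrightarrow> (w, u) \<notin> fold_arrows \<Delta>"
proof -
  show "finite (fold_verts \<Delta>)" by (cases \<Delta>) auto
  show "fold_arrows \<Delta> \<subseteq> fold_verts \<Delta> \<times> fold_verts \<Delta>"
    using assms by (cases \<Delta>) (auto simp: even_to_odd_def)
  show "(u, v) \<in> fold_arrows \<Delta> \<Longrightarrow> (w, u) \<notin> fold_arrows \<Delta>"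
    by (cases \<Delta>) (auto simp: even_to_odd_def)
qed

lemma fold_map_sink: "fold_map \<Delta> v = I1 \<longleftrightarrow> (\<exists>u. (u, v) \<in> fold_arrows \<Delta>)"
  by (auto simp: fold_map_def in_arcs_def fold_quiver_def)

lemma fold_map_I0: "fold_map \<Delta> v = I0 \<longleftrightarrow> fold_map \<Delta> v \<noteq> I1"
  by (cases "fold_map \<Delta> v") simp_all

abbreviation sources :: "folding \<Rightarrow> vertex set" where
  "sources \<Delta> \<equiv> {v \<in> fold_verts \<Delta>. fold_map \<Delta> v = I0}"

abbreviation sinks :: "folding \<Rightarrow> vertex set" where
  "sinks \<Delta> \<equiv> {v \<in> fold_verts \<Delta>. fold_map \<Delta> v = I1}"

lemma fold_arrows_source_sink:
  assumes "valid_folding \<Delta>"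
  shows "fold_arrows \<Delta> \<subseteq> sources \<Delta> \<times> sinks \<Delta>"
proof
  fix e assume e: "e \<in> fold_arrows \<Delta>"
  obtain u v where uv: "e = (u, v)" by (cases e)
  have "fold_map \<Delta> u = I0" unfolding fold_map_I0 fold_map_sink
    using fold_bipartite(3)[OF assms] e uv by blast
  moreover have "fold_map \<Delta> v = I1" unfolding fold_map_sink using e uv by blast
  ultimately show "e \<in> sources \<Delta> \<times> sinks \<Delta>" using fold_bipartite(2)[OF assms] e uv by blast
qed

lemma eigen_source:
  assumes \<Delta>: "valid_folding \<Delta>" and v: "v \<in> sources \<Delta>"
  shows "(\<Sum>y | (v, y) \<in> fold_arrows \<Delta>. kappa \<Delta> y) = 2 * weight_cos \<Delta> * kappa \<Delta> v"
proof -
  have "nbrs \<Delta> v = {y. (v, y) \<in> fold_arrows \<Delta>}"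
    using v unfolding nbrs_def fold_map_I0 fold_map_sink by blast
  then show ?thesis using eigen[OF \<Delta>, of v] v by simp
qed

lemma eigen_sink:
  assumes \<Delta>: "valid_folding \<Delta>" and v: "v \<in> sinks \<Delta>"
  shows "(\<Sum>x | (x, v) \<in> fold_arrows \<Delta>. kappa \<Delta> x) = 2 * weight_cos \<Delta> * kappa \<Delta> v"
proof -
  have "nbrs \<Delta> v = {x. (x, v) \<in> fold_arrows \<Delta>}"
    using v fold_arrows_source_sink[OF \<Delta>] unfolding nbrs_def by auto
  then show ?thesis using eigen[OF \<Delta>, of v] v by simp
qed

text \<open>The weights \<open>varsigma\<close> cancel against the lengths of the simple roots, so
  the point is a + b exp(i \<theta>) with \<theta> = \<pi> - \<pi>/2n, and the cosine of \<theta> is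
  the negative of \<open>weight_cos\<close>.\<close>

lemma fold_length_proj:
  assumes \<Delta>: "valid_folding \<Delta>"
  defines "a u \<equiv> \<Sum>v\<in>sources \<Delta>. kappa \<Delta> v * of_int (u v)"
    and "b u \<equiv> \<Sum>v\<in>sinks \<Delta>. kappa \<Delta> v * of_int (u v)"
  shows "fold_length \<Delta> (fold_proj \<Delta> u) = sqrt ((a u)\<^sup>2 + (b u)\<^sup>2 - 2 * weight_cos \<Delta> * a u * b u)"
proof -
  let ?n = "real (fold_n \<Delta>)" and ?l = "varsigma \<Delta> I0"
  let ?\<theta> = "(2 * ?n - 1) * pi / (2 * ?n)"
  have l: "?l > 0" by (cases \<Delta>) simp_all
  have l1: "varsigma \<Delta> I1 = 2 * ?l * weight_cos \<Delta>" by (cases \<Delta>) (simp_all add: weight_cos_def)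
  have c: "weight_cos \<Delta> > 0" by (rule weight_cos_pos[OF \<Delta>])
  have sq: "(x + y * C)\<^sup>2 + (y * S)\<^sup>2 = x\<^sup>2 + y\<^sup>2 * (S\<^sup>2 + C\<^sup>2) + 2 * x * y * C" for x y C S :: real
    by (simp add: power2_eq_square algebra_simps)
  have s: "{i. i \<in> verts (fold_quiver \<Delta>) \<and> fold_map \<Delta> i = t} = {v \<in> fold_verts \<Delta>. fold_map \<Delta> v = t}" for t
    by (simp add: fold_quiver_def)
  have "fst (fold_proj \<Delta> u) = a u / ?l"
    by (simp add: fold_proj_def a_def s sum_divide_distrib)
  moreover have "snd (fold_proj \<Delta> u) = b u / (2 * ?l * weight_cos \<Delta>)"
    by (simp add: fold_proj_def b_def s sum_divide_distrib l1)
  ultimately have p: "fold_proj \<Delta> u = (a u / ?l, b u / (2 * ?l * weight_cos \<Delta>))"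
    by (metis prod.collapse)
  have "fold_length \<Delta> (fold_proj \<Delta> u) = cmod (of_real (a u / ?l * ?l) +
      of_real (b u / (2 * ?l * weight_cos \<Delta>) * (2 * ?l * weight_cos \<Delta>)) * exp (\<i> * of_real ?\<theta>))"
    unfolding p by (simp add: fold_length_def Let_def weight_cos_def)
  also have "a u / ?l * ?l = a u" using l by simp
  also have "b u / (2 * ?l * weight_cos \<Delta>) * (2 * ?l * weight_cos \<Delta>) = b u" using l c by simp
  also have "exp (\<i> * of_real ?\<theta>) = cis ?\<theta>" by (simp add: cis_conv_exp)
  also have "cmod (of_real (a u) + of_real (b u) * cis ?\<theta>) =
      sqrt ((a u + b u * cos ?\<theta>)\<^sup>2 + (b u * sin ?\<theta>)\<^sup>2)"
    by (simp add: cmod_def)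
  also have "(a u + b u * cos ?\<theta>)\<^sup>2 + (b u * sin ?\<theta>)\<^sup>2 =
      (a u)\<^sup>2 + (b u)\<^sup>2 * ((sin ?\<theta>)\<^sup>2 + (cos ?\<theta>)\<^sup>2) + 2 * a u * b u * cos ?\<theta>"
    by (rule sq)
  also have "(sin ?\<theta>)\<^sup>2 + (cos ?\<theta>)\<^sup>2 = 1" by (rule sin_cos_squared_add)
  also have "cos ?\<theta> = - weight_cos \<Delta>"
  proof -
    have "?\<theta> = pi - pi / (2 * ?n)" using fold_angle(3)[OF \<Delta>] by (simp add: field_simps)
    moreover have "real (2 * fold_n \<Delta>) = 2 * ?n" by simp
    ultimately show ?thesis unfolding weight_cos_def by (simp only: cos_pi_minus)
  qed
  finally show ?thesis by (simp add: ac_simps)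
qed

lemma fold_proj_diff: "fold_proj \<Delta> (\<lambda>v. p v - q v) = fold_proj \<Delta> p - fold_proj \<Delta> q"
  by (simp add: fold_proj_def sum_subtractf right_diff_distrib diff_divide_distrib)

lemma fold_proj_zero: "fold_proj \<Delta> (\<lambda>v. 0) = 0"
  by (simp add: fold_proj_def zero_prod_def)

lemma fold_proj_add: "fold_proj \<Delta> (\<lambda>v. p v + q v) = fold_proj \<Delta> p + fold_proj \<Delta> q"
  by (simp add: fold_proj_def sum.distrib distrib_left add_divide_distrib)

lemma fold_proj_sum: "fold_proj \<Delta> (\<lambda>v. \<Sum>j\<in>S. p j v) = (\<Sum>j\<in>S. fold_proj \<Delta> (p j))"
  by (induction S rule: infinite_finite_induct) (simp_all add: fold_proj_zero fold_proj_add)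

section \<open>The indecomposable projectives\<close>

context bip
begin

text \<open>\<open>proj_at\<close> restated for the abstract algebra, where the trivial path is
  known only through its basis element \<open>eb v\<close>.\<close>

definition proj_mod :: "'v \<Rightarrow> ('b \<Rightarrow> 'k, 'b \<Rightarrow> 'k) module" where
  "proj_mod v = \<lparr> carrier = (\<lambda>a. ee v \<otimes>\<^bsub>A\<^esub> a) ` carrier A, mult = undefined, one = undefined,
      zero = \<zero>\<^bsub>A\<^esub>, add = (\<oplus>\<^bsub>A\<^esub>), smult = (\<lambda>a x. x \<otimes>\<^bsub>A\<^esub> a) \<rparr>"

lemma proj_mod_simps:
  "\<zero>\<^bsub>proj_mod v\<^esub> = \<zero>\<^bsub>A\<^esub>" "x \<oplus>\<^bsub>proj_mod v\<^esub> y = x \<oplus>\<^bsub>A\<^esub> y" "a \<odot>\<^bsub>proj_mod v\<^esub> x = x \<otimes>\<^bsub>A\<^esub> a"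
  by (simp_all add: proj_mod_def)

lemma proj_mod_iff:
  assumes v: "v \<in> V"
  shows "x \<in> carrier (proj_mod v) \<longleftrightarrow> x \<in> carrier A \<and> ee v \<otimes>\<^bsub>A\<^esub> x = x"
proof -
  interpret A: ring A by (rule ring_A)
  have e: "ee v \<in> carrier A" using v by (rule A_closed(5))
  have ei: "ee v \<otimes>\<^bsub>A\<^esub> ee v = ee v" using mult_rules(1)[OF e v v] by simp
  show ?thesis
  proof
    assume "x \<in> carrier (proj_mod v)"
    then obtain a where a: "a \<in> carrier A" "x = ee v \<otimes>\<^bsub>A\<^esub> a" unfolding proj_mod_def by auto
    have "ee v \<otimes>\<^bsub>A\<^esub> x = ee v \<otimes>\<^bsub>A\<^esub> ee v \<otimes>\<^bsub>A\<^esub> a" unfolding a(2) by (rule A.m_assoc[OF e e a(1), symmetric])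
    then show "x \<in> carrier A \<and> ee v \<otimes>\<^bsub>A\<^esub> x = x" using a e ei by simp
  next
    assume x: "x \<in> carrier A \<and> ee v \<otimes>\<^bsub>A\<^esub> x = x"
    then have "x \<in> (\<lambda>a. ee v \<otimes>\<^bsub>A\<^esub> a) ` carrier A" by (intro image_eqI[where x = x]) simp_all
    then show "x \<in> carrier (proj_mod v)" unfolding proj_mod_def by simp
  qed
qed

lemma proj_mod_right_module:
  assumes v: "v \<in> V"
  shows "right_module A (proj_mod v)"
proof -
  interpret A: ring A by (rule ring_A)
  have e: "ee v \<in> carrier A" using v by (rule A_closed(5))
  note [simp] = proj_mod_simps proj_mod_iff[OF v]
  show ?thesis
  proof (rule right_moduleI)
    show "ring A" by (rule ring_A)
    show "abelian_group (proj_mod v)"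
    proof (rule abelian_groupI)
      fix x assume x: "x \<in> carrier (proj_mod v)"
      show "\<exists>y\<in>carrier (proj_mod v). y \<oplus>\<^bsub>proj_mod v\<^esub> x = \<zero>\<^bsub>proj_mod v\<^esub>"
        by (rule bexI[where x = "\<ominus>\<^bsub>A\<^esub> x"]) (use x e in \<open>simp_all add: A.l_neg A.r_minus\<close>)
    qed (use e in \<open>simp_all add: A.r_distr A.a_ac\<close>)
  qed (use e in \<open>simp_all add: A.r_distr A.l_distr A.m_assoc[symmetric]\<close>)
qed

lemma proj_mod_projective:
  assumes v: "v \<in> V"
  shows "fg_projective A (proj_mod v)"
proof -
  interpret A: ring A by (rule ring_A)
  have e: "ee v \<in> carrier A" using v by (rule A_closed(5))
  have ei: "ee v \<otimes>\<^bsub>A\<^esub> ee v = ee v" using mult_rules(1)[OF e v v] by simp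
  note [simp] = proj_mod_simps proj_mod_iff[OF v]
  have s: "(\<lambda>x. \<lambda>i\<in>{..<1::nat}. x) \<in> module_hom A (proj_mod v) (free_mod A 1)"
    unfolding hom_iff free_mod_simps by (auto simp: fun_eq_iff)
  have r: "(\<lambda>f. ee v \<otimes>\<^bsub>A\<^esub> f 0) \<in> module_hom A (free_mod A 1) (proj_mod v)"
    unfolding hom_iff free_mod_simps
  proof (intro conjI ballI)
    fix f g a assume f: "f \<in> {..<1::nat} \<rightarrow>\<^sub>E carrier A"
    then have f0: "f 0 \<in> carrier A" by auto
    show "ee v \<otimes>\<^bsub>A\<^esub> f 0 \<in> carrier (proj_mod v)"
      using f0 e ei by (simp add: A.m_assoc[symmetric])
    show "ee v \<otimes>\<^bsub>A\<^esub> (\<lambda>i\<in>{..<1::nat}. f i \<oplus>\<^bsub>A\<^esub> g i) 0 = ee v \<otimes>\<^bsub>A\<^esub> f 0 \<oplus>\<^bsub>proj_mod v\<^esub> ee v \<otimes>\<^bsub>A\<^esub> g 0"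
      if "g \<in> {..<1::nat} \<rightarrow>\<^sub>E carrier A"
    proof -
      have "g 0 \<in> carrier A" using that by auto
      then show ?thesis using f0 e by (simp add: A.r_distr)
    qed
    show "ee v \<otimes>\<^bsub>A\<^esub> (\<lambda>i\<in>{..<1::nat}. f i \<otimes>\<^bsub>A\<^esub> a) 0 = a \<odot>\<^bsub>proj_mod v\<^esub> (ee v \<otimes>\<^bsub>A\<^esub> f 0)" if "a \<in> carrier A"
      using f0 e that by (simp add: A.m_assoc)
  qed
  have "\<exists>s\<in>module_hom A (proj_mod v) (free_mod A 1). \<exists>r\<in>module_hom A (free_mod A 1) (proj_mod v).
      \<forall>x\<in>carrier (proj_mod v). r (s x) = x"
    by (rule bexI[OF _ s], rule bexI[OF _ r]) simp
  then show ?thesis unfolding fg_projective_def using proj_mod_right_module[OF v] by blast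
qed

text \<open>The basis of \<open>e\<^sub>v A e\<^sub>u\<close>.\<close>

definition proj_basis :: "'v \<Rightarrow> 'v \<Rightarrow> 'b set" where
  "proj_basis v u = (if u = v then {eb v} else if (v, u) \<in> E then {ab (v, u)} else {})"

text \<open>Left multiplication by \<open>ee v\<close> keeps what starts at \<open>v\<close>, right
  multiplication by \<open>ee u\<close> keeps what ends at \<open>u\<close>; so e_v A e_u is at most
  one-dimensional.\<close>

lemma corner_iff:
  assumes v: "v \<in> V" and u: "u \<in> V"
  shows "x \<in> carrier A \<and> ee v \<otimes>\<^bsub>A\<^esub> x = x \<and> x \<otimes>\<^bsub>A\<^esub> ee u = x \<longleftrightarrow> (\<forall>z. z \<notin> proj_basis v u \<longrightarrow> x z = 0)"
proof
  assume x: "x \<in> carrier A \<and> ee v \<otimes>\<^bsub>A\<^esub> x = x \<and> x \<otimes>\<^bsub>A\<^esub> ee u = x"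
  have ev': "ee v \<in> carrier A" "ee u \<in> carrier A" by (rule A_closed(5)[OF v], rule A_closed(5)[OF u])
  have xA: "x \<in> carrier A" and xl: "ee v \<otimes>\<^bsub>A\<^esub> x = x" and xr: "x \<otimes>\<^bsub>A\<^esub> ee u = x" using x by simp_all
  have 1: "x (eb w) = 0" if w: "w \<in> V" "eb w \<notin> proj_basis v u" for w
  proof -
    have "(ee v \<otimes>\<^bsub>A\<^esub> x) (eb w) = 0" if "w \<noteq> v"
      using mult_eb[OF ev'(1) xA w(1)] that by (simp add: ev(6)[OF v w(1)])
    moreover have "(x \<otimes>\<^bsub>A\<^esub> ee u) (eb w) = 0" if "w \<noteq> u"
      using mult_eb[OF xA ev'(2) w(1)] that by (simp add: ev(6)[OF u w(1)])
    moreover have "w \<noteq> v \<or> w \<noteq> u" using w(2) by (auto simp: proj_basis_def)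
    ultimately show ?thesis unfolding xl xr by blast
  qed
  have 2: "x (ab (p, q)) = 0" if pq: "(p, q) \<in> E" "ab (p, q) \<notin> proj_basis v u" for p q
  proof -
    have V: "p \<in> V" "q \<in> V" using E_V(1,2)[OF pq(1)] by blast+
    have "(ee v \<otimes>\<^bsub>A\<^esub> x) (ab (p, q)) = 0" if "p \<noteq> v"
      using mult_ab[OF ev'(1) xA pq(1)] that by (simp add: ev(6)[OF v V(1)] ev(7)[OF v pq(1)])
    moreover have "(x \<otimes>\<^bsub>A\<^esub> ee u) (ab (p, q)) = 0" if "q \<noteq> u"
      using mult_ab[OF xA ev'(2) pq(1)] that by (simp add: ev(6)[OF u V(2)] ev(7)[OF u pq(1)])
    moreover have "p \<noteq> v \<or> q \<noteq> u"
    proof (rule ccontr)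
      assume "\<not> ?thesis"
      then have e: "p = v" "q = u" by simp_all
      have "u \<noteq> v" using E_V(1)[OF pq(1)] E_V(2)[OF pq(1)] XY unfolding e by (metis disjoint_iff)
      then show False using pq unfolding e proj_basis_def by simp
    qed
    ultimately show ?thesis unfolding xl xr by blast
  qed
  show "\<forall>z. z \<notin> proj_basis v u \<longrightarrow> x z = 0"
  proof (intro allI impI)
    fix z assume z: "z \<notin> proj_basis v u"
    show "x z = 0"
    proof (cases "z \<in> eb ` V \<union> ab ` E")
      case True
      then consider w where "w \<in> V" "z = eb w" | p q where "(p, q) \<in> E" "z = ab (p, q)" by auto
      then show ?thesis by cases (use 1 2 z in simp_all)
    next
      case False
      then show ?thesis using x unfolding carrier_A by simp
    qed
  qed
next
  assume x: "\<forall>z. z \<notin> proj_basis v u \<longrightarrow> x z = 0"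
  have ev': "ee v \<in> carrier A" "ee u \<in> carrier A" by (rule A_closed(5)[OF v], rule A_closed(5)[OF u])
  have sub: "proj_basis v u \<subseteq> eb ` V \<union> ab ` E" using v by (simp add: proj_basis_def)
  have "x z = 0" if "z \<notin> eb ` V \<union> ab ` E" for z
    by (rule x[rule_format]) (use sub that in \<open>rule contra_subsetD\<close>)
  then have xA: "x \<in> carrier A" unfolding carrier_A by simp
  have b: "eb w \<in> proj_basis v u \<Longrightarrow> w = v \<and> u = v" if "w \<in> V" for w
  proof -
    assume "eb w \<in> proj_basis v u"
    then have "(u = v \<and> eb w = eb v) \<or> ((v, u) \<in> E \<and> eb w = ab (v, u))"
      by (auto simp: proj_basis_def split: if_splits)
    moreover have "\<not> ((v, u) \<in> E \<and> eb w = ab (v, u))"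
      using imageI[OF that, of eb] imageI[of "(v, u)" E ab] eb_ab by (metis IntI empty_iff)
    ultimately have "u = v" "eb w = eb v" by simp_all
    then show "w = v \<and> u = v" using inj_onD[OF inj_eb _ that v] by simp
  qed
  have a: "ab (p, q) \<in> proj_basis v u \<Longrightarrow> p = v \<and> q = u" if pq: "(p, q) \<in> E" for p q
  proof -
    assume "ab (p, q) \<in> proj_basis v u"
    then have "(u = v \<and> ab (p, q) = eb v) \<or> ((v, u) \<in> E \<and> ab (p, q) = ab (v, u))"
      by (auto simp: proj_basis_def split: if_splits)
    moreover have "ab (p, q) \<noteq> eb v"
      using imageI[OF v, of eb] imageI[OF pq, of ab] eb_ab by (metis IntI empty_iff)
    ultimately have "(v, u) \<in> E" "ab (p, q) = ab (v, u)" by simp_all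
    then show "p = v \<and> q = u" using inj_onD[OF inj_ab _ pq, of "(v, u)"] by simp
  qed
  have xw: "x (eb w) = 0" if "w \<in> V" "w \<noteq> v \<or> w \<noteq> u" for w
    by (rule x[rule_format]) (use b[OF that(1)] that(2) in auto)
  have xp: "x (ab (p, q)) = 0" if "(p, q) \<in> E" "p \<noteq> v \<or> q \<noteq> u" for p q
    by (rule x[rule_format]) (use a[OF that(1)] that(2) in auto)
  have "ee v \<otimes>\<^bsub>A\<^esub> x = x"
  proof (rule A_eqI[OF mult_closed[OF ev'(1) xA] xA])
    fix w assume w: "w \<in> V"
    show "(ee v \<otimes>\<^bsub>A\<^esub> x) (eb w) = x (eb w)"
      using mult_eb[OF ev'(1) xA w] xw[OF w] by (cases "w = v") (simp_all add: ev(6)[OF v w] ev(6)[OF v v])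
  next
    fix p q assume pq: "(p, q) \<in> E"
    show "(ee v \<otimes>\<^bsub>A\<^esub> x) (ab (p, q)) = x (ab (p, q))"
      using mult_ab[OF ev'(1) xA pq] xp[OF pq] pq E_V(1)[OF pq] by (cases "p = v") (simp_all add: ev(6)[OF v] ev(7)[OF v])
  qed
  moreover have "x \<otimes>\<^bsub>A\<^esub> ee u = x"
  proof (rule A_eqI[OF mult_closed[OF xA ev'(2)] xA])
    fix w assume w: "w \<in> V"
    show "(x \<otimes>\<^bsub>A\<^esub> ee u) (eb w) = x (eb w)"
      using mult_eb[OF xA ev'(2) w] xw[OF w] by (cases "w = u") (simp_all add: ev(6)[OF u w] ev(6)[OF u u])
  next
    fix p q assume pq: "(p, q) \<in> E"
    show "(x \<otimes>\<^bsub>A\<^esub> ee u) (ab (p, q)) = x (ab (p, q))"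
      using mult_ab[OF xA ev'(2) pq] xp[OF pq] pq E_V(2)[OF pq] by (cases "q = u") (simp_all add: ev(6)[OF u] ev(7)[OF u])
  qed
  ultimately show "x \<in> carrier A \<and> ee v \<otimes>\<^bsub>A\<^esub> x = x \<and> x \<otimes>\<^bsub>A\<^esub> ee u = x" using xA by simp
qed

text \<open>An endomorphism of e_v A is left multiplication by the image \<open>w\<close> of
  \<open>ee v\<close>, and \<open>w\<close> lies in e_v A e_v, the line spanned by
  \<open>ee v\<close>.\<close>

lemma proj_mod_brick:
  assumes v: "v \<in> V"
  shows "brick (proj_mod v)"
  unfolding brick_def
proof
  fix \<theta> assume \<theta>: "\<theta> \<in> module_hom A (proj_mod v) (proj_mod v)"
  interpret A: ring A by (rule ring_A)
  have e: "ee v \<in> carrier A" using v by (rule A_closed(5))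
  have ei: "ee v \<otimes>\<^bsub>A\<^esub> ee v = ee v" using mult_rules(1)[OF e v v] by simp
  have eP: "ee v \<in> carrier (proj_mod v)" unfolding proj_mod_iff[OF v] using e ei by simp
  define w where "w = \<theta> (ee v)"
  have wP: "w \<in> carrier A \<and> ee v \<otimes>\<^bsub>A\<^esub> w = w"
    using homD(1)[OF \<theta> eP] unfolding w_def proj_mod_iff[OF v] .
  have "w \<otimes>\<^bsub>A\<^esub> ee v = \<theta> (ee v \<otimes>\<^bsub>A\<^esub> ee v)" using homD(3)[OF \<theta> e eP] unfolding w_def proj_mod_simps by simp
  then have "w \<otimes>\<^bsub>A\<^esub> ee v = w" unfolding ei w_def .
  then have "\<forall>z. z \<notin> proj_basis v v \<longrightarrow> w z = 0" using wP corner_iff[OF v v, of w] by blast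
  then have w: "w = w (eb v) \<odot>\<^bsub>A\<^esub> ee v" by (auto simp: fun_eq_iff proj_basis_def smult_A unit_at_def)
  have "\<theta> x = scal (w (eb v)) \<odot>\<^bsub>proj_mod v\<^esub> x" if x: "x \<in> carrier (proj_mod v)" for x
  proof -
    have x': "x \<in> carrier A" "ee v \<otimes>\<^bsub>A\<^esub> x = x" using x unfolding proj_mod_iff[OF v] by simp_all
    have "\<theta> x = \<theta> (x \<odot>\<^bsub>proj_mod v\<^esub> ee v)" by (simp add: proj_mod_simps x'(2))
    also have "\<dots> = w \<otimes>\<^bsub>A\<^esub> x" using homD(3)[OF \<theta> x'(1) eP] by (simp add: proj_mod_simps w_def)
    also have "\<dots> = w (eb v) \<odot>\<^bsub>A\<^esub> (ee v \<otimes>\<^bsub>A\<^esub> x)" by (subst w) (rule mult_rules(8)[OF e x'(1)])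
    also have "\<dots> = x \<otimes>\<^bsub>A\<^esub> scal (w (eb v))" unfolding x'(2) by (rule mult_rules(11)[OF x'(1), symmetric])
    finally show ?thesis by (simp add: proj_mod_simps)
  qed
  then show "\<exists>c. \<forall>x\<in>carrier (proj_mod v). \<theta> x = scal c \<odot>\<^bsub>proj_mod v\<^esub> x" by blast
qed

lemma kd_proj_mod:
  assumes v: "v \<in> V" and u: "u \<in> V"
  shows "kd (proj_mod v) u = card (proj_basis v u)"
proof -
  let ?B = "proj_basis v u"
  let ?F = "fn_space ?B :: ('k, 'b \<Rightarrow> 'k) module"
  have M: "right_module A (proj_mod v)" by (rule proj_mod_right_module[OF v])
  have fin: "finite ?B" by (simp add: proj_basis_def)
  have c: "x \<in> cpt (proj_mod v) (ee u) \<longleftrightarrow> (\<forall>z. z \<notin> ?B \<longrightarrow> x z = 0)" for x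
    unfolding cpt_iff[OF M u] proj_mod_iff[OF v] proj_mod_simps corner_iff[OF v u, symmetric] by blast
  have cc: "x \<in> carrier A" if "x \<in> cpt (proj_mod v) (ee u)" for x
    using cpt_closed(5)[OF M u that] unfolding proj_mod_iff[OF v] by simp
  have T: "(\<lambda>x. restrict x ?B) \<in> module_hom class_ring (cs (proj_mod v) u) ?F"
    unfolding khom_iff cs_simps proj_mod_simps
  proof (intro conjI ballI allI)
    fix x y d assume x: "x \<in> cpt (proj_mod v) (ee u)"
    show "restrict x ?B \<in> carrier ?F" by (simp add: fn_space_simps)
    show "restrict (x \<oplus>\<^bsub>A\<^esub> y) ?B = restrict x ?B \<oplus>\<^bsub>?F\<^esub> restrict y ?B"
      by (auto simp: fn_space_simps ev fun_eq_iff)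
    show "restrict (x \<otimes>\<^bsub>A\<^esub> scal d) ?B = d \<odot>\<^bsub>?F\<^esub> restrict x ?B"
      unfolding mult_rules(11)[OF cc[OF x]] by (auto simp: fn_space_simps ev fun_eq_iff)
  qed
  have "bij_betw (\<lambda>x. restrict x ?B) (carrier (cs (proj_mod v) u)) (carrier ?F)"
    unfolding cs_simps fn_space_simps
  proof (rule bij_betw_byWitness[where f' = "\<lambda>g z. if z \<in> ?B then g z else 0"])
    show "\<forall>x\<in>cpt (proj_mod v) (ee u). (\<lambda>z. if z \<in> ?B then restrict x ?B z else 0) = x"
      using c by (auto simp: fun_eq_iff)
    show "\<forall>g\<in>?B \<rightarrow>\<^sub>E UNIV. restrict (\<lambda>z. if z \<in> ?B then g z else 0) ?B = g"
      by (auto simp: fun_eq_iff PiE_def extensional_def)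
    show "(\<lambda>x. restrict x ?B) ` cpt (proj_mod v) (ee u) \<subseteq> ?B \<rightarrow>\<^sub>E UNIV" by auto
    show "(\<lambda>g z. if z \<in> ?B then g z else 0) ` (?B \<rightarrow>\<^sub>E UNIV) \<subseteq> cpt (proj_mod v) (ee u)"
      unfolding image_subset_iff c by simp
  qed
  from kdim_bij'(2)[OF cs_vspace[OF M u] fn_space_dim(1)[OF fin] T this]
  show ?thesis using fn_space_dim(2)[OF fin] by simp
qed

end

context weighted_bip
begin

text \<open>For a sink the weights \<open>(a, b)\<close> are \<open>(0, \<kappa> v)\<close>. For a
  source they are \<open>(\<kappa> v, 2 c \<kappa> v)\<close>, by the eigenvector equation at
  \<open>v\<close>, and the terms containing \<open>c\<close> cancel in the form.\<close>

lemma form_proj_mod: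
  assumes v: "v \<in> V"
  shows "form (dimv (proj_mod v)) = (\<kappa> v)\<^sup>2"
proof -
  have k: "\<kappa> u * of_int (dimv (proj_mod v) u) = (if u = v then \<kappa> u else if (v, u) \<in> E then \<kappa> u else 0)"
    if "u \<in> V" for u
    using kd_proj_mod[OF v that] by (simp add: proj_basis_def)
  have X: "wt X (dimv (proj_mod v)) = (\<Sum>u\<in>X. if u = v then \<kappa> u else 0)"
    unfolding wt_def by (rule sum.cong) (use k E_V in auto)
  show ?thesis
  proof (cases "v \<in> X")
    case True
    have "wt Y (dimv (proj_mod v)) = (\<Sum>u\<in>Y. if (v, u) \<in> E then \<kappa> u else 0)"
      unfolding wt_def by (rule sum.cong) (use k True E_V(4)[OF True] in auto)
    also have "\<dots> = (\<Sum>u | (v, u) \<in> E. \<kappa> u)"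
      by (rule sum.mono_neutral_cong_right) (use finY EXY in auto)
    finally have Y: "wt Y (dimv (proj_mod v)) = 2 * c * \<kappa> v" using eigen_X[OF True] by simp
    have "wt X (dimv (proj_mod v)) = \<kappa> v" using X True finX by simp
    then show ?thesis using Y by (simp add: form_def power2_eq_square algebra_simps)
  next
    case False
    then have y: "v \<in> Y" using v by blast
    have "wt Y (dimv (proj_mod v)) = (\<Sum>u\<in>Y. if u = v then \<kappa> u else 0)"
      unfolding wt_def by (rule sum.cong) (use k y E_V(1) E_V(4) in auto)
    then have "wt Y (dimv (proj_mod v)) = \<kappa> v" using y finY by simp
    moreover have "wt X (dimv (proj_mod v)) = 0" using X False by (simp add: sum.neutral)
    ultimately show ?thesis by (simp add: form_def)
  qed
qed

end

section \<open>Path algebras of the weighted foldings\<close>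

lemma bipartite_paths:
  assumes E: "E \<subseteq> X \<times> Y" and XY: "X \<inter> Y = {}"
  defines "Q \<equiv> \<lparr>verts = X \<union> Y, arcs = E, tail = fst, head = snd\<rparr>"
  shows "quiver_paths Q = (\<lambda>v. (v, [])) ` (X \<union> Y) \<union> (\<lambda>e. (fst e, [e])) ` E"
proof (intro equalityI subsetI)
  fix z assume "z \<in> quiver_paths Q"
  then obtain u p v where z: "z = (u, p)" and w: "pre_digraph.awalk Q u p v" unfolding quiver_paths_def by auto
  show "z \<in> (\<lambda>v. (v, [])) ` (X \<union> Y) \<union> (\<lambda>e. (fst e, [e])) ` E"
  proof (cases p)
    case Nil
    then show ?thesis using w unfolding z by (auto simp: pre_digraph.awalk_def Q_def)
  next
    case (Cons e es)
    have e: "e \<in> E" "fst e = u" using w Cons by (auto simp: pre_digraph.awalk_def pre_digraph.cas.simps Q_def)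
    have "es = []"
    proof (rule ccontr)
      assume "es \<noteq> []"
      then obtain d ds where d: "es = d # ds" by (cases es) auto
      have "d \<in> E" "fst d = snd e"
        using w Cons d by (auto simp: pre_digraph.awalk_def pre_digraph.cas.simps Q_def)
      then have "fst d \<in> X" "snd e \<in> Y" using e E by auto
      then show False using \<open>fst d = snd e\<close> XY by auto
    qed
    then show ?thesis using e Cons unfolding z by auto
  qed
next
  fix z assume "z \<in> (\<lambda>v. (v, [])) ` (X \<union> Y) \<union> (\<lambda>e. (fst e, [e])) ` E"
  then show "z \<in> quiver_paths Q"
    using E by (fastforce simp: quiver_paths_def pre_digraph.awalk_def pre_digraph.cas.simps Q_def)
qed

lemma path_algebra_bip:
  fixes X Y :: "'v set"
  assumes finX: "finite X" and finY: "finite Y" and E: "E \<subseteq> X \<times> Y" and XY: "X \<inter> Y = {}"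
  defines "Q \<equiv> \<lparr>verts = X \<union> Y, arcs = E, tail = fst, head = snd\<rparr>"
  shows "bip (path_algebra Q :: ('k::field, _) module) X Y E (\<lambda>v. (v, [])) (\<lambda>e. (fst e, [e]))"
proof -
  let ?A = "path_algebra Q :: ('k, 'v \<times> ('v \<times> 'v) list \<Rightarrow> 'k) module"
  let ?P = "(\<lambda>v. (v, [])) ` (X \<union> Y) \<union> (\<lambda>e. (fst e, [e])) ` E"
  have paths: "quiver_paths Q = ?P" unfolding Q_def by (rule bipartite_paths[OF E XY])
  have finP: "finite ?P" using finX finY finite_subset[OF E] by simp
  have carr: "carrier ?A = {f. \<forall>z. z \<notin> ?P \<longrightarrow> f z = 0}"
  proof (intro equalityI subsetI)
    fix f assume "f \<in> carrier ?A"
    then have "{x. f x \<noteq> 0} \<subseteq> ?P" unfolding path_algebra_def paths by simp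
    then show "f \<in> {f. \<forall>z. z \<notin> ?P \<longrightarrow> f z = 0}" by blast
  next
    fix f assume "f \<in> {f :: 'v \<times> ('v \<times> 'v) list \<Rightarrow> 'k. \<forall>z. z \<notin> ?P \<longrightarrow> f z = 0}"
    then have "{x. f x \<noteq> 0} \<subseteq> ?P" by blast
    then show "f \<in> carrier ?A" unfolding path_algebra_def paths using finite_subset[OF _ finP] by simp
  qed
  have mult: "(f \<otimes>\<^bsub>?A\<^esub> g) (u, p) = (\<Sum>n\<le>length p.
      f (u, take n p) * g (last (pre_digraph.awalk_verts Q u (take n p)), drop n p))" for f g u p
    by (simp add: path_algebra_def)
  have av: "pre_digraph.awalk_verts Q u [] = [u]" "pre_digraph.awalk_verts Q u [e] = [fst e, snd e]" for u e
    by (simp_all add: pre_digraph.awalk_verts.simps Q_def)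
  have Psub: "(u, p) \<in> ?P \<longleftrightarrow> (p = [] \<and> u \<in> X \<union> Y) \<or> (\<exists>e\<in>E. p = [e] \<and> u = fst e)" for u p by auto
  \<comment> \<open>A nonzero term splits the path into two basis paths. Two arrows never compose,
    so one of the factors is trivial and the path itself is a basis path.\<close>
  have closed: "f \<otimes>\<^bsub>?A\<^esub> g \<in> carrier ?A" if f: "f \<in> carrier ?A" and g: "g \<in> carrier ?A" for f g
  proof -
    have f0: "f z = 0" if "z \<notin> ?P" for z using f that unfolding carr by blast
    have g0: "g z = 0" if "z \<notin> ?P" for z using g that unfolding carr by blast
    have fP: "z \<in> ?P" if "f z \<noteq> 0" for z by (rule ccontr) (use f0[of z] that in blast)
    have gP: "z \<in> ?P" if "g z \<noteq> 0" for z by (rule ccontr) (use g0[of z] that in blast)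
    have "(f \<otimes>\<^bsub>?A\<^esub> g) (u, p) = 0" if up: "(u, p) \<notin> ?P" for u p
      unfolding mult
    proof (rule sum.neutral, rule ballI)
      fix n assume "n \<in> {..length p}"
      show "f (u, take n p) * g (last (pre_digraph.awalk_verts Q u (take n p)), drop n p) = 0"
      proof (rule ccontr)
        assume "\<not> ?thesis"
        then have fn: "f (u, take n p) \<noteq> 0" and h: "g (last (pre_digraph.awalk_verts Q u (take n p)), drop n p) \<noteq> 0"
          by auto
        have "(u, take n p) \<in> ?P" by (rule fP[OF fn])
        then consider "take n p = []" | e where "e \<in> E" "take n p = [e]" "u = fst e" unfolding Psub by blast
        then show False
        proof cases
          case 1
          then have "drop n p = p" by auto
          then have "g (u, p) \<noteq> 0" using h 1 by (simp add: av)
          then show False using gP[of "(u, p)"] up by blast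
        next
          case 2
          then have "g (snd e, drop n p) \<noteq> 0" using h by (simp add: av)
          then have "(snd e, drop n p) \<in> ?P" by (rule gP)
          moreover have "snd e \<noteq> fst d" if "d \<in> E" for d
          proof -
            have "fst d \<in> X" "snd e \<in> Y" using 2(1) that E by auto
            then show ?thesis using XY by auto
          qed
          ultimately have "drop n p = []" unfolding Psub by blast
          then have "p = [e]" using append_take_drop_id[of n p] 2(2) by simp
          then show False using up 2 unfolding Psub by blast
        qed
      qed
    qed
    then show ?thesis unfolding carr by auto
  qed
  show ?thesis
  proof (unfold_locales)
    show "finite X" "finite Y" "X \<inter> Y = {}" "E \<subseteq> X \<times> Y" by fact+
    show "carrier ?A = {f. \<forall>z. z \<notin> ?P \<longrightarrow> f z = 0}" by (rule carr)
    show "\<one>\<^bsub>?A\<^esub> = (\<lambda>z. if z \<in> (\<lambda>v. (v, [])) ` (X \<union> Y) then 1 else 0)"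
      by (auto simp: path_algebra_def Q_def fun_eq_iff)
    fix f g :: "'v \<times> ('v \<times> 'v) list \<Rightarrow> 'k"
    assume "f \<in> carrier ?A" and "g \<in> carrier ?A"
    then show "f \<otimes>\<^bsub>?A\<^esub> g \<in> carrier ?A" by (rule closed)
    show "(f \<otimes>\<^bsub>?A\<^esub> g) (v, []) = f (v, []) * g (v, [])" for v
      by (simp add: mult av)
    show "(f \<otimes>\<^bsub>?A\<^esub> g) (fst (x, y), [(x, y)]) = f (x, []) * g (fst (x, y), [(x, y)]) + f (fst (x, y), [(x, y)]) * g (y, [])"
      for x y by (simp add: mult av)
  qed (auto simp: path_algebra_def inj_on_def)
qed

lemma fold_weighted_bip:
  assumes \<Delta>: "valid_folding \<Delta>"
  shows "weighted_bip (path_algebra (fold_quiver \<Delta>) :: ('k::field, _) module) (sources \<Delta>) (sinks \<Delta>)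
    (fold_arrows \<Delta>) (\<lambda>v. (v, [])) (\<lambda>e. (fst e, [e])) (kappa \<Delta>) (weight_cos \<Delta>)"
proof -
  have XY: "sources \<Delta> \<inter> sinks \<Delta> = {}" by auto
  have "fold_verts \<Delta> = sources \<Delta> \<union> sinks \<Delta>" using fold_map_I0 by blast
  then have Q: "fold_quiver \<Delta> = \<lparr>verts = sources \<Delta> \<union> sinks \<Delta>, arcs = fold_arrows \<Delta>, tail = fst, head = snd\<rparr>"
    unfolding fold_quiver_def by simp
  have fin: "finite (sources \<Delta>)" "finite (sinks \<Delta>)" using fold_bipartite(1)[OF \<Delta>] by simp_all
  show ?thesis
    unfolding Q
    by (intro weighted_bip.intro weighted_bip_axioms.intro path_algebra_bip eigen_source eigen_sink
        fold_arrows_source_sink fin XY \<Delta>)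
qed

theorem corollary3p8:
  fixes \<Delta> :: folding and i :: vertex and m :: int
  assumes "valid_folding \<Delta>" and "i \<in> verts (fold_quiver \<Delta>)"
  shows "(\<forall>M :: ('k::alg_closed_field kq, nat \<Rightarrow> 'k) module.
            is_tau_power (path_algebra (fold_quiver \<Delta>)) m (proj_at (fold_quiver \<Delta>) i) M \<and>
            \<not> zero_mod M \<longrightarrow>
            fold_length \<Delta> (delta_mod \<Delta> M) = kappa \<Delta> i) \<and>
         (\<forall>(X :: ('k kq, nat \<Rightarrow> 'k) cochain_complex) v.
            is_derived_tau_power (path_algebra (fold_quiver \<Delta>)) m
              (stalk (proj_at (fold_quiver \<Delta>) i)) X \<and>
            is_delta_derived \<Delta> X v \<longrightarrow>
            fold_length \<Delta> v = kappa \<Delta> i)"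
proof -
  let ?A = "path_algebra (fold_quiver \<Delta>) :: ('k, 'k kq) module"
  interpret W: weighted_bip ?A "sources \<Delta>" "sinks \<Delta>" "fold_arrows \<Delta>" "\<lambda>v. (v, [])"
    "\<lambda>e. (fst e, [e])" "kappa \<Delta>" "weight_cos \<Delta>"
    by (rule fold_weighted_bip[OF assms(1)])
  let ?P = "proj_at (fold_quiver \<Delta>) i :: ('k kq, 'k kq) module"
  have verts: "sources \<Delta> \<union> sinks \<Delta> = fold_verts \<Delta>" using fold_map_I0 by blast
  have iv: "i \<in> fold_verts \<Delta>" using assms(2) by (simp add: fold_quiver_def)
  then have i: "i \<in> sources \<Delta> \<union> sinks \<Delta>" unfolding verts .
  have P: "?P = W.proj_mod i"
    by (simp add: proj_at_def W.proj_mod_def Let_def vertex_idem_def unit_at_def)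
  have fP: "W.form (W.dimv ?P) = (kappa \<Delta> i)\<^sup>2" unfolding P by (rule W.form_proj_mod[OF i])
  have dim: "dim_vector (fold_quiver \<Delta>) M = W.dimv M" for M :: "('k kq, nat \<Rightarrow> 'k) module"
    by (simp add: fun_eq_iff dim_vector_def vertex_idem_def unit_at_def cpt_def)
  \<comment> \<open>Both halves of the statement are thereby reduced to the invariance of the
    form.\<close>
  have len: "fold_length \<Delta> (fold_proj \<Delta> u) = kappa \<Delta> i" if "W.form u = W.form (W.dimv ?P)" for u
  proof -
    have "fold_length \<Delta> (fold_proj \<Delta> u) = sqrt (W.form u)"
      unfolding fold_length_proj[OF assms(1)] W.form_def W.wt_def ..
    also have "\<dots> = kappa \<Delta> i" unfolding that fP using kappa_nonneg[OF assms(1) iv] by simp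
    finally show ?thesis .
  qed
  show ?thesis
  proof (intro conjI allI impI)
    fix M :: "('k kq, nat \<Rightarrow> 'k) module"
    assume "is_tau_power ?A m ?P M \<and> \<not> zero_mod M"
    then have t: "is_tau_power ?A m ?P M" and nz: "\<not> zero_mod M" by simp_all
    show "fold_length \<Delta> (delta_mod \<Delta> M) = kappa \<Delta> i"
      unfolding delta_mod_def dim
    proof (rule len, rule W.tau_power_form[OF _ _ t nz])
      show "fg_projective ?A ?P" unfolding P by (rule W.proj_mod_projective[OF i])
      show "W.brick ?P" unfolding P by (rule W.proj_mod_brick[OF i])
    qed
  next
    fix X :: "('k kq, nat \<Rightarrow> 'k) cochain_complex" and v
    assume "is_derived_tau_power ?A m (stalk ?P) X \<and> is_delta_derived \<Delta> X v"
    then have t: "is_derived_tau_power ?A m (stalk ?P) X" and d: "is_delta_derived \<Delta> X v" by simp_all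
    obtain M :: "int \<Rightarrow> ('k kq, nat \<Rightarrow> 'k) module" where iso: "derived_iso ?A X (sum_of_shifts M)"
      and v: "v = (\<Sum>j | \<not> zero_mod (M j) \<and> even j. delta_mod \<Delta> (M j))
        - (\<Sum>j | \<not> zero_mod (M j) \<and> odd j. delta_mod \<Delta> (M j))"
      using d unfolding is_delta_derived_def by (elim exE conjE)
    \<comment> \<open>The sign rule that defines \<open>\<delta>\<close> on shifts is that of the
      Euler characteristic, and \<open>fold_proj\<close> is additive; so the value is the projection
      of \<open>W.chi\<close>.\<close>
    have "v = fold_proj \<Delta> (W.chi (sum_of_shifts M))"
      unfolding v delta_mod_def dim W.chi_sum_of_shifts[OF derived_isoD(2)[OF iso]]
      by (simp only: fold_proj_diff fold_proj_sum)
    moreover have "W.form (W.chi (sum_of_shifts M)) = W.form (W.dimv ?P)"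
    proof -
      have "W.form (W.chi (sum_of_shifts M)) = W.form (W.chi X)"
        by (rule W.form_cong) (rule W.chi_derived_iso[OF iso, symmetric])
      also have "\<dots> = W.form (W.chi (stalk ?P))" by (rule W.derived_tau_power_form[OF t])
      also have "\<dots> = W.form (W.dimv ?P)"
        unfolding P by (rule W.form_cong) (rule W.chi_stalk[OF _ W.proj_mod_right_module[OF i]])
      finally show ?thesis .
    qed
    ultimately show "fold_length \<Delta> v = kappa \<Delta> i" using len by simp
  qed
qed

end
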